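(* For $N=1$, $m\geq 3$, $m$ odd and $\mathrm{char}\,\mathbb{K} = 2$, $\mathrm{HH}^*(\Lambda_1)$ is a finitely generated $\mathbb{K}$-algebra with generators: - $1$ and $a_i\bar a_i$ for $i=0,1,\ldots,m-1$, in degree $0$; - $\varphi_{1,0},\ \psi_{1,0}$ in degree $1$; - $\chi_{2,0}$ in degree $2$; - $\varphi_{m-1,-1},\ \psi_{m-1,1}$ in degree $m-1$; - $\chi_{m,1},\ \chi_{m,-1}$ in degree $m$.
   Context: Let $\mathbb{K}$ be a field. Let $\mathcal{Q}$ be the quiver with vertices $0,1,\ldots,m-1$ and, for each $i$ (indices modulo $m$), arrows $a_i:i\to i+1$ and $\bar a_i:i+1\to i$. Paths are written from left to right; $e_i$ is the trivial path at $i$. $\Lambda_1=\mathbb{K}\mathcal{Q}/I_1$ where $I_1$ is generated by $a_ia_{i+1}$, $\bar a_{i-1}\bar a_{i-2}$, $a_i\bar a_i-\bar a_{i-1}a_{i-1}$ for all $i$. $\mathrm{HH}^*(\Lambda_1)=\mathrm{Ext}^*_{\Lambda_1^e}(\Lambda_1,\Lambda_1)$ with the Yoneda product; $\mathrm{HH}^0(\Lambda_1)$ is identified with the centre $Z(\Lambda_1)$. Write $\otimes=\otimes_{\mathbb{K}}$. A minimal projective bimodule resolution of $\Lambda_1$ is $(P^*,\partial^* )$ with $P^n=\bigoplus_{i=0}^{m-1}\bigoplus_{r=0}^n\Lambda_1e_i\otimes e_{i+n-2r}\Lambda_1$. Write $e_i\otimes_r e_{i+n-2r}$ for the generator of the $(i,r)$-summand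 of $P^n$ (first index modulo $m$; generators in $P^{n-1}$ with tensor subscript $-1$ or $n$ are $0$). Unsubscripted $a,\bar a$ denote the arrows of that type making the expression composable. $\partial^0$ is multiplication, and for $n\geq1$, $\partial^n(e_i\otimes_r e_{i+n-2r})=e_i\otimes_r e_{i+n-1-2r}a+(-1)^ne_i\otimes_{r-1}e_{i+n+1-2r}\bar a+(-1)^{n+r}\big(ae_{i+1}\otimes_re_{i+n-2r}+\bar ae_{i-1}\otimes_{r-1}e_{i+n-2r}\big)$. Classes in $\mathrm{HH}^n(\Lambda_1)$ are represented by cocycles in $\mathrm{Hom}_{\Lambda_1^e}(P^n,\Lambda_1)$; for a cocycle only the non-zero images of generators are listed. For $0\leq i\leq m-1$ and $k\in\mathbb{Z}$, $e_i\otimes e_{i+k}\in P^n$ means $e_i\otimes_r e_{i+n-2r}$ with $r=(n-k)/2$ ($k$ is not reduced modulo $m$). For all $i=0,\ldots,m-1$: $\varphi_{1,0}$: $e_i\otimes e_{i+1}\mapsto a_i$; $\psi_{1,0}$: $e_i\otimes e_{i-1}\mapsto\bar a_{i-1}$; $\chi_{2,0}$: $e_i\otimes e_i\mapsto e_i$; $\varphi_{m-1,-1}$: $e_i\otimes e_{i-m+1}\mapsto a_i$; $\psi_{m-1,1}$: $e_i\otimes e_{i+m-1}\mapsto\bar a_{i-1}$; $\chi_{m,\pm1}$: $e_i\otimes e_{i\pm m}\mapsto e_i$. The first subscript of each symbol is its cohomological degree. *)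

theory Defs
  imports "Graph_Theory.Arc_Walk" "HOL-Algebra.Algebra"
begin

section \<open>Algebras over a field and bimodules\<close>

text \<open>The ground field is a type of class \<^class>\<open>field\<close>; a (not necessarily commutative) unital
  algebra over it is a ring in the sense of HOL-Algebra, together with the operation \<^const>\<open>smult\<close>.\<close>

locale k_algebra = ring A for A :: "('k::field, 'a) module" (structure) +
  assumes smult_in: "x \<in> carrier A \<Longrightarrow> c \<odot> x \<in> carrier A"
    and smult_add_left: "x \<in> carrier A \<Longrightarrow> (c + d) \<odot> x = c \<odot> x \<oplus> d \<odot> x"
    and smult_add_right:
      "\<lbrakk>x \<in> carrier A; y \<in> carrier A\<rbrakk> \<Longrightarrow> c \<odot> (x \<oplus> y) = c \<odot> x \<oplus> c \<odot> y"
    and smult_smult: "x \<in> carrier A \<Longrightarrow> (c * d) \<odot> x = c \<odot> (d \<odot> x)"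
    and smult_1: "x \<in> carrier A \<Longrightarrow> 1 \<odot> x = x"
    and smult_mult_left:
      "\<lbrakk>x \<in> carrier A; y \<in> carrier A\<rbrakk> \<Longrightarrow> (c \<odot> x) \<otimes> y = c \<odot> (x \<otimes> y)"
    and smult_mult_right:
      "\<lbrakk>x \<in> carrier A; y \<in> carrier A\<rbrakk> \<Longrightarrow> x \<otimes> (c \<odot> y) = c \<odot> (x \<otimes> y)"

inductive_set generated_algebra :: "('k::field, 'a) module \<Rightarrow> 'a set \<Rightarrow> 'a set"
  for A :: "('k::field, 'a) module" and S :: "'a set" where
    one: "\<one>\<^bsub>A\<^esub> \<in> generated_algebra A S"
  | incl: "x \<in> S \<Longrightarrow> x \<in> generated_algebra A S"
  | add: "\<lbrakk>x \<in> generated_algebra A S; y \<in> generated_algebra A S\<rbrakk>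
      \<Longrightarrow> x \<oplus>\<^bsub>A\<^esub> y \<in> generated_algebra A S"
  | mult: "\<lbrakk>x \<in> generated_algebra A S; y \<in> generated_algebra A S\<rbrakk>
      \<Longrightarrow> x \<otimes>\<^bsub>A\<^esub> y \<in> generated_algebra A S"
  | smult: "x \<in> generated_algebra A S \<Longrightarrow> c \<odot>\<^bsub>A\<^esub> x \<in> generated_algebra A S"

definition quotient_algebra :: "('k::field, 'a) module \<Rightarrow> 'a set \<Rightarrow> ('k, 'a set) module" where
  "quotient_algebra A I =
     ring.extend (A Quot I) \<lparr>smult = (\<lambda>c U. \<Union>x\<in>U. I +>\<^bsub>A\<^esub> (c \<odot>\<^bsub>A\<^esub> x))\<rparr>"

text \<open>As for \<^const>\<open>smult\<close> in HOL-Algebra, bimodules extend the ring record so that the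
  additive notions of HOL-Algebra apply to them; the fields \<^const>\<open>monoid.mult\<close> and \<^const>\<open>one\<close> carry no
  meaning.\<close>

record ('a, 'b) bimod = "'b ring" +
  lact :: "'a \<Rightarrow> 'b \<Rightarrow> 'b"
  ract :: "'b \<Rightarrow> 'a \<Rightarrow> 'b"

text \<open>The last axiom says that the ground field acts centrally, that is, bimodules are modules
  over the enveloping algebra.\<close>

definition bimodule :: "('k::field, 'a) module \<Rightarrow> ('a, 'b) bimod \<Rightarrow> bool" where
  "bimodule A M \<longleftrightarrow> abelian_group M \<and>
     (\<forall>a\<in>carrier A. \<forall>x\<in>carrier M. lact M a x \<in> carrier M \<and> ract M x a \<in> carrier M) \<and>
     (\<forall>a\<in>carrier A. \<forall>x\<in>carrier M. \<forall>y\<in>carrier M.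
        lact M a (x \<oplus>\<^bsub>M\<^esub> y) = lact M a x \<oplus>\<^bsub>M\<^esub> lact M a y \<and>
        ract M (x \<oplus>\<^bsub>M\<^esub> y) a = ract M x a \<oplus>\<^bsub>M\<^esub> ract M y a) \<and>
     (\<forall>a\<in>carrier A. \<forall>b\<in>carrier A. \<forall>x\<in>carrier M.
        lact M (a \<oplus>\<^bsub>A\<^esub> b) x = lact M a x \<oplus>\<^bsub>M\<^esub> lact M b x \<and>
        ract M x (a \<oplus>\<^bsub>A\<^esub> b) = ract M x a \<oplus>\<^bsub>M\<^esub> ract M x b \<and>
        lact M (a \<otimes>\<^bsub>A\<^esub> b) x = lact M a (lact M b x) \<and>
        ract M x (a \<otimes>\<^bsub>A\<^esub> b) = ract M (ract M x a) b \<and>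
        ract M (lact M a x) b = lact M a (ract M x b)) \<and>
     (\<forall>x\<in>carrier M. lact M \<one>\<^bsub>A\<^esub> x = x \<and> ract M x \<one>\<^bsub>A\<^esub> = x) \<and>
     (\<forall>c. \<forall>x\<in>carrier M. lact M (c \<odot>\<^bsub>A\<^esub> \<one>\<^bsub>A\<^esub>) x = ract M x (c \<odot>\<^bsub>A\<^esub> \<one>\<^bsub>A\<^esub>))"

definition scale :: "('k::field, 'a) module \<Rightarrow> ('a, 'b) bimod \<Rightarrow> 'k \<Rightarrow> 'b \<Rightarrow> 'b" where
  "scale A M c x = lact M (c \<odot>\<^bsub>A\<^esub> \<one>\<^bsub>A\<^esub>) x"

text \<open>Homomorphisms are extensional functions, so that equality of homomorphisms is equality
  of functions.\<close>

definition bimod_hom ::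
    "('k::field, 'a) module \<Rightarrow> ('a, 'b) bimod \<Rightarrow> ('a, 'c) bimod \<Rightarrow> ('b \<Rightarrow> 'c) set" where
  "bimod_hom A M N = {f \<in> carrier M \<rightarrow>\<^sub>E carrier N.
     (\<forall>x\<in>carrier M. \<forall>y\<in>carrier M. f (x \<oplus>\<^bsub>M\<^esub> y) = f x \<oplus>\<^bsub>N\<^esub> f y) \<and>
     (\<forall>a\<in>carrier A. \<forall>x\<in>carrier M. f (lact M a x) = lact N a (f x) \<and> f (ract M x a) = ract N (f x) a)}"

definition hom_module ::
    "('k::field, 'a) module \<Rightarrow> ('a, 'b) bimod \<Rightarrow> ('a, 'c) bimod \<Rightarrow> ('k, 'b \<Rightarrow> 'c) module" where
  "hom_module A M N =
     \<lparr>carrier = bimod_hom A M N, monoid.mult = undefined, one = undefined,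
      ring.zero = (\<lambda>x\<in>carrier M. \<zero>\<^bsub>N\<^esub>),
      ring.add = (\<lambda>f g. \<lambda>x\<in>carrier M. f x \<oplus>\<^bsub>N\<^esub> g x),
      smult = (\<lambda>c f. \<lambda>x\<in>carrier M. scale A N c (f x))\<rparr>"

definition regular_bimod :: "('k::field, 'a) module \<Rightarrow> ('a, 'a) bimod" where
  "regular_bimod A =
     \<lparr>carrier = carrier A, monoid.mult = undefined, one = undefined,
      ring.zero = \<zero>\<^bsub>A\<^esub>, ring.add = ring.add A,
      lact = monoid.mult A, ract = monoid.mult A\<rparr>"

text \<open>Meant for finite index sets only.\<close>

definition direct_sum_bimod :: "'i set \<Rightarrow> ('i \<Rightarrow> ('a, 'b) bimod) \<Rightarrow> ('a, 'i \<Rightarrow> 'b) bimod" where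
  "direct_sum_bimod I M =
     \<lparr>carrier = (\<Pi>\<^sub>E i\<in>I. carrier (M i)), monoid.mult = undefined, one = undefined,
      ring.zero = (\<lambda>i\<in>I. \<zero>\<^bsub>M i\<^esub>),
      ring.add = (\<lambda>s t. \<lambda>i\<in>I. s i \<oplus>\<^bsub>M i\<^esub> t i),
      lact = (\<lambda>a t. \<lambda>i\<in>I. lact (M i) a (t i)),
      ract = (\<lambda>t a. \<lambda>i\<in>I. ract (M i) (t i) a)\<rparr>"

text \<open>The tensor product over the ground field of two subspaces \<open>V\<close>, \<open>W\<close> of an algebra. Over a
  field the bilinear forms on \<open>V \<times> W\<close> separate the elements of the tensor product, which is
  therefore realised as the span of the evaluation functionals \<open>\<beta> \<mapsto> \<beta> v w\<close> in the
  dual of the space of bilinear forms. All functionals are set to 0 outside that space.\<close>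

definition bilinear_forms ::
    "('k::field, 'a) module \<Rightarrow> 'a set \<Rightarrow> 'a set \<Rightarrow> ('a \<Rightarrow> 'a \<Rightarrow> 'k) set" where
  "bilinear_forms A V W = {\<beta>.
     (\<forall>v\<in>V. \<forall>v'\<in>V. \<forall>w\<in>W. \<beta> (v \<oplus>\<^bsub>A\<^esub> v') w = \<beta> v w + \<beta> v' w) \<and>
     (\<forall>v\<in>V. \<forall>w\<in>W. \<forall>w'\<in>W. \<beta> v (w \<oplus>\<^bsub>A\<^esub> w') = \<beta> v w + \<beta> v w') \<and>
     (\<forall>c. \<forall>v\<in>V. \<forall>w\<in>W. \<beta> (c \<odot>\<^bsub>A\<^esub> v) w = c * \<beta> v w \<and> \<beta> v (c \<odot>\<^bsub>A\<^esub> w) = c * \<beta> v w)}"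

type_synonym ('k, 'a) tensor = "('a \<Rightarrow> 'a \<Rightarrow> 'k) \<Rightarrow> 'k"

definition pure_tensor ::
    "('k::field, 'a) module \<Rightarrow> 'a set \<Rightarrow> 'a set \<Rightarrow> 'a \<Rightarrow> 'a \<Rightarrow> ('k, 'a) tensor" where
  "pure_tensor A V W v w = (\<lambda>\<beta>. if \<beta> \<in> bilinear_forms A V W then \<beta> v w else 0)"

definition tensor_carrier ::
    "('k::field, 'a) module \<Rightarrow> 'a set \<Rightarrow> 'a set \<Rightarrow> ('k, 'a) tensor set" where
  "tensor_carrier A V W =
     {t. \<exists>xs. set xs \<subseteq> V \<times> W \<and> t = (\<lambda>\<beta>. \<Sum>(v, w)\<leftarrow>xs. pure_tensor A V W v w \<beta>)}"

definition left_ideal_of :: "('k::field, 'a) module \<Rightarrow> 'a \<Rightarrow> 'a set" where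
  "left_ideal_of A e = (\<lambda>x. x \<otimes>\<^bsub>A\<^esub> e) ` carrier A"

definition right_ideal_of :: "('k::field, 'a) module \<Rightarrow> 'a \<Rightarrow> 'a set" where
  "right_ideal_of A f = (\<lambda>y. f \<otimes>\<^bsub>A\<^esub> y) ` carrier A"

text \<open>The bimodule \<open>A e \<otimes> f A\<close>, on which \<open>a\<close> acts by \<open>a (v \<otimes> w) = (a v) \<otimes> w\<close> and
  \<open>(v \<otimes> w) a = v \<otimes> (w a)\<close>.\<close>

definition tensor_bimod ::
    "('k::field, 'a) module \<Rightarrow> 'a \<Rightarrow> 'a \<Rightarrow> ('a, ('k, 'a) tensor) bimod" where
  "tensor_bimod A e f =
     (let V = left_ideal_of A e; W = right_ideal_of A f; B = bilinear_forms A V W in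
      \<lparr>carrier = tensor_carrier A V W, monoid.mult = undefined, one = undefined,
       ring.zero = (\<lambda>\<beta>. 0), ring.add = (\<lambda>s t \<beta>. s \<beta> + t \<beta>),
       lact = (\<lambda>a t \<beta>. if \<beta> \<in> B then t (\<lambda>v w. \<beta> (a \<otimes>\<^bsub>A\<^esub> v) w) else 0),
       ract = (\<lambda>t a \<beta>. if \<beta> \<in> B then t (\<lambda>v w. \<beta> v (w \<otimes>\<^bsub>A\<^esub> a)) else 0)\<rparr>)"

definition idem_tensor :: "('k::field, 'a) module \<Rightarrow> 'a \<Rightarrow> 'a \<Rightarrow> ('k, 'a) tensor" where
  "idem_tensor A e f = pure_tensor A (left_ideal_of A e) (right_ideal_of A f) e f"


section \<open>Hochschild cohomology from a projective bimodule resolution\<close>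

text \<open>\<open>cx_diff R n\<close> is the differential from degree \<open>n\<close> to degree \<open>n - 1\<close>, for \<open>n \<ge> 1\<close>;
  \<open>cx_aug R\<close> is the augmentation from degree 0 to the algebra.\<close>

record ('a, 'p) aug_complex =
  cx_mod :: "nat \<Rightarrow> ('a, 'p) bimod"
  cx_diff :: "nat \<Rightarrow> 'p \<Rightarrow> 'p"
  cx_aug :: "'p \<Rightarrow> 'a"

text \<open>Finitely generated projective: a direct summand of a free bimodule of finite rank.\<close>

definition fg_projective_bimodule :: "('k::field, 'a) module \<Rightarrow> ('a, 'p) bimod \<Rightarrow> bool" where
  "fg_projective_bimodule A M \<longleftrightarrow> bimodule A M \<and>
     (\<exists>(k::nat) \<iota> \<pi>. let F = direct_sum_bimod {..<k} (\<lambda>_. tensor_bimod A \<one>\<^bsub>A\<^esub> \<one>\<^bsub>A\<^esub>) in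
        \<iota> \<in> bimod_hom A M F \<and> \<pi> \<in> bimod_hom A F M \<and> (\<forall>x\<in>carrier M. \<pi> (\<iota> x) = x))"

definition projective_bimodule_resolution ::
    "('k::field, 'a) module \<Rightarrow> ('a, 'p) aug_complex \<Rightarrow> bool" where
  "projective_bimodule_resolution A R \<longleftrightarrow>
     (\<forall>n. fg_projective_bimodule A (cx_mod R n)) \<and>
     (\<forall>n. cx_diff R (Suc n) \<in> bimod_hom A (cx_mod R (Suc n)) (cx_mod R n)) \<and>
     cx_aug R \<in> bimod_hom A (cx_mod R 0) (regular_bimod A) \<and>
     cx_aug R ` carrier (cx_mod R 0) = carrier A \<and>
     cx_diff R 1 ` carrier (cx_mod R 1) = {x \<in> carrier (cx_mod R 0). cx_aug R x = \<zero>\<^bsub>A\<^esub>} \<and>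
     (\<forall>n. cx_diff R (Suc (Suc n)) ` carrier (cx_mod R (Suc (Suc n))) =
          {x \<in> carrier (cx_mod R (Suc n)). cx_diff R (Suc n) x = \<zero>\<^bsub>cx_mod R n\<^esub>})"

definition cochains ::
    "('k::field, 'a) module \<Rightarrow> ('a, 'p) aug_complex \<Rightarrow> nat \<Rightarrow> ('k, 'p \<Rightarrow> 'a) module" where
  "cochains A R n = hom_module A (cx_mod R n) (regular_bimod A)"

definition cocycles ::
    "('k::field, 'a) module \<Rightarrow> ('a, 'p) aug_complex \<Rightarrow> nat \<Rightarrow> ('p \<Rightarrow> 'a) set" where
  "cocycles A R n = {f \<in> carrier (cochains A R n).
     \<forall>x\<in>carrier (cx_mod R (Suc n)). f (cx_diff R (Suc n) x) = \<zero>\<^bsub>A\<^esub>}"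

fun coboundaries ::
    "('k::field, 'a) module \<Rightarrow> ('a, 'p) aug_complex \<Rightarrow> nat \<Rightarrow> ('p \<Rightarrow> 'a) set" where
  "coboundaries A R 0 = {\<zero>\<^bsub>cochains A R 0\<^esub>}"
| "coboundaries A R (Suc n) =
     (\<lambda>g. \<lambda>x\<in>carrier (cx_mod R (Suc n)). g (cx_diff R (Suc n) x)) ` carrier (cochains A R n)"

definition coh_class ::
    "('k::field, 'a) module \<Rightarrow> ('a, 'p) aug_complex \<Rightarrow> nat \<Rightarrow> ('p \<Rightarrow> 'a) \<Rightarrow> ('p \<Rightarrow> 'a) set" where
  "coh_class A R n f = coboundaries A R n +>\<^bsub>cochains A R n\<^esub> f"

text \<open>Operations on cosets are defined as unions over all representatives, as for
  \<^const>\<open>rcoset_mult\<close>.\<close>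

definition HH_degree ::
    "('k::field, 'a) module \<Rightarrow> ('a, 'p) aug_complex \<Rightarrow> nat \<Rightarrow> ('k, ('p \<Rightarrow> 'a) set) module" where
  "HH_degree A R n =
     \<lparr>carrier = coh_class A R n ` cocycles A R n, monoid.mult = undefined, one = undefined,
      ring.zero = coboundaries A R n, ring.add = set_add (cochains A R n),
      smult = (\<lambda>c U. \<Union>f\<in>U. coh_class A R n (c \<odot>\<^bsub>cochains A R n\<^esub> f))\<rparr>"

text \<open>\<open>G\<close> is a chain map of degree \<open>- q\<close> from the resolution to itself lifting the
  \<open>q\<close>-cocycle \<open>g\<close>.\<close>

definition lifts ::
    "('k::field, 'a) module \<Rightarrow> ('a, 'p) aug_complex \<Rightarrow> nat \<Rightarrow> ('p \<Rightarrow> 'a) \<Rightarrow> (nat \<Rightarrow> 'p \<Rightarrow> 'p) \<Rightarrow> bool"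
  where
  "lifts A R q g G \<longleftrightarrow>
     (\<forall>j. G j \<in> bimod_hom A (cx_mod R (q + j)) (cx_mod R j)) \<and>
     (\<forall>x\<in>carrier (cx_mod R q). cx_aug R (G 0 x) = g x) \<and>
     (\<forall>j. \<forall>x\<in>carrier (cx_mod R (q + Suc j)).
        cx_diff R (Suc j) (G (Suc j) x) = G j (cx_diff R (q + Suc j) x))"

definition yoneda ::
    "('k::field, 'a) module \<Rightarrow> ('a, 'p) aug_complex \<Rightarrow> nat \<Rightarrow> nat
      \<Rightarrow> ('p \<Rightarrow> 'a) set \<Rightarrow> ('p \<Rightarrow> 'a) set \<Rightarrow> ('p \<Rightarrow> 'a) set" where
  "yoneda A R p q U U' =
     (\<Union>f\<in>U. \<Union>g\<in>U'. \<Union>G\<in>{G. lifts A R q g G}.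
        coh_class A R (p + q) (\<lambda>x\<in>carrier (cx_mod R (p + q)). f (G p x)))"

text \<open>Elements of the total cohomology are families of classes, almost all of them zero.\<close>

definition HH ::
    "('k::field, 'a) module \<Rightarrow> ('a, 'p) aug_complex \<Rightarrow> ('k, nat \<Rightarrow> ('p \<Rightarrow> 'a) set) module" where
  "HH A R =
     \<lparr>carrier = {x. (\<forall>n. x n \<in> carrier (HH_degree A R n)) \<and>
                    finite {n. x n \<noteq> \<zero>\<^bsub>HH_degree A R n\<^esub>}},
      monoid.mult = (\<lambda>x y n. \<Oplus>\<^bsub>HH_degree A R n\<^esub> p\<in>{..n}. yoneda A R p (n - p) (x p) (y (n - p))),
      one = (\<lambda>n. if n = 0 then coh_class A R 0 (cx_aug R) else \<zero>\<^bsub>HH_degree A R n\<^esub>),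
      ring.zero = (\<lambda>n. \<zero>\<^bsub>HH_degree A R n\<^esub>),
      ring.add = (\<lambda>x y n. x n \<oplus>\<^bsub>HH_degree A R n\<^esub> y n),
      smult = (\<lambda>c x n. c \<odot>\<^bsub>HH_degree A R n\<^esub> x n)\<rparr>"

definition homogeneous ::
    "('k::field, 'a) module \<Rightarrow> ('a, 'p) aug_complex \<Rightarrow> nat \<Rightarrow> ('p \<Rightarrow> 'a) \<Rightarrow> nat \<Rightarrow> ('p \<Rightarrow> 'a) set" where
  "homogeneous A R n f =
     (\<lambda>k. if k = n then coh_class A R n f else \<zero>\<^bsub>HH_degree A R k\<^esub>)"


section \<open>Path algebras\<close>

text \<open>A path is given by its source, its arrows (read from left to right) and its target.\<close>

type_synonym ('v, 'e) path = "'v \<times> 'e list \<times> 'v"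

definition paths :: "('v, 'e) pre_digraph \<Rightarrow> ('v, 'e) path set" where
  "paths Q = {(u, p, v). pre_digraph.awalk Q u p v}"

text \<open>For quivers with finitely many vertices.\<close>

definition path_algebra :: "('v, 'e) pre_digraph \<Rightarrow> ('k::field, ('v, 'e) path \<Rightarrow> 'k) module" where
  "path_algebra Q =
     \<lparr>carrier = {f. finite {\<pi>. f \<pi> \<noteq> 0} \<and> {\<pi>. f \<pi> \<noteq> 0} \<subseteq> paths Q},
      monoid.mult = (\<lambda>f g (u, p, w). \<Sum>(\<sigma>, \<tau>) | f \<sigma> \<noteq> 0 \<and> g \<tau> \<noteq> 0 \<and>
        fst \<sigma> = u \<and> snd (snd \<sigma>) = fst \<tau> \<and> snd (snd \<tau>) = w \<and>
        fst (snd \<sigma>) @ fst (snd \<tau>) = p. f \<sigma> * g \<tau>),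
      one = (\<lambda>(u, p, v). if u \<in> verts Q \<and> p = [] \<and> u = v then 1 else 0),
      ring.zero = (\<lambda>\<pi>. 0), ring.add = (\<lambda>f g \<pi>. f \<pi> + g \<pi>),
      smult = (\<lambda>c f \<pi>. c * f \<pi>)\<rparr>"

definition path_elem :: "('v, 'e) path \<Rightarrow> ('v, 'e) path \<Rightarrow> 'k::field" where
  "path_elem \<pi> = (\<lambda>\<sigma>. if \<sigma> = \<pi> then 1 else 0)"


section \<open>The algebra\<close>

text \<open>Vertices are the integers \<open>0, \<dots>, m - 1\<close>. In everything below, vertex indices and
  indices of arrows are arbitrary integers and are reduced modulo \<open>m\<close>. \<open>Fwd i\<close> is the arrow
  \<open>a\<^sub>i\<close> from \<open>i\<close> to \<open>i + 1\<close>, and \<open>Bwd i\<close> is the arrow \<open>\<bar>a\<^sub>i\<close> from \<open>i + 1\<close> to \<open>i\<close>.\<close>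

datatype arrow = Fwd int | Bwd int

definition quiverQ :: "nat \<Rightarrow> (int, arrow) pre_digraph" where
  "quiverQ m =
     \<lparr>verts = {0..<int m}, arcs = Fwd ` {0..<int m} \<union> Bwd ` {0..<int m},
      tail = (\<lambda>x. case x of Fwd i \<Rightarrow> i | Bwd i \<Rightarrow> (i + 1) mod int m),
      head = (\<lambda>x. case x of Fwd i \<Rightarrow> (i + 1) mod int m | Bwd i \<Rightarrow> i)\<rparr>"

definition path_e :: "nat \<Rightarrow> int \<Rightarrow> (int, arrow) path" where
  "path_e m i = (i mod int m, [], i mod int m)"

definition path_a :: "nat \<Rightarrow> int \<Rightarrow> (int, arrow) path" where
  "path_a m i = (i mod int m, [Fwd (i mod int m)], (i + 1) mod int m)"

definition path_abar :: "nat \<Rightarrow> int \<Rightarrow> (int, arrow) path" where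
  "path_abar m i = ((i + 1) mod int m, [Bwd (i mod int m)], i mod int m)"

definition relations :: "nat \<Rightarrow> ((int, arrow) path \<Rightarrow> 'k::field) set" where
  "relations m =
     (let KQ = path_algebra (quiverQ m);
          a = (\<lambda>i. path_elem (path_a m i)); abar = (\<lambda>i. path_elem (path_abar m i)) in
      (\<Union>i. {a i \<otimes>\<^bsub>KQ\<^esub> a (i + 1), abar (i - 1) \<otimes>\<^bsub>KQ\<^esub> abar (i - 2),
             a i \<otimes>\<^bsub>KQ\<^esub> abar i \<ominus>\<^bsub>KQ\<^esub> abar (i - 1) \<otimes>\<^bsub>KQ\<^esub> a (i - 1)}))"

definition ideal_I1 :: "nat \<Rightarrow> ((int, arrow) path \<Rightarrow> 'k::field) set" where
  "ideal_I1 m = Idl\<^bsub>(path_algebra (quiverQ m) :: ('k, _) module)\<^esub> (relations m)"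

type_synonym 'k lam = "((int, arrow) path \<Rightarrow> 'k) set"

definition Lambda1 :: "nat \<Rightarrow> ('k::field, 'k lam) module" where
  "Lambda1 m = quotient_algebra (path_algebra (quiverQ m)) (ideal_I1 m)"

definition path_class :: "nat \<Rightarrow> (int, arrow) path \<Rightarrow> 'k::field lam" where
  "path_class m \<pi> = ideal_I1 m +>\<^bsub>path_algebra (quiverQ m) :: ('k, _) module\<^esub> path_elem \<pi>"

definition e_elem :: "nat \<Rightarrow> int \<Rightarrow> 'k::field lam" where
  "e_elem m i = path_class m (path_e m i)"

definition a_elem :: "nat \<Rightarrow> int \<Rightarrow> 'k::field lam" where
  "a_elem m i = path_class m (path_a m i)"

definition abar_elem :: "nat \<Rightarrow> int \<Rightarrow> 'k::field lam" where
  "abar_elem m i = path_class m (path_abar m i)"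


section \<open>The resolution\<close>

type_synonym 'k res = "int \<times> int \<Rightarrow> ('k, 'k lam) tensor"

definition res_index :: "nat \<Rightarrow> nat \<Rightarrow> (int \<times> int) set" where
  "res_index m n = {0..<int m} \<times> {0..int n}"

definition res_mod :: "nat \<Rightarrow> nat \<Rightarrow> ('k::field lam, 'k res) bimod" where
  "res_mod m n = direct_sum_bimod (res_index m n)
     (\<lambda>(i, r). tensor_bimod (Lambda1 m) (e_elem m i) (e_elem m (i + int n - 2 * r)))"

text \<open>The generator \<open>e\<^sub>i \<otimes>\<^sub>r e\<^bsub>i+n-2r\<^esub>\<close>; it is 0 unless \<open>0 \<le> r \<le> n\<close>.\<close>

definition gen :: "nat \<Rightarrow> nat \<Rightarrow> int \<Rightarrow> int \<Rightarrow> 'k::field res" where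
  "gen m n i r = (\<lambda>(i', r')\<in>res_index m n.
     if i' = i mod int m \<and> r' = r
     then idem_tensor (Lambda1 m) (e_elem m i) (e_elem m (i + int n - 2 * r))
     else (\<lambda>\<beta>. 0))"

text \<open>The bimodule homomorphism with prescribed images of the generators.\<close>

definition hom_of_gens ::
    "nat \<Rightarrow> nat \<Rightarrow> ('k::field lam, 'b) bimod \<Rightarrow> (int \<Rightarrow> int \<Rightarrow> 'b) \<Rightarrow> 'k res \<Rightarrow> 'b" where
  "hom_of_gens m n N h = (THE f. f \<in> bimod_hom (Lambda1 m) (res_mod m n) N \<and>
     (\<forall>(i, r)\<in>res_index m n. f (gen m n i r) = h i r))"

definition res_diff :: "nat \<Rightarrow> nat \<Rightarrow> 'k::field res \<Rightarrow> 'k res" where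
  "res_diff m n = hom_of_gens m n (res_mod m (n - 1)) (\<lambda>i r.
     let N = res_mod m (n - 1); g = gen m (n - 1); j = i + int n - 2 * r; sc = scale (Lambda1 m) N in
       ract N (g i r) (a_elem m (j - 1))
       \<oplus>\<^bsub>N\<^esub> sc ((-1) ^ n) (ract N (g i (r - 1)) (abar_elem m j))
       \<oplus>\<^bsub>N\<^esub> sc ((-1) ^ (n + nat r))
             (lact N (a_elem m i) (g (i + 1) r) \<oplus>\<^bsub>N\<^esub> lact N (abar_elem m (i - 1)) (g (i - 1) (r - 1))))"

text \<open>The multiplication \<open>x e\<^sub>i \<otimes> e\<^sub>i y \<mapsto> x e\<^sub>i y\<close>.\<close>

definition res_aug :: "nat \<Rightarrow> 'k::field res \<Rightarrow> 'k lam" where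
  "res_aug m = hom_of_gens m 0 (regular_bimod (Lambda1 m)) (\<lambda>i r. e_elem m i)"

definition resolution :: "nat \<Rightarrow> ('k::field lam, 'k res) aug_complex" where
  "resolution m = \<lparr>cx_mod = res_mod m, cx_diff = res_diff m, cx_aug = res_aug m\<rparr>"

definition HH_Lambda1 :: "nat \<Rightarrow> ('k::field, nat \<Rightarrow> ('k res \<Rightarrow> 'k lam) set) module" where
  "HH_Lambda1 m = HH (Lambda1 m) (resolution m)"


section \<open>The generators of the cohomology\<close>

text \<open>The class in degree \<open>n\<close> of the cocycle \<open>e\<^sub>i \<otimes> e\<^bsub>i+k\<^esub> \<mapsto> h i\<close>, where
  the remaining generators of degree \<open>n\<close> are sent to 0 and \<open>k = n - 2r\<close> as integers.\<close>

definition HH_elem ::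
    "nat \<Rightarrow> nat \<Rightarrow> int \<Rightarrow> (int \<Rightarrow> 'k::field lam) \<Rightarrow> nat \<Rightarrow> ('k res \<Rightarrow> 'k lam) set" where
  "HH_elem m n k h = homogeneous (Lambda1 m) (resolution m) n
     (hom_of_gens m n (regular_bimod (Lambda1 m))
        (\<lambda>i r. if int n - 2 * r = k then h i else \<zero>\<^bsub>Lambda1 m\<^esub>))"

text \<open>A central element \<open>z\<close> corresponds to the 0-cocycle \<open>e\<^sub>i \<otimes> e\<^sub>i \<mapsto> e\<^sub>i z\<close>.\<close>

definition central_elem :: "nat \<Rightarrow> 'k::field lam \<Rightarrow> nat \<Rightarrow> ('k res \<Rightarrow> 'k lam) set" where
  "central_elem m z = HH_elem m 0 0 (\<lambda>i. e_elem m i \<otimes>\<^bsub>Lambda1 m\<^esub> z)"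

definition phi_1_0 :: "nat \<Rightarrow> nat \<Rightarrow> ('k::field res \<Rightarrow> 'k lam) set" where
  "phi_1_0 m = HH_elem m 1 1 (a_elem m)"

definition psi_1_0 :: "nat \<Rightarrow> nat \<Rightarrow> ('k::field res \<Rightarrow> 'k lam) set" where
  "psi_1_0 m = HH_elem m 1 (-1) (\<lambda>i. abar_elem m (i - 1))"

definition chi_2_0 :: "nat \<Rightarrow> nat \<Rightarrow> ('k::field res \<Rightarrow> 'k lam) set" where
  "chi_2_0 m = HH_elem m 2 0 (e_elem m)"

definition phi_pred_m_neg1 :: "nat \<Rightarrow> nat \<Rightarrow> ('k::field res \<Rightarrow> 'k lam) set" where
  "phi_pred_m_neg1 m = HH_elem m (m - 1) (1 - int m) (a_elem m)"

definition psi_pred_m_1 :: "nat \<Rightarrow> nat \<Rightarrow> ('k::field res \<Rightarrow> 'k lam) set" where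
  "psi_pred_m_1 m = HH_elem m (m - 1) (int m - 1) (\<lambda>i. abar_elem m (i - 1))"

definition chi_m_1 :: "nat \<Rightarrow> nat \<Rightarrow> ('k::field res \<Rightarrow> 'k lam) set" where
  "chi_m_1 m = HH_elem m m (int m) (e_elem m)"

definition chi_m_neg1 :: "nat \<Rightarrow> nat \<Rightarrow> ('k::field res \<Rightarrow> 'k lam) set" where
  "chi_m_neg1 m = HH_elem m m (- int m) (e_elem m)"

definition HH_generators :: "nat \<Rightarrow> (nat \<Rightarrow> ('k::field res \<Rightarrow> 'k lam) set) set" where
  "HH_generators m =
     {central_elem m \<one>\<^bsub>Lambda1 m\<^esub>}
     \<union> (\<lambda>i. central_elem m (a_elem m i \<otimes>\<^bsub>Lambda1 m\<^esub> abar_elem m i)) ` {0..<int m}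
     \<union> {phi_1_0 m, psi_1_0 m, chi_2_0 m, phi_pred_m_neg1 m, psi_pred_m_1 m, chi_m_1 m, chi_m_neg1 m}"

end

theory Submission
  imports Defs
begin

text \<open>The differential of the resolution is a signed sum of left and right multiplications by
  arrows, and the signs disappear in characteristic 2. Exactness is shown by a contracting homotopy
  that is linear on the right.

  Shifting the generators by \<open>(n, \<sigma>)\<close> commutes with the differential whenever \<open>n - 2\<sigma>\<close> is divisible
  by \<open>m\<close>. It is the lift of a cocycle \<open>\<chi>\<^bsub>n,\<sigma>\<^esub>\<close> sending the generators \<open>e\<^sub>i \<otimes>\<^sub>\<sigma> e\<^sub>i\<close> to \<open>e\<^sub>i\<close>, so multiplying
  by \<open>\<chi>\<^bsub>n,\<sigma>\<^esub>\<close> just reindexes a cochain. On a cocycle the coefficients of the vertices are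
  constant in \<open>i\<close>. Since \<open>m\<close> is odd, a coboundary makes the coefficients of the arrows \<open>a\<^sub>i\<close>
  constant as well, and the cocycle equation then forces those of the arrows \<open>\<bar>a\<^sub>i\<close> to be constant,
  whereas the coefficients of \<open>a\<^sub>i \<bar>a\<^sub>i\<close> are arbitrary. What remains is a linear combination of
  products of the generators with powers of the three classes \<open>\<chi>\<close>.\<close>

section \<open>Algebras, bimodules and homomorphisms\<close>

text \<open>A contraction by bimodule maps would make Lambda1 projective over its enveloping
  algebra, so the homotopy can be linear on one side only; exactness concerns the underlying groups,
  for which one side suffices. The contraction identity is also the source of
  \<open>d d = 0\<close>, because the generators of positive degree lie in the image of the
  homotopy.

  Products in cohomology are unions over all representatives and all lifts. None can be evaluated
  before the comparison theorem shows that they do not depend on these choices. The Yoneda product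
  composes with a lift of its right factor. The products by which the generators are combined all
  have a class chi on the right, so the shifts are the only lifts to be computed, and no lift of a
  class phi or psi occurs.

  Tensors are functionals on bilinear forms. A homomorphism out of a tensor product is given by a
  formula in coordinates, which is why linear coordinates on Lambda1 have to be available before the
  resolution can be studied.\<close>

context k_algebra
begin

lemma smult_zero_scalar:
  assumes "x \<in> carrier A" shows "0 \<odot> x = \<zero>"
proof -
  have "0 \<odot> x \<oplus> 0 \<odot> x = \<zero> \<oplus> 0 \<odot> x"
    using smult_add_left[OF assms, of 0 0] smult_in[OF assms] by simp
  then show ?thesis
    using smult_in[OF assms] by (metis add.r_cancel zero_closed)
qed

lemma smult_zero: "c \<odot> \<zero> = \<zero>"
  using smult_smult[OF zero_closed, of c 0] smult_zero_scalar[OF zero_closed] by simp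

lemma smult_one_mult: "x \<in> carrier A \<Longrightarrow> (c \<odot> \<one>) \<otimes> x = c \<odot> x"
  by (simp add: smult_mult_left)

lemma mult_smult_one: "x \<in> carrier A \<Longrightarrow> x \<otimes> (c \<odot> \<one>) = c \<odot> x"
  by (simp add: smult_mult_right)

lemma smult_minus: "x \<in> carrier A \<Longrightarrow> (- 1) \<odot> x = \<ominus> x"
  using smult_add_left[of x "- 1" 1]
  by (intro minus_equality[symmetric]) (simp_all add: smult_zero_scalar smult_1 smult_in)

lemma finsum_smult:
  "f \<in> I \<rightarrow> carrier A \<Longrightarrow> c \<odot> finsum A f I = (\<Oplus>i\<in>I. c \<odot> f i)"
proof (induction I rule: infinite_finite_induct)
  case (insert i I)
  then have "f i \<in> carrier A" "f \<in> I \<rightarrow> carrier A" "(\<lambda>i. c \<odot> f i) \<in> I \<rightarrow> carrier A"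
    by (auto intro: smult_in)
  then show ?case using insert by (simp add: smult_in smult_add_right)
qed (simp_all add: smult_zero)

end

section \<open>Bimodules and the induced action of the ground field\<close>

locale bimodule_over = k_algebra A for A :: "('k::field, 'a) module" (structure) +
  fixes M :: "('a, 'b) bimod"
  assumes bimodule: "bimodule A M"
begin

sublocale M: abelian_group M
  using bimodule by (simp add: bimodule_def)

abbreviation sc :: "'k \<Rightarrow> 'b \<Rightarrow> 'b" where "sc \<equiv> scale A M"

lemma lact_closed [simp, intro]: "a \<in> carrier A \<Longrightarrow> x \<in> carrier M \<Longrightarrow> lact M a x \<in> carrier M"
  and ract_closed [simp, intro]: "a \<in> carrier A \<Longrightarrow> x \<in> carrier M \<Longrightarrow> ract M x a \<in> carrier M"
  and lact_add: "a \<in> carrier A \<Longrightarrow> x \<in> carrier M \<Longrightarrow> y \<in> carrier M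
    \<Longrightarrow> lact M a (x \<oplus>\<^bsub>M\<^esub> y) = lact M a x \<oplus>\<^bsub>M\<^esub> lact M a y"
  and ract_add: "a \<in> carrier A \<Longrightarrow> x \<in> carrier M \<Longrightarrow> y \<in> carrier M
    \<Longrightarrow> ract M (x \<oplus>\<^bsub>M\<^esub> y) a = ract M x a \<oplus>\<^bsub>M\<^esub> ract M y a"
  and add_lact: "a \<in> carrier A \<Longrightarrow> b \<in> carrier A \<Longrightarrow> x \<in> carrier M
    \<Longrightarrow> lact M (a \<oplus> b) x = lact M a x \<oplus>\<^bsub>M\<^esub> lact M b x"
  and add_ract: "a \<in> carrier A \<Longrightarrow> b \<in> carrier A \<Longrightarrow> x \<in> carrier M
    \<Longrightarrow> ract M x (a \<oplus> b) = ract M x a \<oplus>\<^bsub>M\<^esub> ract M x b"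
  and lact_mult: "a \<in> carrier A \<Longrightarrow> b \<in> carrier A \<Longrightarrow> x \<in> carrier M
    \<Longrightarrow> lact M (a \<otimes> b) x = lact M a (lact M b x)"
  and ract_mult: "a \<in> carrier A \<Longrightarrow> b \<in> carrier A \<Longrightarrow> x \<in> carrier M
    \<Longrightarrow> ract M x (a \<otimes> b) = ract M (ract M x a) b"
  and ract_lact: "a \<in> carrier A \<Longrightarrow> b \<in> carrier A \<Longrightarrow> x \<in> carrier M
    \<Longrightarrow> ract M (lact M a x) b = lact M a (ract M x b)"
  and lact_one [simp]: "x \<in> carrier M \<Longrightarrow> lact M \<one> x = x"
  and ract_one [simp]: "x \<in> carrier M \<Longrightarrow> ract M x \<one> = x"
  and central: "x \<in> carrier M \<Longrightarrow> ract M x (c \<odot> \<one>) = lact M (c \<odot> \<one>) x"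
  using bimodule unfolding bimodule_def by (blast | simp)+

lemma sc_closed [simp, intro]: "x \<in> carrier M \<Longrightarrow> sc c x \<in> carrier M"
  by (simp add: scale_def smult_in)

lemma sc_add: "x \<in> carrier M \<Longrightarrow> y \<in> carrier M \<Longrightarrow> sc c (x \<oplus>\<^bsub>M\<^esub> y) = sc c x \<oplus>\<^bsub>M\<^esub> sc c y"
  by (simp add: scale_def smult_in lact_add)

lemma add_sc: "x \<in> carrier M \<Longrightarrow> sc (c + d) x = sc c x \<oplus>\<^bsub>M\<^esub> sc d x"
  by (simp add: scale_def smult_in smult_add_left add_lact)

lemma sc_sc: "x \<in> carrier M \<Longrightarrow> sc (c * d) x = sc c (sc d x)"
  by (simp add: scale_def smult_in smult_smult smult_one_mult flip: lact_mult)

lemma sc_1 [simp]: "x \<in> carrier M \<Longrightarrow> sc 1 x = x"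
  by (simp add: scale_def smult_1)

lemma lact_smult: "a \<in> carrier A \<Longrightarrow> x \<in> carrier M \<Longrightarrow> lact M (c \<odot> a) x = sc c (lact M a x)"
  by (simp add: scale_def smult_in smult_one_mult flip: lact_mult)

lemma lact_sc: "a \<in> carrier A \<Longrightarrow> x \<in> carrier M \<Longrightarrow> lact M a (sc c x) = sc c (lact M a x)"
  by (simp add: scale_def smult_in smult_one_mult mult_smult_one flip: lact_mult)

text \<open>By \<open>central\<close>, right multiplication by \<open>c \<odot> \<one>\<close> is
  left multiplication by it, which commutes with the right action of \<open>a\<close>.\<close>

lemma ract_smult: "a \<in> carrier A \<Longrightarrow> x \<in> carrier M \<Longrightarrow> ract M x (c \<odot> a) = sc c (ract M x a)"
  using ract_mult[of "c \<odot> \<one>" a x]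
  by (simp add: scale_def smult_in smult_one_mult central ract_lact)

lemma ract_sc: "a \<in> carrier A \<Longrightarrow> x \<in> carrier M \<Longrightarrow> ract M (sc c x) a = sc c (ract M x a)"
  by (simp add: scale_def smult_in ract_lact)

lemma lact_zero [simp]: "a \<in> carrier A \<Longrightarrow> lact M a \<zero>\<^bsub>M\<^esub> = \<zero>\<^bsub>M\<^esub>"
  by (metis M.add.l_cancel_one M.zero_closed M.l_zero lact_add lact_closed)

lemma ract_zero [simp]: "a \<in> carrier A \<Longrightarrow> ract M \<zero>\<^bsub>M\<^esub> a = \<zero>\<^bsub>M\<^esub>"
  by (metis M.add.l_cancel_one M.zero_closed M.l_zero ract_add ract_closed)

lemma zero_lact [simp]: "x \<in> carrier M \<Longrightarrow> lact M \<zero> x = \<zero>\<^bsub>M\<^esub>"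
  by (metis M.add.l_cancel_one zero_closed l_zero add_lact lact_closed)

lemma zero_ract [simp]: "x \<in> carrier M \<Longrightarrow> ract M x \<zero> = \<zero>\<^bsub>M\<^esub>"
  by (metis M.add.l_cancel_one zero_closed l_zero add_ract ract_closed)

lemma sc_zero [simp]: "sc c \<zero>\<^bsub>M\<^esub> = \<zero>\<^bsub>M\<^esub>"
  by (simp add: scale_def smult_in)

lemma zero_sc [simp]: "x \<in> carrier M \<Longrightarrow> sc 0 x = \<zero>\<^bsub>M\<^esub>"
  by (simp add: scale_def smult_zero_scalar)

lemma sc_minus: "x \<in> carrier M \<Longrightarrow> sc (- 1) x = \<ominus>\<^bsub>M\<^esub> x"
  using add_sc[of x "- 1" 1] by (intro M.minus_equality[symmetric]) simp_all

lemma sc_finsum: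
  "f \<in> I \<rightarrow> carrier M \<Longrightarrow> sc c (finsum M f I) = (\<Oplus>\<^bsub>M\<^esub>i\<in>I. sc c (f i))"
proof (induction I rule: infinite_finite_induct)
  case (insert i I)
  then show ?case by (simp add: Pi_def sc_add)
qed simp_all

end

lemma (in k_algebra) bimodule_overI: "bimodule A M \<Longrightarrow> bimodule_over A M"
  by unfold_locales

lemma (in k_algebra) bimodule_regular: "bimodule A (regular_bimod A)"
proof -
  have "abelian_group (regular_bimod A)"
    by (rule abelian_groupI)
      (auto simp: regular_bimod_def a_ac intro: add.l_inv_ex)
  then show ?thesis
    by (simp add: bimodule_def)
      (simp add: regular_bimod_def l_distr r_distr m_assoc smult_one_mult mult_smult_one)
qed

lemma regular_bimod_simps [simp]:
  "carrier (regular_bimod A) = carrier A"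
  "ring.zero (regular_bimod A) = ring.zero A"
  "ring.add (regular_bimod A) = ring.add A"
  "lact (regular_bimod A) = monoid.mult A"
  "ract (regular_bimod A) = monoid.mult A"
  by (simp_all add: regular_bimod_def)

lemma (in k_algebra) scale_regular [simp]:
  "x \<in> carrier A \<Longrightarrow> scale A (regular_bimod A) c x = c \<odot> x"
  by (simp add: scale_def smult_one_mult)

lemma bimod_homI:
  assumes "\<And>x. x \<in> carrier M \<Longrightarrow> f x \<in> carrier N"
    and "\<And>x y. x \<in> carrier M \<Longrightarrow> y \<in> carrier M \<Longrightarrow> f (x \<oplus>\<^bsub>M\<^esub> y) = f x \<oplus>\<^bsub>N\<^esub> f y"
    and "\<And>a x. a \<in> carrier A \<Longrightarrow> x \<in> carrier M \<Longrightarrow> f (lact M a x) = lact N a (f x)"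
    and "\<And>a x. a \<in> carrier A \<Longrightarrow> x \<in> carrier M \<Longrightarrow> f (ract M x a) = ract N (f x) a"
    and "f \<in> extensional (carrier M)"
  shows "f \<in> bimod_hom A M N"
  using assms by (auto simp: bimod_hom_def PiE_def)

lemma bimod_homD:
  assumes "f \<in> bimod_hom A M N"
  shows "x \<in> carrier M \<Longrightarrow> f x \<in> carrier N"
    and "x \<in> carrier M \<Longrightarrow> y \<in> carrier M \<Longrightarrow> f (x \<oplus>\<^bsub>M\<^esub> y) = f x \<oplus>\<^bsub>N\<^esub> f y"
    and "a \<in> carrier A \<Longrightarrow> x \<in> carrier M \<Longrightarrow> f (lact M a x) = lact N a (f x)"
    and "a \<in> carrier A \<Longrightarrow> x \<in> carrier M \<Longrightarrow> f (ract M x a) = ract N (f x) a"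
    and "f \<in> extensional (carrier M)"
  using assms by (auto simp: bimod_hom_def PiE_def)

lemma bimod_hom_eqI:
  assumes "f \<in> bimod_hom A M N" "g \<in> bimod_hom A M N" "\<And>x. x \<in> carrier M \<Longrightarrow> f x = g x"
  shows "f = g"
  using assms by (meson bimod_homD(5) extensionalityI)

section \<open>Homomorphisms between two bimodules\<close>

locale bimodule_pair = k_algebra A + M: bimodule_over A M + N: bimodule_over A N
  for A :: "('k::field, 'a) module" (structure)
    and M :: "('a, 'b) bimod" and N :: "('a, 'c) bimod"
begin

lemma restrict_hom:
  assumes "\<And>x. x \<in> carrier M \<Longrightarrow> f x \<in> carrier N"
    and "\<And>x y. x \<in> carrier M \<Longrightarrow> y \<in> carrier M \<Longrightarrow> f (x \<oplus>\<^bsub>M\<^esub> y) = f x \<oplus>\<^bsub>N\<^esub> f y"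
    and "\<And>a x. a \<in> carrier A \<Longrightarrow> x \<in> carrier M \<Longrightarrow> f (lact M a x) = lact N a (f x)"
    and "\<And>a x. a \<in> carrier A \<Longrightarrow> x \<in> carrier M \<Longrightarrow> f (ract M x a) = ract N (f x) a"
  shows "restrict f (carrier M) \<in> bimod_hom A M N"
  by (rule bimod_homI) (use assms in auto)

lemma hom_zero:
  assumes "f \<in> bimod_hom A M N" shows "f \<zero>\<^bsub>M\<^esub> = \<zero>\<^bsub>N\<^esub>"
  using bimod_homD(1,2)[OF assms, of "\<zero>\<^bsub>M\<^esub>"]
  by (metis M.M.l_zero M.M.zero_closed N.M.add.r_cancel_one)

lemma hom_scale:
  assumes "f \<in> bimod_hom A M N" "x \<in> carrier M" shows "f (scale A M c x) = scale A N c (f x)"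
  using bimod_homD(3)[OF assms(1) _ assms(2), of "c \<odot> \<one>"] smult_in by (simp add: scale_def)

lemma hom_minus:
  assumes "f \<in> bimod_hom A M N" "x \<in> carrier M" shows "f (\<ominus>\<^bsub>M\<^esub> x) = \<ominus>\<^bsub>N\<^esub> f x"
  using hom_scale[OF assms, of "-1"] assms by (simp add: M.sc_minus N.sc_minus bimod_homD(1))

lemma hom_finsum:
  assumes "f \<in> bimod_hom A M N"
  shows "g \<in> I \<rightarrow> carrier M \<Longrightarrow> f (finsum M g I) = (\<Oplus>\<^bsub>N\<^esub>i\<in>I. f (g i))"
proof (induction I rule: infinite_finite_induct)
  case (insert i I)
  then show ?case
    using bimod_homD(1,2)[OF assms] by (simp add: Pi_def)
qed (simp_all add: hom_zero[OF assms])

lemma hom_module_simps: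
  "carrier (hom_module A M N) = bimod_hom A M N"
  "\<zero>\<^bsub>hom_module A M N\<^esub> = (\<lambda>x\<in>carrier M. \<zero>\<^bsub>N\<^esub>)"
  "f \<oplus>\<^bsub>hom_module A M N\<^esub> g = (\<lambda>x\<in>carrier M. f x \<oplus>\<^bsub>N\<^esub> g x)"
  "c \<odot>\<^bsub>hom_module A M N\<^esub> f = (\<lambda>x\<in>carrier M. scale A N c (f x))"
  by (simp_all add: hom_module_def)

lemma zero_hom: "(\<lambda>x\<in>carrier M. \<zero>\<^bsub>N\<^esub>) \<in> bimod_hom A M N"
  by (rule restrict_hom) auto

lemma add_hom:
  assumes "f \<in> bimod_hom A M N" "g \<in> bimod_hom A M N"
  shows "(\<lambda>x\<in>carrier M. f x \<oplus>\<^bsub>N\<^esub> g x) \<in> bimod_hom A M N"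
  by (rule restrict_hom)
    (use bimod_homD(1-4)[OF assms(1)] bimod_homD(1-4)[OF assms(2)] in
      \<open>simp_all add: N.lact_add N.ract_add N.M.a_ac\<close>)

lemma scale_hom:
  assumes "f \<in> bimod_hom A M N"
  shows "(\<lambda>x\<in>carrier M. scale A N c (f x)) \<in> bimod_hom A M N"
  by (rule restrict_hom)
    (use bimod_homD(1-4)[OF assms(1)] in \<open>simp_all add: N.sc_add N.ract_sc N.lact_sc\<close>)

lemma hom_module_abelian_group: "abelian_group (hom_module A M N)"
proof (rule abelian_groupI)
  fix f assume f: "f \<in> carrier (hom_module A M N)"
  let ?g = "\<lambda>x\<in>carrier M. scale A N (-1) (f x)"
  have "?g \<oplus>\<^bsub>hom_module A M N\<^esub> f = \<zero>\<^bsub>hom_module A M N\<^esub>"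
    using f bimod_homD(1)[of f A M N]
    by (auto simp: hom_module_simps N.sc_minus N.M.l_neg intro!: restrict_ext)
  moreover have "?g \<in> carrier (hom_module A M N)"
    using scale_hom f by (simp add: hom_module_simps)
  ultimately show "\<exists>g\<in>carrier (hom_module A M N). g \<oplus>\<^bsub>hom_module A M N\<^esub> f = \<zero>\<^bsub>hom_module A M N\<^esub>"
    by blast
  have "f \<in> extensional (carrier M)" "\<And>x. x \<in> carrier M \<Longrightarrow> f x \<in> carrier N"
    using f bimod_homD(1,5)[of f A M N] by (simp_all add: hom_module_simps)
  then show "\<zero>\<^bsub>hom_module A M N\<^esub> \<oplus>\<^bsub>hom_module A M N\<^esub> f = f"
    by (auto simp: hom_module_simps extensional_def)
qed (auto simp: hom_module_simps zero_hom add_hom N.M.a_ac bimod_homD(1) intro!: restrict_ext)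

end

lemma (in k_algebra) bimodule_pairI:
  "bimodule A M \<Longrightarrow> bimodule A N \<Longrightarrow> bimodule_pair A M N"
  by (simp add: bimodule_pair_def bimodule_overI k_algebra_axioms)

lemma (in k_algebra) comp_hom:
  assumes "bimodule A L" "f \<in> bimod_hom A L M" "g \<in> bimod_hom A M N"
  shows "(\<lambda>x\<in>carrier L. g (f x)) \<in> bimod_hom A L N"
proof -
  interpret L: bimodule_over A L by (rule bimodule_overI) fact
  note * = bimod_homD(1-4)[OF assms(2)] bimod_homD(1-4)[OF assms(3)]
  show ?thesis
    by (rule bimod_homI) (simp_all add: *)
qed

section \<open>Tensor products\<close>

text \<open>Lists of pairs stand for sums of pure tensors. Every element of
  \<open>tensor_carrier\<close> has such a representative, and both actions can be computed on it
  entry by entry.\<close>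

definition tensor_sum ::
    "('k::field, 'a) module \<Rightarrow> 'a \<Rightarrow> 'a \<Rightarrow> ('a \<times> 'a) list \<Rightarrow> ('k, 'a) tensor" where
  "tensor_sum A e f xs =
     (\<lambda>\<beta>. \<Sum>(v, w)\<leftarrow>xs. pure_tensor A (left_ideal_of A e) (right_ideal_of A f) v w \<beta>)"

locale tensor_product = k_algebra A for A :: "('k::field, 'a) module" (structure) +
  fixes e f :: 'a
  assumes e_in [simp]: "e \<in> carrier A" and f_in [simp]: "f \<in> carrier A"
begin

abbreviation V :: "'a set" where "V \<equiv> left_ideal_of A e"
abbreviation W :: "'a set" where "W \<equiv> right_ideal_of A f"
abbreviation pt :: "'a \<Rightarrow> 'a \<Rightarrow> ('k, 'a) tensor" where "pt \<equiv> pure_tensor A V W"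
abbreviation ts :: "('a \<times> 'a) list \<Rightarrow> ('k, 'a) tensor" where "ts \<equiv> tensor_sum A e f"
abbreviation T :: "('a, ('k, 'a) tensor) bimod" where "T \<equiv> tensor_bimod A e f"

lemma V_carrier: "v \<in> V \<Longrightarrow> v \<in> carrier A"
  and W_carrier: "w \<in> W \<Longrightarrow> w \<in> carrier A"
  by (auto simp: left_ideal_of_def right_ideal_of_def)

lemma V_add: "v \<in> V \<Longrightarrow> v' \<in> V \<Longrightarrow> v \<oplus> v' \<in> V"
  by (auto simp: left_ideal_of_def simp flip: l_distr)

lemma W_add: "v \<in> W \<Longrightarrow> v' \<in> W \<Longrightarrow> v \<oplus> v' \<in> W"
  by (auto simp: right_ideal_of_def simp flip: r_distr)

lemma V_smult: "v \<in> V \<Longrightarrow> c \<odot> v \<in> V"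
  by (auto simp: left_ideal_of_def smult_in simp flip: smult_mult_left)

lemma W_smult: "v \<in> W \<Longrightarrow> c \<odot> v \<in> W"
  by (auto simp: right_ideal_of_def smult_in simp flip: smult_mult_right)

lemma V_mult: "a \<in> carrier A \<Longrightarrow> v \<in> V \<Longrightarrow> a \<otimes> v \<in> V"
  by (auto simp: left_ideal_of_def simp flip: m_assoc)

lemma W_mult: "a \<in> carrier A \<Longrightarrow> w \<in> W \<Longrightarrow> w \<otimes> a \<in> W"
  by (auto simp: right_ideal_of_def m_assoc)

lemma pt_add_left: "v \<in> V \<Longrightarrow> v' \<in> V \<Longrightarrow> w \<in> W \<Longrightarrow> pt (v \<oplus> v') w \<beta> = pt v w \<beta> + pt v' w \<beta>"
  and pt_add_right: "v \<in> V \<Longrightarrow> w \<in> W \<Longrightarrow> w' \<in> W \<Longrightarrow> pt v (w \<oplus> w') \<beta> = pt v w \<beta> + pt v w' \<beta>"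
  and pt_smult_left: "v \<in> V \<Longrightarrow> w \<in> W \<Longrightarrow> pt (c \<odot> v) w \<beta> = c * pt v w \<beta>"
  and pt_smult_right: "v \<in> V \<Longrightarrow> w \<in> W \<Longrightarrow> pt v (c \<odot> w) \<beta> = c * pt v w \<beta>"
  by (auto simp: pure_tensor_def bilinear_forms_def)

lemma ts_Nil [simp]: "ts [] \<beta> = 0"
  and ts_Cons [simp]: "ts ((v, w) # xs) \<beta> = pt v w \<beta> + ts xs \<beta>"
  and ts_append: "ts (xs @ ys) \<beta> = ts xs \<beta> + ts ys \<beta>"
  by (simp_all add: tensor_sum_def)

lemma T_simps:
  "carrier T = {t. \<exists>xs. set xs \<subseteq> V \<times> W \<and> t = ts xs}"
  "\<zero>\<^bsub>T\<^esub> = (\<lambda>\<beta>. 0)"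
  "s \<oplus>\<^bsub>T\<^esub> t = (\<lambda>\<beta>. s \<beta> + t \<beta>)"
  by (simp_all add: tensor_bimod_def tensor_carrier_def Let_def tensor_sum_def)

text \<open>The left action evaluates a tensor at a shifted form, and pure tensors are 0 at
  functions that are not bilinear. The formula \<open>lact_ts\<close> depends on the shifted form
  being bilinear again.\<close>

lemma shift_left_bilinear:
  "\<beta> \<in> bilinear_forms A V W \<Longrightarrow> a \<in> carrier A \<Longrightarrow> (\<lambda>v w. \<beta> (a \<otimes> v) w) \<in> bilinear_forms A V W"
  by (simp add: bilinear_forms_def V_mult V_carrier r_distr smult_mult_right)

lemma shift_right_bilinear:
  "\<beta> \<in> bilinear_forms A V W \<Longrightarrow> a \<in> carrier A \<Longrightarrow> (\<lambda>v w. \<beta> v (w \<otimes> a)) \<in> bilinear_forms A V W"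
  by (simp add: bilinear_forms_def W_mult W_carrier l_distr smult_mult_left)

lemma lact_ts:
  assumes "a \<in> carrier A"
  shows "lact T a (ts xs) = ts (map (\<lambda>(v, w). (a \<otimes> v, w)) xs)"
proof
  fix \<beta>
  show "lact T a (ts xs) \<beta> = ts (map (\<lambda>(v, w). (a \<otimes> v, w)) xs) \<beta>"
    by (induction xs)
      (use assms in \<open>auto simp: tensor_bimod_def Let_def shift_left_bilinear pure_tensor_def\<close>)
qed

lemma ract_ts:
  assumes "a \<in> carrier A"
  shows "ract T (ts xs) a = ts (map (\<lambda>(v, w). (v, w \<otimes> a)) xs)"
proof
  fix \<beta>
  show "ract T (ts xs) a \<beta> = ts (map (\<lambda>(v, w). (v, w \<otimes> a)) xs) \<beta>"
    by (induction xs)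
      (use assms in \<open>auto simp: tensor_bimod_def Let_def shift_right_bilinear pure_tensor_def\<close>)
qed

lemma ts_map_cong:
  assumes "\<And>v w. v \<in> V \<Longrightarrow> w \<in> W \<Longrightarrow> pt (g v) (h w) \<beta> = pt (g' v) (h' w) \<beta>"
  shows "set xs \<subseteq> V \<times> W \<Longrightarrow>
    ts (map (\<lambda>(v, w). (g v, h w)) xs) \<beta> = ts (map (\<lambda>(v, w). (g' v, h' w)) xs) \<beta>"
  by (induction xs) (auto simp: assms)

lemma ts_map_add:
  assumes "\<And>v w. v \<in> V \<Longrightarrow> w \<in> W \<Longrightarrow>
    pt (g v) (h w) \<beta> = pt (g' v) (h' w) \<beta> + pt (g'' v) (h'' w) \<beta>"
  shows "set xs \<subseteq> V \<times> W \<Longrightarrow> ts (map (\<lambda>(v, w). (g v, h w)) xs) \<beta> =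
    ts (map (\<lambda>(v, w). (g' v, h' w)) xs) \<beta> + ts (map (\<lambda>(v, w). (g'' v, h'' w)) xs) \<beta>"
  by (induction xs) (auto simp: assms)

lemma ts_in: "set xs \<subseteq> V \<times> W \<Longrightarrow> ts xs \<in> carrier T"
  by (auto simp: T_simps)

lemma T_cases:
  assumes "t \<in> carrier T"
  obtains xs where "set xs \<subseteq> V \<times> W" "t = ts xs"
  using assms by (auto simp: T_simps)

lemma map_left_in: "set xs \<subseteq> V \<times> W \<Longrightarrow> a \<in> carrier A \<Longrightarrow> set (map (\<lambda>(v, w). (a \<otimes> v, w)) xs) \<subseteq> V \<times> W"
  and map_right_in: "set xs \<subseteq> V \<times> W \<Longrightarrow> a \<in> carrier A \<Longrightarrow> set (map (\<lambda>(v, w). (v, w \<otimes> a)) xs) \<subseteq> V \<times> W"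
  by (auto simp: V_mult W_mult)

lemma T_abelian_group: "abelian_group T"
proof (rule abelian_groupI)
  fix s t assume "s \<in> carrier T" "t \<in> carrier T"
  then obtain xs ys where xs: "set xs \<subseteq> V \<times> W" "s = ts xs" and ys: "set ys \<subseteq> V \<times> W" "t = ts ys"
    by (elim T_cases)
  have "s \<oplus>\<^bsub>T\<^esub> t = ts (xs @ ys)"
    by (simp add: T_simps xs ys ts_append fun_eq_iff)
  then show "s \<oplus>\<^bsub>T\<^esub> t \<in> carrier T"
    using ts_in[of "xs @ ys"] xs ys by simp
next
  have "\<zero>\<^bsub>T\<^esub> = ts []" by (simp add: T_simps fun_eq_iff)
  then show "\<zero>\<^bsub>T\<^esub> \<in> carrier T" using ts_in[of "[]"] by simp
next
  fix s assume "s \<in> carrier T"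
  then obtain xs where xs: "set xs \<subseteq> V \<times> W" "s = ts xs" by (rule T_cases)
  \<comment> \<open>The sign is put into the left entries, which keeps the negative a sum of pure
    tensors from the same two subspaces.\<close>
  define ys where "ys = map (\<lambda>(v, w). ((- 1) \<odot> v, w)) xs"
  have "set ys \<subseteq> V \<times> W" using xs V_smult by (auto simp: ys_def)
  moreover have "ts ys \<beta> + ts xs \<beta> = 0" for \<beta>
    using xs(1) unfolding ys_def by (induction xs) (auto simp: pt_smult_left)
  ultimately show "\<exists>t\<in>carrier T. t \<oplus>\<^bsub>T\<^esub> s = \<zero>\<^bsub>T\<^esub>"
    using ts_in by (intro bexI[of _ "ts ys"]) (simp_all add: T_simps(2,3) xs(2))
qed (simp_all add: T_simps(2,3) add_ac)

lemma tensor_bimodule: "bimodule A T"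
proof -
  have closed: "lact T a s \<in> carrier T \<and> ract T s a \<in> carrier T"
    if "a \<in> carrier A" "s \<in> carrier T" for a s
    using that(2) by (rule T_cases)
      (use that(1) in \<open>simp add: lact_ts ract_ts ts_in map_left_in map_right_in del: set_map\<close>)
  have add: "lact T a (s \<oplus>\<^bsub>T\<^esub> t) = lact T a s \<oplus>\<^bsub>T\<^esub> lact T a t \<and>
        ract T (s \<oplus>\<^bsub>T\<^esub> t) a = ract T s a \<oplus>\<^bsub>T\<^esub> ract T t a"
    if "a \<in> carrier A" "s \<in> carrier T" "t \<in> carrier T" for a s t
    by (auto simp: T_simps tensor_bimod_def Let_def)
  have rest: "lact T (a \<oplus> b) s = lact T a s \<oplus>\<^bsub>T\<^esub> lact T b s"
      "ract T s (a \<oplus> b) = ract T s a \<oplus>\<^bsub>T\<^esub> ract T s b"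
      "lact T (a \<otimes> b) s = lact T a (lact T b s)"
      "ract T s (a \<otimes> b) = ract T (ract T s a) b"
      "ract T (lact T a s) b = lact T a (ract T s b)"
    if ab: "a \<in> carrier A" "b \<in> carrier A" and s: "s \<in> carrier T" for a b s
  proof -
    obtain xs where xs: "set xs \<subseteq> V \<times> W" "s = ts xs" using s by (rule T_cases)
    show "lact T (a \<oplus> b) s = lact T a s \<oplus>\<^bsub>T\<^esub> lact T b s"
      using ab xs(1) unfolding xs(2)
      by (auto simp: lact_ts T_simps(3) l_distr V_carrier pt_add_left V_mult intro!: ts_map_add)
    show "ract T s (a \<oplus> b) = ract T s a \<oplus>\<^bsub>T\<^esub> ract T s b"
      using ab xs(1) unfolding xs(2)
      by (auto simp: ract_ts T_simps(3) r_distr W_carrier pt_add_right W_mult intro!: ts_map_add)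
    show "lact T (a \<otimes> b) s = lact T a (lact T b s)"
      using ab xs(1) unfolding xs(2)
      by (force simp: lact_ts m_assoc V_carrier intro!: arg_cong[of _ _ ts])
    show "ract T s (a \<otimes> b) = ract T (ract T s a) b"
      using ab xs(1) unfolding xs(2)
      by (force simp: ract_ts m_assoc W_carrier intro!: arg_cong[of _ _ ts])
    show "ract T (lact T a s) b = lact T a (ract T s b)"
      using ab xs(1) unfolding xs(2)
      by (force simp: lact_ts ract_ts intro!: arg_cong[of _ _ ts])
  qed
  have units: "lact T \<one> s = s" "ract T s \<one> = s" "lact T (c \<odot> \<one>) s = ract T s (c \<odot> \<one>)"
    if s: "s \<in> carrier T" for s c
  proof -
    obtain xs where xs: "set xs \<subseteq> V \<times> W" "s = ts xs" using s by (rule T_cases)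
    show "lact T \<one> s = s"
      using xs(1) unfolding xs(2)
      by (force simp: lact_ts V_carrier intro!: arg_cong[of _ _ ts] map_idI)
    show "ract T s \<one> = s"
      using xs(1) unfolding xs(2)
      by (force simp: ract_ts W_carrier intro!: arg_cong[of _ _ ts] map_idI)
    \<comment> \<open>Bilinearity lets a scalar cross the tensor sign; the representing lists
      differ, but their entries have equal values.\<close>
    show "lact T (c \<odot> \<one>) s = ract T s (c \<odot> \<one>)"
      using xs(1) unfolding xs(2)
      by (auto simp: lact_ts ract_ts smult_in V_carrier W_carrier smult_one_mult mult_smult_one
          pt_smult_left pt_smult_right intro!: ts_map_cong)
  qed
  show ?thesis
    unfolding bimodule_def using T_abelian_group closed add rest units by auto
qed

lemma T_zero: "\<zero>\<^bsub>T\<^esub> = ts []"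
  by (simp add: T_simps fun_eq_iff)

lemma pt_ts: "pt v w = ts [(v, w)]"
  by (simp add: fun_eq_iff)

lemma pt_in: "v \<in> V \<Longrightarrow> w \<in> W \<Longrightarrow> pt v w \<in> carrier T"
  by (simp add: pt_ts ts_in)

lemma lact_pt: "a \<in> carrier A \<Longrightarrow> lact T a (pt v w) = pt (a \<otimes> v) w"
  and ract_pt: "a \<in> carrier A \<Longrightarrow> ract T (pt v w) a = pt v (w \<otimes> a)"
  by (simp_all add: pt_ts lact_ts ract_ts)

lemma T_induct:
  assumes "t \<in> carrier T" "Q \<zero>\<^bsub>T\<^esub>"
    and "\<And>v w. v \<in> V \<Longrightarrow> w \<in> W \<Longrightarrow> Q (pt v w)"
    and "\<And>s t. s \<in> carrier T \<Longrightarrow> t \<in> carrier T \<Longrightarrow> Q s \<Longrightarrow> Q t \<Longrightarrow> Q (s \<oplus>\<^bsub>T\<^esub> t)"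
  shows "Q t"
proof -
  obtain xs where "set xs \<subseteq> V \<times> W" "t = ts xs" using assms(1) by (rule T_cases)
  moreover have "set xs \<subseteq> V \<times> W \<Longrightarrow> Q (ts xs)" for xs
  proof (induction xs)
    case Nil show ?case by (rule assms(2)[unfolded T_zero])
  next
    case (Cons x xs)
    obtain v w where x: "x = (v, w)" by fastforce
    have "ts (x # xs) = pt v w \<oplus>\<^bsub>T\<^esub> ts xs" by (simp add: x T_simps fun_eq_iff)
    then show ?case using Cons assms(3,4) x by (simp add: pt_in ts_in)
  qed
  ultimately show ?thesis by simp
qed

end

section \<open>Direct sums\<close>

lemma direct_sum_simps:
  "carrier (direct_sum_bimod I M) = (\<Pi>\<^sub>E i\<in>I. carrier (M i))"
  "\<zero>\<^bsub>direct_sum_bimod I M\<^esub> = (\<lambda>i\<in>I. \<zero>\<^bsub>M i\<^esub>)"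
  "s \<oplus>\<^bsub>direct_sum_bimod I M\<^esub> t = (\<lambda>i\<in>I. s i \<oplus>\<^bsub>M i\<^esub> t i)"
  "lact (direct_sum_bimod I M) a t = (\<lambda>i\<in>I. lact (M i) a (t i))"
  "ract (direct_sum_bimod I M) t a = (\<lambda>i\<in>I. ract (M i) (t i) a)"
  by (simp_all add: direct_sum_bimod_def)

lemma (in k_algebra) direct_sum_bimodule:
  assumes "\<And>i. i \<in> I \<Longrightarrow> bimodule A (M i)"
  shows "bimodule A (direct_sum_bimod I M)"
proof -
  have M: "bimodule_over A (M i)" if "i \<in> I" for i
    using assms[OF that] by (rule bimodule_overI)
  have G: "abelian_group (M i)" if "i \<in> I" for i
    using assms[OF that] by (simp add: bimodule_def)
  let ?D = "direct_sum_bimod I M"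
  have mem: "s i \<in> carrier (M i)" if "s \<in> carrier ?D" "i \<in> I" for s i
    using that by (auto simp: direct_sum_simps)
  have D: "abelian_group ?D"
  proof (rule abelian_groupI)
    fix s assume s: "s \<in> carrier ?D"
    let ?t = "\<lambda>i\<in>I. \<ominus>\<^bsub>M i\<^esub> s i"
    have "?t \<in> carrier ?D"
      using mem[OF s] by (simp add: direct_sum_simps abelian_group.a_inv_closed[OF G])
    moreover have "?t \<oplus>\<^bsub>?D\<^esub> s = \<zero>\<^bsub>?D\<^esub>"
      using mem[OF s] by (auto simp: direct_sum_simps abelian_group.l_neg[OF G] intro!: restrict_ext)
    ultimately show "\<exists>t\<in>carrier ?D. t \<oplus>\<^bsub>?D\<^esub> s = \<zero>\<^bsub>?D\<^esub>" by blast
    have "s \<in> extensional I" using s by (simp add: direct_sum_simps PiE_def)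
    then show "\<zero>\<^bsub>?D\<^esub> \<oplus>\<^bsub>?D\<^esub> s = s"
      using mem[OF s] by (auto simp: direct_sum_simps extensional_def fun_eq_iff
          abelian_groupE(5)[OF G])
  next
    fix s t u assume "s \<in> carrier ?D" "t \<in> carrier ?D" "u \<in> carrier ?D"
    note mem' = mem[OF this(1)] mem[OF this(2)] mem[OF this(3)]
    show "s \<oplus>\<^bsub>?D\<^esub> t \<oplus>\<^bsub>?D\<^esub> u = s \<oplus>\<^bsub>?D\<^esub> (t \<oplus>\<^bsub>?D\<^esub> u)"
      using mem' by (auto simp: direct_sum_simps abelian_groupE(3)[OF G] intro!: restrict_ext)
  next
    fix s t assume "s \<in> carrier ?D" "t \<in> carrier ?D"
    note mem' = mem[OF this(1)] mem[OF this(2)]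
    show "s \<oplus>\<^bsub>?D\<^esub> t \<in> carrier ?D"
      using mem' by (auto simp: direct_sum_simps abelian_groupE(1)[OF G])
    show "s \<oplus>\<^bsub>?D\<^esub> t = t \<oplus>\<^bsub>?D\<^esub> s"
      using mem' by (auto simp: direct_sum_simps abelian_groupE(4)[OF G] intro!: restrict_ext)
  qed (auto simp: direct_sum_simps abelian_groupE(2)[OF G])
  have rest: "lact ?D (c \<odot> \<one>) s = ract ?D s (c \<odot> \<one>)" if "s \<in> carrier ?D" for c s
    using mem[OF that] by (auto simp: direct_sum_simps bimodule_over.central[OF M] intro!: restrict_ext)
  have units: "lact ?D \<one> s = s" "ract ?D s \<one> = s" if s: "s \<in> carrier ?D" for s
  proof -
    have "s \<in> extensional I" using s by (simp add: direct_sum_simps PiE_def)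
    then show "lact ?D \<one> s = s" "ract ?D s \<one> = s"
      using mem[OF s] by (auto simp: direct_sum_simps extensional_def fun_eq_iff
          bimodule_over.lact_one[OF M] bimodule_over.ract_one[OF M])
  qed
  have closed: "lact ?D a s \<in> carrier ?D" "ract ?D s a \<in> carrier ?D"
    if "a \<in> carrier A" "s \<in> carrier ?D" for a s
    using that(1) mem[OF that(2)]
    by (simp_all add: direct_sum_simps bimodule_over.lact_closed[OF M] bimodule_over.ract_closed[OF M])
  have add: "lact ?D a (s \<oplus>\<^bsub>?D\<^esub> t) = lact ?D a s \<oplus>\<^bsub>?D\<^esub> lact ?D a t"
    "ract ?D (s \<oplus>\<^bsub>?D\<^esub> t) a = ract ?D s a \<oplus>\<^bsub>?D\<^esub> ract ?D t a"
    if "a \<in> carrier A" "s \<in> carrier ?D" "t \<in> carrier ?D" for a s t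
    using that(1) mem[OF that(2)] mem[OF that(3)]
    by (auto simp: direct_sum_simps bimodule_over.lact_add[OF M] bimodule_over.ract_add[OF M]
        intro!: restrict_ext)
  have mult: "lact ?D (a \<oplus> b) s = lact ?D a s \<oplus>\<^bsub>?D\<^esub> lact ?D b s"
    "ract ?D s (a \<oplus> b) = ract ?D s a \<oplus>\<^bsub>?D\<^esub> ract ?D s b"
    "lact ?D (a \<otimes> b) s = lact ?D a (lact ?D b s)"
    "ract ?D s (a \<otimes> b) = ract ?D (ract ?D s a) b"
    "ract ?D (lact ?D a s) b = lact ?D a (ract ?D s b)"
    if "a \<in> carrier A" "b \<in> carrier A" "s \<in> carrier ?D" for a b s
    using that(1,2) mem[OF that(3)]
    by (auto simp: direct_sum_simps bimodule_over.add_lact[OF M] bimodule_over.add_ract[OF M]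
        bimodule_over.lact_mult[OF M] bimodule_over.ract_mult[OF M] bimodule_over.ract_lact[OF M]
        intro!: restrict_ext)
  show ?thesis
    unfolding bimodule_def using D closed add mult units rest by simp
qed

text \<open>The family \<open>F\<close> only has to split termwise, so the rule applies repeatedly
  to nested sums without first rewriting the summand.\<close>

lemma (in abelian_group) finsum_eq_add:
  assumes "\<And>i. i \<in> I \<Longrightarrow> F i = f i \<oplus> g i"
    and "\<And>i. i \<in> I \<Longrightarrow> f i \<in> carrier G" "\<And>i. i \<in> I \<Longrightarrow> g i \<in> carrier G"
  shows "finsum G F I = finsum G f I \<oplus> finsum G g I"
proof -
  have "finsum G F I = (\<Oplus>i\<in>I. f i \<oplus> g i)"
    by (rule finsum_cong') (use assms in auto)
  also have "\<dots> = finsum G f I \<oplus> finsum G g I"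
    by (rule finsum_addf) (use assms in auto)
  finally show ?thesis .
qed

section \<open>Finitely generated projective bimodules\<close>

text \<open>Linear coordinates that reproduce every element. Products of two of them are bilinear
  forms, and evaluating a tensor at such a form reads off a coefficient.\<close>

locale fd_algebra = k_algebra A for A :: "('k::field, 'a) module" (structure) +
  fixes Bs :: "'b set" and bs :: "'b \<Rightarrow> 'a" and co :: "'a \<Rightarrow> 'b \<Rightarrow> 'k"
  assumes finite_Bs [simp]: "finite Bs"
    and bs_in [simp]: "p \<in> Bs \<Longrightarrow> bs p \<in> carrier A"
    and co_add: "x \<in> carrier A \<Longrightarrow> y \<in> carrier A \<Longrightarrow> co (x \<oplus> y) p = co x p + co y p"
    and co_smult: "x \<in> carrier A \<Longrightarrow> co (c \<odot> x) p = c * co x p"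
    and co_expand: "x \<in> carrier A \<Longrightarrow> x = (\<Oplus>p\<in>Bs. co x p \<odot> bs p)"

text \<open>The map \<open>h\<close> is linear only on the subspace \<open>U\<close>: a bilinear map
  out of a tensor product is controlled on one-sided ideals and arbitrary elsewhere.\<close>

lemma (in k_algebra) linear_finsum:
  assumes "bimodule A M" "finite J" "\<zero> \<in> U"
    and "U \<subseteq> carrier A" "\<And>u v. u \<in> U \<Longrightarrow> v \<in> U \<Longrightarrow> u \<oplus> v \<in> U" "\<And>c u. u \<in> U \<Longrightarrow> c \<odot> u \<in> U"
    and h: "\<And>u. u \<in> U \<Longrightarrow> h u \<in> carrier M"
      "\<And>u v. u \<in> U \<Longrightarrow> v \<in> U \<Longrightarrow> h (u \<oplus> v) = h u \<oplus>\<^bsub>M\<^esub> h v"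
      "\<And>c u. u \<in> U \<Longrightarrow> h (c \<odot> u) = scale A M c (h u)"
    and "\<And>j. j \<in> J \<Longrightarrow> u j \<in> U"
  shows "h (\<Oplus>j\<in>J. c j \<odot> u j) = (\<Oplus>\<^bsub>M\<^esub>j\<in>J. scale A M (c j) (h (u j)))"
proof -
  interpret M: bimodule_over A M by (rule bimodule_overI) fact
  \<comment> \<open>Membership in \<open>U\<close> is carried through the induction, because
    \<open>h\<close> is additive only there.\<close>
  have "(\<Oplus>j\<in>J. c j \<odot> u j) \<in> U \<and> h (\<Oplus>j\<in>J. c j \<odot> u j) = (\<Oplus>\<^bsub>M\<^esub>j\<in>J. scale A M (c j) (h (u j)))"
    using assms(2,10)
  proof (induction J rule: finite_induct)
    case empty
    have "h \<zero> = \<zero>\<^bsub>M\<^esub>"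
      using h(3)[OF assms(3), of 0] h(1)[OF assms(3)] by (simp add: smult_zero)
    then show ?case using assms(3) by simp
  next
    case (insert j J)
    then have u: "u j \<in> U" "(\<lambda>j. c j \<odot> u j) \<in> J \<rightarrow> carrier A"
        "(\<lambda>j. scale A M (c j) (h (u j))) \<in> J \<rightarrow> carrier M"
      using assms(4,6) h(1) by auto
    then have "c j \<odot> u j \<in> U" "c j \<odot> u j \<in> carrier A" "scale A M (c j) (h (u j)) \<in> carrier M"
      using assms(4,6) h(1) by auto
    then show ?case using insert u assms(5) h(2,3) by simp
  qed
  then show ?thesis by simp
qed

text \<open>Idempotency puts \<open>e i\<close> and \<open>f i\<close> into their own ideals, so
  that their tensor belongs to the summand \<open>i\<close> and generates it. The modules of the
  resolution and the free bimodules of finite rank both have this form.\<close>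

locale proj_sum = fd_algebra A Bs bs co
  for A :: "('k::field, 'a) module" (structure) and Bs :: "'b set" and bs co +
  fixes I :: "'i set" and e f :: "'i \<Rightarrow> 'a"
  assumes finite_I [simp]: "finite I"
    and e_closed [simp]: "i \<in> I \<Longrightarrow> e i \<in> carrier A"
    and f_closed [simp]: "i \<in> I \<Longrightarrow> f i \<in> carrier A"
    and e_idem: "i \<in> I \<Longrightarrow> e i \<otimes> e i = e i"
    and f_idem: "i \<in> I \<Longrightarrow> f i \<otimes> f i = f i"
begin

abbreviation V :: "'i \<Rightarrow> 'a set" where "V i \<equiv> left_ideal_of A (e i)"
abbreviation W :: "'i \<Rightarrow> 'a set" where "W i \<equiv> right_ideal_of A (f i)"
abbreviation T :: "'i \<Rightarrow> ('a, ('k, 'a) tensor) bimod" where "T i \<equiv> tensor_bimod A (e i) (f i)"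
abbreviation P :: "('a, 'i \<Rightarrow> ('k, 'a) tensor) bimod" where "P \<equiv> direct_sum_bimod I T"

definition elt :: "'i \<Rightarrow> 'a \<Rightarrow> 'a \<Rightarrow> 'i \<Rightarrow> ('k, 'a) tensor" where
  "elt i v w = (\<lambda>j\<in>I. if j = i then pure_tensor A (V i) (W i) v w else (\<lambda>\<beta>. 0))"

abbreviation gn :: "'i \<Rightarrow> 'i \<Rightarrow> ('k, 'a) tensor" where "gn i \<equiv> elt i (e i) (f i)"

lemma tensor: "i \<in> I \<Longrightarrow> tensor_product A (e i) (f i)"
  by (intro tensor_product.intro tensor_product_axioms.intro k_algebra_axioms) simp_all

lemma bimodule_P: "bimodule A P"
  by (rule direct_sum_bimodule) (rule tensor_product.tensor_bimodule[OF tensor])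

sublocale P: bimodule_over A P
  by (rule bimodule_overI) (rule bimodule_P)

lemma e_V [simp]: "i \<in> I \<Longrightarrow> e i \<in> V i" and f_W [simp]: "i \<in> I \<Longrightarrow> f i \<in> W i"
  using e_idem f_idem by (metis e_closed imageI left_ideal_of_def, metis f_closed imageI right_ideal_of_def)

lemma V_e: "i \<in> I \<Longrightarrow> v \<in> V i \<Longrightarrow> v \<otimes> e i = v" and W_f: "i \<in> I \<Longrightarrow> w \<in> W i \<Longrightarrow> f i \<otimes> w = w"
  by (auto simp: left_ideal_of_def right_ideal_of_def m_assoc e_idem) (simp add: f_idem flip: m_assoc)

lemma P_add_apply: "i \<in> I \<Longrightarrow> (x \<oplus>\<^bsub>P\<^esub> y) i = (\<lambda>\<beta>. x i \<beta> + y i \<beta>)"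
  by (simp add: direct_sum_simps tensor_product.T_simps[OF tensor])

lemma elt_in: "i \<in> I \<Longrightarrow> v \<in> V i \<Longrightarrow> w \<in> W i \<Longrightarrow> elt i v w \<in> carrier P"
  using tensor_product.pt_in[OF tensor] abelian_groupE(2)[OF tensor_product.T_abelian_group[OF tensor]]
  by (auto simp: elt_def direct_sum_simps tensor_product.T_simps(2)[OF tensor])

lemma gn_in [simp]: "i \<in> I \<Longrightarrow> gn i \<in> carrier P"
  by (simp add: elt_in)

lemma lact_elt: "i \<in> I \<Longrightarrow> a \<in> carrier A \<Longrightarrow> lact P a (elt i v w) = elt i (a \<otimes> v) w"
  and ract_elt: "i \<in> I \<Longrightarrow> a \<in> carrier A \<Longrightarrow> ract P (elt i v w) a = elt i v (w \<otimes> a)"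
proof -
  assume i: "i \<in> I" and a: "a \<in> carrier A"
  have "lact (T j) a (\<lambda>\<beta>. 0) = (\<lambda>\<beta>. 0)" "ract (T j) (\<lambda>\<beta>. 0) a = (\<lambda>\<beta>. 0)" for j
    by (simp_all add: tensor_bimod_def Let_def)
  then show "lact P a (elt i v w) = elt i (a \<otimes> v) w" "ract P (elt i v w) a = elt i v (w \<otimes> a)"
    using i a by (auto simp: elt_def direct_sum_simps tensor_product.lact_pt[OF tensor]
        tensor_product.ract_pt[OF tensor] intro!: restrict_ext)
qed

lemma elt_gn: "i \<in> I \<Longrightarrow> v \<in> V i \<Longrightarrow> w \<in> W i \<Longrightarrow> elt i v w = lact P v (ract P (gn i) w)"
  using tensor_product.V_carrier[OF tensor] tensor_product.W_carrier[OF tensor]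
  by (simp add: lact_elt ract_elt V_e W_f)

lemma P_induct [consumes 1, case_names zero elt add]:
  assumes "x \<in> carrier P" "Q \<zero>\<^bsub>P\<^esub>"
    and elt: "\<And>i v w. i \<in> I \<Longrightarrow> v \<in> V i \<Longrightarrow> w \<in> W i \<Longrightarrow> Q (elt i v w)"
    and add: "\<And>x y. x \<in> carrier P \<Longrightarrow> y \<in> carrier P \<Longrightarrow> Q x \<Longrightarrow> Q y \<Longrightarrow> Q (x \<oplus>\<^bsub>P\<^esub> y)"
  shows "Q x"
proof -
  \<comment> \<open>\<open>ins i\<close> embeds the summand \<open>i\<close>. The claim is shown on
    embedded summands by induction on tensors, and then for growing sets of indices.\<close>
  define ins where "ins = (\<lambda>i t. \<lambda>j\<in>I. if j = i then t else (\<lambda>\<beta> :: 'a \<Rightarrow> 'a \<Rightarrow> 'k. 0 :: 'k))"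
  have T0: "(\<lambda>\<beta>. 0) \<in> carrier (T i)" if "i \<in> I" for i
    using abelian_groupE(2)[OF tensor_product.T_abelian_group[OF tensor[OF that]]]
    unfolding tensor_product.T_simps(2)[OF tensor[OF that]] .
  have ins_in: "ins i t \<in> carrier P" if "i \<in> I" "t \<in> carrier (T i)" for i t
    using that T0 by (auto simp: direct_sum_simps ins_def)
  have Q_ins: "Q (ins i t)" if i: "i \<in> I" and t: "t \<in> carrier (T i)" for i t
    using t
  proof (induction t rule: tensor_product.T_induct[OF tensor[OF i], consumes 1, case_names zero pure add])
    case zero
    have "ins i \<zero>\<^bsub>T i\<^esub> = \<zero>\<^bsub>P\<^esub>"
      using i by (auto simp: direct_sum_simps ins_def tensor_product.T_simps(2)[OF tensor] intro!: restrict_ext)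
    then show ?case using assms(2) by simp
  next
    case (pure v w)
    have "ins i (pure_tensor A (V i) (W i) v w) = elt i v w" by (simp add: elt_def ins_def)
    then show ?case using elt[OF i pure] by simp
  next
    case (add s t)
    have "ins i (s \<oplus>\<^bsub>T i\<^esub> t) = ins i s \<oplus>\<^bsub>P\<^esub> ins i t"
      using i by (auto simp: direct_sum_simps ins_def tensor_product.T_simps(3)[OF tensor] intro!: restrict_ext)
    then show ?case using add.hyps add.IH assms(4) ins_in i by simp
  qed
  have Q_J: "finite J \<Longrightarrow> J \<subseteq> I \<Longrightarrow> Q (\<lambda>i\<in>I. if i \<in> J then x i else (\<lambda>\<beta>. 0))" for J
  proof (induction J rule: finite_induct)
    case empty
    have "(\<lambda>i\<in>I. if i \<in> {} then x i else (\<lambda>\<beta>. 0)) = \<zero>\<^bsub>P\<^esub>"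
      by (auto simp: direct_sum_simps tensor_product.T_simps(2)[OF tensor] intro!: restrict_ext)
    then show ?case using assms(2) by simp
  next
    case (insert j J)
    let ?y = "\<lambda>J. \<lambda>i\<in>I. if i \<in> J then x i else (\<lambda>\<beta>. 0)"
    have xj: "x j \<in> carrier (T j)" using assms(1) insert.prems by (auto simp: direct_sum_simps)
    have "?y (insert j J) = ins j (x j) \<oplus>\<^bsub>P\<^esub> ?y J"
      using insert.hyps(2) by (auto simp: direct_sum_simps ins_def tensor_product.T_simps(3)[OF tensor] intro!: restrict_ext)
    moreover have "?y J \<in> carrier P"
      using T0 assms(1) by (auto simp: direct_sum_simps)
    moreover have "Q (?y J)" by (rule insert.IH) (use insert.prems in simp)
    moreover have "j \<in> I" using insert.prems by simp
    ultimately show ?case using add[OF ins_in _ Q_ins] xj by simp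
  qed
  have "(\<lambda>i\<in>I. if i \<in> I then x i else (\<lambda>\<beta>. 0)) = x"
    using assms(1) by (auto simp: direct_sum_simps PiE_def extensional_def)
  with Q_J[OF finite_I subset_refl] show ?thesis by (simp only:)
qed

text \<open>The value of a tensor at the form \<open>\<beta> v w = co v p * co w q\<close> is its coefficient at
  \<open>bs p \<otimes> bs q\<close>.\<close>

definition ind :: "('a, 'c) bimod \<Rightarrow> ('i \<Rightarrow> 'a \<Rightarrow> 'a \<Rightarrow> 'c) \<Rightarrow> ('i \<Rightarrow> ('k, 'a) tensor) \<Rightarrow> 'c" where
  "ind M \<Phi> x = (\<Oplus>\<^bsub>M\<^esub>i\<in>I. \<Oplus>\<^bsub>M\<^esub>p\<in>Bs. \<Oplus>\<^bsub>M\<^esub>q\<in>Bs.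
     scale A M (x i (\<lambda>v w. co v p * co w q)) (\<Phi> i (bs p \<otimes> e i) (f i \<otimes> bs q)))"

definition bilinear_map :: "('a, 'c) bimod \<Rightarrow> ('i \<Rightarrow> 'a \<Rightarrow> 'a \<Rightarrow> 'c) \<Rightarrow> bool" where
  "bilinear_map M \<Phi> \<longleftrightarrow> (\<forall>i\<in>I. \<forall>v\<in>V i. \<forall>w\<in>W i. \<Phi> i v w \<in> carrier M \<and>
     (\<forall>v'\<in>V i. \<Phi> i (v \<oplus> v') w = \<Phi> i v w \<oplus>\<^bsub>M\<^esub> \<Phi> i v' w) \<and>
     (\<forall>w'\<in>W i. \<Phi> i v (w \<oplus> w') = \<Phi> i v w \<oplus>\<^bsub>M\<^esub> \<Phi> i v w') \<and>
     (\<forall>c. \<Phi> i (c \<odot> v) w = scale A M c (\<Phi> i v w) \<and> \<Phi> i v (c \<odot> w) = scale A M c (\<Phi> i v w)))"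

lemma V_bs [simp]: "p \<in> Bs \<Longrightarrow> bs p \<otimes> e i \<in> V i" and W_bs [simp]: "p \<in> Bs \<Longrightarrow> f i \<otimes> bs p \<in> W i"
  by (auto simp: left_ideal_of_def right_ideal_of_def)

context
  fixes M :: "('a, 'c) bimod" and \<Phi>
  assumes M: "bimodule A M" and \<Phi>: "bilinear_map M \<Phi>"
begin

interpretation M: bimodule_over A M by (rule bimodule_overI) (rule M)

lemma Phi_closed [simp]: "i \<in> I \<Longrightarrow> v \<in> V i \<Longrightarrow> w \<in> W i \<Longrightarrow> \<Phi> i v w \<in> carrier M"
  using \<Phi> by (simp add: bilinear_map_def)

lemma ind_closed: "ind M \<Phi> x \<in> carrier M"
  by (simp add: ind_def Pi_def)

text \<open>No independence of representatives has to be checked: \<open>ind\<close> sees a tensor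
  only through its values at fixed forms, and tensors are added pointwise.\<close>

lemma ind_add: "ind M \<Phi> (x \<oplus>\<^bsub>P\<^esub> y) = ind M \<Phi> x \<oplus>\<^bsub>M\<^esub> ind M \<Phi> y"
  unfolding ind_def
  by (intro M.M.finsum_eq_add) (simp_all add: P_add_apply M.add_sc M.M.finsum_closed Pi_def)

text \<open>Expanding \<open>v\<close> and \<open>w\<close> in the spanning family and multiplying
  by the idempotents writes them through elements of the two ideals; bilinearity of
  \<open>\<Phi>\<close> then collapses the double sum.\<close>

lemma ind_elt:
  assumes i: "i \<in> I" and v: "v \<in> V i" and w: "w \<in> W i"
  shows "ind M \<Phi> (elt i v w) = \<Phi> i v w"
proof -
  interpret T: tensor_product A "e i" "f i" using tensor[OF i] .
  note carr = T.V_carrier T.W_carrier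
  have v0: "\<zero> \<in> V i" and w0: "\<zero> \<in> W i"
    using i T.V_smult[OF e_V[OF i], of 0] T.W_smult[OF f_W[OF i], of 0] by (simp_all add: smult_zero_scalar)
  have v_exp: "v = (\<Oplus>p\<in>Bs. co v p \<odot> (bs p \<otimes> e i))"
  proof -
    have "v = (\<Oplus>p\<in>Bs. co v p \<odot> bs p) \<otimes> e i"
      using co_expand[of v] V_e[OF i v] carr(1)[OF v] by simp
    also have "\<dots> = (\<Oplus>p\<in>Bs. co v p \<odot> (bs p \<otimes> e i))"
      using i by (subst finsum_ldistr) (auto simp: smult_mult_left smult_in intro!: finsum_cong')
    finally show ?thesis .
  qed
  have w_exp: "w = (\<Oplus>p\<in>Bs. co w p \<odot> (f i \<otimes> bs p))"
  proof -
    have "w = f i \<otimes> (\<Oplus>p\<in>Bs. co w p \<odot> bs p)"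
      using co_expand[of w] W_f[OF i w] carr(2)[OF w] by simp
    also have "\<dots> = (\<Oplus>p\<in>Bs. co w p \<odot> (f i \<otimes> bs p))"
      using i by (subst finsum_rdistr) (auto simp: smult_mult_right smult_in intro!: finsum_cong')
    finally show ?thesis .
  qed
  \<comment> \<open>A pure tensor is 0 by convention at anything but a bilinear form, so membership
    must be known before it is evaluated.\<close>
  have \<beta>: "(\<lambda>v w. co v p * co w q) \<in> bilinear_forms A (V i) (W i)" for p q
    using carr by (auto simp: bilinear_forms_def co_add co_smult algebra_simps)
  let ?c = "\<lambda>j. \<Oplus>\<^bsub>M\<^esub>p\<in>Bs. \<Oplus>\<^bsub>M\<^esub>q\<in>Bs.
     scale A M (co v p * co w q) (\<Phi> j (bs p \<otimes> e j) (f j \<otimes> bs q))"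
  have "ind M \<Phi> (elt i v w) = (\<Oplus>\<^bsub>M\<^esub>j\<in>I. if i = j then ?c j else \<zero>\<^bsub>M\<^esub>)"
    unfolding ind_def
    by (intro M.M.finsum_cong') (auto simp: elt_def pure_tensor_def \<beta> intro!: M.M.finsum_closed
        M.M.finsum_cong' M.M.add.finprod_one_eqI)
  also have "\<dots> = ?c i"
    using i by (intro M.M.finsum_singleton) auto
  also have "\<dots> = (\<Oplus>\<^bsub>M\<^esub>p\<in>Bs. scale A M (co v p) (\<Phi> i (bs p \<otimes> e i) w))"
  proof (intro M.M.finsum_cong')
    fix p assume p: "p \<in> Bs"
    have "\<Phi> i (bs p \<otimes> e i) (\<Oplus>q\<in>Bs. co w q \<odot> (f i \<otimes> bs q)) =
        (\<Oplus>\<^bsub>M\<^esub>q\<in>Bs. scale A M (co w q) (\<Phi> i (bs p \<otimes> e i) (f i \<otimes> bs q)))"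
      using i p \<Phi> w0 T.W_add T.W_smult carr(2)
      by (intro linear_finsum[OF M, where U = "W i"]) (auto simp: bilinear_map_def)
    then have "scale A M (co v p) (\<Phi> i (bs p \<otimes> e i) w) =
        (\<Oplus>\<^bsub>M\<^esub>q\<in>Bs. scale A M (co v p) (scale A M (co w q) (\<Phi> i (bs p \<otimes> e i) (f i \<otimes> bs q))))"
      using i p by (simp add: M.sc_finsum flip: w_exp)
    also have "\<dots> = (\<Oplus>\<^bsub>M\<^esub>q\<in>Bs. scale A M (co v p * co w q) (\<Phi> i (bs p \<otimes> e i) (f i \<otimes> bs q)))"
      using i p by (intro M.M.finsum_cong') (auto simp: M.sc_sc)
    finally show "(\<Oplus>\<^bsub>M\<^esub>q\<in>Bs. scale A M (co v p * co w q) (\<Phi> i (bs p \<otimes> e i) (f i \<otimes> bs q)))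
      = scale A M (co v p) (\<Phi> i (bs p \<otimes> e i) w)" by simp
  qed (use i w in auto)
  also have "\<dots> = \<Phi> i v w"
  proof -
    have "\<Phi> i (\<Oplus>p\<in>Bs. co v p \<odot> (bs p \<otimes> e i)) w =
        (\<Oplus>\<^bsub>M\<^esub>p\<in>Bs. scale A M (co v p) (\<Phi> i (bs p \<otimes> e i) w))"
      using i w \<Phi> v0 T.V_add T.V_smult carr(1)
      by (intro linear_finsum[OF M, where U = "V i" and h = "\<lambda>v. \<Phi> i v w"]) (auto simp: bilinear_map_def)
    then show ?thesis by (simp flip: v_exp)
  qed
  finally show ?thesis .
qed

end

section \<open>Universal property and projectivity of the sums\<close>

lemma hom_unique:
  assumes "g \<in> bimod_hom A P M" "h \<in> bimod_hom A P M" "bimodule A M"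
    and "\<And>i. i \<in> I \<Longrightarrow> g (gn i) = h (gn i)"
  shows "g = h"
proof (rule bimod_hom_eqI[OF assms(1,2)])
  interpret bimodule_pair A P M by (rule bimodule_pairI) (fact bimodule_P, fact)
  fix x assume "x \<in> carrier P"
  then show "g x = h x"
  proof (induction rule: P_induct)
    case zero
    then show ?case using assms(1,2) by (simp add: hom_zero)
  next
    case (elt i v w)
    then have "v \<in> carrier A" "w \<in> carrier A"
      using tensor_product.V_carrier[OF tensor] tensor_product.W_carrier[OF tensor] by auto
    then show ?case
      using elt_gn[OF elt] elt(1) by (simp add: bimod_homD[OF assms(1)] bimod_homD[OF assms(2)] assms(4))
  next
    case (add x y)
    then show ?case by (simp add: bimod_homD[OF assms(1)] bimod_homD[OF assms(2)])
  qed
qed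

text \<open>The homomorphism is induced by the bilinear map sending \<open>v\<close> and
  \<open>w\<close> to \<open>v (x i) w\<close>. The idempotent conditions ensure that its value
  \<open>e i (x i) f i\<close> at the generator is \<open>x i\<close>.\<close>

lemma hom_exists:
  assumes M: "bimodule A M" and x: "\<And>i. i \<in> I \<Longrightarrow> x i \<in> carrier M"
    and ex: "\<And>i. i \<in> I \<Longrightarrow> lact M (e i) (x i) = x i"
    and xf: "\<And>i. i \<in> I \<Longrightarrow> ract M (x i) (f i) = x i"
  shows "\<exists>h\<in>bimod_hom A P M. \<forall>i\<in>I. h (gn i) = x i"
proof -
  interpret M: bimodule_over A M by (rule bimodule_overI) fact
  interpret bimodule_pair A P M by (rule bimodule_pairI) (fact bimodule_P, fact)
  note carr = tensor_product.V_carrier[OF tensor] tensor_product.W_carrier[OF tensor]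
  define \<Phi> where "\<Phi> = (\<lambda>i v w. lact M v (ract M (x i) w))"
  have \<Phi>: "bilinear_map M \<Phi>"
    using carr x by (auto simp: bilinear_map_def \<Phi>_def M.add_lact M.add_ract M.lact_add
        M.lact_smult M.ract_smult M.lact_sc)
  define h where "h = ind M \<Phi>"
  have h_elt: "h (elt i v w) = lact M v (ract M (x i) w)" if "i \<in> I" "v \<in> V i" "w \<in> W i" for i v w
    using ind_elt[OF M \<Phi> that] by (simp add: h_def \<Phi>_def)
  have h_closed: "h y \<in> carrier M" for y
    using ind_closed[OF M \<Phi>] by (simp add: h_def)
  have h_add: "h (y \<oplus>\<^bsub>P\<^esub> z) = h y \<oplus>\<^bsub>M\<^esub> h z" for y z
    using ind_add[OF M \<Phi>] by (simp add: h_def)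
  have h_zero: "h \<zero>\<^bsub>P\<^esub> = \<zero>\<^bsub>M\<^esub>"
    using h_add[of "\<zero>\<^bsub>P\<^esub>" "\<zero>\<^bsub>P\<^esub>"] h_closed[of "\<zero>\<^bsub>P\<^esub>"] M.M.add.r_cancel_one' by simp
  have h_act: "h (lact P a y) = lact M a (h y) \<and> h (ract P y a) = ract M (h y) a"
    if a: "a \<in> carrier A" and y: "y \<in> carrier P" for a y
    using y
  proof (induction rule: P_induct)
    case zero
    then show ?case using a by (simp add: h_zero)
  next
    case (elt i v w)
    then have "v \<in> carrier A" "w \<in> carrier A" "a \<otimes> v \<in> V i" "w \<otimes> a \<in> W i"
      using carr a tensor_product.V_mult[OF tensor] tensor_product.W_mult[OF tensor] by auto
    then show ?case
      using elt a x by (simp add: lact_elt ract_elt h_elt M.lact_mult M.ract_mult M.ract_lact)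
  next
    case (add y z)
    then show ?case using a by (simp add: h_add h_closed P.lact_add P.ract_add M.lact_add M.ract_add)
  qed
  have "restrict h (carrier P) \<in> bimod_hom A P M"
    by (rule restrict_hom) (simp_all add: h_closed h_add h_act)
  moreover have "h (gn i) = x i" if "i \<in> I" for i
    using that by (simp add: h_elt ex xf x)
  ultimately show ?thesis
    by (intro bexI[of _ "restrict h (carrier P)"]) auto
qed

lemma hom_lift:
  assumes M: "bimodule A M" and N: "bimodule A N" and d: "d \<in> bimod_hom A M N"
    and g: "g \<in> bimod_hom A P N" and im: "\<And>i. i \<in> I \<Longrightarrow> g (gn i) \<in> d ` carrier M"
  shows "\<exists>h\<in>bimod_hom A P M. \<forall>x\<in>carrier P. d (h x) = g x"
proof -
  interpret M: bimodule_over A M by (rule bimodule_overI) fact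
  have "\<forall>i\<in>I. \<exists>y. y \<in> carrier M \<and> d y = g (gn i)"
    using im by (force simp: image_iff)
  from bchoice[OF this] obtain y where y: "\<forall>i\<in>I. y i \<in> carrier M \<and> d (y i) = g (gn i)" ..
  \<comment> \<open>An arbitrary preimage may violate the idempotent conditions. Multiplying by
    \<open>e i\<close> and \<open>f i\<close> enforces them and keeps the image, since
    \<open>g (gn i)\<close> is fixed by both.\<close>
  define x where "x i = lact M (e i) (ract M (y i) (f i))" for i
  have "\<exists>h\<in>bimod_hom A P M. \<forall>i\<in>I. h (gn i) = x i"
  proof (rule hom_exists[OF M])
    fix i assume i: "i \<in> I"
    then show "x i \<in> carrier M" "lact M (e i) (x i) = x i" "ract M (x i) (f i) = x i"
      using y by (simp_all add: x_def e_idem f_idem M.ract_lact flip: M.lact_mult M.ract_mult)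
  qed
  then obtain h where h: "h \<in> bimod_hom A P M" "\<And>i. i \<in> I \<Longrightarrow> h (gn i) = x i" by blast
  have dx: "d (x i) = g (gn i)" if i: "i \<in> I" for i
  proof -
    have "d (x i) = g (lact P (e i) (ract P (gn i) (f i)))"
      using i y by (simp add: x_def bimod_homD[OF d] bimod_homD[OF g])
    then show ?thesis using i by (simp add: lact_elt ract_elt e_idem f_idem)
  qed
  have "(\<lambda>x\<in>carrier P. d (h x)) = g"
  proof (rule hom_unique[OF _ g N])
    show "(\<lambda>x\<in>carrier P. d (h x)) \<in> bimod_hom A P N"
      by (rule comp_hom[OF bimodule_P h(1) d])
  qed (simp add: h dx)
  then have "d (h x) = g x" if "x \<in> carrier P" for x
    using that fun_cong[of _ g x] by fastforce
  then show ?thesis using h(1) by blast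
qed

text \<open>Each summand is a retract of the free bimodule of rank one: the inclusion sends
  \<open>e \<otimes> f\<close> to \<open>e (1 \<otimes> 1) f\<close>, the retraction sends
  \<open>1 \<otimes> 1\<close> to \<open>e \<otimes> f\<close>. One free copy is taken for each
  index.\<close>

lemma fg_projective_P: "fg_projective_bimodule A P"
proof -
  obtain h where h: "bij_betw h I {0..<card I}"
    using ex_bij_betw_finite_nat[OF finite_I] by blast
  let ?k = "card I"
  \<comment> \<open>With both idempotents equal to 1 the same construction yields the free bimodule,
    together with its universal property.\<close>
  interpret F: proj_sum A Bs bs co "{..<?k}" "\<lambda>_. \<one>" "\<lambda>_. \<one>"
    by unfold_locales auto
  interpret PF: bimodule_pair A P F.P by (rule bimodule_pairI) (rule bimodule_P F.bimodule_P)+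
  have hk: "h i \<in> {..<?k}" if "i \<in> I" for i
    using h that by (auto simp: bij_betw_def)
  define g where "g j = inv_into I h j" for j
  have gI: "g j \<in> I" if "j \<in> {..<?k}" for j
    using h that by (auto simp: bij_betw_def g_def intro!: inv_into_into)
  have gh: "g (h i) = i" if "i \<in> I" for i
    using h that by (auto simp: bij_betw_def g_def)
  have "\<exists>\<iota>\<in>bimod_hom A P F.P. \<forall>i\<in>I. \<iota> (gn i) = lact F.P (e i) (ract F.P (F.gn (h i)) (f i))"
    by (rule hom_exists[OF F.bimodule_P])
      (use hk in \<open>simp_all add: F.P.ract_lact e_idem f_idem flip: F.P.lact_mult F.P.ract_mult\<close>)
  then obtain \<iota> where \<iota>: "\<iota> \<in> bimod_hom A P F.P"
      "\<forall>i\<in>I. \<iota> (gn i) = lact F.P (e i) (ract F.P (F.gn (h i)) (f i))" by (rule bexE)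
  have "\<exists>\<pi>\<in>bimod_hom A F.P P. \<forall>j\<in>{..<?k}. \<pi> (F.gn j) = gn (g j)"
    by (rule F.hom_exists[OF bimodule_P]) (use gI in simp_all)
  then obtain \<pi> where \<pi>: "\<pi> \<in> bimod_hom A F.P P" "\<forall>j\<in>{..<?k}. \<pi> (F.gn j) = gn (g j)"
    by (rule bexE)
  have \<pi>\<iota>: "(\<lambda>x\<in>carrier P. \<pi> (\<iota> x)) = (\<lambda>x\<in>carrier P. x)"
  proof (rule hom_unique[OF _ _ bimodule_P])
    show "(\<lambda>x\<in>carrier P. \<pi> (\<iota> x)) \<in> bimod_hom A P P"
      by (rule comp_hom[OF bimodule_P \<iota>(1) \<pi>(1)])
    show "(\<lambda>x\<in>carrier P. x) \<in> bimod_hom A P P"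
      by (rule bimod_homI) auto
    fix i assume i: "i \<in> I"
    then have "\<pi> (\<iota> (gn i)) = lact P (e i) (ract P (gn i) (f i))"
      using hk[OF i] by (simp add: \<iota> bimod_homD[OF \<pi>(1)] \<pi>(2) gh)
    then show "(\<lambda>x\<in>carrier P. \<pi> (\<iota> x)) (gn i) = (\<lambda>x\<in>carrier P. x) (gn i)"
      using i by (simp add: lact_elt ract_elt e_idem f_idem)
  qed
  have "\<pi> (\<iota> x) = x" if "x \<in> carrier P" for x
    using fun_cong[OF \<pi>\<iota>, of x] that by simp
  then show ?thesis
    unfolding fg_projective_bimodule_def Let_def
    using bimodule_P \<iota>(1) \<pi>(1) by blast
qed

end

section \<open>The Yoneda algebra of a projective resolution\<close>

text \<open>The augmentation takes the place of the differential in degree 0, which allows one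
  lifting statement for all degrees.\<close>

definition is_cycle :: "('k::field, 'a) module \<Rightarrow> ('a, 'p) aug_complex \<Rightarrow> nat \<Rightarrow> 'p \<Rightarrow> bool" where
  "is_cycle A R j x = (case j of 0 \<Rightarrow> cx_aug R x = \<zero>\<^bsub>A\<^esub> | Suc i \<Rightarrow> cx_diff R j x = \<zero>\<^bsub>cx_mod R i\<^esub>)"

text \<open>Projectivity and exactness enter the comparison theorem only through the two lifting
  properties. Assuming these directly separates the theory of products from the proof that a
  particular complex is exact.\<close>

locale lifting_complex = k_algebra A for A :: "('k::field, 'a) module" (structure) +
  fixes R :: "('a, 'p) aug_complex"
  assumes bim: "bimodule A (cx_mod R n)"
    and diff_hom: "cx_diff R (Suc n) \<in> bimod_hom A (cx_mod R (Suc n)) (cx_mod R n)"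
    and aug_hom: "cx_aug R \<in> bimod_hom A (cx_mod R 0) (regular_bimod A)"
    and diff_cycle: "x \<in> carrier (cx_mod R (Suc n)) \<Longrightarrow> is_cycle A R n (cx_diff R (Suc n) x)"
    and lift_aug: "f \<in> bimod_hom A (cx_mod R n) (regular_bimod A) \<Longrightarrow>
      \<exists>h\<in>bimod_hom A (cx_mod R n) (cx_mod R 0). \<forall>x\<in>carrier (cx_mod R n). cx_aug R (h x) = f x"
    and lift_diff: "g \<in> bimod_hom A (cx_mod R n) (cx_mod R j) \<Longrightarrow>
      (\<And>x. x \<in> carrier (cx_mod R n) \<Longrightarrow> is_cycle A R j (g x)) \<Longrightarrow>
      \<exists>h\<in>bimod_hom A (cx_mod R n) (cx_mod R (Suc j)).
        \<forall>x\<in>carrier (cx_mod R n). cx_diff R (Suc j) (h x) = g x"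
begin

section \<open>Cochains, cocycles and cohomology groups\<close>

abbreviation P :: "nat \<Rightarrow> ('a, 'p) bimod" where "P n \<equiv> cx_mod R n"
abbreviation d :: "nat \<Rightarrow> 'p \<Rightarrow> 'p" where "d n \<equiv> cx_diff R n"
abbreviation C :: "nat \<Rightarrow> ('k, 'p \<Rightarrow> 'a) module" where "C n \<equiv> cochains A R n"
abbreviation Z :: "nat \<Rightarrow> ('p \<Rightarrow> 'a) set" where "Z n \<equiv> cocycles A R n"
abbreviation B :: "nat \<Rightarrow> ('p \<Rightarrow> 'a) set" where "B n \<equiv> coboundaries A R n"
abbreviation cls :: "nat \<Rightarrow> ('p \<Rightarrow> 'a) \<Rightarrow> ('p \<Rightarrow> 'a) set" where "cls n f \<equiv> coh_class A R n f"
abbreviation H :: "nat \<Rightarrow> ('k, ('p \<Rightarrow> 'a) set) module" where "H n \<equiv> HH_degree A R n"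

lemma P_bimodule_over: "bimodule_over A (P n)"
  by (rule bimodule_overI) (rule bim)

sublocale P: bimodule_over A "P n" for n
  by (rule P_bimodule_over)

lemma pair_PP: "bimodule_pair A (P n) (P j)"
  by (rule bimodule_pairI) (rule bim)+

lemma pair_PA: "bimodule_pair A (P n) (regular_bimod A)"
  by (rule bimodule_pairI) (rule bim bimodule_regular)+

lemma C_simps:
  "carrier (C n) = bimod_hom A (P n) (regular_bimod A)"
  "\<zero>\<^bsub>C n\<^esub> = (\<lambda>x\<in>carrier (P n). \<zero>)"
  "f \<oplus>\<^bsub>C n\<^esub> g = (\<lambda>x\<in>carrier (P n). f x \<oplus> g x)"
  by (simp_all add: cochains_def bimodule_pair.hom_module_simps[OF pair_PA])

lemma C_in: "f \<in> carrier (C n) \<Longrightarrow> x \<in> carrier (P n) \<Longrightarrow> f x \<in> carrier A"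
  using bimod_homD(1)[of f A "P n" "regular_bimod A" x] by (simp add: C_simps)

lemma C_add: "f \<in> carrier (C n) \<Longrightarrow> x \<in> carrier (P n) \<Longrightarrow> y \<in> carrier (P n)
  \<Longrightarrow> f (x \<oplus>\<^bsub>P n\<^esub> y) = f x \<oplus> f y"
  using bimod_homD(2)[of f A "P n" "regular_bimod A" x y] by (simp add: C_simps)

lemma C_sc: "f \<in> carrier (C n) \<Longrightarrow> x \<in> carrier (P n) \<Longrightarrow> f (scale A (P n) c x) = c \<odot> f x"
  using bimodule_pair.hom_scale[OF pair_PA, of f n x c] C_in[of f n x] by (simp add: C_simps)

lemma C_zero: "f \<in> carrier (C n) \<Longrightarrow> f \<zero>\<^bsub>P n\<^esub> = \<zero>"
  using bimodule_pair.hom_zero[OF pair_PA, of f n] by (simp add: C_simps)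

lemma C_ext: "f \<in> carrier (C n) \<Longrightarrow> restrict f (carrier (P n)) = f"
  using bimod_homD(5)[of f A "P n" "regular_bimod A"] by (simp add: C_simps extensional_restrict)

lemma C_eqI: "f \<in> carrier (C n) \<Longrightarrow> g \<in> carrier (C n) \<Longrightarrow> (\<And>x. x \<in> carrier (P n) \<Longrightarrow> f x = g x) \<Longrightarrow> f = g"
  using bimod_hom_eqI[of f A "P n" "regular_bimod A" g] by (simp add: C_simps)

lemma C_smult:
  assumes "f \<in> carrier (C n)"
  shows "c \<odot>\<^bsub>C n\<^esub> f = (\<lambda>x\<in>carrier (P n). c \<odot> f x)"
  unfolding cochains_def bimodule_pair.hom_module_simps[OF pair_PA]
  by (rule restrict_ext) (simp add: C_in[OF assms])

lemma C_smult_in: "f \<in> carrier (C n) \<Longrightarrow> c \<odot>\<^bsub>C n\<^esub> f \<in> carrier (C n)"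
  by (simp add: cochains_def bimodule_pair.hom_module_simps[OF pair_PA] bimodule_pair.scale_hom[OF pair_PA])

sublocale C: abelian_group "C n" for n
  unfolding cochains_def by (rule bimodule_pair.hom_module_abelian_group[OF pair_PA])

lemma C_apply:
  assumes "x \<in> carrier (P n)"
  shows C_zero_apply: "\<zero>\<^bsub>C n\<^esub> x = \<zero>"
    and C_add_apply: "(f \<oplus>\<^bsub>C n\<^esub> g) x = f x \<oplus> g x"
    and C_smult_apply: "f \<in> carrier (C n) \<Longrightarrow> (c \<odot>\<^bsub>C n\<^esub> f) x = c \<odot> f x"
  using assms by (simp_all add: C_simps C_smult)

lemma C_smult_add:
  assumes "f \<in> carrier (C n)" "g \<in> carrier (C n)"
  shows "c \<odot>\<^bsub>C n\<^esub> (f \<oplus>\<^bsub>C n\<^esub> g) = c \<odot>\<^bsub>C n\<^esub> f \<oplus>\<^bsub>C n\<^esub> c \<odot>\<^bsub>C n\<^esub> g"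
  by (rule C_eqI[where n = n]) (simp_all add: assms C_smult_in C_apply C_in[OF assms(1)] C_in[OF assms(2)] smult_add_right)

lemma C_minus: "f \<in> carrier (C n) \<Longrightarrow> \<ominus>\<^bsub>C n\<^esub> f = (-1) \<odot>\<^bsub>C n\<^esub> f"
proof (rule C.minus_equality)
  assume f: "f \<in> carrier (C n)"
  show "(-1) \<odot>\<^bsub>C n\<^esub> f \<oplus>\<^bsub>C n\<^esub> f = \<zero>\<^bsub>C n\<^esub>"
    unfolding C_simps(2,3) C_smult[OF f]
    by (rule restrict_ext) (simp add: C_in[OF f] smult_minus l_neg)
qed (auto simp: C_smult_in)

lemma d_in: "x \<in> carrier (P (Suc n)) \<Longrightarrow> d (Suc n) x \<in> carrier (P n)"
  by (rule bimod_homD(1)[OF diff_hom])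

lemma aug_in: "x \<in> carrier (P 0) \<Longrightarrow> cx_aug R x \<in> carrier A"
  using bimod_homD(1)[OF aug_hom] by simp

lemma aug_d: "x \<in> carrier (P (Suc 0)) \<Longrightarrow> cx_aug R (d (Suc 0) x) = \<zero>"
  using diff_cycle[of x 0] by (simp add: is_cycle_def)

lemma d_d: "x \<in> carrier (P (Suc (Suc n))) \<Longrightarrow> d (Suc n) (d (Suc (Suc n)) x) = \<zero>\<^bsub>P n\<^esub>"
  using diff_cycle[of x "Suc n"] by (simp add: is_cycle_def)

text \<open>The coboundary as a map; \<open>coboundaries\<close> gives only its image.\<close>

definition cobd :: "nat \<Rightarrow> ('p \<Rightarrow> 'a) \<Rightarrow> 'p \<Rightarrow> 'a" where
  "cobd n g = (\<lambda>x\<in>carrier (P (Suc n)). g (d (Suc n) x))"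

lemma cobd_in: "g \<in> carrier (C n) \<Longrightarrow> cobd n g \<in> carrier (C (Suc n))"
  unfolding cobd_def C_simps by (rule comp_hom[OF bim diff_hom])

lemma cobd_add:
  assumes "g \<in> carrier (C n)" "h \<in> carrier (C n)"
  shows "cobd n (g \<oplus>\<^bsub>C n\<^esub> h) = cobd n g \<oplus>\<^bsub>C (Suc n)\<^esub> cobd n h"
  unfolding cobd_def C_simps(3) by (rule restrict_ext) (simp add: d_in)

lemma cobd_smult:
  assumes "g \<in> carrier (C n)"
  shows "cobd n (c \<odot>\<^bsub>C n\<^esub> g) = c \<odot>\<^bsub>C (Suc n)\<^esub> cobd n g"
  unfolding C_smult[OF assms] C_smult[OF cobd_in[OF assms]]
  unfolding cobd_def by (rule restrict_ext) (simp add: d_in)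

lemma B_Suc: "B (Suc n) = cobd n ` carrier (C n)"
  by (simp add: cobd_def[abs_def])

lemma cobdI: "g \<in> carrier (C n) \<Longrightarrow> cobd n g \<in> B (Suc n)"
  by (simp only: B_Suc) blast

lemma B_cases:
  assumes "b \<in> B n"
  obtains "n = 0" "b = \<zero>\<^bsub>C 0\<^esub>" | k g where "n = Suc k" "g \<in> carrier (C k)" "b = cobd k g"
  using assms by (cases n) (auto simp: cobd_def)

lemma C_smult_zero: "c \<odot>\<^bsub>C n\<^esub> \<zero>\<^bsub>C n\<^esub> = \<zero>\<^bsub>C n\<^esub>"
  unfolding C_smult[OF C.zero_closed] unfolding C_simps(2)
  by (rule restrict_ext) (simp add: smult_zero)

lemma B_carrier: "b \<in> B n \<Longrightarrow> b \<in> carrier (C n)"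
  by (erule B_cases) (auto simp: cobd_in)

lemma B_zero: "\<zero>\<^bsub>C n\<^esub> \<in> B n"
proof (cases n)
  case (Suc k)
  have "cobd k \<zero>\<^bsub>C k\<^esub> = \<zero>\<^bsub>C (Suc k)\<^esub>"
    unfolding cobd_def C_simps(2) by (rule restrict_ext) (simp add: d_in)
  then show ?thesis using cobdI[OF C.zero_closed, of k] by (simp add: Suc)
qed simp

lemma B_add: "b \<in> B n \<Longrightarrow> b' \<in> B n \<Longrightarrow> b \<oplus>\<^bsub>C n\<^esub> b' \<in> B n"
proof (cases n)
  case (Suc k)
  assume "b \<in> B n" "b' \<in> B n"
  then obtain g g' where "g \<in> carrier (C k)" "b = cobd k g" "g' \<in> carrier (C k)" "b' = cobd k g'"
    unfolding Suc B_Suc by blast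
  then show ?thesis
    using cobdI[of "g \<oplus>\<^bsub>C k\<^esub> g'" k] by (simp add: Suc cobd_add del: coboundaries.simps)
qed simp

lemma B_smult: "b \<in> B n \<Longrightarrow> c \<odot>\<^bsub>C n\<^esub> b \<in> B n"
proof (cases n)
  case 0
  assume "b \<in> B n"
  then show ?thesis using 0 C_smult_zero by simp
next
  case (Suc k)
  assume "b \<in> B n"
  then obtain g where "g \<in> carrier (C k)" "b = cobd k g"
    unfolding Suc B_Suc by blast
  then show ?thesis
    using cobdI[OF C_smult_in[of g k c]] by (simp add: Suc cobd_smult del: coboundaries.simps)
qed

lemma B_subgroup: "abelian_subgroup (B n) (C n)"
proof (rule abelian_subgroupI3)
  show "additive_subgroup (B n) (C n)"
  proof (rule additive_subgroup.intro, rule group.subgroupI[OF C.a_group])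
    show "B n \<subseteq> carrier (add_monoid (C n))" using B_carrier by auto
    show "B n \<noteq> {}" using B_zero by blast
    fix b b' assume b: "b \<in> B n" "b' \<in> B n"
    show "inv\<^bsub>add_monoid (C n)\<^esub> b \<in> B n"
      using C_minus[OF B_carrier[OF b(1)]] B_smult[OF b(1)] by (simp add: a_inv_def)
    show "b \<otimes>\<^bsub>add_monoid (C n)\<^esub> b' \<in> B n" using B_add b by simp
  qed
qed (rule C.abelian_group_axioms)

lemma cls_iff: "h \<in> cls n f \<longleftrightarrow> (\<exists>b\<in>B n. h = b \<oplus>\<^bsub>C n\<^esub> f)"
  by (auto simp: coh_class_def a_r_coset_def')

lemma cls_self: "f \<in> carrier (C n) \<Longrightarrow> f \<in> cls n f"
  unfolding coh_class_def by (rule abelian_subgroup.a_rcos_self[OF B_subgroup])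

lemma cls_eqI: "f \<in> carrier (C n) \<Longrightarrow> b \<in> B n \<Longrightarrow> cls n (b \<oplus>\<^bsub>C n\<^esub> f) = cls n f"
  unfolding coh_class_def
  by (rule abelian_subgroup.a_repr_independence'[OF B_subgroup, symmetric])
    (auto simp: a_r_coset_def')

lemma cls_B: "b \<in> B n \<Longrightarrow> cls n b = B n"
  unfolding coh_class_def by (rule abelian_subgroup.a_rcos_const[OF B_subgroup])

lemma Z_iff: "f \<in> Z n \<longleftrightarrow> f \<in> carrier (C n) \<and> (\<forall>x\<in>carrier (P (Suc n)). f (d (Suc n) x) = \<zero>)"
  by (simp add: cocycles_def)

lemma Z_carrier: "f \<in> Z n \<Longrightarrow> f \<in> carrier (C n)"
  by (simp add: Z_iff)

lemma Z_add: "f \<in> Z n \<Longrightarrow> g \<in> Z n \<Longrightarrow> f \<oplus>\<^bsub>C n\<^esub> g \<in> Z n"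
  by (simp add: Z_iff C_add_apply d_in)

lemma Z_smult: "f \<in> Z n \<Longrightarrow> c \<odot>\<^bsub>C n\<^esub> f \<in> Z n"
  by (simp add: Z_iff C_smult_in C_smult_apply d_in smult_zero)

lemma B_Z: assumes "b \<in> B n" shows "b \<in> Z n"
  unfolding Z_iff
proof (intro conjI ballI B_carrier[OF assms])
  fix x assume "x \<in> carrier (P (Suc n))"
  then show "b (d (Suc n) x) = \<zero>"
    using assms by (elim B_cases) (auto simp: C_zero_apply d_in cobd_def d_d C_zero)
qed

lemma Z_zero: "\<zero>\<^bsub>C n\<^esub> \<in> Z n"
  using B_zero B_Z by blast

lemma H_simps:
  "carrier (H n) = cls n ` Z n" "\<zero>\<^bsub>H n\<^esub> = B n"
  by (simp_all add: HH_degree_def)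

lemma H_zero: "\<zero>\<^bsub>H n\<^esub> = cls n \<zero>\<^bsub>C n\<^esub>"
  by (simp add: H_simps cls_B B_zero)

lemma cls_H: "f \<in> Z n \<Longrightarrow> cls n f \<in> carrier (H n)"
  by (simp add: H_simps)

lemma H_cases:
  assumes "x \<in> carrier (H n)" obtains f where "f \<in> Z n" "x = cls n f"
  using assms by (auto simp: H_simps)

lemma H_add: "f \<in> Z n \<Longrightarrow> g \<in> Z n \<Longrightarrow> cls n f \<oplus>\<^bsub>H n\<^esub> cls n g = cls n (f \<oplus>\<^bsub>C n\<^esub> g)"
  using abelian_subgroup.a_rcos_sum[OF B_subgroup, of f n g]
  by (simp add: HH_degree_def coh_class_def Z_carrier)

lemma H_smult: assumes f: "f \<in> Z n" shows "c \<odot>\<^bsub>H n\<^esub> cls n f = cls n (c \<odot>\<^bsub>C n\<^esub> f)"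
proof -
  \<comment> \<open>Scaling a coset is a union over its representatives. It is a single coset
    because \<open>b \<oplus> f\<close> and \<open>f\<close> have multiples that differ by a
    coboundary.\<close>
  have "cls n (c \<odot>\<^bsub>C n\<^esub> g) = cls n (c \<odot>\<^bsub>C n\<^esub> f)" if g: "g \<in> cls n f" for g
  proof -
    obtain b where b: "b \<in> B n" "g = b \<oplus>\<^bsub>C n\<^esub> f" using g by (auto simp: cls_iff)
    then show ?thesis
      using f by (simp add: C_smult_add B_carrier Z_carrier cls_eqI B_smult C_smult_in)
  qed
  then have "(\<Union>g\<in>cls n f. cls n (c \<odot>\<^bsub>C n\<^esub> g)) = cls n (c \<odot>\<^bsub>C n\<^esub> f)"
    by (intro UN_constant_eq[OF cls_self[OF Z_carrier[OF f]]]) blast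
  then show ?thesis by (simp add: HH_degree_def)
qed

lemma H_abelian_group: "abelian_group (H n)"
proof (rule abelian_groupI)
  fix x assume "x \<in> carrier (H n)"
  then obtain f where f: "f \<in> Z n" "x = cls n f" by (rule H_cases)
  then have "cls n ((-1) \<odot>\<^bsub>C n\<^esub> f) \<oplus>\<^bsub>H n\<^esub> x = \<zero>\<^bsub>H n\<^esub>"
    using C.l_neg[OF Z_carrier[OF f(1)]] by (simp add: H_add Z_smult H_zero C_minus Z_carrier)
  then show "\<exists>y\<in>carrier (H n). y \<oplus>\<^bsub>H n\<^esub> x = \<zero>\<^bsub>H n\<^esub>"
    using cls_H[OF Z_smult[OF f(1)]] by blast
qed (auto elim!: H_cases simp: H_zero H_add cls_H Z_add Z_zero Z_carrier C.a_ac)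

sublocale H: abelian_group "H n" for n
  by (rule H_abelian_group)

lemma H_module:
  assumes "x \<in> carrier (H n)"
  shows H_smult_in: "c \<odot>\<^bsub>H n\<^esub> x \<in> carrier (H n)"
    and H_add_smult: "(c + c') \<odot>\<^bsub>H n\<^esub> x = c \<odot>\<^bsub>H n\<^esub> x \<oplus>\<^bsub>H n\<^esub> c' \<odot>\<^bsub>H n\<^esub> x"
    and H_smult_smult: "(c * c') \<odot>\<^bsub>H n\<^esub> x = c \<odot>\<^bsub>H n\<^esub> (c' \<odot>\<^bsub>H n\<^esub> x)"
    and H_smult_1: "1 \<odot>\<^bsub>H n\<^esub> x = x"
    and H_smult_add: "y \<in> carrier (H n) \<Longrightarrow>
      c \<odot>\<^bsub>H n\<^esub> (x \<oplus>\<^bsub>H n\<^esub> y) = c \<odot>\<^bsub>H n\<^esub> x \<oplus>\<^bsub>H n\<^esub> c \<odot>\<^bsub>H n\<^esub> y"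
proof -
  obtain f where f: "f \<in> Z n" and x: "x = cls n f" using assms by (rule H_cases)
  note fC = Z_carrier[OF f]
  note H = H_smult H_add Z_smult Z_add cls_H f x
  show "c \<odot>\<^bsub>H n\<^esub> x \<in> carrier (H n)" by (simp add: H)
  have "(c + c') \<odot>\<^bsub>C n\<^esub> f = c \<odot>\<^bsub>C n\<^esub> f \<oplus>\<^bsub>C n\<^esub> c' \<odot>\<^bsub>C n\<^esub> f"
    by (rule C_eqI[where n = n]) (simp_all add: fC C_smult_in C_apply C_in[OF fC] smult_add_left)
  then show "(c + c') \<odot>\<^bsub>H n\<^esub> x = c \<odot>\<^bsub>H n\<^esub> x \<oplus>\<^bsub>H n\<^esub> c' \<odot>\<^bsub>H n\<^esub> x" by (simp add: H)
  have "(c * c') \<odot>\<^bsub>C n\<^esub> f = c \<odot>\<^bsub>C n\<^esub> (c' \<odot>\<^bsub>C n\<^esub> f)"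
    by (rule C_eqI[where n = n]) (simp_all add: fC C_smult_in C_apply C_in[OF fC] smult_smult)
  then show "(c * c') \<odot>\<^bsub>H n\<^esub> x = c \<odot>\<^bsub>H n\<^esub> (c' \<odot>\<^bsub>H n\<^esub> x)" by (simp add: H)
  have "1 \<odot>\<^bsub>C n\<^esub> f = f"
    by (rule C_eqI[where n = n]) (simp_all add: fC C_smult_in C_apply C_in[OF fC] smult_1)
  then show "1 \<odot>\<^bsub>H n\<^esub> x = x" by (simp add: H)
  assume "y \<in> carrier (H n)"
  then obtain g where "g \<in> Z n" "y = cls n g" by (rule H_cases)
  then show "c \<odot>\<^bsub>H n\<^esub> (x \<oplus>\<^bsub>H n\<^esub> y) = c \<odot>\<^bsub>H n\<^esub> x \<oplus>\<^bsub>H n\<^esub> c \<odot>\<^bsub>H n\<^esub> y"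
    by (simp add: H C_smult_add fC Z_carrier)
qed

section \<open>Lifts of cocycles and products of cochains\<close>

definition pull :: "nat \<Rightarrow> nat \<Rightarrow> ('p \<Rightarrow> 'a) \<Rightarrow> (nat \<Rightarrow> 'p \<Rightarrow> 'p) \<Rightarrow> 'p \<Rightarrow> 'a" where
  "pull p q f G = (\<lambda>x\<in>carrier (P (p + q)). f (G p x))"

lemma liftsD:
  assumes "lifts A R q g G"
  shows lifts_hom: "G j \<in> bimod_hom A (P (j + q)) (P j)"
    and lifts_in: "x \<in> carrier (P (j + q)) \<Longrightarrow> G j x \<in> carrier (P j)"
    and lifts_aug: "x \<in> carrier (P q) \<Longrightarrow> cx_aug R (G 0 x) = g x"
    and lifts_d: "x \<in> carrier (P (Suc (j + q))) \<Longrightarrow>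
      d (Suc j) (G (Suc j) x) = G j (d (Suc (j + q)) x)"
proof -
  show G: "G j \<in> bimod_hom A (P (j + q)) (P j)"
    using assms by (simp add: lifts_def add.commute)
  then show "x \<in> carrier (P (j + q)) \<Longrightarrow> G j x \<in> carrier (P j)"
    by (rule bimod_homD(1))
  show "x \<in> carrier (P q) \<Longrightarrow> cx_aug R (G 0 x) = g x"
    "x \<in> carrier (P (Suc (j + q))) \<Longrightarrow> d (Suc j) (G (Suc j) x) = G j (d (Suc (j + q)) x)"
    using assms by (simp_all add: lifts_def add.commute)
qed

lemma liftsI:
  assumes "\<And>j. G j \<in> bimod_hom A (P (j + q)) (P j)"
    and "\<And>x. x \<in> carrier (P q) \<Longrightarrow> cx_aug R (G 0 x) = g x"
    and "\<And>j x. x \<in> carrier (P (Suc (j + q))) \<Longrightarrow> d (Suc j) (G (Suc j) x) = G j (d (Suc (j + q)) x)"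
  shows "lifts A R q g G"
  using assms by (simp add: lifts_def add.commute)

lemma pull_in: "f \<in> carrier (C p) \<Longrightarrow> lifts A R q g G \<Longrightarrow> pull p q f G \<in> carrier (C (p + q))"
  unfolding pull_def C_simps by (rule comp_hom[OF bim lifts_hom])

lemma pull_Z:
  assumes f: "f \<in> Z p" and G: "lifts A R q g G" shows "pull p q f G \<in> Z (p + q)"
  using f lifts_in[OF G, of _ "Suc p"]
  by (simp add: Z_iff pull_in[OF _ G]) (simp add: pull_def d_in flip: lifts_d[OF G])

text \<open>Since \<open>G\<close> is a chain map, composing the coboundary of \<open>h\<close> with
  it gives the coboundary of \<open>h\<close> composed with \<open>G\<close> one degree lower. In
  degree 0 the only coboundary is zero.\<close>

lemma pull_B:
  assumes b: "b \<in> B p" and G: "lifts A R q g G" shows "pull p q b G \<in> B (p + q)"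
  using b
proof (cases rule: B_cases)
  case 1
  have "pull p q b G = \<zero>\<^bsub>C (p + q)\<^esub>"
    unfolding pull_def 1 C_simps(2) by (rule restrict_ext) (use lifts_in[OF G, of _ p] 1 in simp)
  then show ?thesis by (simp add: B_zero)
next
  case (2 k h)
  have "pull p q b G = cobd (k + q) (pull k q h G)"
    unfolding pull_def 2 cobd_def
    using lifts_in[OF G, of _ "Suc k"] by (auto simp: d_in lifts_d[OF G] intro!: restrict_ext)
  then show ?thesis using 2 cobdI[OF pull_in[OF 2(2) G]] by (simp del: coboundaries.simps)
qed

text \<open>The comparison theorem, by dependent choice. The invariant says that the current
  component sends boundaries to cycles; this permits the next lifting step and is inherited because
  \<open>d d = 0\<close>.\<close>

lemma lifts_exists:
  assumes g: "g \<in> Z q" shows "\<exists>G. lifts A R q g G"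
proof -
  let ?P = "\<lambda>j T. T \<in> bimod_hom A (P (j + q)) (P j) \<and>
     (\<forall>x\<in>carrier (P (Suc (j + q))). is_cycle A R j (T (d (Suc (j + q)) x))) \<and>
     (j = 0 \<longrightarrow> (\<forall>x\<in>carrier (P q). cx_aug R (T x) = g x))"
  let ?Q = "\<lambda>j T T'. \<forall>x\<in>carrier (P (Suc (j + q))). d (Suc j) (T' x) = T (d (Suc (j + q)) x)"
  have "\<exists>G. \<forall>j. ?P j (G j) \<and> ?Q j (G j) (G (Suc j))"
  proof (rule dependent_nat_choice)
    have "g \<in> bimod_hom A (P q) (regular_bimod A)" using g by (simp add: Z_iff C_simps)
    then obtain T where "T \<in> bimod_hom A (P q) (P 0)" "\<forall>x\<in>carrier (P q). cx_aug R (T x) = g x"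
      using lift_aug by blast
    then show "\<exists>T. ?P 0 T" using g by (intro exI[of _ T]) (simp add: is_cycle_def Z_iff d_in)
  next
    fix T j assume T: "?P j T"
    let ?f = "\<lambda>x\<in>carrier (P (Suc (j + q))). T (d (Suc (j + q)) x)"
    have "?f \<in> bimod_hom A (P (Suc (j + q))) (P j)"
      using T by (intro comp_hom[OF bim diff_hom]) simp
    from lift_diff[OF this] T obtain T' where T':
      "T' \<in> bimod_hom A (P (Suc (j + q))) (P (Suc j))"
      "\<forall>x\<in>carrier (P (Suc (j + q))). d (Suc j) (T' x) = T (d (Suc (j + q)) x)" by auto
    have "T \<zero>\<^bsub>P (j + q)\<^esub> = \<zero>\<^bsub>P j\<^esub>"
      using bimodule_pair.hom_zero[OF pair_PP] T by simp
    then have "is_cycle A R (Suc j) (T' (d (Suc (Suc j + q)) x))"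
      if "x \<in> carrier (P (Suc (Suc j + q)))" for x
      using T' that by (simp add: is_cycle_def d_in d_d)
    then show "\<exists>T'. ?P (Suc j) T' \<and> ?Q j T T'"
      using T' by (intro exI[of _ T']) simp
  qed
  then obtain G where G: "\<forall>j. ?P j (G j) \<and> ?Q j (G j) (G (Suc j))" ..
  have "lifts A R q g G"
    by (rule liftsI) (use G in simp_all)
  then show ?thesis by (intro exI[of _ G])
qed

text \<open>A lift of the zero cocycle is null-homotopic, \<open>G = d T + T d\<close>. The cocycle
  \<open>f\<close> kills the part \<open>f d T\<close>, and \<open>f T d\<close> is a
  coboundary.\<close>

lemma pull_null:
  assumes f: "f \<in> Z p" and G: "lifts A R q g G" and g: "\<And>x. x \<in> carrier (P q) \<Longrightarrow> g x = \<zero>"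
  shows "pull p q f G \<in> B (p + q)"
proof -
  \<comment> \<open>The invariant is \<open>d T d = G d\<close>. It makes \<open>G - T d\<close>
    cycle-valued in the next degree, so that this difference can be lifted along the
    differential.\<close>
  let ?P = "\<lambda>j T. T \<in> bimod_hom A (P (j + q)) (P (Suc j)) \<and>
     (\<forall>x\<in>carrier (P (Suc (j + q))). d (Suc j) (T (d (Suc (j + q)) x)) = G j (d (Suc (j + q)) x)) \<and>
     (j = 0 \<longrightarrow> (\<forall>x\<in>carrier (P q). d (Suc 0) (T x) = G 0 x))"
  let ?Q = "\<lambda>j T T'. \<forall>x\<in>carrier (P (Suc (j + q))).
     d (Suc (Suc j)) (T' x) \<oplus>\<^bsub>P (Suc j)\<^esub> T (d (Suc (j + q)) x) = G (Suc j) x"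
  have "\<exists>T. \<forall>j. ?P j (T j) \<and> ?Q j (T j) (T (Suc j))"
  proof (rule dependent_nat_choice)
    have "G 0 \<in> bimod_hom A (P q) (P 0)" using lifts_hom[OF G, of 0] by simp
    from lift_diff[OF this] obtain T where T: "T \<in> bimod_hom A (P q) (P (Suc 0))"
        "\<forall>x\<in>carrier (P q). d (Suc 0) (T x) = G 0 x"
      using lifts_aug[OF G] g by (auto simp: is_cycle_def)
    then show "\<exists>T. ?P 0 T" by (intro exI[of _ T]) (simp add: d_in)
  next
    fix T j assume T: "?P j T"
    let ?n = "Suc (j + q)" and ?s = "\<lambda>x. scale A (P (Suc j)) (- 1) x"
    let ?f = "\<lambda>x\<in>carrier (P ?n). G (Suc j) x \<oplus>\<^bsub>P (Suc j)\<^esub>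
      (\<lambda>x\<in>carrier (P ?n). ?s ((\<lambda>x\<in>carrier (P ?n). T (d ?n x)) x)) x"
    have Td: "T (d ?n x) \<in> carrier (P (Suc j))" if "x \<in> carrier (P ?n)" for x
      using bimod_homD(1)[of T] T d_in that by blast
    have Gx: "G (Suc j) x \<in> carrier (P (Suc j))" if "x \<in> carrier (P ?n)" for x
      using lifts_in[OF G, of x "Suc j"] that by simp
    have f: "?f \<in> bimod_hom A (P ?n) (P (Suc j))"
      using T lifts_hom[OF G, of "Suc j"]
      by (intro bimodule_pair.add_hom[OF pair_PP] bimodule_pair.scale_hom[OF pair_PP]
          comp_hom[OF bim diff_hom]) simp_all
    have fx: "?f x = G (Suc j) x \<ominus>\<^bsub>P (Suc j)\<^esub> T (d ?n x)" if "x \<in> carrier (P ?n)" for x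
      using that Td[OF that] by (simp add: P.sc_minus P.M.minus_eq)
    have "is_cycle A R (Suc j) (?f x)" if x: "x \<in> carrier (P ?n)" for x
    proof -
      have "d (Suc j) (?f x) = d (Suc j) (G (Suc j) x) \<oplus>\<^bsub>P j\<^esub> \<ominus>\<^bsub>P j\<^esub> d (Suc j) (T (d ?n x))"
        unfolding fx[OF x] P.M.minus_eq
        using Gx[OF x] Td[OF x]
        by (simp add: bimod_homD(2)[OF diff_hom] bimodule_pair.hom_minus[OF pair_PP diff_hom])
      also have "\<dots> = \<zero>\<^bsub>P j\<^esub>"
        using T x lifts_d[OF G x] lifts_in[OF G d_in[OF x]] by (simp add: P.M.r_neg)
      finally show ?thesis by (simp add: is_cycle_def)
    qed
    from lift_diff[OF f this] obtain T' where T': "T' \<in> bimod_hom A (P ?n) (P (Suc (Suc j)))"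
      "\<forall>x\<in>carrier (P ?n). d (Suc (Suc j)) (T' x) = ?f x" by blast
    have T'2: "d (Suc (Suc j)) (T' x) \<oplus>\<^bsub>P (Suc j)\<^esub> T (d ?n x) = G (Suc j) x"
      if x: "x \<in> carrier (P ?n)" for x
      using T'(2) x fx[OF x] Td[OF x] Gx[OF x]
      by (simp add: P.M.minus_eq P.M.a_assoc P.M.l_neg del: restrict_apply)
    have "d (Suc (Suc j)) (T' (d (Suc (Suc j + q)) x)) = G (Suc j) (d (Suc (Suc j + q)) x)"
      if x: "x \<in> carrier (P (Suc (Suc j + q)))" for x
    proof -
      have dx: "d (Suc (Suc j + q)) x \<in> carrier (P ?n)" using d_in[of x "Suc j + q"] x by simp
      have "T (d ?n (d (Suc (Suc j + q)) x)) = \<zero>\<^bsub>P (Suc j)\<^esub>"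
        using T x by (simp add: d_d bimodule_pair.hom_zero[OF pair_PP])
      then show ?thesis
        using T'2[OF dx] bimod_homD(1)[OF diff_hom bimod_homD(1)[OF T'(1) dx]] by simp
    qed
    then show "\<exists>T'. ?P (Suc j) T' \<and> ?Q j T T'"
      using T' T'2 by (intro exI[of _ T']) simp
  qed
  then obtain T where T: "\<forall>j. ?P j (T j) \<and> ?Q j (T j) (T (Suc j))" ..
  then have T_hom: "T j \<in> bimod_hom A (P (j + q)) (P (Suc j))" for j by blast
  have fC: "f \<in> carrier (C p)" using f by (rule Z_carrier)
  have f0: "f (d (Suc p) x) = \<zero>" if "x \<in> carrier (P (Suc p))" for x
    using f that by (simp add: Z_iff)
  show ?thesis
  proof (cases p)
    case 0
    \<comment> \<open>The homotopy has no term \<open>T d\<close> in degree 0, so the product is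
      zero itself and not merely a coboundary.\<close>
    have "pull p q f G = \<zero>\<^bsub>C (p + q)\<^esub>"
      unfolding pull_def C_simps(2)
    proof (rule restrict_ext)
      fix x assume x: "x \<in> carrier (P (p + q))"
      then have "G 0 x = d (Suc 0) (T 0 x)" using T 0 by simp
      then show "f (G p x) = \<zero>" using f0[of "T 0 x"] bimod_homD(1)[OF T_hom, of x 0] x 0 by simp
    qed
    then show ?thesis by (simp add: B_zero)
  next
    case (Suc k)
    let ?h = "\<lambda>x\<in>carrier (P (k + q)). f (T k x)"
    have h: "?h \<in> carrier (C (k + q))"
      using fC unfolding C_simps Suc by (rule comp_hom[OF bim T_hom])
    have "pull p q f G = cobd (k + q) ?h"
      unfolding pull_def cobd_def Suc add_Suc
    proof (rule restrict_ext)
      fix x assume x: "x \<in> carrier (P (Suc (k + q)))"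
      then have "G (Suc k) x = d (Suc p) (T (Suc k) x) \<oplus>\<^bsub>P p\<^esub> T k (d (Suc (k + q)) x)"
        using T Suc by simp
      moreover have TS: "T (Suc k) x \<in> carrier (P (Suc p))" "T k (d (Suc (k + q)) x) \<in> carrier (P p)"
        using bimod_homD(1)[OF T_hom, of x "Suc k"] bimod_homD(1)[OF T_hom, of _ k] x d_in Suc
        by simp_all
      ultimately show "f (G (Suc k) x) = ?h (d (Suc (k + q)) x)"
        using x f0[OF TS(1)] C_in[OF fC TS(2)] C_add[OF fC d_in[OF TS(1)] TS(2)] by (simp add: d_in)
    qed
    then show ?thesis using cobdI[OF h] Suc by (simp del: coboundaries.simps)
  qed
qed

lemma lifts_lincomb:
  assumes G: "lifts A R q g G" and G': "lifts A R q g' G'" and g: "g \<in> carrier (C q)"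
  shows "lifts A R q (c \<odot>\<^bsub>C q\<^esub> g \<oplus>\<^bsub>C q\<^esub> g')
    (\<lambda>j. \<lambda>x\<in>carrier (P (j + q)). scale A (P j) c (G j x) \<oplus>\<^bsub>P j\<^esub> G' j x)" (is "lifts _ _ _ _ ?K")
proof (rule liftsI)
  fix j
  have "?K j = (\<lambda>x\<in>carrier (P (j + q)).
      (\<lambda>x\<in>carrier (P (j + q)). scale A (P j) c (G j x)) x \<oplus>\<^bsub>P j\<^esub> G' j x)"
    by (rule restrict_ext) simp
  then show "?K j \<in> bimod_hom A (P (j + q)) (P j)"
    by (simp only: bimodule_pair.add_hom[OF pair_PP] bimodule_pair.scale_hom[OF pair_PP]
        lifts_hom[OF G] lifts_hom[OF G'])
next
  fix x assume x: "x \<in> carrier (P q)"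
  have "G 0 x \<in> carrier (P 0)" "G' 0 x \<in> carrier (P 0)"
    using lifts_in[OF G, of x 0] lifts_in[OF G', of x 0] x by simp_all
  moreover have "cx_aug R (G 0 x) = g x" "cx_aug R (G' 0 x) = g' x"
    by (rule lifts_aug[OF G x], rule lifts_aug[OF G' x])
  ultimately show "cx_aug R (?K 0 x) = (c \<odot>\<^bsub>C q\<^esub> g \<oplus>\<^bsub>C q\<^esub> g') x"
    using x g C_in[OF g x] bimod_homD(2)[OF aug_hom] bimodule_pair.hom_scale[OF pair_PA aug_hom]
    by (simp add: C_apply)
next
  fix j x assume x: "x \<in> carrier (P (Suc (j + q)))"
  then have "G (Suc j) x \<in> carrier (P (Suc j))" "G' (Suc j) x \<in> carrier (P (Suc j))"
    using lifts_in[OF G, of x "Suc j"] lifts_in[OF G', of x "Suc j"] x by simp_all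
  then show "d (Suc j) (?K (Suc j) x) = ?K j (d (Suc (j + q)) x)"
    using x by (simp add: d_in bimod_homD(2)[OF diff_hom] bimodule_pair.hom_scale[OF pair_PP diff_hom]
        lifts_d[OF G x] lifts_d[OF G' x])
qed

lemma pull_lincomb_right:
  assumes f: "f \<in> carrier (C p)" and G: "lifts A R q g G" and G': "lifts A R q g' G'"
  shows "pull p q f (\<lambda>j. \<lambda>x\<in>carrier (P (j + q)). scale A (P j) c (G j x) \<oplus>\<^bsub>P j\<^esub> G' j x) =
    c \<odot>\<^bsub>C (p + q)\<^esub> pull p q f G \<oplus>\<^bsub>C (p + q)\<^esub> pull p q f G'"
  unfolding C_simps(3) C_smult[OF pull_in[OF f G]] unfolding pull_def
  by (rule restrict_ext)
    (use lifts_in[OF G, of _ p] lifts_in[OF G', of _ p] in \<open>simp add: C_add[OF f] C_sc[OF f]\<close>)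

lemma pull_lincomb_left:
  assumes f: "f \<in> carrier (C p)" and G: "lifts A R q g G"
  shows "pull p q (c \<odot>\<^bsub>C p\<^esub> f \<oplus>\<^bsub>C p\<^esub> f') G =
    c \<odot>\<^bsub>C (p + q)\<^esub> pull p q f G \<oplus>\<^bsub>C (p + q)\<^esub> pull p q f' G"
  unfolding C_simps(3) C_smult[OF f] C_smult[OF pull_in[OF f G]] unfolding pull_def
  by (rule restrict_ext) (use lifts_in[OF G, of _ p] in simp)

lemma pull_add_left:
  assumes G: "lifts A R q g G"
  shows "pull p q (f \<oplus>\<^bsub>C p\<^esub> f') G = pull p q f G \<oplus>\<^bsub>C (p + q)\<^esub> pull p q f' G"
  unfolding C_simps(3) pull_def
  by (rule restrict_ext) (use lifts_in[OF G, of _ p] in simp)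

lemma C_minus_cancel:
  assumes "u \<in> carrier (C n)" "v \<in> carrier (C n)"
  shows "u \<oplus>\<^bsub>C n\<^esub> ((-1) \<odot>\<^bsub>C n\<^esub> u \<oplus>\<^bsub>C n\<^esub> v) = v" "(-1) \<odot>\<^bsub>C n\<^esub> u \<oplus>\<^bsub>C n\<^esub> (v \<oplus>\<^bsub>C n\<^esub> u) = v"
  using assms C.a_comm[OF assms(2,1)] by (simp_all add: C.r_neg2 C.r_neg1 flip: C_minus)

text \<open>A coboundary \<open>h d\<close> has a lift concentrated in degree 0: lift
  \<open>h\<close> through the augmentation and compose with \<open>d\<close>. Products with this
  lift are visibly coboundaries, and any other lift differs from it by a lift of zero, which
  \<open>pull_null\<close> handles. In degree 0 the coboundary itself is zero.\<close>

lemma pull_B_right: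
  assumes f: "f \<in> Z p" and b: "b \<in> B q" and K: "lifts A R q b K"
  shows "pull p q f K \<in> B (p + q)"
proof (cases q)
  case 0
  then show ?thesis
    using b by (intro pull_null[OF f K]) (simp add: C_zero_apply)
next
  case (Suc k)
  note fC = Z_carrier[OF f]
  obtain h where h: "h \<in> carrier (C k)" "b = cobd k h"
    using b unfolding Suc B_Suc by blast
  obtain h0 where h0: "h0 \<in> bimod_hom A (P k) (P 0)" "\<forall>x\<in>carrier (P k). cx_aug R (h0 x) = h x"
    using lift_aug h(1) unfolding C_simps(1) by blast
  \<comment> \<open>The vanishing of the higher components is compatible with the differentials
    because \<open>L 0\<close> ends in a factor \<open>d\<close>.\<close>
  define L where "L j = (if j = 0 then \<lambda>x\<in>carrier (P (Suc k)). h0 (d (Suc k) x)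
      else (\<lambda>x\<in>carrier (P (j + q)). \<zero>\<^bsub>P j\<^esub>))" for j
  have L: "lifts A R q b L"
  proof (rule liftsI)
    show "L j \<in> bimod_hom A (P (j + q)) (P j)" for j
      unfolding L_def using comp_hom[OF bim diff_hom h0(1)] bimodule_pair.zero_hom[OF pair_PP]
      by (simp add: Suc)
    show "cx_aug R (L 0 x) = b x" if "x \<in> carrier (P q)" for x
      using that h0(2) by (simp add: L_def Suc h(2) cobd_def d_in)
    show "d (Suc j) (L (Suc j) x) = L j (d (Suc (j + q)) x)" if "x \<in> carrier (P (Suc (j + q)))" for j x
      using that by (cases j) (simp_all add: L_def Suc d_in d_d bimodule_pair.hom_zero[OF pair_PP h0(1)]
          bimodule_pair.hom_zero[OF pair_PP diff_hom])
  qed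
  have L_B: "pull p q f L \<in> B (p + q)"
  proof (cases p)
    case 0
    have "pull p q f L = cobd k (\<lambda>x\<in>carrier (P k). f (h0 x))"
      unfolding pull_def cobd_def by (auto simp: 0 Suc L_def d_in intro!: restrict_ext)
    moreover have "(\<lambda>x\<in>carrier (P k). f (h0 x)) \<in> carrier (C k)"
      using fC 0 unfolding C_simps by (intro comp_hom[OF bim h0(1)]) simp
    ultimately show ?thesis using cobdI by (simp add: 0 Suc del: coboundaries.simps)
  next
    case (Suc l)
    have "pull p q f L = \<zero>\<^bsub>C (p + q)\<^esub>"
      unfolding pull_def C_simps(2) by (rule restrict_ext) (simp add: Suc L_def C_zero[OF fC, unfolded Suc])
    then show ?thesis by (simp add: B_zero)
  qed
  \<comment> \<open>The difference \<open>K - L\<close> lifts \<open>b - b\<close>, which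
    vanishes.\<close>
  let ?M = "\<lambda>j. \<lambda>x\<in>carrier (P (j + q)). scale A (P j) (-1) (L j x) \<oplus>\<^bsub>P j\<^esub> K j x"
  have "pull p q f ?M \<in> B (p + q)"
  proof (rule pull_null[OF f lifts_lincomb[OF L K B_carrier[OF b]]])
    fix x assume "x \<in> carrier (P q)"
    then show "(- 1 \<odot>\<^bsub>C q\<^esub> b \<oplus>\<^bsub>C q\<^esub> b) x = \<zero>"
      using C.l_neg[OF B_carrier[OF b]] by (simp add: C_zero_apply B_carrier[OF b] flip: C_minus)
  qed
  then have "pull p q f L \<oplus>\<^bsub>C (p + q)\<^esub> ((-1) \<odot>\<^bsub>C (p + q)\<^esub> pull p q f L \<oplus>\<^bsub>C (p + q)\<^esub> pull p q f K) \<in> B (p + q)"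
    using L_B B_add by (simp add: pull_lincomb_right[OF fC L K])
  then show ?thesis
    by (simp add: C_minus_cancel pull_in[OF fC L] pull_in[OF fC K])
qed

text \<open>If \<open>f' = b + f\<close> and \<open>g' = b' + g\<close>, then \<open>G' - G\<close>
  lifts \<open>b'\<close> and the two products differ by \<open>b G' + f (G' - G)\<close>. The
  summands are coboundaries by \<open>pull_B\<close> and \<open>pull_B_right\<close>.\<close>

lemma pull_cls_cong:
  assumes f: "f \<in> Z p" and g: "g \<in> Z q" and f': "f' \<in> cls p f" and g': "g' \<in> cls q g"
    and G: "lifts A R q g G" and G': "lifts A R q g' G'"
  shows "cls (p + q) (pull p q f' G') = cls (p + q) (pull p q f G)"
proof -
  obtain b b' where b: "b \<in> B p" "f' = b \<oplus>\<^bsub>C p\<^esub> f" and b': "b' \<in> B q" "g' = b' \<oplus>\<^bsub>C q\<^esub> g"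
    using f' g' by (auto simp: cls_iff)
  note fC = Z_carrier[OF f] and gC = Z_carrier[OF g]
  let ?K = "\<lambda>j. \<lambda>x\<in>carrier (P (j + q)). scale A (P j) (-1) (G j x) \<oplus>\<^bsub>P j\<^esub> G' j x"
  let ?n = "p + q"
  have K: "lifts A R q b' ?K"
    using lifts_lincomb[OF G G' gC, of "-1"] gC B_carrier[OF b'(1)] unfolding b'(2)
    by (simp add: C_minus_cancel)
  have "pull p q f ?K \<in> B ?n"
    by (rule pull_B_right[OF f b'(1) K])
  then have "pull p q b G' \<oplus>\<^bsub>C ?n\<^esub> pull p q f ?K \<in> B ?n"
    using pull_B[OF b(1) G'] B_add by blast
  note * = cls_eqI[OF pull_in[OF fC G] this]
  have "pull p q f' G' = pull p q b G' \<oplus>\<^bsub>C ?n\<^esub> pull p q f G'"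
    unfolding b(2) by (rule pull_add_left[OF G'])
  also have "pull p q f G' = pull p q f G \<oplus>\<^bsub>C ?n\<^esub> pull p q f ?K"
    unfolding pull_lincomb_right[OF fC G G'] by (simp add: C_minus_cancel pull_in[OF fC G] pull_in[OF fC G'])
  finally have "pull p q f' G' = pull p q b G' \<oplus>\<^bsub>C ?n\<^esub> pull p q f ?K \<oplus>\<^bsub>C ?n\<^esub> pull p q f G"
    using pull_in[OF fC G] pull_in[OF fC K] pull_in[OF B_carrier[OF b(1)] G']
    by (simp add: C.a_ac)
  then show ?thesis using * by simp
qed

text \<open>All cosets in the nested unions agree by \<open>pull_cls_cong\<close>, and none of the
  unions is empty: a class contains its representative, and every cocycle in it has a lift.\<close>

lemma yoneda_cls:
  assumes f: "f \<in> Z p" and g: "g \<in> Z q" and G: "lifts A R q g G"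
  shows "yoneda A R p q (cls p f) (cls q g) = cls (p + q) (pull p q f G)"
proof -
  have "(\<Union>G'\<in>{G'. lifts A R q g' G'}. cls (p + q) (pull p q f' G')) = cls (p + q) (pull p q f G)"
    if f': "f' \<in> cls p f" and g': "g' \<in> cls q g" for f' g'
  proof -
    obtain b' where b': "b' \<in> B q" "g' = b' \<oplus>\<^bsub>C q\<^esub> g" using g' by (auto simp: cls_iff)
    then have "g' \<in> Z q" using B_Z Z_add g by simp
    then obtain G' where "lifts A R q g' G'" using lifts_exists by blast
    then have "G' \<in> {G'. lifts A R q g' G'}" by simp
    then show ?thesis
      by (rule UN_constant_eq) (use pull_cls_cong[OF f g f' g' G] in blast)
  qed
  then have "(\<Union>g'\<in>cls q g. \<Union>G'\<in>{G'. lifts A R q g' G'}. cls (p + q) (pull p q f' G')) =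
      cls (p + q) (pull p q f G)" if "f' \<in> cls p f" for f'
    using that by (intro UN_constant_eq[OF cls_self[OF Z_carrier[OF g]]]) blast
  then have "(\<Union>f'\<in>cls p f. \<Union>g'\<in>cls q g. \<Union>G'\<in>{G'. lifts A R q g' G'}. cls (p + q) (pull p q f' G')) =
      cls (p + q) (pull p q f G)"
    by (intro UN_constant_eq[OF cls_self[OF Z_carrier[OF f]]]) blast
  then show ?thesis unfolding yoneda_def pull_def .
qed

lemma yoneda_closed:
  assumes "x \<in> carrier (H p)" "y \<in> carrier (H q)"
  shows "yoneda A R p q x y \<in> carrier (H (p + q))"
proof -
  obtain f g where "f \<in> Z p" "x = cls p f" "g \<in> Z q" "y = cls q g"
    using assms by (elim H_cases)
  moreover obtain G where "lifts A R q g G" using lifts_exists calculation by blast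
  ultimately show ?thesis by (simp add: yoneda_cls cls_H pull_Z)
qed

text \<open>Additivity and homogeneity are kept in one statement: \<open>c = 1\<close> and
  \<open>x' = 0\<close> recover them, and \<open>c = 1\<close> with both classes zero gives the
  absorption of zero.\<close>

lemma yoneda_left_linear:
  assumes "x \<in> carrier (H p)" "x' \<in> carrier (H p)" "y \<in> carrier (H q)"
  shows "yoneda A R p q (c \<odot>\<^bsub>H p\<^esub> x \<oplus>\<^bsub>H p\<^esub> x') y =
    c \<odot>\<^bsub>H (p + q)\<^esub> yoneda A R p q x y \<oplus>\<^bsub>H (p + q)\<^esub> yoneda A R p q x' y"
proof -
  obtain f f' g where fg: "f \<in> Z p" "x = cls p f" "f' \<in> Z p" "x' = cls p f'" "g \<in> Z q" "y = cls q g"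
    using assms by (elim H_cases)
  moreover obtain G where G: "lifts A R q g G" using lifts_exists calculation by blast
  ultimately show ?thesis
    by (simp add: H_smult H_add Z_smult Z_add yoneda_cls[OF _ _ G] pull_Z[OF _ G]
        pull_lincomb_left[OF Z_carrier[OF fg(1)] G])
qed

lemma yoneda_right_linear:
  assumes "x \<in> carrier (H p)" "y \<in> carrier (H q)" "y' \<in> carrier (H q)"
  shows "yoneda A R p q x (c \<odot>\<^bsub>H q\<^esub> y \<oplus>\<^bsub>H q\<^esub> y') =
    c \<odot>\<^bsub>H (p + q)\<^esub> yoneda A R p q x y \<oplus>\<^bsub>H (p + q)\<^esub> yoneda A R p q x y'"
proof -
  obtain f g g' where fg: "f \<in> Z p" "x = cls p f" "g \<in> Z q" "y = cls q g" "g' \<in> Z q" "y' = cls q g'"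
    using assms by (elim H_cases)
  moreover obtain G G' where G: "lifts A R q g G" "lifts A R q g' G'"
    using lifts_exists calculation by blast
  ultimately show ?thesis
    by (simp add: H_smult H_add Z_smult Z_add yoneda_cls[OF _ _ G(1)] yoneda_cls[OF _ _ G(2)]
        yoneda_cls[OF _ _ lifts_lincomb[OF G Z_carrier]] pull_Z[OF _ G(1)] pull_Z[OF _ G(2)]
        pull_lincomb_right[OF Z_carrier[OF fg(1)] G])
qed

text \<open>A lift of \<open>g\<close> composed with a lift of \<open>h\<close> lifts their product.
  With these lifts associativity already holds for cochains.\<close>

lemma yoneda_assoc:
  assumes "x \<in> carrier (H p)" "y \<in> carrier (H q)" "z \<in> carrier (H r)"
  shows "yoneda A R (p + q) r (yoneda A R p q x y) z = yoneda A R p (q + r) x (yoneda A R q r y z)"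
proof -
  obtain f g h where fgh: "f \<in> Z p" "x = cls p f" "g \<in> Z q" "y = cls q g" "h \<in> Z r" "z = cls r h"
    using assms by (elim H_cases)
  moreover obtain G K where G: "lifts A R q g G" and K: "lifts A R r h K"
    using lifts_exists calculation by blast
  let ?L = "\<lambda>j. \<lambda>x\<in>carrier (P (j + (q + r))). G j (K (j + q) x)"
  have Kin: "K (j + q) x \<in> carrier (P (j + q))" if "x \<in> carrier (P (j + (q + r)))" for j x
    using lifts_in[OF K, of x "j + q"] that by (simp add: add.assoc)
  have L: "lifts A R (q + r) (pull q r g K) ?L"
  proof (rule liftsI)
    show "?L j \<in> bimod_hom A (P (j + (q + r))) (P j)" for j
      using lifts_hom[OF K, of "j + q"]
      by (intro comp_hom[OF bim _ lifts_hom[OF G]]) (simp add: add.assoc)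
    show "cx_aug R (?L 0 x) = pull q r g K x" if "x \<in> carrier (P (q + r))" for x
      using that Kin[of x 0] by (simp add: pull_def lifts_aug[OF G])
    show "d (Suc j) (?L (Suc j) x) = ?L j (d (Suc (j + (q + r))) x)"
      if x: "x \<in> carrier (P (Suc (j + (q + r))))" for j x
      using x Kin[of x "Suc j"] lifts_d[OF K, of x "j + q"]
      by (simp add: d_in lifts_d[OF G] add.assoc)
  qed
  have "pull (p + q) r (pull p q f G) K = pull p (q + r) f ?L"
    unfolding pull_def add.assoc by (rule restrict_ext) (simp add: Kin)
  then show ?thesis
    using fgh by (simp add: yoneda_cls[OF _ _ G] yoneda_cls[OF _ _ K] yoneda_cls[OF _ _ L]
        pull_Z[OF _ G] pull_Z[OF _ K] add.assoc)
qed

lemma aug_Z: "cx_aug R \<in> Z 0"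
  using aug_hom aug_d by (simp add: Z_iff C_simps)

text \<open>The identity is a lift of the augmentation. On the other side, the degree 0 component of
  a lift of \<open>f\<close> augments to \<open>f\<close>.\<close>

lemma yoneda_one_right:
  assumes "x \<in> carrier (H n)" shows "yoneda A R n 0 x (cls 0 (cx_aug R)) = x"
proof -
  obtain f where f: "f \<in> Z n" "x = cls n f" using assms by (rule H_cases)
  let ?I = "\<lambda>j. \<lambda>x\<in>carrier (P j). x"
  have I: "lifts A R 0 (cx_aug R) ?I"
    by (rule liftsI) (auto simp: d_in intro!: bimod_homI)
  have "pull n 0 f ?I = f"
    using C_ext[OF Z_carrier[OF f(1)]] unfolding pull_def by (simp cong: restrict_cong)
  then show ?thesis using f by (simp add: yoneda_cls[OF _ aug_Z I])
qed

lemma yoneda_one_left: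
  assumes "x \<in> carrier (H n)" shows "yoneda A R 0 n (cls 0 (cx_aug R)) x = x"
proof -
  obtain f where f: "f \<in> Z n" "x = cls n f" using assms by (rule H_cases)
  obtain G where G: "lifts A R n f G" using lifts_exists f(1) by blast
  have "pull 0 n (cx_aug R) G = restrict f (carrier (P n))"
    unfolding pull_def by (auto simp: lifts_aug[OF G] intro!: restrict_ext)
  then show ?thesis using f C_ext[OF Z_carrier[OF f(1)]] by (simp add: yoneda_cls[OF aug_Z _ G])
qed

lemma yoneda_zero:
  assumes "x \<in> carrier (H p)" "y \<in> carrier (H q)"
  shows "yoneda A R p q \<zero>\<^bsub>H p\<^esub> y = \<zero>\<^bsub>H (p + q)\<^esub>" "yoneda A R p q x \<zero>\<^bsub>H q\<^esub> = \<zero>\<^bsub>H (p + q)\<^esub>"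
proof -
  note c = yoneda_closed[OF _ assms(2), of "\<zero>\<^bsub>H p\<^esub>"] yoneda_closed[OF assms(1), of "\<zero>\<^bsub>H q\<^esub>"]
  show "yoneda A R p q \<zero>\<^bsub>H p\<^esub> y = \<zero>\<^bsub>H (p + q)\<^esub>"
    using yoneda_left_linear[of "\<zero>\<^bsub>H p\<^esub>" p "\<zero>\<^bsub>H p\<^esub>" y q 1] assms c
    by (simp add: H_smult_1)
  show "yoneda A R p q x \<zero>\<^bsub>H q\<^esub> = \<zero>\<^bsub>H (p + q)\<^esub>"
    using yoneda_right_linear[of x p "\<zero>\<^bsub>H q\<^esub>" q "\<zero>\<^bsub>H q\<^esub>" 1] assms c
    by (simp add: H_smult_1)
qed

lemma yoneda_add_left:
  assumes "x \<in> carrier (H p)" "x' \<in> carrier (H p)" "y \<in> carrier (H q)"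
  shows "yoneda A R p q (x \<oplus>\<^bsub>H p\<^esub> x') y = yoneda A R p q x y \<oplus>\<^bsub>H (p + q)\<^esub> yoneda A R p q x' y"
  using yoneda_left_linear[of x p x' y q 1] assms by (simp add: H_smult_1 yoneda_closed)

lemma yoneda_add_right:
  assumes "x \<in> carrier (H p)" "y \<in> carrier (H q)" "y' \<in> carrier (H q)"
  shows "yoneda A R p q x (y \<oplus>\<^bsub>H q\<^esub> y') = yoneda A R p q x y \<oplus>\<^bsub>H (p + q)\<^esub> yoneda A R p q x y'"
  using yoneda_right_linear[of x p y q y' 1] assms by (simp add: H_smult_1 yoneda_closed)

lemma yoneda_smult:
  assumes "x \<in> carrier (H p)" "y \<in> carrier (H q)"
  shows "yoneda A R p q (c \<odot>\<^bsub>H p\<^esub> x) y = c \<odot>\<^bsub>H (p + q)\<^esub> yoneda A R p q x y"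
    "yoneda A R p q x (c \<odot>\<^bsub>H q\<^esub> y) = c \<odot>\<^bsub>H (p + q)\<^esub> yoneda A R p q x y"
  using yoneda_left_linear[of x p "\<zero>\<^bsub>H p\<^esub>" y q c] yoneda_right_linear[of x p y q "\<zero>\<^bsub>H q\<^esub>" c] assms
  by (simp_all add: H_smult_in yoneda_zero yoneda_closed)

lemma H_smult_zero: "c \<odot>\<^bsub>H n\<^esub> \<zero>\<^bsub>H n\<^esub> = \<zero>\<^bsub>H n\<^esub>"
  using H_smult_add[OF H.zero_closed H.zero_closed, where c = c and n = n]
    H_smult_in[OF H.zero_closed, where c = c and n = n] by simp

lemma yoneda_finsum:
  assumes "y \<in> carrier (H q)" "f \<in> I \<rightarrow> carrier (H p)"
  shows "yoneda A R p q (finsum (H p) f I) y = (\<Oplus>\<^bsub>H (p + q)\<^esub>i\<in>I. yoneda A R p q (f i) y)"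
    and "yoneda A R q p y (finsum (H p) f I) = (\<Oplus>\<^bsub>H (q + p)\<^esub>i\<in>I. yoneda A R q p y (f i))"
proof -
  note z = yoneda_zero[OF H.zero_closed assms(1)] yoneda_zero[OF assms(1) H.zero_closed]
  have "f \<in> I \<rightarrow> carrier (H p) \<longrightarrow>
      yoneda A R p q (finsum (H p) f I) y = (\<Oplus>\<^bsub>H (p + q)\<^esub>i\<in>I. yoneda A R p q (f i) y) \<and>
      yoneda A R q p y (finsum (H p) f I) = (\<Oplus>\<^bsub>H (q + p)\<^esub>i\<in>I. yoneda A R q p y (f i))"
  proof (induction I rule: infinite_finite_induct)
    case (insert i I)
    show ?case
    proof
      assume f: "f \<in> insert i I \<rightarrow> carrier (H p)"
      then have f': "f i \<in> carrier (H p)" "f \<in> I \<rightarrow> carrier (H p)"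
        "(\<lambda>i. yoneda A R p q (f i) y) \<in> I \<rightarrow> carrier (H (p + q))"
        "(\<lambda>i. yoneda A R q p y (f i)) \<in> I \<rightarrow> carrier (H (q + p))"
        using assms(1) by (auto intro!: yoneda_closed)
      then show "yoneda A R p q (finsum (H p) f (insert i I)) y = (\<Oplus>\<^bsub>H (p + q)\<^esub>i\<in>insert i I. yoneda A R p q (f i) y) \<and>
      yoneda A R q p y (finsum (H p) f (insert i I)) = (\<Oplus>\<^bsub>H (q + p)\<^esub>i\<in>insert i I. yoneda A R q p y (f i))"
        using insert assms(1) by (simp add: yoneda_closed yoneda_add_left yoneda_add_right)
    qed
  qed (simp_all add: z)
  with assms(2) show "yoneda A R p q (finsum (H p) f I) y = (\<Oplus>\<^bsub>H (p + q)\<^esub>i\<in>I. yoneda A R p q (f i) y)"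
    "yoneda A R q p y (finsum (H p) f I) = (\<Oplus>\<^bsub>H (q + p)\<^esub>i\<in>I. yoneda A R q p y (f i))"
    by blast+
qed

section \<open>The graded algebra of total cohomology\<close>

abbreviation HHR where "HHR \<equiv> HH A R"

lemma HH_carrier: "x \<in> carrier HHR \<longleftrightarrow> (\<forall>n. x n \<in> carrier (H n)) \<and> (\<exists>N. \<forall>n>N. x n = \<zero>\<^bsub>H n\<^esub>)"
proof -
  have "finite {n. x n \<noteq> \<zero>\<^bsub>H n\<^esub>} \<longleftrightarrow> (\<exists>N. \<forall>n>N. x n = \<zero>\<^bsub>H n\<^esub>)"
    unfolding finite_nat_set_iff_bounded_le by (meson mem_Collect_eq not_le)
  then show ?thesis by (simp add: HH_def)
qed

lemma HH_simps:
  "x \<otimes>\<^bsub>HHR\<^esub> y = (\<lambda>n. \<Oplus>\<^bsub>H n\<^esub>p\<in>{..n}. yoneda A R p (n - p) (x p) (y (n - p)))"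
  "\<one>\<^bsub>HHR\<^esub> = (\<lambda>n. if n = 0 then cls 0 (cx_aug R) else \<zero>\<^bsub>H n\<^esub>)"
  "\<zero>\<^bsub>HHR\<^esub> = (\<lambda>n. \<zero>\<^bsub>H n\<^esub>)"
  "x \<oplus>\<^bsub>HHR\<^esub> y = (\<lambda>n. x n \<oplus>\<^bsub>H n\<^esub> y n)"
  "c \<odot>\<^bsub>HHR\<^esub> x = (\<lambda>n. c \<odot>\<^bsub>H n\<^esub> x n)"
  by (simp_all add: HH_def)

lemma HH_in: "x \<in> carrier HHR \<Longrightarrow> x n \<in> carrier (H n)"
  by (simp add: HH_carrier)

lemma yoneda_in:
  "x \<in> carrier (H p) \<Longrightarrow> y \<in> carrier (H (n - p)) \<Longrightarrow> p \<le> n \<Longrightarrow> yoneda A R p (n - p) x y \<in> carrier (H n)"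
  using yoneda_closed[of x p y "n - p"] by simp

lemma HH_abelian_group: "abelian_group HHR"
proof (rule abelian_groupI)
  fix x y assume xy: "x \<in> carrier HHR" "y \<in> carrier HHR"
  then obtain N M where "\<forall>n>N. x n = \<zero>\<^bsub>H n\<^esub>" "\<forall>n>M. y n = \<zero>\<^bsub>H n\<^esub>" by (auto simp: HH_carrier)
  then show "x \<oplus>\<^bsub>HHR\<^esub> y \<in> carrier HHR"
    using xy by (auto simp: HH_carrier HH_simps intro!: exI[of _ "max N M"])
next
  fix x assume x: "x \<in> carrier HHR"
  then obtain N where N: "\<forall>n>N. x n = \<zero>\<^bsub>H n\<^esub>" by (auto simp: HH_carrier)
  let ?y = "\<lambda>n. \<ominus>\<^bsub>H n\<^esub> x n"
  have "?y \<in> carrier HHR" using x N by (auto simp: HH_carrier intro!: exI[of _ N])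
  moreover have "?y \<oplus>\<^bsub>HHR\<^esub> x = \<zero>\<^bsub>HHR\<^esub>" using HH_in[OF x] by (simp add: HH_simps H.l_neg)
  ultimately show "\<exists>y\<in>carrier HHR. y \<oplus>\<^bsub>HHR\<^esub> x = \<zero>\<^bsub>HHR\<^esub>" by blast
qed (auto simp: HH_carrier HH_simps H.a_ac)

text \<open>If \<open>n > N + M\<close>, every splitting of \<open>n\<close> into two degrees
  exceeds one of the two bounds, so all summands vanish.\<close>

lemma HH_mult_in:
  assumes x: "x \<in> carrier HHR" and y: "y \<in> carrier HHR" shows "x \<otimes>\<^bsub>HHR\<^esub> y \<in> carrier HHR"
proof -
  obtain N M where NM: "\<forall>n>N. x n = \<zero>\<^bsub>H n\<^esub>" "\<forall>n>M. y n = \<zero>\<^bsub>H n\<^esub>"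
    using x y by (auto simp: HH_carrier)
  have "(x \<otimes>\<^bsub>HHR\<^esub> y) n = \<zero>\<^bsub>H n\<^esub>" if n: "n > N + M" for n
    unfolding HH_simps
  proof (rule H.add.finprod_one_eqI)
    fix p assume p: "p \<in> {..n}"
    have "p > N \<or> n - p > M" using n by linarith
    then show "yoneda A R p (n - p) (x p) (y (n - p)) = \<zero>\<^bsub>H n\<^esub>"
      using NM p yoneda_zero[OF HH_in[OF x] HH_in[OF y], of p "n - p"] by auto
  qed
  moreover have "(x \<otimes>\<^bsub>HHR\<^esub> y) n \<in> carrier (H n)" for n
    unfolding HH_simps by (rule H.finsum_closed) (auto simp: yoneda_in HH_in[OF x] HH_in[OF y])
  ultimately show ?thesis by (auto simp: HH_carrier)
qed

lemma HH_one_in: "\<one>\<^bsub>HHR\<^esub> \<in> carrier HHR"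
  by (auto simp: HH_carrier HH_simps cls_H aug_Z)

end

text \<open>Both sides sum over the triangle \<open>j + i \<le> k\<close>, by diagonals and by rows.
  A new diagonal lengthens every row by one entry and starts a new row; the bound \<open>N\<close>
  keeps the closure assumption fixed during the induction.\<close>

lemma (in abelian_group) finsum_triangle:
  fixes k N :: nat
  assumes "\<And>j i. j + i \<le> N \<Longrightarrow> F j i \<in> carrier G"
  shows "k \<le> N \<Longrightarrow> (\<Oplus>i\<in>{..k}. \<Oplus>j\<in>{..i}. F j (i - j)) = (\<Oplus>j\<in>{..k}. \<Oplus>i\<in>{..k - j}. F j i)"
proof (induction k)
  case 0
  then show ?case using assms[of 0 0] by simp
next
  case (Suc k)
  have F: "F j i \<in> carrier G" if "j + i \<le> Suc k" for j i using assms that Suc.prems by simp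
  have "(\<Oplus>j\<in>{..k}. \<Oplus>i\<in>{..Suc k - j}. F j i) =
      (\<Oplus>j\<in>{..k}. F j (Suc k - j)) \<oplus> (\<Oplus>j\<in>{..k}. \<Oplus>i\<in>{..k - j}. F j i)"
  proof (rule finsum_eq_add)
    fix j assume "j \<in> {..k}"
    then show "(\<Oplus>i\<in>{..Suc k - j}. F j i) = F j (Suc k - j) \<oplus> (\<Oplus>i\<in>{..k - j}. F j i)"
      using F by (simp add: Suc_diff_le Pi_def)
    show "F j (Suc k - j) \<in> carrier G" "(\<Oplus>i\<in>{..k - j}. F j i) \<in> carrier G"
      using F \<open>j \<in> {..k}\<close> by (auto intro!: finsum_closed)
  qed
  moreover have "(\<Oplus>i\<in>{..k}. \<Oplus>j\<in>{..i}. F j (i - j)) = (\<Oplus>j\<in>{..k}. \<Oplus>i\<in>{..k - j}. F j i)"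
    using Suc by simp
  moreover have "(\<Oplus>j\<in>{..k}. F j (Suc k - j)) \<in> carrier G" "F (Suc k) 0 \<in> carrier G"
    "(\<Oplus>j\<in>{..k}. \<Oplus>i\<in>{..k - j}. F j i) \<in> carrier G"
    using F by (auto intro!: finsum_closed)
  moreover have "(\<Oplus>i\<in>{..Suc k}. \<Oplus>j\<in>{..i}. F j (i - j)) =
      (\<Oplus>j\<in>{..Suc k}. F j (Suc k - j)) \<oplus> (\<Oplus>i\<in>{..k}. \<Oplus>j\<in>{..i}. F j (i - j))"
    using F by (intro finsum_Suc) (auto intro!: finsum_closed)
  moreover have "(\<Oplus>j\<in>{..Suc k}. F j (Suc k - j)) = F (Suc k) 0 \<oplus> (\<Oplus>j\<in>{..k}. F j (Suc k - j))"
    using F by (subst finsum_Suc) auto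
  moreover have "(\<Oplus>j\<in>{..Suc k}. \<Oplus>i\<in>{..Suc k - j}. F j i) =
      F (Suc k) 0 \<oplus> (\<Oplus>j\<in>{..k}. \<Oplus>i\<in>{..Suc k - j}. F j i)"
    using F by (subst finsum_Suc) (auto intro!: finsum_closed)
  ultimately show ?case by (simp add: a_assoc)
qed

context lifting_complex
begin

lemma HH_assoc:
  assumes x: "x \<in> carrier HHR" and y: "y \<in> carrier HHR" and z: "z \<in> carrier HHR"
  shows "x \<otimes>\<^bsub>HHR\<^esub> y \<otimes>\<^bsub>HHR\<^esub> z = x \<otimes>\<^bsub>HHR\<^esub> (y \<otimes>\<^bsub>HHR\<^esub> z)"
proof
  fix n
  note xyz = HH_in[OF x] HH_in[OF y] HH_in[OF z]
  \<comment> \<open>The triple product of the components in degrees \<open>p\<close>,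
    \<open>q\<close> and \<open>n - p - q\<close>; both bracketings sum it over the same
    triangle.\<close>
  define F where "F p q = yoneda A R p (n - p) (x p) (yoneda A R q (n - p - q) (y q) (z (n - p - q)))" for p q
  have F_in: "F p q \<in> carrier (H n)" if "p + q \<le> n" for p q
    unfolding F_def using that xyz by (intro yoneda_in) auto
  have yz: "yoneda A R q (n - (p + q)) (y q) (z (n - (p + q))) \<in> carrier (H (n - p))"
    if "q \<le> n - p" for p q
    using yoneda_in[of "y q" q "z (n - p - q)" "n - p"] xyz that by simp
  have "(x \<otimes>\<^bsub>HHR\<^esub> y \<otimes>\<^bsub>HHR\<^esub> z) n = (\<Oplus>\<^bsub>H n\<^esub>k\<in>{..n}. \<Oplus>\<^bsub>H n\<^esub>p\<in>{..k}. F p (k - p))"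
    unfolding HH_simps
  proof (rule H.finsum_cong')
    fix k assume k: "k \<in> {..n}"
    have "yoneda A R k (n - k) (\<Oplus>\<^bsub>H k\<^esub>p\<in>{..k}. yoneda A R p (k - p) (x p) (y (k - p))) (z (n - k)) =
        (\<Oplus>\<^bsub>H n\<^esub>p\<in>{..k}. yoneda A R k (n - k) (yoneda A R p (k - p) (x p) (y (k - p))) (z (n - k)))"
      using k yoneda_finsum(1)[of "z (n - k)" "n - k" "\<lambda>p. yoneda A R p (k - p) (x p) (y (k - p))" "{..k}" k]
      by (simp add: xyz yoneda_in)
    also have "\<dots> = (\<Oplus>\<^bsub>H n\<^esub>p\<in>{..k}. F p (k - p))"
    proof (rule H.finsum_cong')
      fix p assume p: "p \<in> {..k}"
      then show "yoneda A R k (n - k) (yoneda A R p (k - p) (x p) (y (k - p))) (z (n - k)) = F p (k - p)"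
        using k yoneda_assoc[of "x p" p "y (k - p)" "k - p" "z (n - k)" "n - k"] xyz by (simp add: F_def)
    qed (use k F_in in auto)
    finally show "yoneda A R k (n - k) (\<Oplus>\<^bsub>H k\<^esub>p\<in>{..k}. yoneda A R p (k - p) (x p) (y (k - p))) (z (n - k)) =
        (\<Oplus>\<^bsub>H n\<^esub>p\<in>{..k}. F p (k - p))" .
  qed (use F_in in \<open>auto intro!: H.finsum_closed\<close>)
  also have "\<dots> = (\<Oplus>\<^bsub>H n\<^esub>p\<in>{..n}. \<Oplus>\<^bsub>H n\<^esub>q\<in>{..n - p}. F p q)"
    by (rule H.finsum_triangle[where N = n]) (simp_all add: F_in)
  also have "\<dots> = (x \<otimes>\<^bsub>HHR\<^esub> (y \<otimes>\<^bsub>HHR\<^esub> z)) n"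
    unfolding HH_simps
  proof (rule H.finsum_cong')
    fix p assume p: "p \<in> {..n}"
    then show "(\<Oplus>\<^bsub>H n\<^esub>q\<in>{..n - p}. F p q) =
        yoneda A R p (n - p) (x p) (\<Oplus>\<^bsub>H (n - p)\<^esub>q\<in>{..n - p}. yoneda A R q (n - p - q) (y q) (z (n - p - q)))"
      using yoneda_finsum(2)[of "x p" p "\<lambda>q. yoneda A R q (n - p - q) (y q) (z (n - p - q))" "{..n - p}" "n - p"]
      by (simp add: xyz yz F_def Pi_def)
  qed (auto intro!: yoneda_in H.finsum_closed xyz simp: yz)
  finally show "(x \<otimes>\<^bsub>HHR\<^esub> y \<otimes>\<^bsub>HHR\<^esub> z) n = (x \<otimes>\<^bsub>HHR\<^esub> (y \<otimes>\<^bsub>HHR\<^esub> z)) n" .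
qed

lemma HH_one:
  assumes x: "x \<in> carrier HHR"
  shows "\<one>\<^bsub>HHR\<^esub> \<otimes>\<^bsub>HHR\<^esub> x = x" "x \<otimes>\<^bsub>HHR\<^esub> \<one>\<^bsub>HHR\<^esub> = x"
proof -
  note x' = HH_in[OF x]
  show "\<one>\<^bsub>HHR\<^esub> \<otimes>\<^bsub>HHR\<^esub> x = x"
  proof
    fix n
    have "(\<one>\<^bsub>HHR\<^esub> \<otimes>\<^bsub>HHR\<^esub> x) n = (\<Oplus>\<^bsub>H n\<^esub>p\<in>{..n}. if 0 = p then x n else \<zero>\<^bsub>H n\<^esub>)"
      unfolding HH_simps
    proof (rule H.finsum_cong')
      fix p assume "p \<in> {..n}"
      then show "yoneda A R p (n - p) (if p = 0 then cls 0 (cx_aug R) else \<zero>\<^bsub>H p\<^esub>) (x (n - p)) =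
          (if 0 = p then x n else \<zero>\<^bsub>H n\<^esub>)"
        using yoneda_zero(1)[OF H.zero_closed x', of p "n - p"] by (auto simp: yoneda_one_left x')
    qed (auto simp: x')
    also have "\<dots> = x n" by (rule H.finsum_singleton) (auto simp: x')
    finally show "(\<one>\<^bsub>HHR\<^esub> \<otimes>\<^bsub>HHR\<^esub> x) n = x n" .
  qed
  show "x \<otimes>\<^bsub>HHR\<^esub> \<one>\<^bsub>HHR\<^esub> = x"
  proof
    fix n
    have "(x \<otimes>\<^bsub>HHR\<^esub> \<one>\<^bsub>HHR\<^esub>) n = (\<Oplus>\<^bsub>H n\<^esub>p\<in>{..n}. if n = p then x n else \<zero>\<^bsub>H n\<^esub>)"
      unfolding HH_simps
    proof (rule H.finsum_cong')
      fix p assume "p \<in> {..n}"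
      then show "yoneda A R p (n - p) (x p) (if n - p = 0 then cls 0 (cx_aug R) else \<zero>\<^bsub>H (n - p)\<^esub>) =
          (if n = p then x n else \<zero>\<^bsub>H n\<^esub>)"
        using yoneda_zero(2)[OF x' H.zero_closed, of p "n - p"] by (auto simp: yoneda_one_right x')
    qed (auto simp: x')
    also have "\<dots> = x n" by (rule H.finsum_singleton) (auto simp: x')
    finally show "(x \<otimes>\<^bsub>HHR\<^esub> \<one>\<^bsub>HHR\<^esub>) n = x n" .
  qed
qed

lemma HH_distrib:
  assumes x: "x \<in> carrier HHR" and y: "y \<in> carrier HHR" and z: "z \<in> carrier HHR"
  shows "(x \<oplus>\<^bsub>HHR\<^esub> y) \<otimes>\<^bsub>HHR\<^esub> z = x \<otimes>\<^bsub>HHR\<^esub> z \<oplus>\<^bsub>HHR\<^esub> y \<otimes>\<^bsub>HHR\<^esub> z"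
    and "z \<otimes>\<^bsub>HHR\<^esub> (x \<oplus>\<^bsub>HHR\<^esub> y) = z \<otimes>\<^bsub>HHR\<^esub> x \<oplus>\<^bsub>HHR\<^esub> z \<otimes>\<^bsub>HHR\<^esub> y"
proof -
  note xyz = HH_in[OF x] HH_in[OF y] HH_in[OF z]
  have *: "yoneda A R p (n - p) (x p \<oplus>\<^bsub>H p\<^esub> y p) (z (n - p)) =
      yoneda A R p (n - p) (x p) (z (n - p)) \<oplus>\<^bsub>H n\<^esub> yoneda A R p (n - p) (y p) (z (n - p))"
    "yoneda A R p (n - p) (z p) (x (n - p) \<oplus>\<^bsub>H (n - p)\<^esub> y (n - p)) =
      yoneda A R p (n - p) (z p) (x (n - p)) \<oplus>\<^bsub>H n\<^esub> yoneda A R p (n - p) (z p) (y (n - p))"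
    if "p \<le> n" for p n
    using that yoneda_add_left[of "x p" p "y p" "z (n - p)" "n - p"]
      yoneda_add_right[of "z p" p "x (n - p)" "n - p" "y (n - p)"] xyz by simp_all
  show "(x \<oplus>\<^bsub>HHR\<^esub> y) \<otimes>\<^bsub>HHR\<^esub> z = x \<otimes>\<^bsub>HHR\<^esub> z \<oplus>\<^bsub>HHR\<^esub> y \<otimes>\<^bsub>HHR\<^esub> z"
    unfolding HH_simps by (intro ext H.finsum_eq_add) (auto simp: * yoneda_in xyz)
  show "z \<otimes>\<^bsub>HHR\<^esub> (x \<oplus>\<^bsub>HHR\<^esub> y) = z \<otimes>\<^bsub>HHR\<^esub> x \<oplus>\<^bsub>HHR\<^esub> z \<otimes>\<^bsub>HHR\<^esub> y"
    unfolding HH_simps by (intro ext H.finsum_eq_add) (auto simp: * yoneda_in xyz)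
qed

lemma H_smult_finsum:
  assumes "\<And>i. i \<in> I \<Longrightarrow> f i \<in> carrier (H n)"
  shows "c \<odot>\<^bsub>H n\<^esub> finsum (H n) f I = (\<Oplus>\<^bsub>H n\<^esub>i\<in>I. c \<odot>\<^bsub>H n\<^esub> f i)"
  using assms
proof (induction I rule: infinite_finite_induct)
  case (insert i I)
  then have "f i \<in> carrier (H n)" "f \<in> I \<rightarrow> carrier (H n)" "(\<lambda>i. c \<odot>\<^bsub>H n\<^esub> f i) \<in> I \<rightarrow> carrier (H n)"
    by (auto intro: H_smult_in)
  then show ?case using insert by (simp add: H_smult_in H_smult_add)
qed (simp_all add: H_smult_zero)

lemma HH_smult_mult:
  assumes x: "x \<in> carrier HHR" and y: "y \<in> carrier HHR"
  shows "(c \<odot>\<^bsub>HHR\<^esub> x) \<otimes>\<^bsub>HHR\<^esub> y = c \<odot>\<^bsub>HHR\<^esub> (x \<otimes>\<^bsub>HHR\<^esub> y)"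
    and "x \<otimes>\<^bsub>HHR\<^esub> (c \<odot>\<^bsub>HHR\<^esub> y) = c \<odot>\<^bsub>HHR\<^esub> (x \<otimes>\<^bsub>HHR\<^esub> y)"
proof -
  note xy = HH_in[OF x] HH_in[OF y]
  have *: "yoneda A R p (n - p) (c \<odot>\<^bsub>H p\<^esub> x p) (y (n - p)) = c \<odot>\<^bsub>H n\<^esub> yoneda A R p (n - p) (x p) (y (n - p))"
    "yoneda A R p (n - p) (x p) (c \<odot>\<^bsub>H (n - p)\<^esub> y (n - p)) = c \<odot>\<^bsub>H n\<^esub> yoneda A R p (n - p) (x p) (y (n - p))"
    if "p \<le> n" for p n
    using that yoneda_smult[of "x p" p "y (n - p)" "n - p" c] xy by simp_all
  have **: "c \<odot>\<^bsub>H n\<^esub> (\<Oplus>\<^bsub>H n\<^esub>p\<in>{..n}. yoneda A R p (n - p) (x p) (y (n - p))) =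
      (\<Oplus>\<^bsub>H n\<^esub>p\<in>{..n}. c \<odot>\<^bsub>H n\<^esub> yoneda A R p (n - p) (x p) (y (n - p)))" for n
    by (rule H_smult_finsum) (simp add: yoneda_in xy)
  show "(c \<odot>\<^bsub>HHR\<^esub> x) \<otimes>\<^bsub>HHR\<^esub> y = c \<odot>\<^bsub>HHR\<^esub> (x \<otimes>\<^bsub>HHR\<^esub> y)"
    unfolding HH_simps **
    by (intro ext H.finsum_cong') (auto simp: * yoneda_in xy H_smult_in)
  show "x \<otimes>\<^bsub>HHR\<^esub> (c \<odot>\<^bsub>HHR\<^esub> y) = c \<odot>\<^bsub>HHR\<^esub> (x \<otimes>\<^bsub>HHR\<^esub> y)"
    unfolding HH_simps **
    by (intro ext H.finsum_cong') (auto simp: * yoneda_in xy H_smult_in)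
qed

theorem HH_k_algebra: "k_algebra HHR"
proof (intro k_algebra.intro k_algebra_axioms.intro ringI monoidI HH_abelian_group)
  show "c \<odot>\<^bsub>HHR\<^esub> x \<in> carrier HHR" if "x \<in> carrier HHR" for c x
    using that by (auto simp: HH_carrier HH_simps H_smult_in) (metis H_smult_zero)
qed (simp_all add: HH_mult_in HH_one_in HH_assoc HH_one HH_distrib HH_smult_mult,
    simp_all add: HH_simps HH_in H_add_smult H_smult_add H_smult_smult H_smult_1)

end

section \<open>Quotient algebras and path algebras\<close>

lemma quotient_algebra_simps:
  "carrier (quotient_algebra A I) = A_RCOSETS A I"
  "U \<otimes>\<^bsub>quotient_algebra A I\<^esub> W = rcoset_mult A I U W"
  "\<one>\<^bsub>quotient_algebra A I\<^esub> = I +>\<^bsub>A\<^esub> \<one>\<^bsub>A\<^esub>"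
  "\<zero>\<^bsub>quotient_algebra A I\<^esub> = I"
  "U \<oplus>\<^bsub>quotient_algebra A I\<^esub> W = set_add A U W"
  "c \<odot>\<^bsub>quotient_algebra A I\<^esub> U = (\<Union>x\<in>U. I +>\<^bsub>A\<^esub> (c \<odot>\<^bsub>A\<^esub> x))"
  by (simp_all add: quotient_algebra_def ring.defs FactRing_def)

locale algebra_ideal = k_algebra A + ideal I A for A :: "('k::field, 'a) module" (structure) and I
begin

abbreviation Q :: "('k, 'a set) module" where "Q \<equiv> quotient_algebra A I"
abbreviation cl :: "'a \<Rightarrow> 'a set" where "cl x \<equiv> a_r_coset A I x"

lemma cl_in: "x \<in> carrier A \<Longrightarrow> cl x \<in> carrier Q"
  by (auto simp: quotient_algebra_simps A_RCOSETS_def')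

lemma Q_cases: assumes "U \<in> carrier Q" obtains x where "x \<in> carrier A" "U = cl x"
  using assms by (auto simp: quotient_algebra_simps A_RCOSETS_def')

lemma cl_mult: "x \<in> carrier A \<Longrightarrow> y \<in> carrier A \<Longrightarrow> cl x \<otimes>\<^bsub>Q\<^esub> cl y = cl (x \<otimes> y)"
  by (simp add: quotient_algebra_simps rcoset_mult_add)

lemma cl_add: "x \<in> carrier A \<Longrightarrow> y \<in> carrier A \<Longrightarrow> cl x \<oplus>\<^bsub>Q\<^esub> cl y = cl (x \<oplus> y)"
  by (simp add: quotient_algebra_simps a_rcos_sum)

lemma cl_zero: "\<zero>\<^bsub>Q\<^esub> = cl \<zero>"
  using a_rcos_const[of \<zero>] by (simp add: quotient_algebra_simps)

lemma cl_eq_iff: "x \<in> carrier A \<Longrightarrow> y \<in> carrier A \<Longrightarrow> cl x = cl y \<longleftrightarrow> x \<ominus> y \<in> I"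
  by (simp add: quotient_eq_iff_same_a_r_cos ideal_axioms)

text \<open>A ring ideal is stable under scalars because \<open>c \<odot> h\<close> is the product
  of \<open>c \<odot> \<one>\<close> with \<open>h\<close>; scaling therefore passes to
  cosets.\<close>

lemma cl_smult: assumes x: "x \<in> carrier A" shows "c \<odot>\<^bsub>Q\<^esub> cl x = cl (c \<odot> x)"
proof -
  have I_smult: "c \<odot> h \<in> I" if "h \<in> I" for h
    using I_l_closed[OF that, of "c \<odot> \<one>"] Icarr[OF that] by (simp add: smult_in smult_one_mult)
  have "cl (c \<odot> y) = cl (c \<odot> x)" if y: "y \<in> cl x" for y
  proof -
    obtain h where h: "h \<in> I" "y = h \<oplus> x" using y by (auto simp: a_r_coset_def')
    then have "c \<odot> y = c \<odot> h \<oplus> c \<odot> x" using x by (simp add: smult_add_right)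
    then have "c \<odot> y \<in> cl (c \<odot> x)" using I_smult[OF h(1)] by (auto simp: a_r_coset_def')
    then show ?thesis using a_repr_independence' smult_in[OF x] by metis
  qed
  then show ?thesis
    unfolding quotient_algebra_simps by (intro UN_constant_eq[OF a_rcos_self[OF x]]) blast
qed

lemmas cl_simps = cl_mult cl_add cl_smult cl_in smult_in

theorem quotient_k_algebra: "k_algebra Q"
proof (intro k_algebra.intro k_algebra_axioms.intro ringI abelian_groupI monoidI)
  fix U assume "U \<in> carrier Q"
  then obtain x where x: "x \<in> carrier A" "U = cl x" by (rule Q_cases)
  then have "cl (\<ominus> x) \<oplus>\<^bsub>Q\<^esub> U = \<zero>\<^bsub>Q\<^esub>" by (simp add: cl_add cl_zero l_neg)
  then show "\<exists>W\<in>carrier Q. W \<oplus>\<^bsub>Q\<^esub> U = \<zero>\<^bsub>Q\<^esub>" using x cl_in[of "\<ominus> x"] by blast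
qed (auto elim!: Q_cases simp: cl_simps cl_zero quotient_algebra_simps(3) a_ac m_assoc l_distr r_distr
    smult_add_left smult_add_right smult_smult smult_1 smult_mult_left smult_mult_right)

end

section \<open>Path algebras\<close>

primrec endv :: "('v, 'e) pre_digraph \<Rightarrow> 'v \<Rightarrow> 'e list \<Rightarrow> 'v" where
  "endv Q u [] = u"
| "endv Q u (x # p) = endv Q (head Q x) p"

lemma endv_append: "endv Q u (p @ q) = endv Q (endv Q u p) q"
  by (induction p arbitrary: u) auto

lemma paths_iff: "(u, p, v) \<in> paths Q \<longleftrightarrow> u \<in> verts Q \<and> set p \<subseteq> arcs Q \<and> pre_digraph.cas Q u p v"
  by (auto simp: paths_def pre_digraph.awalk_def)

lemma cas_endv: "pre_digraph.cas Q u p v \<Longrightarrow> endv Q u p = v"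
  by (induction p arbitrary: u) (auto simp: pre_digraph.cas.simps)

lemma cas_append: "pre_digraph.cas Q u (p @ q) w \<longleftrightarrow>
    pre_digraph.cas Q u p (endv Q u p) \<and> pre_digraph.cas Q (endv Q u p) q w"
  by (induction p arbitrary: u) (auto simp: pre_digraph.cas.simps)

lemma cas_verts: "wf_digraph Q \<Longrightarrow> u \<in> verts Q \<Longrightarrow> set p \<subseteq> arcs Q \<Longrightarrow> pre_digraph.cas Q u p v \<Longrightarrow> v \<in> verts Q"
  by (induction p arbitrary: u) (auto simp: pre_digraph.cas.simps wf_digraph_def)

lemma path_algebra_simps:
  "carrier (path_algebra Q) = {f. finite {\<pi>. f \<pi> \<noteq> 0} \<and> {\<pi>. f \<pi> \<noteq> 0} \<subseteq> paths Q}"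
  "\<one>\<^bsub>path_algebra Q\<^esub> = (\<lambda>(u, p, v). if u \<in> verts Q \<and> p = [] \<and> u = v then 1 else 0)"
  "\<zero>\<^bsub>path_algebra Q\<^esub> = (\<lambda>\<pi>. 0)"
  "f \<oplus>\<^bsub>path_algebra Q\<^esub> g = (\<lambda>\<pi>. f \<pi> + g \<pi>)"
  "c \<odot>\<^bsub>path_algebra Q\<^esub> f = (\<lambda>\<pi>. c * f \<pi>)"
  by (simp_all add: path_algebra_def)

lemma path_algebra_support: "f \<in> carrier (path_algebra Q) \<Longrightarrow> f \<pi> \<noteq> 0 \<Longrightarrow> \<pi> \<in> paths Q"
  by (auto simp: path_algebra_simps)

text \<open>A factorisation of a path is determined by the position of the cut: the left factor is a
  genuine path, so the middle vertex is the one its arrows lead to. The sum over pairs of paths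
  becomes a sum over cuts.\<close>

lemma path_algebra_mult:
  assumes f: "f \<in> carrier (path_algebra Q)" and g: "g \<in> carrier (path_algebra Q)"
  shows "(f \<otimes>\<^bsub>path_algebra Q\<^esub> g) (u, p, w) =
    (\<Sum>k\<le>length p. f (u, take k p, endv Q u (take k p)) * g (endv Q u (take k p), drop k p, w))"
proof -
  let ?\<phi> = "\<lambda>k. ((u, take k p, endv Q u (take k p)), (endv Q u (take k p), drop k p, w))"
  let ?S = "{(\<sigma>, \<tau>). f \<sigma> \<noteq> 0 \<and> g \<tau> \<noteq> 0 \<and> fst \<sigma> = u \<and> snd (snd \<sigma>) = fst \<tau> \<and> snd (snd \<tau>) = w \<and>
        fst (snd \<sigma>) @ fst (snd \<tau>) = p}"
  let ?h = "\<lambda>(\<sigma>, \<tau>). f \<sigma> * g \<tau>"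
  let ?K = "{k. k \<le> length p \<and> f (u, take k p, endv Q u (take k p)) \<noteq> 0 \<and>
      g (endv Q u (take k p), drop k p, w) \<noteq> 0}"
  have S: "?S = ?\<phi> ` ?K"
  proof (intro equalityI subsetI)
    fix x assume x: "x \<in> ?S"
    obtain u1 p1 v1 u2 p2 v2 where x_eq: "x = ((u1, p1, v1), (u2, p2, v2))"
      by (cases x rule: prod.exhaust) (auto elim: prod.exhaust)
    have "(u1, p1, v1) \<in> paths Q" using x x_eq path_algebra_support[OF f] by auto
    then have "endv Q u1 p1 = v1" by (auto simp: paths_iff cas_endv)
    then have "x = ?\<phi> (length p1)" using x x_eq by auto
    moreover have "length p1 \<le> length p" using x x_eq by auto
    ultimately show "x \<in> ?\<phi> ` ?K" using x by (intro image_eqI[of _ _ "length p1"]) auto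
  qed auto
  have "inj_on ?\<phi> ?K"
    by (rule inj_on_inverseI[where g = "\<lambda>(\<sigma>, \<tau>). length (fst (snd \<sigma>))"]) simp
  then have "sum ?h ?S = (\<Sum>k\<in>?K. ?h (?\<phi> k))"
    unfolding S by (subst sum.reindex) (auto simp: o_def)
  also have "\<dots> = (\<Sum>k\<le>length p. ?h (?\<phi> k))"
    by (rule sum.mono_neutral_left) auto
  finally show ?thesis by (simp add: path_algebra_def case_prod_unfold)
qed

locale quiver = wf_digraph Q for Q :: "('v, 'e) pre_digraph" +
  assumes finite_verts: "finite (verts Q)"
begin

abbreviation KQ :: "('k::field, ('v, 'e) path \<Rightarrow> 'k) module" where "KQ \<equiv> path_algebra Q"

lemma paths_append:
  "(u, p, v) \<in> paths Q \<Longrightarrow> (v, q, w) \<in> paths Q \<Longrightarrow> (u, p @ q, w) \<in> paths Q"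
  by (auto simp: paths_iff cas_append cas_endv)

lemma KQ_mult_in:
  assumes f: "f \<in> carrier (KQ :: ('k::field, _) module)" and g: "g \<in> carrier KQ"
  shows "f \<otimes>\<^bsub>KQ\<^esub> g \<in> carrier KQ"
proof -
  let ?c = "\<lambda>(\<sigma>, \<tau>). (fst \<sigma>, fst (snd \<sigma>) @ fst (snd \<tau>), snd (snd \<tau>))"
  have *: "\<pi> \<in> ?c ` ({\<sigma>. f \<sigma> \<noteq> 0} \<times> {\<tau>. g \<tau> \<noteq> 0}) \<and> \<pi> \<in> paths Q" if nz: "(f \<otimes>\<^bsub>KQ\<^esub> g) \<pi> \<noteq> 0" for \<pi>
  proof -
    obtain u p w where \<pi>: "\<pi> = (u, p, w)" by (cases \<pi>)
    then obtain k where k: "k \<le> length p" "f (u, take k p, endv Q u (take k p)) \<noteq> 0"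
      "g (endv Q u (take k p), drop k p, w) \<noteq> 0"
      using nz by (auto simp: path_algebra_mult[OF f g] elim!: sum.not_neutral_contains_not_neutral)
    have "(u, take k p @ drop k p, w) \<in> paths Q"
      by (rule paths_append) (use k path_algebra_support[OF f] path_algebra_support[OF g] in blast)+
    then show ?thesis
      using k \<pi> by (auto intro!: image_eqI[of _ _ "((u, take k p, endv Q u (take k p)), (endv Q u (take k p), drop k p, w))"])
  qed
  have "finite {\<pi>. (f \<otimes>\<^bsub>KQ\<^esub> g) \<pi> \<noteq> 0}"
    by (rule finite_subset[of _ "?c ` ({\<sigma>. f \<sigma> \<noteq> 0} \<times> {\<tau>. g \<tau> \<noteq> 0})"])
      (use * f g in \<open>auto simp: path_algebra_simps\<close>)
  then show ?thesis using * by (auto simp: path_algebra_simps)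
qed

text \<open>Both bracketings sum over two cuts of the same list of arrows; \<open>F l k\<close> is
  the term whose first factor has \<open>l\<close> arrows and whose second has
  \<open>k\<close>.\<close>

lemma KQ_assoc:
  assumes f: "f \<in> carrier (KQ :: ('k::field, _) module)" and g: "g \<in> carrier KQ" and h: "h \<in> carrier KQ"
  shows "f \<otimes>\<^bsub>KQ\<^esub> g \<otimes>\<^bsub>KQ\<^esub> h = f \<otimes>\<^bsub>KQ\<^esub> (g \<otimes>\<^bsub>KQ\<^esub> h)"
proof
  fix \<pi> :: "('v, 'e) path"
  obtain u p w where \<pi>: "\<pi> = (u, p, w)" by (cases \<pi>)
  let ?v = "\<lambda>k. endv Q u (take k p)"
  define F where "F l k = f (u, take l p, ?v l) * g (?v l, take k (drop l p), ?v (l + k)) * h (?v (l + k), drop (l + k) p, w)"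
    for l k
  have v: "endv Q (?v l) (take k (drop l p)) = ?v (l + k)" for l k
    by (simp add: take_add endv_append)
  have "(f \<otimes>\<^bsub>KQ\<^esub> g \<otimes>\<^bsub>KQ\<^esub> h) (u, p, w) = (\<Sum>k\<le>length p. \<Sum>l\<le>k. F l (k - l))"
    unfolding path_algebra_mult[OF KQ_mult_in[OF f g] h]
  proof (rule sum.cong[OF refl])
    fix k assume k: "k \<in> {..length p}"
    then show "(f \<otimes>\<^bsub>KQ\<^esub> g) (u, take k p, ?v k) * h (?v k, drop k p, w) = (\<Sum>l\<le>k. F l (k - l))"
      by (auto simp: path_algebra_mult[OF f g] sum_distrib_right F_def min_absorb2 min_absorb1 drop_take intro!: sum.cong)
  qed
  also have "\<dots> = (\<Sum>(l, k)\<in>{(l, k). l + k \<le> length p}. F l k)"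
    by (rule sum.triangle_reindex_eq[symmetric])
  also have "{(l, k). l + k \<le> length p} = Sigma {..length p} (\<lambda>l. {..length p - l})"
    by auto
  also have "(\<Sum>(l, k)\<in>\<dots>. F l k) = (\<Sum>l\<le>length p. \<Sum>k\<le>length p - l. F l k)"
    by (rule sum.Sigma[symmetric]) auto
  also have "\<dots> = (f \<otimes>\<^bsub>KQ\<^esub> (g \<otimes>\<^bsub>KQ\<^esub> h)) (u, p, w)"
    unfolding path_algebra_mult[OF f KQ_mult_in[OF g h]]
    by (intro sum.cong refl)
      (auto simp: path_algebra_mult[OF g h] sum_distrib_left F_def v add.commute mult.assoc intro!: sum.cong)
  finally show "(f \<otimes>\<^bsub>KQ\<^esub> g \<otimes>\<^bsub>KQ\<^esub> h) \<pi> = (f \<otimes>\<^bsub>KQ\<^esub> (g \<otimes>\<^bsub>KQ\<^esub> h)) \<pi>" by (simp add: \<pi>)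
qed

text \<open>The unit is supported on trivial paths, so only the first or the last cut
  contributes.\<close>

lemma KQ_one:
  assumes f: "f \<in> carrier (KQ :: ('k::field, _) module)"
  shows "\<one>\<^bsub>KQ\<^esub> \<in> carrier (KQ :: ('k::field, _) module)" "\<one>\<^bsub>KQ\<^esub> \<otimes>\<^bsub>KQ\<^esub> f = f" "f \<otimes>\<^bsub>KQ\<^esub> \<one>\<^bsub>KQ\<^esub> = f"
proof -
  have "{\<pi>. (\<one>\<^bsub>KQ\<^esub> :: _ \<Rightarrow> 'k) \<pi> \<noteq> 0} = (\<lambda>u. (u, [], u)) ` verts Q"
    by (auto simp: path_algebra_simps split: if_splits)
  then show one: "\<one>\<^bsub>KQ\<^esub> \<in> carrier (KQ :: ('k::field, _) module)"
    using finite_verts by (auto simp: path_algebra_simps(1) paths_iff pre_digraph.cas.simps)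
  have "(\<one>\<^bsub>KQ\<^esub> \<otimes>\<^bsub>KQ\<^esub> f) (u, p, w) = f (u, p, w) \<and> (f \<otimes>\<^bsub>KQ\<^esub> \<one>\<^bsub>KQ\<^esub>) (u, p, w) = f (u, p, w)" for u p w
  proof
    have u: "u \<in> verts Q \<and> w \<in> verts Q \<and> endv Q u p = w" if "f (u, p, w) \<noteq> 0"
      using path_algebra_support[OF f that] cas_verts wf_digraph_axioms by (auto simp: paths_iff cas_endv)
    have "(\<one>\<^bsub>KQ\<^esub> \<otimes>\<^bsub>KQ\<^esub> f) (u, p, w) = (\<Sum>k\<le>length p. if k = 0 then f (u, p, w) else 0)"
      unfolding path_algebra_mult[OF one f] using u
      by (intro sum.cong refl) (auto simp: path_algebra_simps)
    then show "(\<one>\<^bsub>KQ\<^esub> \<otimes>\<^bsub>KQ\<^esub> f) (u, p, w) = f (u, p, w)" by simp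
    have "(f \<otimes>\<^bsub>KQ\<^esub> \<one>\<^bsub>KQ\<^esub>) (u, p, w) = (\<Sum>k\<le>length p. if k = length p then f (u, p, w) else 0)"
      unfolding path_algebra_mult[OF f one]
    proof (intro sum.cong refl)
      fix k assume "k \<in> {..length p}"
      show "f (u, take k p, endv Q u (take k p)) * \<one>\<^bsub>KQ\<^esub> (endv Q u (take k p), drop k p, w) =
        (if k = length p then f (u, p, w) else 0)"
      proof (cases "k = length p")
        case True
        show ?thesis
        proof (cases "endv Q u p = w")
          case False
          then have "f (u, p, w) = 0" using u by blast
          then show ?thesis using True False by (simp add: path_algebra_simps)
        next
          case w: True
          then show ?thesis using True u by (auto simp: path_algebra_simps)
        qed
      qed (use \<open>k \<in> {..length p}\<close> in \<open>auto simp: path_algebra_simps\<close>)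
    qed
    then show "(f \<otimes>\<^bsub>KQ\<^esub> \<one>\<^bsub>KQ\<^esub>) (u, p, w) = f (u, p, w)" by simp
  qed
  then show "\<one>\<^bsub>KQ\<^esub> \<otimes>\<^bsub>KQ\<^esub> f = f" "f \<otimes>\<^bsub>KQ\<^esub> \<one>\<^bsub>KQ\<^esub> = f" by auto
qed

lemma KQ_add_in: "f \<in> carrier (KQ :: ('k::field, _) module) \<Longrightarrow> g \<in> carrier KQ \<Longrightarrow> f \<oplus>\<^bsub>KQ\<^esub> g \<in> carrier KQ"
proof -
  assume f: "f \<in> carrier (KQ :: ('k::field, _) module)" and g: "g \<in> carrier KQ"
  have "{\<pi>. (f \<oplus>\<^bsub>KQ\<^esub> g) \<pi> \<noteq> 0} \<subseteq> {\<pi>. f \<pi> \<noteq> 0} \<union> {\<pi>. g \<pi> \<noteq> 0}" by (auto simp: path_algebra_simps)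
  moreover have "finite ({\<pi>. f \<pi> \<noteq> 0} \<union> {\<pi>. g \<pi> \<noteq> 0})" "{\<pi>. f \<pi> \<noteq> 0} \<union> {\<pi>. g \<pi> \<noteq> 0} \<subseteq> paths Q"
    using f g by (auto simp: path_algebra_simps)
  ultimately show ?thesis unfolding path_algebra_simps(1) using finite_subset by blast
qed

lemma KQ_smult_in: "f \<in> carrier (KQ :: ('k::field, _) module) \<Longrightarrow> c \<odot>\<^bsub>KQ\<^esub> f \<in> carrier KQ"
  by (cases "c = 0") (auto simp: path_algebra_simps)

lemma KQ_zero_in: "\<zero>\<^bsub>KQ\<^esub> \<in> carrier (KQ :: ('k::field, _) module)"
  by (simp add: path_algebra_simps)

theorem KQ_k_algebra: "k_algebra (KQ :: ('k::field, ('v, 'e) path \<Rightarrow> 'k) module)"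
proof (intro k_algebra.intro k_algebra_axioms.intro ringI abelian_groupI monoidI)
  fix f :: "('v, 'e) path \<Rightarrow> 'k" assume "f \<in> carrier KQ"
  then show "\<exists>g\<in>carrier KQ. g \<oplus>\<^bsub>KQ\<^esub> f = \<zero>\<^bsub>KQ\<^esub>"
    by (intro bexI[of _ "(-1) \<odot>\<^bsub>KQ\<^esub> f"]) (auto simp: KQ_smult_in, simp add: path_algebra_simps)
next
  show "\<one>\<^bsub>KQ\<^esub> \<in> carrier (KQ :: ('k::field, ('v, 'e) path \<Rightarrow> 'k) module)"
    by (rule KQ_one(1)[OF KQ_zero_in])
qed (auto simp: KQ_zero_in KQ_mult_in KQ_add_in KQ_smult_in KQ_assoc KQ_one
    path_algebra_mult intro!: ext,
  simp_all add: path_algebra_mult path_algebra_simps(2-) algebra_simps sum.distrib sum_distrib_left)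

lemma path_elem_in:
  assumes "\<pi> \<in> paths Q" shows "path_elem \<pi> \<in> carrier (KQ :: ('k::field, _) module)"
proof -
  have "{\<sigma>. (path_elem \<pi> :: _ \<Rightarrow> 'k) \<sigma> \<noteq> 0} = {\<pi>}" by (auto simp: path_elem_def)
  then show ?thesis using assms by (simp add: path_algebra_simps)
qed

text \<open>Only the cut after \<open>length p\<close> can make both indicator functions
  non-zero.\<close>

lemma path_elem_mult:
  assumes "(u, p, v) \<in> paths Q" "(v, q, w) \<in> paths Q"
  shows "path_elem (u, p, v) \<otimes>\<^bsub>KQ\<^esub> path_elem (v, q, w) = (path_elem (u, p @ q, w) :: _ \<Rightarrow> 'k::field)"
proof (rule ext, clarify)
  fix u' r w'
  note in' = path_elem_in[OF assms(1), where ?'k = 'k] path_elem_in[OF assms(2), where ?'k = 'k]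
  have v: "endv Q u p = v" using assms(1) by (auto simp: paths_iff cas_endv)
  have "(path_elem (u, p, v) \<otimes>\<^bsub>KQ\<^esub> path_elem (v, q, w)) (u', r, w') =
      (\<Sum>k\<le>length r. if k = length p then (path_elem (u, p @ q, w) (u', r, w') :: 'k) else 0)"
    unfolding path_algebra_mult[OF in']
  proof (intro sum.cong refl)
    fix k assume "k \<in> {..length r}"
    then have *: "take k r = p \<and> drop k r = q \<longleftrightarrow> k = length p \<and> r = p @ q" by auto
    show "path_elem (u, p, v) (u', take k r, endv Q u' (take k r)) *
        path_elem (v, q, w) (endv Q u' (take k r), drop k r, w') =
        (if k = length p then (path_elem (u, p @ q, w) (u', r, w') :: 'k) else 0)"
    proof (cases "take k r = p \<and> drop k r = q")
      case True
      then show ?thesis using * v by (simp add: path_elem_def)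
    next
      case False
      then have "path_elem (u, p, v) (u', take k r, endv Q u' (take k r)) *
          path_elem (v, q, w) (endv Q u' (take k r), drop k r, w') = (0 :: 'k)"
        by (simp add: path_elem_def)
      moreover have "k \<noteq> length p \<or> path_elem (u, p @ q, w) (u', r, w') = (0 :: 'k)"
        using False * by (simp add: path_elem_def)
      ultimately show ?thesis by auto
    qed
  qed
  also have "\<dots> = (if length p \<le> length r then path_elem (u, p @ q, w) (u', r, w') else 0)"
    by simp
  also have "\<dots> = path_elem (u, p @ q, w) (u', r, w')"
    by (simp add: path_elem_def)
  finally show "(path_elem (u, p, v) \<otimes>\<^bsub>KQ\<^esub> path_elem (v, q, w)) (u', r, w') =
      (path_elem (u, p @ q, w) (u', r, w') :: 'k)" .
qed

lemma KQ_induct [consumes 1, case_names zero add]: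
  assumes f: "f \<in> carrier (KQ :: ('k::field, _) module)"
    and zero: "\<Phi> \<zero>\<^bsub>KQ\<^esub>"
    and add: "\<And>f \<pi> c. f \<in> carrier KQ \<Longrightarrow> \<pi> \<in> paths Q \<Longrightarrow> \<Phi> f \<Longrightarrow> \<Phi> (f \<oplus>\<^bsub>KQ\<^esub> c \<odot>\<^bsub>KQ\<^esub> path_elem \<pi>)"
  shows "\<Phi> f"
proof -
  have "finite S \<Longrightarrow> f \<in> carrier KQ \<Longrightarrow> {\<pi>. f \<pi> \<noteq> 0} = S \<Longrightarrow> \<Phi> f" for S f
  proof (induction S arbitrary: f rule: finite_induct)
    case empty
    then have "f = \<zero>\<^bsub>KQ\<^esub>" by (auto simp: path_algebra_simps)
    then show ?case using zero by simp
  next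
    case (insert \<pi> S)
    let ?g = "f(\<pi> := 0)"
    have g: "{\<sigma>. ?g \<sigma> \<noteq> 0} = S" using insert by auto
    then have g_in: "?g \<in> carrier KQ" using insert by (auto simp: path_algebra_simps)
    have \<pi>: "\<pi> \<in> paths Q" using insert path_algebra_support by blast
    have f_eq: "f = ?g \<oplus>\<^bsub>KQ\<^esub> f \<pi> \<odot>\<^bsub>KQ\<^esub> path_elem \<pi>"
      by (auto simp: path_algebra_simps path_elem_def fun_eq_iff)
    show ?case by (subst f_eq) (rule add[OF g_in \<pi> insert.IH[OF g_in g]])
  qed
  then show ?thesis using f by (auto simp: path_algebra_simps(1))
qed

end

section \<open>The algebra \<open>\<Lambda>\<^sub>1\<close>\<close>

text \<open>The kinds of basis elements with a given source i: the vertex, the arrow to i + 1, the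
  arrow to i - 1, and the socle element, which is a closed path of length 2.\<close>

datatype basis_kind = BE | BA | BB | BS

locale lambda1 =
  fixes m :: nat and K :: "'k::field itself"
  assumes m3: "m \<ge> 3"
begin

abbreviation M :: int where "M \<equiv> int m"
abbreviation KQ :: "('k, (int, arrow) path \<Rightarrow> 'k) module" where "KQ \<equiv> path_algebra (quiverQ m)"
abbreviation I1 :: "((int, arrow) path \<Rightarrow> 'k) set" where "I1 \<equiv> ideal_I1 m"
abbreviation L :: "('k, 'k lam) module" where "L \<equiv> Lambda1 m"
abbreviation clL :: "((int, arrow) path \<Rightarrow> 'k) \<Rightarrow> 'k lam" where "clL x \<equiv> a_r_coset KQ I1 x"

lemma quiver: "quiver (quiverQ m)"
  by unfold_locales (use m3 in \<open>auto simp: quiverQ_def\<close>)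

sublocale Q: quiver "quiverQ m" by (rule quiver)

sublocale KQ: k_algebra KQ by (rule Q.KQ_k_algebra)

definition path_s :: "int \<Rightarrow> (int, arrow) path" where
  "path_s i = (i mod M, [Fwd (i mod M), Bwd (i mod M)], i mod M)"

definition path_s' :: "int \<Rightarrow> (int, arrow) path" where
  "path_s' i = (i mod M, [Bwd ((i - 1) mod M), Fwd ((i - 1) mod M)], i mod M)"

text \<open>Coefficients are indexed by the source, hence the shift for \<open>BB\<close>. In the
  quotient the two closed paths of length 2 at a vertex become equal, so their coefficients are
  added; the remaining paths will vanish there and are ignored.\<close>

fun cf :: "((int, arrow) path \<Rightarrow> 'k) \<Rightarrow> int \<Rightarrow> basis_kind \<Rightarrow> 'k" where
  "cf f i BE = f (path_e m i)"
| "cf f i BA = f (path_a m i)"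
| "cf f i BB = f (path_abar m (i - 1))"
| "cf f i BS = f (path_s i) + f (path_s' i)"

lemma vertex_mod [simp]: "(i mod M + 1) mod M = (i + 1) mod M" "(i mod M - 1) mod M = (i - 1) mod M"
  "((i - 1) mod M + 1) mod M = i mod M" "((i + 1) mod M - 1) mod M = i mod M"
  using mod_add_left_eq[of i M 1] mod_diff_left_eq[of i M 1] mod_add_left_eq[of "i - 1" M 1]
    mod_diff_left_eq[of "i + 1" M 1] by simp_all

lemma path_mod [simp]: "path_e m (i mod M) = path_e m i" "path_a m (i mod M) = path_a m i"
  "path_abar m (i mod M) = path_abar m i" "path_abar m (i mod M - 1) = path_abar m (i - 1)"
  "path_s (i mod M) = path_s i" "path_s' (i mod M) = path_s' i"
  by (simp_all add: path_e_def path_a_def path_abar_def path_s_def path_s'_def)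

lemma paths_in [simp]:
  "path_e m i \<in> paths (quiverQ m)" "path_a m i \<in> paths (quiverQ m)" "path_abar m i \<in> paths (quiverQ m)"
  "path_s i \<in> paths (quiverQ m)" "path_s' i \<in> paths (quiverQ m)"
  using m3 by (auto simp: path_e_def path_a_def path_abar_def path_s_def path_s'_def paths_iff
      pre_digraph.cas.simps quiverQ_def)

declare cf.simps [simp del]

lemma cf_linear: "cf (f \<oplus>\<^bsub>KQ\<^esub> g) i t = cf f i t + cf g i t" "cf (c \<odot>\<^bsub>KQ\<^esub> f) i t = c * cf f i t"
  "cf \<zero>\<^bsub>KQ\<^esub> i t = 0"
  by (cases t; simp add: cf.simps path_algebra_simps algebra_simps)+

lemma cf_periodic: "cf f (i mod M) t = cf f i t"
  by (cases t) (simp_all add: cf.simps)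

text \<open>The multiplication of Lambda1 in these coordinates. The index of \<open>y\<close> is the
  target of the left factor.\<close>

fun cmul :: "(int \<Rightarrow> basis_kind \<Rightarrow> 'k) \<Rightarrow> (int \<Rightarrow> basis_kind \<Rightarrow> 'k) \<Rightarrow> int \<Rightarrow> basis_kind \<Rightarrow> 'k" where
  "cmul x y i BE = x i BE * y i BE"
| "cmul x y i BA = x i BE * y i BA + x i BA * y (i + 1) BE"
| "cmul x y i BB = x i BE * y i BB + x i BB * y (i - 1) BE"
| "cmul x y i BS = x i BE * y i BS + x i BA * y (i + 1) BB + x i BB * y (i - 1) BA + x i BS * y i BE"

text \<open>Cutting a path of length at most 2 yields only paths of length at most 2, so the longer
  paths in \<open>f\<close> and \<open>g\<close> do not disturb the formula.\<close>

lemma cf_mult: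
  assumes "f \<in> carrier KQ" "g \<in> carrier KQ"
  shows "cf (f \<otimes>\<^bsub>KQ\<^esub> g) i t = cmul (cf f) (cf g) i t"
proof -
  have h: "head (quiverQ m) (Fwd j) = (j + 1) mod M" "head (quiverQ m) (Bwd j) = j" for j
    by (simp_all add: quiverQ_def)
  show ?thesis
    by (cases t) (simp_all add: cf.simps path_e_def path_a_def path_abar_def path_s_def path_s'_def
      path_algebra_mult[OF assms] h, simp add: algebra_simps)
qed

lemma mod_eq_shift: "(i + 1) mod M = (j + 1) mod M \<longleftrightarrow> i mod M = j mod M"
  "(i - 1) mod M = (j - 1) mod M \<longleftrightarrow> i mod M = j mod M"
  by (simp_all add: mod_eq_dvd_iff)

lemma mod_minus_shift: "(i - 1) mod M = j mod M \<longleftrightarrow> i mod M = (j + 1) mod M"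
  by (simp add: mod_eq_dvd_iff algebra_simps)

lemma path_eq_iff:
  "path_e m i = path_e m j \<longleftrightarrow> i mod M = j mod M" "path_a m i = path_a m j \<longleftrightarrow> i mod M = j mod M"
  "path_abar m i = path_abar m j \<longleftrightarrow> i mod M = j mod M" "path_s i = path_s j \<longleftrightarrow> i mod M = j mod M"
  "path_s' i = path_s' j \<longleftrightarrow> i mod M = j mod M"
  by (simp_all only: path_e_def path_a_def path_abar_def path_s_def path_s'_def prod.inject list.inject
      arrow.inject mod_eq_shift simp_thms cong: conj_cong)

lemma path_neq:
  "path_e m i \<noteq> path_a m j" "path_e m i \<noteq> path_abar m j" "path_e m i \<noteq> path_s j" "path_e m i \<noteq> path_s' j"
  "path_a m i \<noteq> path_abar m j" "path_a m i \<noteq> path_s j" "path_a m i \<noteq> path_s' j"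
  "path_abar m i \<noteq> path_s j" "path_abar m i \<noteq> path_s' j" "path_s i \<noteq> path_s' j"
  by (simp_all add: path_e_def path_a_def path_abar_def path_s_def path_s'_def)

lemma cf_path_elem [simp]:
  "cf (path_elem (path_e m j)) i t = (if t = BE \<and> i mod M = j mod M then 1 else 0)"
  "cf (path_elem (path_a m j)) i t = (if t = BA \<and> i mod M = j mod M then 1 else 0)"
  "cf (path_elem (path_abar m j)) i t = (if t = BB \<and> (i - 1) mod M = j mod M then 1 else 0)"
  "cf (path_elem (path_s j)) i t = (if t = BS \<and> i mod M = j mod M then 1 else 0)"
  "cf (path_elem (path_s' j)) i t = (if t = BS \<and> i mod M = j mod M then 1 else 0)"
  by (cases t; simp add: cf.simps path_elem_def path_eq_iff path_neq path_neq[symmetric])+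

text \<open>An ideal given by explicit equations that contains the relations. From
  \<open>I1 \<subseteq> J\<close> it follows that coordinates descend to the quotient, which
  excludes an unexpected collapse of Lambda1.\<close>

definition J :: "((int, arrow) path \<Rightarrow> 'k) set" where
  "J = {f \<in> carrier KQ. \<forall>i t. cf f i t = 0}"

lemma cf_minus: "f \<in> carrier KQ \<Longrightarrow> cf (\<ominus>\<^bsub>KQ\<^esub> f) i t = - cf f i t"
  using cf_linear(2)[of "- 1" f i t] by (simp add: KQ.smult_minus)

lemma J_ideal: "ideal J KQ"
proof (rule idealI)
  show "subgroup J (add_monoid KQ)"
    by (rule group.subgroupI[OF KQ.a_group])
      (auto simp: J_def cf_linear cf_minus intro: exI[of _ "\<zero>\<^bsub>KQ\<^esub>"] simp flip: a_inv_def)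
next
  fix f g assume "f \<in> J" "g \<in> carrier KQ"
  moreover have f: "cf f = (\<lambda>i t. 0)"
    using \<open>f \<in> J\<close> by (simp add: J_def fun_eq_iff)
  have "cmul (cf g) (cf f) i t = 0" "cmul (cf f) (cf g) i t = 0" for i t
    unfolding f by (cases t; simp)+
  ultimately show "g \<otimes>\<^bsub>KQ\<^esub> f \<in> J" "f \<otimes>\<^bsub>KQ\<^esub> g \<in> J"
    by (auto simp: J_def cf_mult)
qed (rule KQ.ring_axioms)

abbreviation pa :: "int \<Rightarrow> (int, arrow) path \<Rightarrow> 'k" where "pa i \<equiv> path_elem (path_a m i)"
abbreviation pb :: "int \<Rightarrow> (int, arrow) path \<Rightarrow> 'k" where "pb i \<equiv> path_elem (path_abar m i)"

lemma pe_in [simp]: "path_elem (path_e m i) \<in> carrier KQ" "pa i \<in> carrier KQ" "pb i \<in> carrier KQ"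
  "path_elem (path_s i) \<in> carrier KQ" "path_elem (path_s' i) \<in> carrier KQ"
  by (simp_all add: Q.path_elem_in)

lemma relations_eq: "relations m = (\<Union>i. {pa i \<otimes>\<^bsub>KQ\<^esub> pa (i + 1), pb (i - 1) \<otimes>\<^bsub>KQ\<^esub> pb (i - 2),
    pa i \<otimes>\<^bsub>KQ\<^esub> pb i \<ominus>\<^bsub>KQ\<^esub> pb (i - 1) \<otimes>\<^bsub>KQ\<^esub> pa (i - 1)})"
  by (simp add: relations_def Let_def)

lemma relations_J: "relations m \<subseteq> J"
proof -
  have "cmul (cf (pa i)) (cf (pa (i + 1))) j t = 0" "cmul (cf (pb (i - 1))) (cf (pb (i - 2))) j t = 0"
    "cmul (cf (pa i)) (cf (pb i)) j t = cmul (cf (pb (i - 1))) (cf (pa (i - 1))) j t" for i j t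
    by (cases t; simp add: mod_eq_shift)+
  then show ?thesis
    by (auto simp: relations_eq J_def KQ.minus_eq cf_linear cf_minus cf_mult)
qed

section \<open>The quotient algebra and its distinguished elements\<close>

lemma I1_ideal: "ideal I1 KQ"
  unfolding ideal_I1_def using relations_J by (intro KQ.genideal_ideal) (auto simp: J_def)

sublocale QI: algebra_ideal KQ I1
  by (intro algebra_ideal.intro KQ.k_algebra_axioms I1_ideal)

lemma L_eq: "L = quotient_algebra KQ I1"
  by (simp add: Lambda1_def)

sublocale L: k_algebra L
  unfolding L_eq by (rule QI.quotient_k_algebra)

lemmas cl_simps = QI.cl_mult[folded L_eq] QI.cl_add[folded L_eq] QI.cl_smult[folded L_eq]
  QI.cl_in[folded L_eq]
lemmas cl_zero = QI.cl_zero[folded L_eq]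

lemma I1_J: "I1 \<subseteq> J"
  unfolding ideal_I1_def by (rule KQ.genideal_minimal[OF J_ideal relations_J])

abbreviation ee :: "int \<Rightarrow> 'k lam" where "ee \<equiv> e_elem m"
abbreviation aa :: "int \<Rightarrow> 'k lam" where "aa \<equiv> a_elem m"
abbreviation ab :: "int \<Rightarrow> 'k lam" where "ab \<equiv> abar_elem m"
definition ss :: "int \<Rightarrow> 'k lam" where "ss i = aa i \<otimes>\<^bsub>L\<^esub> ab i"

lemma elem_cl: "ee i = clL (path_elem (path_e m i))" "aa i = clL (pa i)" "ab i = clL (pb i)"
  by (simp_all add: e_elem_def a_elem_def abar_elem_def path_class_def)

lemma elem_in [simp]: "ee i \<in> carrier L" "aa i \<in> carrier L" "ab i \<in> carrier L" "ss i \<in> carrier L"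
  by (simp_all add: elem_cl cl_simps ss_def)

lemma elem_mod [simp]: "ee (i mod M) = ee i" "aa (i mod M) = aa i" "ab (i mod M) = ab i"
  "ab (i mod M - 1) = ab (i - 1)" "ss (i mod M) = ss i"
  by (simp_all add: elem_cl ss_def)

lemma cl_I1: "f \<in> I1 \<Longrightarrow> clL f = \<zero>\<^bsub>L\<^esub>"
  using QI.a_rcos_const by (simp add: L_eq quotient_algebra_simps)

lemma relations_I1: "relations m \<subseteq> I1"
  unfolding ideal_I1_def using relations_J by (intro KQ.genideal_self) (auto simp: J_def)

lemma aa_aa: "aa i \<otimes>\<^bsub>L\<^esub> aa (i + 1) = \<zero>\<^bsub>L\<^esub>"
proof -
  have "pa i \<otimes>\<^bsub>KQ\<^esub> pa (i + 1) \<in> I1" using relations_I1 unfolding relations_eq by blast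
  then show ?thesis using cl_I1 by (simp add: elem_cl cl_simps)
qed

lemma ab_ab: "ab i \<otimes>\<^bsub>L\<^esub> ab (i - 1) = \<zero>\<^bsub>L\<^esub>"
proof -
  have "pb (i + 1 - 1) \<otimes>\<^bsub>KQ\<^esub> pb (i + 1 - 2) \<in> I1" using relations_I1 unfolding relations_eq by blast
  then show ?thesis using cl_I1 by (simp add: elem_cl cl_simps)
qed

lemma ss_alt: "ab (i - 1) \<otimes>\<^bsub>L\<^esub> aa (i - 1) = ss i"
proof -
  have "pa i \<otimes>\<^bsub>KQ\<^esub> pb i \<ominus>\<^bsub>KQ\<^esub> pb (i - 1) \<otimes>\<^bsub>KQ\<^esub> pa (i - 1) \<in> I1"
    using relations_I1 unfolding relations_eq by blast
  then show ?thesis by (simp add: elem_cl cl_simps ss_def QI.cl_eq_iff[symmetric])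
qed

lemma ss_cl: "ss i = clL (path_elem (path_s i))" "ss i = clL (path_elem (path_s' i))"
proof -
  have "pa i \<otimes>\<^bsub>KQ\<^esub> pb i = path_elem (path_s i)"
    unfolding path_a_def path_abar_def path_s_def
    using Q.path_elem_mult[of "i mod M" "[Fwd (i mod M)]" "(i + 1) mod M" "[Bwd (i mod M)]" "i mod M"]
      paths_in(2,3)[of i] by (simp add: path_a_def path_abar_def)
  then show "ss i = clL (path_elem (path_s i))" by (simp add: ss_def elem_cl cl_simps)
  have "pb (i - 1) \<otimes>\<^bsub>KQ\<^esub> pa (i - 1) = path_elem (path_s' i)"
    unfolding path_a_def path_abar_def path_s'_def
    using Q.path_elem_mult[of "i mod M" "[Bwd ((i - 1) mod M)]" "(i - 1) mod M" "[Fwd ((i - 1) mod M)]" "i mod M"]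
      paths_in(2,3)[of "i - 1"] by (simp add: path_a_def path_abar_def)
  then show "ss i = clL (path_elem (path_s' i))" by (simp add: elem_cl cl_simps flip: ss_alt)
qed

section \<open>A spanning family of the quotient\<close>

definition Bs :: "(int \<times> basis_kind) set" where "Bs = {0..<M} \<times> {BE, BA, BB, BS}"

fun bs :: "int \<times> basis_kind \<Rightarrow> 'k lam" where
  "bs (i, BE) = ee i" | "bs (i, BA) = aa i" | "bs (i, BB) = ab (i - 1)" | "bs (i, BS) = ss i"

lemma bs_in [simp]: "bs p \<in> carrier L"
  by (cases p rule: bs.cases) simp_all

lemma finite_Bs: "finite Bs"
  by (simp add: Bs_def)

text \<open>The candidate for the class of \<open>f\<close>. That the two agree, shown path by path,
  is the spanning half of the basis property.\<close>

definition expansion :: "((int, arrow) path \<Rightarrow> 'k) \<Rightarrow> 'k lam" where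
  "expansion f = (\<Oplus>\<^bsub>L\<^esub>p\<in>Bs. cf f (fst p) (snd p) \<odot>\<^bsub>L\<^esub> bs p)"

lemma expansion_delta:
  assumes "q \<in> Bs" "\<And>p. p \<in> Bs \<Longrightarrow> cf f (fst p) (snd p) = (if p = q then 1 else 0)"
  shows "expansion f = bs q"
proof -
  have "expansion f = (\<Oplus>\<^bsub>L\<^esub>p\<in>Bs. if q = p then bs p else \<zero>\<^bsub>L\<^esub>)"
    unfolding expansion_def using assms(2)
    by (intro L.finsum_cong') (auto simp: L.smult_1 L.smult_zero_scalar)
  also have "\<dots> = bs q" by (rule L.finsum_singleton) (auto simp: assms(1) finite_Bs)
  finally show ?thesis .
qed

lemma expansion_zero:
  assumes "\<And>p. p \<in> Bs \<Longrightarrow> cf f (fst p) (snd p) = 0" shows "expansion f = \<zero>\<^bsub>L\<^esub>"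
  unfolding expansion_def by (rule L.add.finprod_one_eqI) (simp add: assms L.smult_zero_scalar)

lemma arrow_cases:
  assumes "x \<in> arcs (quiverQ m)" "tail (quiverQ m) x = u"
  obtains "x = Fwd u" "head (quiverQ m) x = (u + 1) mod M"
  | "x = Bwd ((u - 1) mod M)" "head (quiverQ m) x = (u - 1) mod M"
  using assms by (cases x) (auto simp: quiverQ_def)

lemma expansion_basis:
  assumes "0 \<le> i" "i < M"
  shows "expansion (path_elem (path_e m i)) = ee i" "expansion (pa i) = aa i"
    "expansion (pb (i - 1)) = ab (i - 1)" "expansion (path_elem (path_s i)) = ss i"
    "expansion (path_elem (path_s' i)) = ss i"
  using assms expansion_delta[of "(i, BE)"] expansion_delta[of "(i, BA)"]
    expansion_delta[of "(i, BB)"] expansion_delta[of "(i, BS)"]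
  by (force simp: Bs_def mod_eq_shift)+

lemma ab_aa: "ab (i - 1) \<otimes>\<^bsub>L\<^esub> aa (i - 1) = aa i \<otimes>\<^bsub>L\<^esub> ab i"
  using ss_alt[of i] by (simp add: ss_def)

text \<open>Two arrows leave each vertex, so removing the first arrow of a path leaves two cases.
  Each case keeps the remaining path, and the rule can be applied again.\<close>

lemma Cons_class_cases:
  assumes "(u, x # p, w) \<in> paths (quiverQ m)"
  shows "((u + 1) mod M, p, w) \<in> paths (quiverQ m) \<and> u mod M = u \<and> x = Fwd u \<and>
      clL (path_elem (u, x # p, w)) = aa u \<otimes>\<^bsub>L\<^esub> clL (path_elem ((u + 1) mod M, p, w)) \<or>
    ((u - 1) mod M, p, w) \<in> paths (quiverQ m) \<and> u mod M = u \<and> x = Bwd ((u - 1) mod M) \<and>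
      clL (path_elem (u, x # p, w)) = ab (u - 1) \<otimes>\<^bsub>L\<^esub> clL (path_elem ((u - 1) mod M, p, w))"
proof -
  let ?v = "head (quiverQ m) x"
  have x: "x \<in> arcs (quiverQ m)" "tail (quiverQ m) x = u" and u: "u mod M = u" "u \<in> verts (quiverQ m)"
    using assms by (auto simp: paths_iff pre_digraph.cas.simps quiverQ_def)
  then have paths: "(u, [x], ?v) \<in> paths (quiverQ m)" "(?v, p, w) \<in> paths (quiverQ m)"
    using assms Q.head_in_verts by (simp_all add: paths_iff pre_digraph.cas.simps)
  have cl: "clL (path_elem (u, x # p, w)) = clL (path_elem (u, [x], ?v)) \<otimes>\<^bsub>L\<^esub> clL (path_elem (?v, p, w))"
    using Q.path_elem_mult[OF paths, where ?'k = 'k] paths by (simp add: cl_simps Q.path_elem_in)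
  from x show ?thesis
  proof (cases rule: arrow_cases)
    case 1
    then have "path_elem (u, [x], ?v) = pa u" by (simp add: path_a_def u)
    then show ?thesis using cl paths(2) u 1 by (simp add: elem_cl)
  next
    case 2
    then have "path_elem (u, [x], ?v) = pb (u - 1)" by (simp add: path_abar_def u)
    then show ?thesis using cl paths(2) u 2 by (simp add: elem_cl)
  qed
qed

text \<open>In an alternating product, the commutativity relation applied to the first two arrows
  brings two arrows of the same direction together: a abar a = abar a a = 0, and likewise with the
  roles exchanged. The factor \<open>r\<close> fits the right-nested products that arise from
  removing first arrows.\<close>

lemma triple_zero:
  "aa i \<otimes>\<^bsub>L\<^esub> (aa (i + 1) \<otimes>\<^bsub>L\<^esub> r) = \<zero>\<^bsub>L\<^esub>" "ab i \<otimes>\<^bsub>L\<^esub> (ab (i - 1) \<otimes>\<^bsub>L\<^esub> r) = \<zero>\<^bsub>L\<^esub>"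
  "aa i \<otimes>\<^bsub>L\<^esub> (ab i \<otimes>\<^bsub>L\<^esub> (aa i \<otimes>\<^bsub>L\<^esub> r)) = \<zero>\<^bsub>L\<^esub>" "ab i \<otimes>\<^bsub>L\<^esub> (aa i \<otimes>\<^bsub>L\<^esub> (ab i \<otimes>\<^bsub>L\<^esub> r)) = \<zero>\<^bsub>L\<^esub>"
  if "r \<in> carrier L" for i r
proof -
  note assoc = L.m_assoc[symmetric]
  have 1: "aa i \<otimes>\<^bsub>L\<^esub> ab i = ab (i - 1) \<otimes>\<^bsub>L\<^esub> aa (i - 1)"
    "aa i \<otimes>\<^bsub>L\<^esub> aa (i + 1) = \<zero>\<^bsub>L\<^esub>" "aa (i - 1) \<otimes>\<^bsub>L\<^esub> aa i = \<zero>\<^bsub>L\<^esub>" for i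
    using aa_aa[of i] aa_aa[of "i - 1"] ab_aa by simp_all
  have 2: "ab i \<otimes>\<^bsub>L\<^esub> aa i = aa (i + 1) \<otimes>\<^bsub>L\<^esub> ab (i + 1)" "ab (i + 1) \<otimes>\<^bsub>L\<^esub> ab i = \<zero>\<^bsub>L\<^esub>" for i
    using ab_aa[of "i + 1"] ab_ab[of "i + 1"] by simp_all
  show "aa i \<otimes>\<^bsub>L\<^esub> (aa (i + 1) \<otimes>\<^bsub>L\<^esub> r) = \<zero>\<^bsub>L\<^esub>" "ab i \<otimes>\<^bsub>L\<^esub> (ab (i - 1) \<otimes>\<^bsub>L\<^esub> r) = \<zero>\<^bsub>L\<^esub>"
    using that by (simp_all add: assoc aa_aa ab_ab)
  have "aa i \<otimes>\<^bsub>L\<^esub> (ab i \<otimes>\<^bsub>L\<^esub> (aa i \<otimes>\<^bsub>L\<^esub> r)) = (aa i \<otimes>\<^bsub>L\<^esub> ab i) \<otimes>\<^bsub>L\<^esub> (aa i \<otimes>\<^bsub>L\<^esub> r)"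
    using that by (simp add: L.m_assoc)
  also have "\<dots> = ab (i - 1) \<otimes>\<^bsub>L\<^esub> ((aa (i - 1) \<otimes>\<^bsub>L\<^esub> aa i) \<otimes>\<^bsub>L\<^esub> r)"
    unfolding 1(1) using that by (simp add: L.m_assoc)
  finally show "aa i \<otimes>\<^bsub>L\<^esub> (ab i \<otimes>\<^bsub>L\<^esub> (aa i \<otimes>\<^bsub>L\<^esub> r)) = \<zero>\<^bsub>L\<^esub>"
    using that by (simp add: 1(3))
  have "ab i \<otimes>\<^bsub>L\<^esub> (aa i \<otimes>\<^bsub>L\<^esub> (ab i \<otimes>\<^bsub>L\<^esub> r)) = (ab i \<otimes>\<^bsub>L\<^esub> aa i) \<otimes>\<^bsub>L\<^esub> (ab i \<otimes>\<^bsub>L\<^esub> r)"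
    using that by (simp add: L.m_assoc)
  also have "\<dots> = aa (i + 1) \<otimes>\<^bsub>L\<^esub> ((ab (i + 1) \<otimes>\<^bsub>L\<^esub> ab i) \<otimes>\<^bsub>L\<^esub> r)"
    unfolding 2(1) using that by (simp add: L.m_assoc)
  finally show "ab i \<otimes>\<^bsub>L\<^esub> (aa i \<otimes>\<^bsub>L\<^esub> (ab i \<otimes>\<^bsub>L\<^esub> r)) = \<zero>\<^bsub>L\<^esub>"
    using that by (simp add: 2(2))
qed

lemma nil_path:
  assumes "(v, [], w) \<in> paths (quiverQ m)"
  shows "w = v \<and> clL (path_elem (v, [], v)) \<in> carrier L"
  using assms Q.path_elem_in[OF assms, where ?'k = 'k] by (simp add: cl_simps paths_iff pre_digraph.cas.simps)

lemma class_two: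
  assumes "(u, [x, y], w) \<in> paths (quiverQ m)"
  shows "clL (path_elem (u, [x, y], w)) = \<zero>\<^bsub>L\<^esub> \<and>
      (\<forall>i. (u, [x, y], w) \<noteq> path_s i \<and> (u, [x, y], w) \<noteq> path_s' i) \<or>
    (u, [x, y], w) = path_s u \<or> (u, [x, y], w) = path_s' u"
proof -
  note zero = triple_zero triple_zero(2)[of _ "u - 1", simplified]
  show ?thesis
    by (insert Cons_class_cases[OF assms],
        (elim disjE conjE; drule Cons_class_cases; elim disjE conjE; drule nil_path),
        simp_all add: zero path_s_def path_s'_def)
qed

text \<open>Among three consecutive arrows, either two neighbours have the same direction or the
  directions alternate; \<open>triple_zero\<close> covers both.\<close>

lemma class_three:
  assumes "(u, x # y # z # q, w) \<in> paths (quiverQ m)"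
  shows "clL (path_elem (u, x # y # z # q, w)) = \<zero>\<^bsub>L\<^esub>"
proof -
  have r: "clL (path_elem (v, q, w)) \<in> carrier L" if "(v, q, w) \<in> paths (quiverQ m)" for v
    using that by (simp add: cl_simps Q.path_elem_in)
  note zero = triple_zero triple_zero(1)[of _ "u - 1", simplified] triple_zero(2)[of _ "u - 1", simplified]
  show ?thesis
    by (insert Cons_class_cases[OF assms],
        (elim disjE conjE; drule Cons_class_cases; elim disjE conjE; drule Cons_class_cases; elim disjE conjE),
        simp_all add: zero r)
qed

lemma expand_path:
  assumes \<pi>: "\<pi> \<in> paths (quiverQ m)"
  shows "clL (path_elem \<pi>) = expansion (path_elem \<pi>)"
proof -
  obtain u p w where \<pi>_eq: "\<pi> = (u, p, w)" by (cases \<pi>)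
  have u: "0 \<le> u" "u < M" "u mod M = u" and p: "set p \<subseteq> arcs (quiverQ m)" "pre_digraph.cas (quiverQ m) u p w"
    using \<pi> by (auto simp: \<pi>_eq paths_iff quiverQ_def)
  consider (e) "p = []" | (arrow) x where "p = [x]" | (two) x y where "p = [x, y]"
    | (long) x y z q where "p = x # y # z # q"
    by (metis list.exhaust)
  then show ?thesis
  proof cases
    case e
    then have "\<pi> = path_e m u" using p u by (simp add: \<pi>_eq path_e_def pre_digraph.cas.simps)
    then show ?thesis using u by (simp add: expansion_basis elem_cl)
  next
    case arrow
    then have x: "x \<in> arcs (quiverQ m)" "tail (quiverQ m) x = u" "head (quiverQ m) x = w"
      using p by (simp_all add: pre_digraph.cas.simps)
    then have "\<pi> = path_a m u \<or> \<pi> = path_abar m (u - 1)"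
      using u arrow by (elim arrow_cases) (auto simp: \<pi>_eq path_a_def path_abar_def)
    then show ?thesis using u by (auto simp: expansion_basis elem_cl)
  next
    case two
    \<comment> \<open>A path of length 2 that is not of the form \<open>path_s\<close> or
      \<open>path_s'\<close> has all coordinates zero, in agreement with its vanishing
      class.\<close>
    have zero: "expansion (path_elem \<pi>) = \<zero>\<^bsub>L\<^esub>" if "\<forall>i. \<pi> \<noteq> path_s i \<and> \<pi> \<noteq> path_s' i"
    proof (rule expansion_zero)
      fix q
      have "path_s i \<noteq> \<pi>" "path_s' i \<noteq> \<pi>" for i using that[rule_format, of i] by auto
      moreover have "path_e m i \<noteq> \<pi>" "path_a m i \<noteq> \<pi>" "path_abar m i \<noteq> \<pi>" for i
        by (simp_all add: \<pi>_eq two path_e_def path_a_def path_abar_def)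
      ultimately show "cf (path_elem \<pi>) (fst q) (snd q) = 0"
        by (cases "snd q") (simp_all add: cf.simps path_elem_def)
    qed
    have "clL (path_elem \<pi>) = \<zero>\<^bsub>L\<^esub> \<and> (\<forall>i. \<pi> \<noteq> path_s i \<and> \<pi> \<noteq> path_s' i) \<or>
        \<pi> = path_s u \<or> \<pi> = path_s' u"
      using class_two[of u x y w] \<pi> by (simp only: \<pi>_eq two)
    then show ?thesis
    proof (elim disjE conjE)
      assume "\<pi> = path_s u"
      then show ?thesis by (simp add: expansion_basis(4)[OF u(1,2)] flip: ss_cl(1))
    next
      assume "\<pi> = path_s' u"
      then show ?thesis by (simp add: expansion_basis(5)[OF u(1,2)] flip: ss_cl(2))
    qed (use zero in simp)
  next
    case (long x y z q)
    have "expansion (path_elem \<pi>) = \<zero>\<^bsub>L\<^esub>"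
    proof (rule expansion_zero)
      fix r
      show "cf (path_elem \<pi>) (fst r) (snd r) = 0"
        by (cases "snd r") (auto simp: cf.simps \<pi>_eq long path_elem_def path_e_def path_a_def path_abar_def path_s_def path_s'_def)
    qed
    moreover have "clL (path_elem \<pi>) = \<zero>\<^bsub>L\<^esub>"
      using class_three[of u x y z q w] \<pi> by (simp only: \<pi>_eq long)
    ultimately show ?thesis by simp
  qed
qed

lemma expand:
  assumes "f \<in> carrier KQ" shows "clL f = expansion f"
  using assms
proof (induction rule: Q.KQ_induct)
  case zero
  then show ?case by (simp add: expansion_zero cf_linear flip: cl_zero)
next
  case (add f \<pi> c)
  have "expansion (f \<oplus>\<^bsub>KQ\<^esub> c \<odot>\<^bsub>KQ\<^esub> path_elem \<pi>) = expansion f \<oplus>\<^bsub>L\<^esub> c \<odot>\<^bsub>L\<^esub> expansion (path_elem \<pi>)"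
  proof -
    have "c \<odot>\<^bsub>L\<^esub> expansion (path_elem \<pi>) =
        (\<Oplus>\<^bsub>L\<^esub>p\<in>Bs. c \<odot>\<^bsub>L\<^esub> (cf (path_elem \<pi>) (fst p) (snd p) \<odot>\<^bsub>L\<^esub> bs p))"
      unfolding expansion_def by (rule L.finsum_smult) (auto intro: L.smult_in)
    then show ?thesis
      unfolding expansion_def
      by (simp only:) (rule L.finsum_eq_add; simp add: cf_linear L.smult_add_left L.smult_smult L.smult_in)
  qed
  moreover have "clL (f \<oplus>\<^bsub>KQ\<^esub> c \<odot>\<^bsub>KQ\<^esub> path_elem \<pi>) = clL f \<oplus>\<^bsub>L\<^esub> c \<odot>\<^bsub>L\<^esub> clL (path_elem \<pi>)"
    using add.hyps by (simp add: cl_simps Q.path_elem_in KQ.smult_in)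
  ultimately show ?case using add expand_path by simp
qed

section \<open>Coordinates on the quotient\<close>

lemma L_cases: assumes "x \<in> carrier L" obtains f where "f \<in> carrier KQ" "x = clL f"
  using assms unfolding L_eq by (rule QI.Q_cases)

definition co :: "'k lam \<Rightarrow> int \<Rightarrow> basis_kind \<Rightarrow> 'k" where
  "co x = cf (SOME f. f \<in> carrier KQ \<and> x = clL f)"

text \<open>Two representatives differ by an element of \<open>I1\<close>, where all coordinates
  vanish by \<open>I1_J\<close>; the choice in \<open>co\<close> is therefore immaterial.\<close>

lemma co_cl:
  assumes f: "f \<in> carrier KQ" shows "co (clL f) i t = cf f i t"
proof -
  define g where "g = (SOME g. g \<in> carrier KQ \<and> clL f = clL g)"
  have g: "g \<in> carrier KQ \<and> clL f = clL g"
    unfolding g_def by (rule someI[of _ f]) (simp add: f)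
  then have "f \<ominus>\<^bsub>KQ\<^esub> g \<in> J" using QI.cl_eq_iff[of f g] f I1_J by auto
  then have "cf (f \<ominus>\<^bsub>KQ\<^esub> g) i t = 0" by (simp add: J_def)
  then have "cf f i t = cf g i t" using g by (simp add: KQ.minus_eq cf_linear cf_minus)
  then show ?thesis by (simp add: co_def g_def)
qed

lemma co_periodic: "co x (i mod M) t = co x i t"
  by (simp add: co_def cf_periodic)

lemma co_add: "x \<in> carrier L \<Longrightarrow> y \<in> carrier L \<Longrightarrow> co (x \<oplus>\<^bsub>L\<^esub> y) i t = co x i t + co y i t"
  by (elim L_cases) (simp add: cl_simps co_cl cf_linear)

lemma co_smult: "x \<in> carrier L \<Longrightarrow> co (c \<odot>\<^bsub>L\<^esub> x) i t = c * co x i t"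
  by (elim L_cases) (simp add: cl_simps co_cl cf_linear KQ.smult_in)

lemma co_zero [simp]: "co \<zero>\<^bsub>L\<^esub> i t = 0"
  by (simp add: cl_zero co_cl cf_linear)

lemma co_mult: "x \<in> carrier L \<Longrightarrow> y \<in> carrier L \<Longrightarrow> co (x \<otimes>\<^bsub>L\<^esub> y) i t = cmul (co x) (co y) i t"
  by (elim L_cases) (cases t; simp add: cl_simps co_cl cf_mult)

lemma co_basis [simp]:
  "co (ee j) i t = (if t = BE \<and> i mod M = j mod M then 1 else 0)"
  "co (aa j) i t = (if t = BA \<and> i mod M = j mod M then 1 else 0)"
  "co (ab j) i t = (if t = BB \<and> i mod M = (j + 1) mod M then 1 else 0)"
  "co (ss j) i t = (if t = BS \<and> i mod M = j mod M then 1 else 0)"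
  by (simp_all add: elem_cl ss_cl(1) co_cl mod_minus_shift)

lemma co_expand:
  assumes "x \<in> carrier L" shows "x = (\<Oplus>\<^bsub>L\<^esub>p\<in>Bs. co x (fst p) (snd p) \<odot>\<^bsub>L\<^esub> bs p)"
proof -
  obtain f where f: "f \<in> carrier KQ" "x = clL f" using assms by (rule L_cases)
  show ?thesis unfolding f(2) co_cl[OF f(1)] by (rule expand[OF f(1), unfolded expansion_def])
qed

text \<open>The expansion recovers an element from its coordinates, so identities between products
  can be decided by computing coordinates.\<close>

lemma L_eqI:
  assumes "x \<in> carrier L" "y \<in> carrier L" "\<And>i t. co x i t = co y i t"
  shows "x = y"
proof -
  have "co x = co y" using assms(3) by blast
  then have "x = (\<Oplus>\<^bsub>L\<^esub>p\<in>Bs. co y (fst p) (snd p) \<odot>\<^bsub>L\<^esub> bs p)"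
    using co_expand[OF assms(1)] by (simp only:)
  then show ?thesis using co_expand[OF assms(2)] by (rule trans[OF _ sym])
qed

sublocale fd_algebra L Bs bs "\<lambda>x p. co x (fst p) (snd p)"
proof (rule fd_algebra.intro[OF L.k_algebra_axioms], rule fd_algebra_axioms.intro)
  show "x = (\<Oplus>\<^bsub>L\<^esub>p\<in>Bs. co x (fst p) (snd p) \<odot>\<^bsub>L\<^esub> bs p)" if "x \<in> carrier L" for x
    using that by (rule co_expand)
  show "finite Bs" by (rule finite_Bs)
  show "bs p \<in> carrier L" for p by (rule bs_in)
  show "co (x \<oplus>\<^bsub>L\<^esub> y) (fst p) (snd p) = co x (fst p) (snd p) + co y (fst p) (snd p)"
    if "x \<in> carrier L" "y \<in> carrier L" for x y p
    using that by (rule co_add)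
  show "co (c \<odot>\<^bsub>L\<^esub> x) (fst p) (snd p) = c * co x (fst p) (snd p)" if "x \<in> carrier L" for x c p
    using that by (rule co_smult)
qed

end

section \<open>The resolution\<close>

context lambda1
begin

lemma elem_eqI:
  assumes "x \<in> carrier L" "y \<in> carrier L"
    and "\<And>i. co x i BE = co y i BE" "\<And>i. co x i BA = co y i BA"
    and "\<And>i. co x i BB = co y i BB" "\<And>i. co x i BS = co y i BS"
  shows "x = y"
proof (rule L_eqI[OF assms(1,2)])
  show "co x i t = co y i t" for i t using assms(3-6) by (cases t) simp_all
qed

lemma elem_table [simp]:
  "ee i \<otimes>\<^bsub>L\<^esub> ee i = ee i"
  "ee i \<otimes>\<^bsub>L\<^esub> aa i = aa i" "aa i \<otimes>\<^bsub>L\<^esub> ee (i + 1) = aa i"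
  "ee (i + 1) \<otimes>\<^bsub>L\<^esub> ab i = ab i" "ab i \<otimes>\<^bsub>L\<^esub> ee i = ab i"
  "ee i \<otimes>\<^bsub>L\<^esub> ss i = ss i" "ss i \<otimes>\<^bsub>L\<^esub> ee i = ss i"
  "aa i \<otimes>\<^bsub>L\<^esub> ab i = ss i" "ab i \<otimes>\<^bsub>L\<^esub> aa i = ss (i + 1)"
  "ss i \<otimes>\<^bsub>L\<^esub> aa i = \<zero>\<^bsub>L\<^esub>" "ss (i + 1) \<otimes>\<^bsub>L\<^esub> ab i = \<zero>\<^bsub>L\<^esub>"
  by (rule elem_eqI; simp add: co_mult mod_eq_shift mod_minus_shift)+

lemma e_shift: "ee (i mod M + k) = ee (i + k)"
  using elem_mod(1)[of "i mod M + k"] elem_mod(1)[of "i + k"] by (simp add: mod_add_left_eq)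

abbreviation ev :: "int \<times> int \<Rightarrow> 'k lam" where "ev p \<equiv> ee (fst p)"
abbreviation fv :: "nat \<Rightarrow> int \<times> int \<Rightarrow> 'k lam" where "fv n p \<equiv> ee (fst p + int n - 2 * snd p)"

sublocale PS: proj_sum L Bs bs "\<lambda>x p. co x (fst p) (snd p)" "res_index m n" "\<lambda>p. ev p" "\<lambda>p. fv n p" for n
  by unfold_locales (simp_all add: res_index_def)

abbreviation R :: "nat \<Rightarrow> ('k lam, 'k res) bimod" where "R n \<equiv> res_mod m n"
abbreviation G :: "nat \<Rightarrow> int \<Rightarrow> int \<Rightarrow> 'k res" where "G n \<equiv> gen m n"

lemma R_eq: "R n = PS.P n"
  by (simp add: res_mod_def case_prod_unfold)

sublocale R: bimodule_over L "R n" for n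
  unfolding R_eq by (rule PS.P.bimodule_over_axioms)

lemma R_bimodule: "bimodule L (R n)"
  by (rule R.bimodule)

lemma index_in: "0 \<le> r \<Longrightarrow> r \<le> int n \<Longrightarrow> (i mod M, r) \<in> res_index m n"
  using m3 by (auto simp: res_index_def)

lemma fv_shift: "ee (i mod M + int n - 2 * r) = ee (i + int n - 2 * r)"
  using e_shift[of i "int n - 2 * r"] by (simp only: add_diff_eq)

lemma G_gn: "0 \<le> r \<Longrightarrow> r \<le> int n \<Longrightarrow> G n i r = PS.gn n (i mod M, r)"
  by (auto simp: gen_def PS.elt_def idem_tensor_def fv_shift intro!: restrict_ext)

lemma G_out: "\<not> (0 \<le> r \<and> r \<le> int n) \<Longrightarrow> G n i r = \<zero>\<^bsub>R n\<^esub>"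
  by (auto simp: gen_def R_eq direct_sum_simps tensor_bimod_def Let_def res_index_def
      intro!: restrict_ext)

lemma G_in [simp]: "G n i r \<in> carrier (R n)"
proof (cases "0 \<le> r \<and> r \<le> int n")
  case True
  then show ?thesis using PS.gn_in[OF index_in[of r n i]] by (simp add: G_gn R_eq)
qed (simp add: G_out)

lemma G_mod: "G n (i mod M) r = G n i r"
  by (cases "0 \<le> r \<and> r \<le> int n") (simp_all add: G_gn G_out)

lemma G_left: "lact (R n) (ee i) (G n i r) = G n i r"
  and G_right: "ract (R n) (G n i r) (ee (i + int n - 2 * r)) = G n i r"
proof -
  have "lact (R n) (ee i) (G n i r) = G n i r \<and> ract (R n) (G n i r) (ee (i + int n - 2 * r)) = G n i r"
  proof (cases "0 \<le> r \<and> r \<le> int n")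
    case True
    then have ix: "(i mod M, r) \<in> res_index m n" by (simp add: index_in)
    show ?thesis
      using True fv_shift[of i n r] PS.lact_elt[OF ix, of "ee i"] PS.ract_elt[OF ix, of "ee (i + int n - 2 * r)"]
      by (simp add: G_gn R_eq)
  qed (simp add: G_out)
  then show "lact (R n) (ee i) (G n i r) = G n i r" "ract (R n) (G n i r) (ee (i + int n - 2 * r)) = G n i r"
    by auto
qed

text \<open>The description by \<open>THE\<close> is justified by \<open>PS.hom_exists\<close> and
  \<open>PS.hom_unique\<close>; the side conditions say that \<open>h i r\<close> has the source and
  target of the generator.\<close>

lemma hom_of_gens:
  assumes N: "bimodule L N" and h: "\<And>i r. 0 \<le> i \<Longrightarrow> i < M \<Longrightarrow> 0 \<le> r \<Longrightarrow> r \<le> int n \<Longrightarrow>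
      h i r \<in> carrier N \<and> lact N (ee i) (h i r) = h i r \<and> ract N (h i r) (ee (i + int n - 2 * r)) = h i r"
  shows "hom_of_gens m n N h \<in> bimod_hom L (R n) N"
    and "0 \<le> i \<Longrightarrow> i < M \<Longrightarrow> 0 \<le> r \<Longrightarrow> r \<le> int n \<Longrightarrow> hom_of_gens m n N h (G n i r) = h i r"
proof -
  let ?Q = "\<lambda>f. f \<in> bimod_hom L (R n) N \<and> (\<forall>(i, r)\<in>res_index m n. f (G n i r) = h i r)"
  have gn: "PS.gn n (i, r) = G n i r" if "(i, r) \<in> res_index m n" for i r
    using that G_gn[of r n i] by (auto simp: res_index_def)
  have "\<exists>f\<in>bimod_hom L (PS.P n) N. \<forall>p\<in>res_index m n. f (PS.gn n p) = (\<lambda>(i, r). h i r) p"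
    by (rule PS.hom_exists[OF N]) (use h in \<open>auto simp: res_index_def\<close>)
  then obtain f where f: "f \<in> bimod_hom L (PS.P n) N" "\<forall>p\<in>res_index m n. f (PS.gn n p) = (\<lambda>(i, r). h i r) p"
    by (rule bexE)
  have "?Q f" using f gn by (auto simp: R_eq)
  moreover have "g = f" if "?Q g" for g
  proof (rule PS.hom_unique[OF _ _ N])
    show "g \<in> bimod_hom L (PS.P n) N" "f \<in> bimod_hom L (PS.P n) N" using that f by (simp_all add: R_eq)
    fix p assume p: "p \<in> res_index m n"
    obtain a b where ab: "p = (a, b)" by (cases p)
    have "f (G n a b) = h a b" using bspec[OF f(2), of "(a, b)"] gn[of a b] p ab by simp
    moreover have "g (G n a b) = h a b" using that p ab by auto
    ultimately show "g (PS.gn n p) = f (PS.gn n p)" using gn[of a b] p ab by simp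
  qed
  ultimately have "?Q (THE f. ?Q f)" by (rule theI)
  then have *: "?Q (hom_of_gens m n N h)" unfolding hom_of_gens_def .
  then show "hom_of_gens m n N h \<in> bimod_hom L (R n) N" by blast
  show "0 \<le> i \<Longrightarrow> i < M \<Longrightarrow> 0 \<le> r \<Longrightarrow> r \<le> int n \<Longrightarrow> hom_of_gens m n N h (G n i r) = h i r"
    using * by (auto simp: res_index_def)
qed

text \<open>The element \<open>b \<otimes>\<^sub>r w\<close> for arbitrary algebra elements and
  arbitrary integers \<open>i\<close> and \<open>r\<close>. It is zero for \<open>r\<close> out of
  range, so the boundary terms of the differential need no case distinction.\<close>

definition Y :: "nat \<Rightarrow> 'k lam \<Rightarrow> int \<Rightarrow> int \<Rightarrow> 'k lam \<Rightarrow> 'k res" where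
  "Y n b i r w = lact (R n) b (ract (R n) (G n i r) w)"

lemma Y_in [simp]: "b \<in> carrier L \<Longrightarrow> w \<in> carrier L \<Longrightarrow> Y n b i r w \<in> carrier (R n)"
  by (simp add: Y_def)

lemma Y_zero [simp]: "w \<in> carrier L \<Longrightarrow> Y n \<zero>\<^bsub>L\<^esub> i r w = \<zero>\<^bsub>R n\<^esub>"
  "b \<in> carrier L \<Longrightarrow> Y n b i r \<zero>\<^bsub>L\<^esub> = \<zero>\<^bsub>R n\<^esub>"
  by (simp_all add: Y_def)

lemma Y_out: "b \<in> carrier L \<Longrightarrow> w \<in> carrier L \<Longrightarrow> \<not> (0 \<le> r \<and> r \<le> int n) \<Longrightarrow> Y n b i r w = \<zero>\<^bsub>R n\<^esub>"
  by (simp add: Y_def G_out)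

lemma lact_Y: "a \<in> carrier L \<Longrightarrow> b \<in> carrier L \<Longrightarrow> w \<in> carrier L \<Longrightarrow> lact (R n) a (Y n b i r w) = Y n (a \<otimes>\<^bsub>L\<^esub> b) i r w"
  and ract_Y: "a \<in> carrier L \<Longrightarrow> b \<in> carrier L \<Longrightarrow> w \<in> carrier L \<Longrightarrow> ract (R n) (Y n b i r w) a = Y n b i r (w \<otimes>\<^bsub>L\<^esub> a)"
  by (simp_all add: Y_def R.lact_mult R.ract_mult R.ract_lact)

lemma G_Y: "G n i r = Y n (ee i) i r (ee (i + int n - 2 * r))"
  by (simp add: Y_def G_left G_right)

lemma Y_e: "b \<in> carrier L \<Longrightarrow> w \<in> carrier L \<Longrightarrow> Y n (b \<otimes>\<^bsub>L\<^esub> ee i) i r w = Y n b i r w"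
    "b \<in> carrier L \<Longrightarrow> w \<in> carrier L \<Longrightarrow> Y n b i r (ee (i + int n - 2 * r) \<otimes>\<^bsub>L\<^esub> w) = Y n b i r w"
  by (simp_all add: Y_def R.lact_mult R.ract_mult G_right)
    (simp add: G_left R.ract_lact[symmetric] R.lact_mult)

end

section \<open>The differential in characteristic 2\<close>

locale lambda1_char2 = lambda1 m K for m and K :: "'k::field itself" +
  assumes char2: "CHAR('k) = 2"
begin

lemma two_zero: "(1 :: 'k) + 1 = 0" and minus_one: "(- 1 :: 'k) = 1"
proof -
  have "of_nat CHAR('k) = (0 :: 'k)" by (rule of_nat_CHAR)
  then show *: "(1 :: 'k) + 1 = 0" by (simp add: char2)
  then show "(- 1 :: 'k) = 1" by (simp add: minus_unique)
qed

lemma R_double [simp]: "x \<in> carrier (R n) \<Longrightarrow> x \<oplus>\<^bsub>R n\<^esub> x = \<zero>\<^bsub>R n\<^esub>"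
  using R.add_sc[of x n 1 1] unfolding two_zero by simp

lemma R_double' [simp]: "x \<in> carrier (R n) \<Longrightarrow> y \<in> carrier (R n) \<Longrightarrow> x \<oplus>\<^bsub>R n\<^esub> (x \<oplus>\<^bsub>R n\<^esub> y) = y"
  by (simp flip: R.M.a_assoc)

text \<open>The prescribed images have the source and target of the generators, so
  \<open>hom_of_gens\<close> applies. Periodicity in \<open>i\<close> and the vanishing of
  generators out of range extend the formula from the index set to all integers.\<close>

lemma res_diff_hom: "res_diff m (Suc n) \<in> bimod_hom L (R (Suc n)) (R n)"
  and res_diff_G: "res_diff m (Suc n) (G (Suc n) i r) =
    Y n (ee i) i r (aa (i + int n - 2 * r)) \<oplus>\<^bsub>R n\<^esub> Y n (ee i) i (r - 1) (ab (i + int n + 1 - 2 * r)) \<oplus>\<^bsub>R n\<^esub>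
    (Y n (aa i) (i + 1) r (ee (i + int n + 1 - 2 * r)) \<oplus>\<^bsub>R n\<^esub>
     Y n (ab (i - 1)) (i - 1) (r - 1) (ee (i + int n + 1 - 2 * r)))"
proof -
  define h where "h i r = (let N = res_mod m n; g = gen m n; j = i + int (Suc n) - 2 * r; sc = scale L N in
       ract N (g i r) (a_elem m (j - 1))
       \<oplus>\<^bsub>N\<^esub> sc ((-1) ^ Suc n) (ract N (g i (r - 1)) (abar_elem m j))
       \<oplus>\<^bsub>N\<^esub> sc ((-1) ^ (Suc n + nat r))
             (lact N (a_elem m i) (g (i + 1) r) \<oplus>\<^bsub>N\<^esub> lact N (abar_elem m (i - 1)) (g (i - 1) (r - 1))))" for i r
  define D where "D i r = Y n (ee i) i r (aa (i + int n - 2 * r)) \<oplus>\<^bsub>R n\<^esub> Y n (ee i) i (r - 1) (ab (i + int n + 1 - 2 * r)) \<oplus>\<^bsub>R n\<^esub>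
    (Y n (aa i) (i + 1) r (ee (i + int n + 1 - 2 * r)) \<oplus>\<^bsub>R n\<^esub>
     Y n (ab (i - 1)) (i - 1) (r - 1) (ee (i + int n + 1 - 2 * r)))" for i r
  have a_e: "aa (k - 1) \<otimes>\<^bsub>L\<^esub> ee k = aa (k - 1)" "ee k \<otimes>\<^bsub>L\<^esub> ab (k - 1) = ab (k - 1)" for k
    using elem_table(3)[of "k - 1"] elem_table(4)[of "k - 1"] by simp_all
  have h_D: "h i r = D i r" for i r
  proof -
    have "ract (R n) (G n i r) (aa (i + int n - 2 * r)) = Y n (ee i) i r (aa (i + int n - 2 * r))"
      "ract (R n) (G n i (r - 1)) (ab (i + int n + 1 - 2 * r)) = Y n (ee i) i (r - 1) (ab (i + int n + 1 - 2 * r))"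
      by (simp_all add: Y_def G_left flip: R.ract_lact)
    moreover have "lact (R n) (aa i) (G n (i + 1) r) = Y n (aa i) (i + 1) r (ee (i + int n + 1 - 2 * r))"
      using G_right[of n "i + 1" r] by (simp add: Y_def algebra_simps)
    moreover have "lact (R n) (ab (i - 1)) (G n (i - 1) (r - 1)) = Y n (ab (i - 1)) (i - 1) (r - 1) (ee (i + int n + 1 - 2 * r))"
      using G_right[of n "i - 1" "r - 1"] by (simp add: Y_def algebra_simps)
    ultimately show ?thesis
      by (simp add: h_def D_def Let_def minus_one algebra_simps)
  qed
  have D: "D i r \<in> carrier (R n) \<and> lact (R n) (ee i) (D i r) = D i r \<and>
      ract (R n) (D i r) (ee (i + int (Suc n) - 2 * r)) = D i r" for i r
  proof -
    have j: "i + int (Suc n) - 2 * r = i + int n + 1 - 2 * r" by simp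
    have "aa (i + int n - 2 * r) \<otimes>\<^bsub>L\<^esub> ee (i + int n + 1 - 2 * r) = aa (i + int n - 2 * r)"
      using elem_table(3)[of "i + int n - 2 * r"] by (simp add: algebra_simps)
    moreover have "ab (i + int n + 1 - 2 * r) \<otimes>\<^bsub>L\<^esub> ee (i + int n + 1 - 2 * r) = ab (i + int n + 1 - 2 * r)" by simp
    ultimately show ?thesis
      unfolding j by (simp add: D_def R.lact_add R.ract_add lact_Y ract_Y a_e)
  qed
  have eq: "res_diff m (Suc n) = hom_of_gens m (Suc n) (R n) h"
    unfolding res_diff_def h_def by simp
  note hom = hom_of_gens[OF R_bimodule, of "Suc n" h n]
  have h: "h i r \<in> carrier (R n) \<and> lact (R n) (ee i) (h i r) = h i r \<and>
      ract (R n) (h i r) (ee (i + int (Suc n) - 2 * r)) = h i r" for i r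
    using D h_D by simp
  show hom': "res_diff m (Suc n) \<in> bimod_hom L (R (Suc n)) (R n)"
    unfolding eq by (rule hom(1)) (use h in blast)
  have D_mod: "D (i mod M) r = D i r"
  proof -
    have sh: "x (i mod M + k) = x (i + k)" if "\<And>j. x (j mod M) = x j" for x :: "int \<Rightarrow> 'k lam" and k
      using that[of "i mod M + k"] that[of "i + k"] by (simp add: mod_add_left_eq)
    have shG: "G n (i mod M + k) r = G n (i + k) r" for k r
      using G_mod[of n "i mod M + k" r] G_mod[of n "i + k" r] by (simp add: mod_add_left_eq)
    note a = sh[of aa, OF elem_mod(2), of "int n - 2 * r"] sh[of ab, OF elem_mod(3), of "int n + 1 - 2 * r"]
      sh[of ee, OF elem_mod(1), of "int n + 1 - 2 * r"]
    show ?thesis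
      using a shG[of 1 r] shG[of "-1" "r - 1"] G_mod[of n i]
      by (simp add: D_def Y_def add_diff_eq add.assoc[symmetric])
  qed
  show "res_diff m (Suc n) (G (Suc n) i r) = D i r"
  proof (cases "0 \<le> r \<and> r \<le> int (Suc n)")
    case True
    have "res_diff m (Suc n) (G (Suc n) (i mod M) r) = h (i mod M) r"
      unfolding eq by (rule hom(2)) (use h True m3 in auto)
    then show ?thesis by (simp add: G_mod h_D D_mod)
  next
    case False
    \<comment> \<open>If \<open>r\<close> is outside the range 0 to n + 1, then both
      \<open>r\<close> and \<open>r - 1\<close> are outside the range 0 to n.\<close>
    then have "D i r = \<zero>\<^bsub>R n\<^esub>" by (auto simp: D_def Y_out)
    then show ?thesis
      using False bimodule_pair.hom_zero[OF L.bimodule_pairI[OF R_bimodule R_bimodule] hom'] by (simp add: G_out)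
  qed
qed

end

context proj_sum
begin

lemma bilinear_map_add:
  assumes "bimodule A M" "bilinear_map M \<Phi>" "bilinear_map M \<Psi>"
  shows "bilinear_map M (\<lambda>i v w. \<Phi> i v w \<oplus>\<^bsub>M\<^esub> \<Psi> i v w)"
proof -
  interpret M: bimodule_over A M by (rule bimodule_overI) fact
  show ?thesis
    using assms(2,3) by (simp add: bilinear_map_def M.sc_add M.M.a_ac)
qed

text \<open>A functional of the left factor times a linear function of the right one: such maps can
  respect the right action and ignore the left one. The homotopy is a sum of three of them.\<close>

lemma bilinear_map_tensor:
  assumes "bimodule A M"
    and l: "\<And>i v v'. i \<in> I \<Longrightarrow> v \<in> carrier A \<Longrightarrow> v' \<in> carrier A \<Longrightarrow> l i (v \<oplus> v') = l i v + l i v'"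
      "\<And>i c v. i \<in> I \<Longrightarrow> v \<in> carrier A \<Longrightarrow> l i (c \<odot> v) = c * l i v"
    and u: "\<And>i w. i \<in> I \<Longrightarrow> w \<in> carrier A \<Longrightarrow> u i w \<in> carrier M"
      "\<And>i w w'. i \<in> I \<Longrightarrow> w \<in> carrier A \<Longrightarrow> w' \<in> carrier A \<Longrightarrow> u i (w \<oplus> w') = u i w \<oplus>\<^bsub>M\<^esub> u i w'"
      "\<And>i c w. i \<in> I \<Longrightarrow> w \<in> carrier A \<Longrightarrow> u i (c \<odot> w) = scale A M c (u i w)"
  shows "bilinear_map M (\<lambda>i v w. scale A M (l i v) (u i w))"
proof -
  interpret M: bimodule_over A M by (rule bimodule_overI) fact
  note carr = tensor_product.V_carrier[OF tensor] tensor_product.W_carrier[OF tensor]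
  have "scale A M c (scale A M d x) = scale A M d (scale A M c x)" if "x \<in> carrier M" for c d x
    using that by (simp add: mult.commute flip: M.sc_sc)
  then show ?thesis
    unfolding bilinear_map_def by (simp add: carr l u M.add_sc M.sc_add M.sc_sc)
qed

end

context lambda1_char2
begin

abbreviation dd :: "nat \<Rightarrow> 'k res \<Rightarrow> 'k res" where "dd n \<equiv> res_diff m (Suc n)"

lemma RR_pair: "bimodule_pair L (R n) (R k)"
  by (rule L.bimodule_pairI[OF R_bimodule R_bimodule])

lemma dd_in: "x \<in> carrier (R (Suc n)) \<Longrightarrow> dd n x \<in> carrier (R n)"
  by (rule bimod_homD(1)[OF res_diff_hom])

lemma dd_add: "x \<in> carrier (R (Suc n)) \<Longrightarrow> y \<in> carrier (R (Suc n)) \<Longrightarrow>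
    dd n (x \<oplus>\<^bsub>R (Suc n)\<^esub> y) = dd n x \<oplus>\<^bsub>R n\<^esub> dd n y"
  by (rule bimod_homD(2)[OF res_diff_hom])

lemma dd_zero [simp]: "dd n \<zero>\<^bsub>R (Suc n)\<^esub> = \<zero>\<^bsub>R n\<^esub>"
  by (rule bimodule_pair.hom_zero[OF RR_pair res_diff_hom])

lemma Y_e': "b \<in> carrier L \<Longrightarrow> w \<in> carrier L \<Longrightarrow> j = i + int n - 2 * r \<Longrightarrow> Y n b i r (ee j \<otimes>\<^bsub>L\<^esub> w) = Y n b i r w"
  by (simp add: Y_e)

lemma dd_Y:
  assumes b: "b \<in> carrier L" and w: "w \<in> carrier L"
  shows "dd n (Y (Suc n) b i r w) =
    Y n b i r (aa (i + int n - 2 * r) \<otimes>\<^bsub>L\<^esub> w) \<oplus>\<^bsub>R n\<^esub> Y n b i (r - 1) (ab (i + int n + 1 - 2 * r) \<otimes>\<^bsub>L\<^esub> w) \<oplus>\<^bsub>R n\<^esub>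
    (Y n (b \<otimes>\<^bsub>L\<^esub> aa i) (i + 1) r w \<oplus>\<^bsub>R n\<^esub> Y n (b \<otimes>\<^bsub>L\<^esub> ab (i - 1)) (i - 1) (r - 1) w)"
proof -
  have "dd n (Y (Suc n) b i r w) = lact (R n) b (ract (R n) (dd n (G (Suc n) i r)) w)"
    using assms by (simp add: Y_def bimod_homD[OF res_diff_hom])
  also have "\<dots> = Y n (b \<otimes>\<^bsub>L\<^esub> ee i) i r (aa (i + int n - 2 * r) \<otimes>\<^bsub>L\<^esub> w) \<oplus>\<^bsub>R n\<^esub>
    Y n (b \<otimes>\<^bsub>L\<^esub> ee i) i (r - 1) (ab (i + int n + 1 - 2 * r) \<otimes>\<^bsub>L\<^esub> w) \<oplus>\<^bsub>R n\<^esub>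
    (Y n (b \<otimes>\<^bsub>L\<^esub> aa i) (i + 1) r (ee (i + int n + 1 - 2 * r) \<otimes>\<^bsub>L\<^esub> w) \<oplus>\<^bsub>R n\<^esub>
     Y n (b \<otimes>\<^bsub>L\<^esub> ab (i - 1)) (i - 1) (r - 1) (ee (i + int n + 1 - 2 * r) \<otimes>\<^bsub>L\<^esub> w))"
    using assms by (simp add: res_diff_G R.lact_add R.ract_add lact_Y ract_Y)
  finally show ?thesis using assms by (simp add: Y_e Y_e')
qed

text \<open>These are the four basis elements with target \<open>i\<close>. Coordinates are indexed
  by sources, which for the two arrows are \<open>i - 1\<close> and \<open>i + 1\<close>.\<close>

lemma left_expand:
  assumes v: "v \<in> carrier L" "v \<otimes>\<^bsub>L\<^esub> ee i = v"
  shows "v = co v i BE \<odot>\<^bsub>L\<^esub> ee i \<oplus>\<^bsub>L\<^esub> co v (i - 1) BA \<odot>\<^bsub>L\<^esub> aa (i - 1) \<oplus>\<^bsub>L\<^esub>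
    (co v (i + 1) BB \<odot>\<^bsub>L\<^esub> ab i \<oplus>\<^bsub>L\<^esub> co v i BS \<odot>\<^bsub>L\<^esub> ss i)"
proof -
  have per: "co v j t = co v k t" if "j mod M = k mod M" for j k t
    using co_periodic[of v j t] co_periodic[of v k t] that by simp
  have *: "co v j t = cmul (co v) (co (ee i)) j t" for j t
    using co_mult[OF v(1), of "ee i" j t] v(2) by simp
  have BE: "co v j BE = (if j mod M = i mod M then co v i BE else 0)" for j
  proof (cases "j mod M = i mod M")
    case False
    then show ?thesis using *[of j BE] by simp
  qed (simp add: per[of j i])
  have BA: "co v j BA = (if (j + 1) mod M = i mod M then co v (i - 1) BA else 0)" for j
  proof (cases "(j + 1) mod M = i mod M")
    case False
    then show ?thesis using *[of j BA] by simp
  qed (use per[of j "i - 1"] mod_minus_shift[of i j] in simp)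
  have BB: "co v j BB = (if (j - 1) mod M = i mod M then co v (i + 1) BB else 0)" for j
  proof (cases "(j - 1) mod M = i mod M")
    case False
    then show ?thesis using *[of j BB] by simp
  qed (use per[of j "i + 1"] mod_minus_shift[of j i] in simp)
  have BS: "co v j BS = (if j mod M = i mod M then co v i BS else 0)" for j
  proof (cases "j mod M = i mod M")
    case False
    then show ?thesis using *[of j BS] by (simp add: BE)
  qed (simp add: per[of j i])
  have shift: "j mod M = (i - 1) mod M \<longleftrightarrow> (j + 1) mod M = i mod M" for j
    using mod_minus_shift[of i j] by auto
  show ?thesis (is "v = ?x")
  proof (rule elem_eqI[OF v(1)])
    show "?x \<in> carrier L" by (simp add: L.smult_in)
    fix j
    show "co v j BE = co ?x j BE" by (subst BE) (simp add: co_add co_smult L.smult_in)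
    show "co v j BA = co ?x j BA" by (subst BA) (simp add: co_add co_smult L.smult_in shift)
    show "co v j BB = co ?x j BB" by (subst BB) (simp add: co_add co_smult L.smult_in mod_minus_shift)
    show "co v j BS = co ?x j BS" by (subst BS) (simp add: co_add co_smult L.smult_in)
  qed
qed

lemma Y_add_left: "b \<in> carrier L \<Longrightarrow> b' \<in> carrier L \<Longrightarrow> w \<in> carrier L \<Longrightarrow>
    Y n (b \<oplus>\<^bsub>L\<^esub> b') i r w = Y n b i r w \<oplus>\<^bsub>R n\<^esub> Y n b' i r w"
  and Y_add_right: "b \<in> carrier L \<Longrightarrow> w \<in> carrier L \<Longrightarrow> w' \<in> carrier L \<Longrightarrow>
    Y n b i r (w \<oplus>\<^bsub>L\<^esub> w') = Y n b i r w \<oplus>\<^bsub>R n\<^esub> Y n b i r w'"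
  and Y_smult_left: "b \<in> carrier L \<Longrightarrow> w \<in> carrier L \<Longrightarrow> Y n (c \<odot>\<^bsub>L\<^esub> b) i r w = scale L (R n) c (Y n b i r w)"
  and Y_smult_right: "b \<in> carrier L \<Longrightarrow> w \<in> carrier L \<Longrightarrow> Y n b i r (c \<odot>\<^bsub>L\<^esub> w) = scale L (R n) c (Y n b i r w)"
  by (simp_all add: Y_def R.add_lact R.add_ract R.lact_add R.lact_smult R.ract_smult R.lact_sc)

text \<open>A contracting homotopy that is linear on the right only. It is the translation of the
  homotopy \<open>x u\<^sub>p \<mapsto> u\<^bsub>p+1\<^esub>\<close>, \<open>u\<^sub>p \<mapsto> 0\<close> for the periodic resolution of \<open>\<bbbK>[x]/(x\<^sup>2)\<close>
  to the tensor product of two such resolutions.\<close>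

definition hom_a :: "nat \<Rightarrow> int \<times> int \<Rightarrow> 'k lam \<Rightarrow> 'k res" where
  "hom_a n p w = Y (Suc n) (ee (fst p - 1)) (fst p - 1) (snd p) w"

text \<open>The generator with index \<open>r\<close> in degree \<open>n\<close> has degree
  \<open>n - r\<close> in the first of the two resolutions and \<open>r\<close> in the second. The
  second homotopy is applied only where the first degree is 0, that is for
  \<open>r = n\<close>.\<close>

definition hom_b :: "nat \<Rightarrow> int \<times> int \<Rightarrow> 'k lam \<Rightarrow> 'k res" where
  "hom_b n p w = (if snd p = int n then Y (Suc n) (ee (fst p + 1)) (fst p + 1) (int n + 1) w else \<zero>\<^bsub>R (Suc n)\<^esub>)"

text \<open>The first homotopy strips a from the socle element and leaves abar. Where the first
  degree is 0, there remains the projection that moves a to the right of the tensor sign, after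
  which the second homotopy strips abar; this is the extra term for \<open>r = n\<close>.\<close>

definition hom_s :: "nat \<Rightarrow> int \<times> int \<Rightarrow> 'k lam \<Rightarrow> 'k res" where
  "hom_s n p w = Y (Suc n) (ab (fst p - 1)) (fst p - 1) (snd p) w \<oplus>\<^bsub>R (Suc n)\<^esub>
     (if snd p = int n then Y (Suc n) (ee (fst p)) (fst p) (int n + 1) (aa (fst p - int n - 1) \<otimes>\<^bsub>L\<^esub> w)
      else \<zero>\<^bsub>R (Suc n)\<^esub>)"

definition homotopy :: "nat \<Rightarrow> 'k res \<Rightarrow> 'k res" where
  "homotopy n = PS.ind n (R (Suc n)) (\<lambda>p v w.
     scale L (R (Suc n)) (co v (fst p - 1) BA) (hom_a n p w) \<oplus>\<^bsub>R (Suc n)\<^esub>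
     (scale L (R (Suc n)) (co v (fst p + 1) BB) (hom_b n p w) \<oplus>\<^bsub>R (Suc n)\<^esub>
      scale L (R (Suc n)) (co v (fst p) BS) (hom_s n p w)))"

lemma homotopy_bilinear: "PS.bilinear_map n (R (Suc n)) (\<lambda>p v w.
     scale L (R (Suc n)) (co v (fst p - 1) BA) (hom_a n p w) \<oplus>\<^bsub>R (Suc n)\<^esub>
     (scale L (R (Suc n)) (co v (fst p + 1) BB) (hom_b n p w) \<oplus>\<^bsub>R (Suc n)\<^esub>
      scale L (R (Suc n)) (co v (fst p) BS) (hom_s n p w)))"
  by (intro PS.bilinear_map_add PS.bilinear_map_tensor R_bimodule)
    (simp_all add: co_add co_smult hom_a_def hom_b_def hom_s_def Y_add_right Y_smult_right
      L.r_distr L.smult_mult_right R.sc_add R.M.a_ac)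

lemma homotopy_in: "homotopy n x \<in> carrier (R (Suc n))"
  unfolding homotopy_def by (rule PS.ind_closed[OF R_bimodule homotopy_bilinear])

lemma homotopy_add: "homotopy n (x \<oplus>\<^bsub>R n\<^esub> y) = homotopy n x \<oplus>\<^bsub>R (Suc n)\<^esub> homotopy n y"
  using PS.ind_add[OF R_bimodule homotopy_bilinear] unfolding homotopy_def R_eq[of n] .

lemma homotopy_zero [simp]: "homotopy n \<zero>\<^bsub>R n\<^esub> = \<zero>\<^bsub>R (Suc n)\<^esub>"
  using homotopy_add[of n "\<zero>\<^bsub>R n\<^esub>" "\<zero>\<^bsub>R n\<^esub>"] homotopy_in[of n "\<zero>\<^bsub>R n\<^esub>"] by simp

lemma Y_elt:
  assumes r: "0 \<le> r" "r \<le> int n" and v: "v \<in> carrier L" "v \<otimes>\<^bsub>L\<^esub> ee i = v" and w: "w \<in> carrier L"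
  shows "Y n v i r w = PS.elt n (i mod M, r) v (ee (i + int n - 2 * r) \<otimes>\<^bsub>L\<^esub> w)"
  using r v w by (simp add: Y_def G_gn R_eq PS.ract_elt PS.lact_elt index_in fv_shift)

lemma V_iff: "v \<in> left_ideal_of L (ee i) \<longleftrightarrow> v \<in> carrier L \<and> v \<otimes>\<^bsub>L\<^esub> ee i = v"
proof
  assume "v \<in> left_ideal_of L (ee i)"
  then show "v \<in> carrier L \<and> v \<otimes>\<^bsub>L\<^esub> ee i = v" by (auto simp: left_ideal_of_def L.m_assoc)
next
  assume "v \<in> carrier L \<and> v \<otimes>\<^bsub>L\<^esub> ee i = v"
  then show "v \<in> left_ideal_of L (ee i)" unfolding left_ideal_of_def by (metis imageI)
qed

lemma W_iff: "v \<in> right_ideal_of L (ee i) \<longleftrightarrow> v \<in> carrier L \<and> ee i \<otimes>\<^bsub>L\<^esub> v = v"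
proof
  assume "v \<in> right_ideal_of L (ee i)"
  then show "v \<in> carrier L \<and> ee i \<otimes>\<^bsub>L\<^esub> v = v" by (auto simp: right_ideal_of_def simp flip: L.m_assoc)
next
  assume "v \<in> carrier L \<and> ee i \<otimes>\<^bsub>L\<^esub> v = v"
  then show "v \<in> right_ideal_of L (ee i)" unfolding right_ideal_of_def by (metis imageI)
qed

lemma Y_mod: "Y n b (i mod M) r w = Y n b i r w" "Y n b (i mod M + k) r w = Y n b (i + k) r w"
  using G_mod[of n "i mod M + k" r] G_mod[of n "i + k" r] by (simp_all add: Y_def G_mod mod_add_left_eq)

lemma elem_shift: "ee (i mod M + k) = ee (i + k)" "aa (i mod M + k) = aa (i + k)" "ab (i mod M + k) = ab (i + k)"
  using elem_mod(1-3)[of "i mod M + k"] elem_mod(1-3)[of "i + k"] by (simp_all add: mod_add_left_eq)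

text \<open>The right factor is replaced by its component at the target of the generator, and
  \<open>i\<close> by its residue; neither affects the three terms.\<close>

lemma homotopy_Y:
  assumes r: "0 \<le> r" "r \<le> int n" and v: "v \<in> carrier L" "v \<otimes>\<^bsub>L\<^esub> ee i = v" and w: "w \<in> carrier L"
  shows "homotopy n (Y n v i r w) =
    scale L (R (Suc n)) (co v (i - 1) BA) (hom_a n (i, r) w) \<oplus>\<^bsub>R (Suc n)\<^esub>
     (scale L (R (Suc n)) (co v (i + 1) BB) (hom_b n (i, r) w) \<oplus>\<^bsub>R (Suc n)\<^esub>
      scale L (R (Suc n)) (co v i BS) (hom_s n (i, r) w))"
proof -
  let ?w = "ee (i + int n - 2 * r) \<otimes>\<^bsub>L\<^esub> w"
  have co: "co v (i mod M + k) t = co v (i + k) t" for k t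
    using co_periodic[of v "i mod M + k" t] co_periodic[of v "i + k" t] by (simp add: mod_add_left_eq)
  have a: "aa (i - int n - 1) \<otimes>\<^bsub>L\<^esub> ee (i - int n) = aa (i - int n - 1)"
    using elem_table(3)[of "i - int n - 1"] by simp
  have "hom_a n (i mod M, r) ?w = hom_a n (i, r) w"
    using w Y_mod(2)[where k = "-1"] elem_shift(1)[of i "-1"] by (simp add: hom_a_def Y_e')
  moreover have "hom_b n (i mod M, r) ?w = hom_b n (i, r) w"
    using w Y_mod(2)[where k = 1] elem_shift(1)[of i 1] by (simp add: hom_b_def Y_e')
  moreover have "hom_s n (i mod M, r) ?w = hom_s n (i, r) w"
    using w Y_mod(2)[where k = "-1"] elem_shift(3)[of i "-1"] elem_shift(2)[of i "- int n - 1"]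
    by (simp add: hom_s_def Y_e' Y_mod a add_diff_eq flip: L.m_assoc)
  moreover have "homotopy n (PS.elt n (i mod M, r) v ?w) =
    scale L (R (Suc n)) (co v (i mod M - 1) BA) (hom_a n (i mod M, r) ?w) \<oplus>\<^bsub>R (Suc n)\<^esub>
     (scale L (R (Suc n)) (co v (i mod M + 1) BB) (hom_b n (i mod M, r) ?w) \<oplus>\<^bsub>R (Suc n)\<^esub>
      scale L (R (Suc n)) (co v (i mod M) BS) (hom_s n (i mod M, r) ?w))"
  proof -
    have "v \<in> left_ideal_of L (ee (fst (i mod M, r)))" using v by (simp add: V_iff)
    moreover have "?w \<in> right_ideal_of L (ee (fst (i mod M, r) + int n - 2 * snd (i mod M, r)))"
      using w by (simp add: W_iff fv_shift flip: L.m_assoc)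
    ultimately show ?thesis
      unfolding homotopy_def using PS.ind_elt[OF R_bimodule homotopy_bilinear index_in[OF r]] by simp
  qed
  ultimately show ?thesis
    using Y_elt[OF r v w] co[of "-1" BA] co[of 1 BB] co[of 0 BS] by simp
qed

lemma elem_table' [simp]:
  "aa (i - 1) \<otimes>\<^bsub>L\<^esub> ee i = aa (i - 1)" "ee i \<otimes>\<^bsub>L\<^esub> ab (i - 1) = ab (i - 1)"
  "aa (i - 1) \<otimes>\<^bsub>L\<^esub> aa i = \<zero>\<^bsub>L\<^esub>" "aa i \<otimes>\<^bsub>L\<^esub> aa (i + 1) = \<zero>\<^bsub>L\<^esub>" "ab i \<otimes>\<^bsub>L\<^esub> ab (i - 1) = \<zero>\<^bsub>L\<^esub>"
  "ss i \<otimes>\<^bsub>L\<^esub> ab (i - 1) = \<zero>\<^bsub>L\<^esub>"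
  using elem_table(3,4,11)[of "i - 1"] aa_aa[of "i - 1"] aa_aa[of i] ab_ab[of i] by simp_all

lemma homotopy_e: "w \<in> carrier L \<Longrightarrow> homotopy n (Y n (ee i) i r w) = \<zero>\<^bsub>R (Suc n)\<^esub>"
  by (cases "0 \<le> r \<and> r \<le> int n") (simp_all add: homotopy_Y Y_out hom_a_def hom_b_def hom_s_def)

text \<open>The exception \<open>r = n + 1\<close> comes from the different ranges: there is no such
  generator in degree \<open>n\<close>, whereas the one on the right exists in degree
  \<open>n + 1\<close>.\<close>

lemma homotopy_a: "w \<in> carrier L \<Longrightarrow> homotopy n (Y n (aa (i - 1)) i r w) =
    (if r = int n + 1 then \<zero>\<^bsub>R (Suc n)\<^esub> else Y (Suc n) (ee (i - 1)) (i - 1) r w)"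
  by (cases "0 \<le> r \<and> r \<le> int n") (auto simp: homotopy_Y Y_out hom_a_def hom_b_def hom_s_def)

lemma homotopy_b: "w \<in> carrier L \<Longrightarrow> homotopy n (Y n (ab i) i r w) =
    (if r = int n then Y (Suc n) (ee (i + 1)) (i + 1) (int n + 1) w else \<zero>\<^bsub>R (Suc n)\<^esub>)"
  by (cases "0 \<le> r \<and> r \<le> int n") (auto simp: homotopy_Y Y_out hom_a_def hom_b_def hom_s_def)

lemma homotopy_s: "w \<in> carrier L \<Longrightarrow> homotopy n (Y n (ss i) i r w) =
    (if r = int n + 1 then \<zero>\<^bsub>R (Suc n)\<^esub> else Y (Suc n) (ab (i - 1)) (i - 1) r w \<oplus>\<^bsub>R (Suc n)\<^esub>
     (if r = int n then Y (Suc n) (ee i) i (int n + 1) (aa (i - int n - 1) \<otimes>\<^bsub>L\<^esub> w) else \<zero>\<^bsub>R (Suc n)\<^esub>))"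
  by (cases "0 \<le> r \<and> r \<le> int n") (auto simp: homotopy_Y Y_out hom_a_def hom_b_def hom_s_def)

lemma homotopy_a': "w \<in> carrier L \<Longrightarrow> homotopy n (Y n (aa i) (i + 1) r w) =
    (if r = int n + 1 then \<zero>\<^bsub>R (Suc n)\<^esub> else Y (Suc n) (ee i) i r w)"
  using homotopy_a[of w n "i + 1" r] by simp

text \<open>Index equations appear as premises, so that the multiplication table still applies after
  arithmetic has rearranged the indices.\<close>

lemma elem_table_arith:
  "j = i + 1 \<Longrightarrow> ee j \<otimes>\<^bsub>L\<^esub> ab i = ab i" "j = i - 1 \<Longrightarrow> ab i \<otimes>\<^bsub>L\<^esub> ab j = \<zero>\<^bsub>L\<^esub>"
  "j = i + 1 \<Longrightarrow> w \<in> carrier L \<Longrightarrow> aa i \<otimes>\<^bsub>L\<^esub> (aa j \<otimes>\<^bsub>L\<^esub> w) = \<zero>\<^bsub>L\<^esub>"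
  "w \<in> carrier L \<Longrightarrow> aa i \<otimes>\<^bsub>L\<^esub> (ab i \<otimes>\<^bsub>L\<^esub> w) = ss i \<otimes>\<^bsub>L\<^esub> w"
  "w \<in> carrier L \<Longrightarrow> ab i \<otimes>\<^bsub>L\<^esub> (aa i \<otimes>\<^bsub>L\<^esub> w) = ss (i + 1) \<otimes>\<^bsub>L\<^esub> w"
  "j = i + 1 \<Longrightarrow> w \<in> carrier L \<Longrightarrow> homotopy n (Y n (aa i) j r w) =
    (if r = int n + 1 then \<zero>\<^bsub>R (Suc n)\<^esub> else Y (Suc n) (ee i) i r w)"
  by (simp_all add: homotopy_a' flip: L.m_assoc)

lemmas homotopy_simps = Y_out elem_table_arith homotopy_e homotopy_a homotopy_a' homotopy_b homotopy_s dd_Y homotopy_add dd_add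
  R.M.a_ac L.m_assoc

text \<open>As the homotopy ignores the left action, \<open>d h + h d = id\<close> must be verified
  for each of the four left factors. The terms other than the given element vanish or cancel in
  pairs in characteristic 2.\<close>

lemma contract_e:
  assumes r: "0 \<le> r" "r \<le> int (Suc k)" and w: "w \<in> carrier L"
  shows "dd (Suc k) (homotopy (Suc k) (Y (Suc k) (ee i) i r w)) \<oplus>\<^bsub>R (Suc k)\<^esub>
    homotopy k (dd k (Y (Suc k) (ee i) i r w)) = Y (Suc k) (ee i) i r w"
  using assms by (auto simp: homotopy_simps algebra_simps)

lemma contract_a:
  assumes r: "0 \<le> r" "r \<le> int (Suc k)" and w: "w \<in> carrier L"
  shows "dd (Suc k) (homotopy (Suc k) (Y (Suc k) (aa (i - 1)) i r w)) \<oplus>\<^bsub>R (Suc k)\<^esub>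
    homotopy k (dd k (Y (Suc k) (aa (i - 1)) i r w)) = Y (Suc k) (aa (i - 1)) i r w"
  using assms by (auto simp: homotopy_simps algebra_simps)

lemma contract_b:
  assumes r: "0 \<le> r" "r \<le> int (Suc k)" and w: "w \<in> carrier L"
  shows "dd (Suc k) (homotopy (Suc k) (Y (Suc k) (ab i) i r w)) \<oplus>\<^bsub>R (Suc k)\<^esub>
    homotopy k (dd k (Y (Suc k) (ab i) i r w)) = Y (Suc k) (ab i) i r w"
  using assms by (auto simp: homotopy_simps algebra_simps)

lemma contract_s:
  assumes r: "0 \<le> r" "r \<le> int (Suc k)" and w: "w \<in> carrier L"
  shows "dd (Suc k) (homotopy (Suc k) (Y (Suc k) (ss i) i r w)) \<oplus>\<^bsub>R (Suc k)\<^esub>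
    homotopy k (dd k (Y (Suc k) (ss i) i r w)) = Y (Suc k) (ss i) i r w"
  using assms by (auto simp: homotopy_simps algebra_simps)

end

context lambda1_char2
begin

text \<open>Scalars move into the right factor. This leaves as left factors the four basis elements
  with target \<open>i\<close>, those at which the homotopy has been computed.\<close>

lemma R_induct [consumes 1, case_names zero basis add]:
  assumes x: "x \<in> carrier (R n)" and zero: "\<Phi> \<zero>\<^bsub>R n\<^esub>"
    and basis: "\<And>b i r w. 0 \<le> r \<Longrightarrow> r \<le> int n \<Longrightarrow> w \<in> carrier L \<Longrightarrow> b \<in> {ee i, aa (i - 1), ab i, ss i} \<Longrightarrow>
      \<Phi> (Y n b i r w)"
    and add: "\<And>x y. x \<in> carrier (R n) \<Longrightarrow> y \<in> carrier (R n) \<Longrightarrow> \<Phi> x \<Longrightarrow> \<Phi> y \<Longrightarrow> \<Phi> (x \<oplus>\<^bsub>R n\<^esub> y)"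
  shows "\<Phi> x"
  using x unfolding R_eq
proof (induction rule: PS.P_induct)
  case (elt p v w)
  obtain i r where p: "p = (i, r)" by (cases p)
  then have ir: "0 \<le> i" "i < M" "0 \<le> r" "r \<le> int n" using elt(1) by (auto simp: res_index_def)
  have v: "v \<in> carrier L" "v \<otimes>\<^bsub>L\<^esub> ee i = v" using elt(2) by (simp_all add: V_iff p)
  have w: "w \<in> carrier L" "ee (i + int n - 2 * r) \<otimes>\<^bsub>L\<^esub> w = w" using elt(3) by (simp_all add: W_iff p)
  have "PS.elt n p v w = Y n v i r w"
    using Y_elt[OF ir(3,4) v w(1)] ir w(2) by (simp add: p)
  moreover have "\<Phi> (Y n v i r w)"
  proof -
    let ?b = "\<lambda>c b. Y n b i r (c \<odot>\<^bsub>L\<^esub> w)"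
    have eq: "Y n v i r w = ?b (co v i BE) (ee i) \<oplus>\<^bsub>R n\<^esub> ?b (co v (i - 1) BA) (aa (i - 1)) \<oplus>\<^bsub>R n\<^esub>
        (?b (co v (i + 1) BB) (ab i) \<oplus>\<^bsub>R n\<^esub> ?b (co v i BS) (ss i))"
      using w(1) by (subst left_expand[OF v])
        (simp add: Y_add_left Y_smult_left Y_smult_right L.smult_in)
    show ?thesis
      unfolding eq
      by (intro assms(4) basis R.M.a_closed Y_in) (simp_all add: L.smult_in ir w(1))
  qed
  ultimately show ?case by (simp only:)
next
  case zero
  then show ?case using assms(2) by (simp only: R_eq)
next
  case (add x y)
  then show ?case by (rule assms(4)[unfolded R_eq])
qed

lemma contract:
  assumes "x \<in> carrier (R (Suc k))"
  shows "dd (Suc k) (homotopy (Suc k) x) \<oplus>\<^bsub>R (Suc k)\<^esub> homotopy k (dd k x) = x"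
  using assms
proof (induction rule: R_induct)
  case (basis b i r w)
  then have "b = ee i \<or> b = aa (i - 1) \<or> b = ab i \<or> b = ss i" by simp
  then show ?case
    by (elim disjE) (simp_all only: contract_e[OF basis(1-3)] contract_a[OF basis(1-3)]
        contract_b[OF basis(1-3)] contract_s[OF basis(1-3)])
next
  case (add x y)
  let ?D = "\<lambda>x. dd (Suc k) (homotopy (Suc k) x)" and ?E = "\<lambda>x. homotopy k (dd k x)"
  have in': "?D x \<in> carrier (R (Suc k))" "?D y \<in> carrier (R (Suc k))" "?E x \<in> carrier (R (Suc k))"
      "?E y \<in> carrier (R (Suc k))"
    by (simp_all add: dd_in homotopy_in)
  have "?D (x \<oplus>\<^bsub>R (Suc k)\<^esub> y) \<oplus>\<^bsub>R (Suc k)\<^esub> ?E (x \<oplus>\<^bsub>R (Suc k)\<^esub> y) =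
      (?D x \<oplus>\<^bsub>R (Suc k)\<^esub> ?E x) \<oplus>\<^bsub>R (Suc k)\<^esub> (?D y \<oplus>\<^bsub>R (Suc k)\<^esub> ?E y)"
    using add in' by (simp add: dd_add homotopy_add homotopy_in R.M.a_ac)
  then show ?case using add by simp
qed simp

section \<open>Augmentation, exactness and lifting\<close>

abbreviation aug :: "'k res \<Rightarrow> 'k lam" where "aug \<equiv> res_aug m"

lemma aug_hom: "aug \<in> bimod_hom L (R 0) (regular_bimod L)"
  and aug_G: "aug (G 0 i 0) = ee i"
proof -
  note hom = hom_of_gens[OF L.bimodule_regular, where n = 0 and h = "\<lambda>i r. ee i"]
  show "aug \<in> bimod_hom L (R 0) (regular_bimod L)"
    unfolding res_aug_def by (rule hom(1)) simp
  have "aug (G 0 (i mod M) 0) = ee (i mod M)"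
    unfolding res_aug_def by (rule hom(2)) (use m3 in simp_all)
  then show "aug (G 0 i 0) = ee i" by (simp add: G_mod)
qed

lemma aug_add: "x \<in> carrier (R 0) \<Longrightarrow> y \<in> carrier (R 0) \<Longrightarrow> aug (x \<oplus>\<^bsub>R 0\<^esub> y) = aug x \<oplus>\<^bsub>L\<^esub> aug y"
  using bimod_homD(2)[OF aug_hom] by simp

lemma aug_in: "x \<in> carrier (R 0) \<Longrightarrow> aug x \<in> carrier L"
  using bimod_homD(1)[OF aug_hom] by simp

lemma RA_pair: "bimodule_pair L (R n) (regular_bimod L)"
  by (rule L.bimodule_pairI[OF R_bimodule L.bimodule_regular])

lemma aug_zero [simp]: "aug \<zero>\<^bsub>R 0\<^esub> = \<zero>\<^bsub>L\<^esub>"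
  using bimodule_pair.hom_zero[OF RA_pair aug_hom] by simp

lemma aug_Y: "b \<in> carrier L \<Longrightarrow> w \<in> carrier L \<Longrightarrow> aug (Y 0 b i 0 w) = b \<otimes>\<^bsub>L\<^esub> (ee i \<otimes>\<^bsub>L\<^esub> w)"
  by (simp add: Y_def bimod_homD[OF aug_hom] aug_G)

text \<open>The section \<open>y \<mapsto> 1 \<otimes> y\<close> of the multiplication, with 1 split
  into vertices. It is linear on the right and continues the homotopy to degree -1.\<close>

definition sec :: "'k lam \<Rightarrow> 'k res" where
  "sec y = (\<Oplus>\<^bsub>R 0\<^esub>i\<in>{0..<M}. Y 0 (ee i) i 0 y)"

lemma sec_in: "y \<in> carrier L \<Longrightarrow> sec y \<in> carrier (R 0)"
  by (simp add: sec_def Pi_def)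

lemma sec_add: "y \<in> carrier L \<Longrightarrow> z \<in> carrier L \<Longrightarrow> sec (y \<oplus>\<^bsub>L\<^esub> z) = sec y \<oplus>\<^bsub>R 0\<^esub> sec z"
  unfolding sec_def by (rule R.M.finsum_eq_add) (simp_all add: Y_add_right)

lemma sec_zero [simp]: "sec \<zero>\<^bsub>L\<^esub> = \<zero>\<^bsub>R 0\<^esub>"
  unfolding sec_def by (rule R.M.add.finprod_one_eqI) simp

lemma ee_ee: "ee i \<otimes>\<^bsub>L\<^esub> ee j = (if i mod M = j mod M then ee j else \<zero>\<^bsub>L\<^esub>)"
  by (rule elem_eqI) (auto simp: co_mult)

text \<open>Vertices are orthogonal idempotents, so only the summand at the source of
  \<open>b\<close> survives.\<close>

lemma sec_start:
  assumes b: "b \<in> carrier L" "ee j \<otimes>\<^bsub>L\<^esub> b = b"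
  shows "sec b = Y 0 (ee j) j 0 b"
proof -
  have "Y 0 (ee i) i 0 b = (if j mod M = i then Y 0 (ee j) j 0 b else \<zero>\<^bsub>R 0\<^esub>)" if "i \<in> {0..<M}" for i
  proof -
    have i: "i mod M = i" using that by simp
    have "Y 0 (ee i) i 0 b = Y 0 (ee i) i 0 (ee i \<otimes>\<^bsub>L\<^esub> (ee j \<otimes>\<^bsub>L\<^esub> b))"
      using b by (simp add: Y_e')
    also have "\<dots> = Y 0 (ee i) i 0 ((ee i \<otimes>\<^bsub>L\<^esub> ee j) \<otimes>\<^bsub>L\<^esub> b)"
      using b(1) by (simp add: L.m_assoc)
    also have "\<dots> = (if j mod M = i then Y 0 (ee j) j 0 b else \<zero>\<^bsub>R 0\<^esub>)"
      using b Y_mod(1)[of 0 "ee j" j 0 b] elem_mod(1)[of j] by (auto simp: ee_ee i)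
    finally show ?thesis .
  qed
  then have "sec b = (\<Oplus>\<^bsub>R 0\<^esub>i\<in>{0..<M}. if j mod M = i then Y 0 (ee j) j 0 b else \<zero>\<^bsub>R 0\<^esub>)"
    unfolding sec_def using b by (intro R.M.finsum_cong') auto
  also have "\<dots> = Y 0 (ee j) j 0 b"
    using b m3 by (intro R.M.finsum_singleton) auto
  finally show ?thesis .
qed

lemma aug_sec: assumes y: "y \<in> carrier L" shows "aug (sec y) = y"
proof -
  have "aug (sec y) = (\<Oplus>\<^bsub>L\<^esub>i\<in>{0..<M}. ee i \<otimes>\<^bsub>L\<^esub> y)"
  proof -
    have "aug (sec y) = (\<Oplus>\<^bsub>regular_bimod L\<^esub>i\<in>{0..<M}. aug (Y 0 (ee i) i 0 y))"
      unfolding sec_def using y by (intro bimodule_pair.hom_finsum[OF RA_pair aug_hom]) simp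
    also have "\<dots> = (\<Oplus>\<^bsub>L\<^esub>i\<in>{0..<M}. aug (Y 0 (ee i) i 0 y))"
      by (simp add: finsum_def finprod_def)
    also have "\<dots> = (\<Oplus>\<^bsub>L\<^esub>i\<in>{0..<M}. ee i \<otimes>\<^bsub>L\<^esub> y)"
      using y by (intro L.finsum_cong') (simp_all add: aug_Y flip: L.m_assoc)
    finally show ?thesis .
  qed
  also have "\<dots> = y"
  proof (rule L_eqI)
    fix j t
    have co_sum: "co (\<Oplus>\<^bsub>L\<^esub>i\<in>S. ee i \<otimes>\<^bsub>L\<^esub> y) j t = (\<Sum>i\<in>S. co (ee i \<otimes>\<^bsub>L\<^esub> y) j t)" if "finite S" for S
      using that by (induction S) (simp_all add: co_add y Pi_def)
    have "co (ee i \<otimes>\<^bsub>L\<^esub> y) j t = (if j mod M = i then co y j t else 0)" if "i \<in> {0..<M}" for i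
      using that y by (cases t) (auto simp: co_mult)
    then have "co (\<Oplus>\<^bsub>L\<^esub>i\<in>{0..<M}. ee i \<otimes>\<^bsub>L\<^esub> y) j t = (\<Sum>i\<in>{0..<M}. if j mod M = i then co y j t else 0)"
      unfolding co_sum[OF finite_atLeastLessThan_int] by (intro sum.cong) auto
    also have "\<dots> = co y j t" using m3 by simp
    finally show "co (\<Oplus>\<^bsub>L\<^esub>i\<in>{0..<M}. ee i \<otimes>\<^bsub>L\<^esub> y) j t = co y j t" .
  qed (simp_all add: y Pi_def)
  finally show ?thesis .
qed

lemma contract0:
  assumes "x \<in> carrier (R 0)"
  shows "dd 0 (homotopy 0 x) \<oplus>\<^bsub>R 0\<^esub> sec (aug x) = x"
  using assms
proof (induction rule: R_induct)
  case (basis b i r w)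
  have r: "r = 0" using basis by simp
  have start: "sec (b \<otimes>\<^bsub>L\<^esub> w) = Y 0 (ee j) j 0 (b \<otimes>\<^bsub>L\<^esub> w)" if "b \<in> carrier L" "ee j \<otimes>\<^bsub>L\<^esub> b = b" for j b
    using that basis(3) by (intro sec_start) (simp_all flip: L.m_assoc)
  have w: "w \<in> carrier L" using basis(3) .
  from basis(4) consider "b = ee i" | "b = aa (i - 1)" | "b = ab i" | "b = ss i" by blast
  then show ?case
  proof cases
    case 1
    then show ?thesis
      using w start[of "ee i" i] by (simp add: r homotopy_simps aug_Y Y_e' flip: L.m_assoc)
  next
    case 2
    have "aug (Y 0 b i 0 w) = aa (i - 1) \<otimes>\<^bsub>L\<^esub> w"
      using w by (simp add: 2 aug_Y flip: L.m_assoc)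
    then show ?thesis
      using w start[of "aa (i - 1)" "i - 1"] by (simp add: r 2 homotopy_simps)
  next
    case 3
    have "aug (Y 0 b i 0 w) = ab i \<otimes>\<^bsub>L\<^esub> w"
      using w by (simp add: 3 aug_Y flip: L.m_assoc)
    then show ?thesis
      using w start[of "ab i" "i + 1"] by (simp add: r 3 homotopy_simps)
  next
    case 4
    have "aug (Y 0 b i 0 w) = ss i \<otimes>\<^bsub>L\<^esub> w"
      using w by (simp add: 4 aug_Y flip: L.m_assoc)
    then show ?thesis
      using w start[of "ss i" i] elem_table_arith(5)[of w "i - 1"] by (simp add: r 4 homotopy_simps)
  qed
next
  case (add x y)
  let ?D = "\<lambda>x. dd 0 (homotopy 0 x)" and ?E = "\<lambda>x. sec (aug x)"
  have in': "?D x \<in> carrier (R 0)" "?D y \<in> carrier (R 0)" "?E x \<in> carrier (R 0)" "?E y \<in> carrier (R 0)"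
    using add by (simp_all add: dd_in homotopy_in sec_in aug_in)
  have "?D (x \<oplus>\<^bsub>R 0\<^esub> y) \<oplus>\<^bsub>R 0\<^esub> ?E (x \<oplus>\<^bsub>R 0\<^esub> y) = (?D x \<oplus>\<^bsub>R 0\<^esub> ?E x) \<oplus>\<^bsub>R 0\<^esub> (?D y \<oplus>\<^bsub>R 0\<^esub> ?E y)"
    using add in' by (simp add: dd_add homotopy_add homotopy_in aug_add sec_add aug_in R.M.a_ac)
  then show ?case using add by simp
qed simp

text \<open>This is what deduces \<open>d d = 0\<close> from the contraction identity: a bimodule
  homomorphism that vanishes on the image of the homotopy vanishes on all generators, hence
  everywhere.\<close>

lemma homotopy_gens: "0 \<le> r \<Longrightarrow> r \<le> int (Suc n) \<Longrightarrow> \<exists>y\<in>carrier (R n). G (Suc n) i r = homotopy n y"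
proof (cases "r = int n + 1")
  case True
  let ?w = "ee (i + int (Suc n) - 2 * r)"
  have "homotopy n (Y n (ab (i - 1)) (i - 1) (int n) ?w) = Y (Suc n) (ee i) i r ?w"
    by (simp add: homotopy_b True)
  then show ?thesis unfolding G_Y by (intro bexI[of _ "Y n (ab (i - 1)) (i - 1) (int n) ?w"]) simp_all
next
  case False
  let ?w = "ee (i + int (Suc n) - 2 * r)"
  have "homotopy n (Y n (aa i) (i + 1) r ?w) = Y (Suc n) (ee i) i r ?w"
    by (simp add: homotopy_a' False)
  then show ?thesis unfolding G_Y by (intro bexI[of _ "Y n (aa i) (i + 1) r ?w"]) simp_all
qed

lemma hom_zero_gens:
  assumes N: "bimodule L N" and f: "f \<in> bimod_hom L (R n) N"
    and z: "\<And>i r. 0 \<le> r \<Longrightarrow> r \<le> int n \<Longrightarrow> f (G n i r) = \<zero>\<^bsub>N\<^esub>" and x: "x \<in> carrier (R n)"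
  shows "f x = \<zero>\<^bsub>N\<^esub>"
proof -
  interpret N: bimodule_over L N by (rule L.bimodule_overI[OF N])
  show ?thesis using x
  proof (induction rule: R_induct)
    case zero
    then show ?case by (rule bimodule_pair.hom_zero[OF L.bimodule_pairI[OF R_bimodule N] f])
  next
    case (basis b i r w)
    then have "b \<in> carrier L" by auto
    then show ?case using basis by (simp add: Y_def bimod_homD[OF f] z)
  next
    case (add x y)
    then show ?case by (simp add: bimod_homD[OF f])
  qed
qed

lemma L_double: "x \<in> carrier L \<Longrightarrow> x \<oplus>\<^bsub>L\<^esub> x = \<zero>\<^bsub>L\<^esub>"
  using L.smult_add_left[of x 1 1] unfolding two_zero by (simp add: L.smult_1 L.smult_zero_scalar)

text \<open>The contraction identities with one term moved across; in characteristic 2 this costs no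
  sign.\<close>

lemma dd0_homotopy: "y \<in> carrier (R 0) \<Longrightarrow> dd 0 (homotopy 0 y) = y \<oplus>\<^bsub>R 0\<^esub> sec (aug y)"
  and dd_homotopy: "x \<in> carrier (R (Suc n)) \<Longrightarrow>
    dd (Suc n) (homotopy (Suc n) x) = x \<oplus>\<^bsub>R (Suc n)\<^esub> homotopy n (dd n x)"
proof -
  have *: "a = c \<oplus>\<^bsub>R n\<^esub> b" if "a \<oplus>\<^bsub>R n\<^esub> b = c" "a \<in> carrier (R n)" "b \<in> carrier (R n)" for a b c n
    using that by (auto simp: R.M.a_assoc)
  show "y \<in> carrier (R 0) \<Longrightarrow> dd 0 (homotopy 0 y) = y \<oplus>\<^bsub>R 0\<^esub> sec (aug y)"
    by (rule *[OF contract0]) (simp_all add: dd_in homotopy_in sec_in aug_in)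
  show "x \<in> carrier (R (Suc n)) \<Longrightarrow>
    dd (Suc n) (homotopy (Suc n) x) = x \<oplus>\<^bsub>R (Suc n)\<^esub> homotopy n (dd n x)"
    by (rule *[OF contract]) (simp_all add: dd_in homotopy_in)
qed

text \<open>On a generator \<open>h y\<close> the contraction identity gives
  \<open>aug y + aug (sec (aug y))\<close>, which is twice \<open>aug y\<close> and thus
  zero.\<close>

lemma aug_dd: assumes "x \<in> carrier (R (Suc 0))" shows "aug (dd 0 x) = \<zero>\<^bsub>L\<^esub>"
proof -
  let ?f = "\<lambda>x\<in>carrier (R (Suc 0)). aug (dd 0 x)"
  have f: "?f \<in> bimod_hom L (R (Suc 0)) (regular_bimod L)"
    by (rule L.comp_hom[OF R_bimodule res_diff_hom aug_hom])
  have "?f x = \<zero>\<^bsub>regular_bimod L\<^esub>"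
  proof (rule hom_zero_gens[OF L.bimodule_regular f _ assms])
    fix i r assume "0 \<le> r" "r \<le> int (Suc 0)"
    then obtain y where "y \<in> carrier (R 0)" "G (Suc 0) i r = homotopy 0 y" using homotopy_gens by blast
    then show "?f (G (Suc 0) i r) = \<zero>\<^bsub>regular_bimod L\<^esub>"
      by (simp add: homotopy_in dd0_homotopy aug_add sec_in aug_in aug_sec L_double)
  qed
  then show ?thesis using assms by simp
qed

text \<open>On a generator \<open>h y\<close> the contraction identity gives
  \<open>d d h y = d y + d h d y\<close>, and by \<open>H\<close> this is twice \<open>d y\<close>.
  The hypothesis \<open>H\<close> itself follows from the vanishing of the composite one degree
  lower, starting with \<open>aug_dd\<close>, so the two alternate in an induction.\<close>

lemma dd_dd_step:
  assumes x: "x \<in> carrier (R (Suc (Suc n)))"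
    and H: "\<And>y. y \<in> carrier (R (Suc n)) \<Longrightarrow> dd n (homotopy n (dd n y)) = dd n y"
  shows "dd n (dd (Suc n) x) = \<zero>\<^bsub>R n\<^esub>"
proof -
  let ?f = "\<lambda>x\<in>carrier (R (Suc (Suc n))). dd n (dd (Suc n) x)"
  have f: "?f \<in> bimod_hom L (R (Suc (Suc n))) (R n)"
    by (rule L.comp_hom[OF R_bimodule res_diff_hom res_diff_hom])
  have "?f x = \<zero>\<^bsub>R n\<^esub>"
  proof (rule hom_zero_gens[OF R_bimodule f _ x])
    fix i r assume "0 \<le> r" "r \<le> int (Suc (Suc n))"
    then obtain y where y: "y \<in> carrier (R (Suc n))" "G (Suc (Suc n)) i r = homotopy (Suc n) y"
      using homotopy_gens by blast
    then show "?f (G (Suc (Suc n)) i r) = \<zero>\<^bsub>R n\<^esub>"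
      by (simp add: homotopy_in dd_homotopy dd_add H dd_in)
  qed
  then show ?thesis using x by simp
qed

lemma dd_dd: "x \<in> carrier (R (Suc (Suc n))) \<Longrightarrow> dd n (dd (Suc n) x) = \<zero>\<^bsub>R n\<^esub>"
proof (induction n arbitrary: x)
  case 0
  then show ?case by (rule dd_dd_step) (simp add: dd_in dd0_homotopy aug_dd)
next
  case (Suc n)
  then show ?case by (intro dd_dd_step) (simp_all add: dd_in dd_homotopy Suc.IH)
qed

text \<open>For a cycle the contraction identity reads \<open>x = d (h x)\<close>; the same holds in
  higher degrees.\<close>

lemma exact0: assumes "x \<in> carrier (R 0)" "aug x = \<zero>\<^bsub>L\<^esub>" shows "x \<in> dd 0 ` carrier (R (Suc 0))"
  using dd0_homotopy[OF assms(1)] assms homotopy_in by (intro image_eqI[of _ _ "homotopy 0 x"]) simp_all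

lemma exact: assumes "x \<in> carrier (R (Suc n))" "dd n x = \<zero>\<^bsub>R n\<^esub>" shows "x \<in> dd (Suc n) ` carrier (R (Suc (Suc n)))"
  using dd_homotopy[OF assms(1)] assms homotopy_in by (intro image_eqI[of _ _ "homotopy (Suc n) x"]) simp_all

lemma resolution_simps:
  "cx_mod (resolution m) = R" "cx_diff (resolution m) = res_diff m" "cx_aug (resolution m) = aug"
  by (simp_all add: resolution_def)

theorem resolution_projective: "projective_bimodule_resolution L (resolution m)"
  unfolding projective_bimodule_resolution_def resolution_simps One_nat_def
proof (intro conjI allI)
  show "fg_projective_bimodule L (R n)" for n
    unfolding R_eq by (rule PS.fg_projective_P)
  show "aug ` carrier (R 0) = carrier L"
  proof
    show "carrier L \<subseteq> aug ` carrier (R 0)" by (metis aug_sec sec_in imageI subsetI)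
  qed (auto simp: aug_in)
  show "dd 0 ` carrier (R (Suc 0)) = {x \<in> carrier (R 0). aug x = \<zero>\<^bsub>L\<^esub>}"
    using exact0 aug_dd by (auto simp: dd_in)
  show "dd (Suc n) ` carrier (R (Suc (Suc n))) = {x \<in> carrier (R (Suc n)). dd n x = \<zero>\<^bsub>R n\<^esub>}" for n
    using exact dd_dd by (auto simp: dd_in)
qed (rule res_diff_hom aug_hom)+

text \<open>By \<open>PS.hom_lift\<close> it is enough that the images of the generators have
  preimages. In this form exactness yields the lifting properties.\<close>

lemma lift_gens:
  assumes M: "bimodule L N" and N: "bimodule L N'" and d: "d \<in> bimod_hom L N N'"
    and g: "g \<in> bimod_hom L (R n) N'" and im: "\<And>i r. g (G n i r) \<in> d ` carrier N"
  shows "\<exists>h\<in>bimod_hom L (R n) N. \<forall>x\<in>carrier (R n). d (h x) = g x"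
proof -
  have "g (PS.gn n p) \<in> d ` carrier N" if "p \<in> res_index m n" for p
  proof -
    obtain i r where "p = (i, r)" by (cases p)
    then have "PS.gn n p = G n i r" using that G_gn[of r n i] by (auto simp: res_index_def)
    then show ?thesis using im by simp
  qed
  from PS.hom_lift[OF M N d g[unfolded R_eq] this] show ?thesis unfolding R_eq by simp
qed

sublocale LC: lifting_complex L "resolution m"
proof (intro lifting_complex.intro lifting_complex_axioms.intro L.k_algebra_axioms; unfold resolution_simps)
  show "is_cycle L (resolution m) n (dd n x)" if "x \<in> carrier (R (Suc n))" for n x
    using that aug_dd[of x] dd_dd[of x]
    by (cases n) (simp_all only: is_cycle_def resolution_simps nat.case)
  show "\<exists>h\<in>bimod_hom L (R n) (R 0). \<forall>x\<in>carrier (R n). aug (h x) = f x"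
    if "f \<in> bimod_hom L (R n) (regular_bimod L)" for f n
  proof (rule lift_gens[OF R_bimodule L.bimodule_regular aug_hom that])
    fix i r
    have "f (G n i r) \<in> carrier L" using bimod_homD(1)[OF that G_in] by simp
    then show "f (G n i r) \<in> aug ` carrier (R 0)" by (metis aug_sec sec_in imageI)
  qed
  show "\<exists>h\<in>bimod_hom L (R n) (R (Suc j)). \<forall>x\<in>carrier (R n). dd j (h x) = g x"
    if g: "g \<in> bimod_hom L (R n) (R j)" and c: "\<And>x. x \<in> carrier (R n) \<Longrightarrow> is_cycle L (resolution m) j (g x)" for g n j
  proof (rule lift_gens[OF R_bimodule R_bimodule res_diff_hom g])
    fix i r
    have "g (G n i r) \<in> carrier (R j)" by (rule bimod_homD(1)[OF g G_in])
    then show "g (G n i r) \<in> dd j ` carrier (R (Suc j))"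
      using c[OF G_in] exact0 exact by (cases j) (simp_all only: is_cycle_def resolution_simps nat.case)
  qed
qed (rule R_bimodule res_diff_hom aug_hom)+

end

section \<open>Generators of the cohomology\<close>

context lambda1_char2
begin

abbreviation CC where "CC n \<equiv> cochains L (resolution m) n"
abbreviation ZZ where "ZZ n \<equiv> cocycles L (resolution m) n"
abbreviation hg where "hg n f \<equiv> homogeneous L (resolution m) n f"

lemma CC_hom: "f \<in> carrier (CC n) \<longleftrightarrow> f \<in> bimod_hom L (R n) (regular_bimod L)"
  by (simp add: LC.C_simps resolution_simps)

lemma CC_G:
  assumes f: "f \<in> carrier (CC n)"
  shows "f (G n i r) \<in> carrier L" "ee i \<otimes>\<^bsub>L\<^esub> f (G n i r) = f (G n i r)"
    "f (G n i r) \<otimes>\<^bsub>L\<^esub> ee (i + int n - 2 * r) = f (G n i r)"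
    "\<not> (0 \<le> r \<and> r \<le> int n) \<Longrightarrow> f (G n i r) = \<zero>\<^bsub>L\<^esub>"
proof -
  note h = f[unfolded CC_hom]
  show "f (G n i r) \<in> carrier L" using bimod_homD(1)[OF h G_in] by simp
  show "ee i \<otimes>\<^bsub>L\<^esub> f (G n i r) = f (G n i r)"
    using bimod_homD(3)[OF h elem_in(1)[of i] G_in[of n i r]] by (simp add: G_left)
  show "f (G n i r) \<otimes>\<^bsub>L\<^esub> ee (i + int n - 2 * r) = f (G n i r)"
    using bimod_homD(4)[OF h elem_in(1)[of "i + int n - 2 * r"] G_in[of n i r]] by (simp add: G_right)
  show "\<not> (0 \<le> r \<and> r \<le> int n) \<Longrightarrow> f (G n i r) = \<zero>\<^bsub>L\<^esub>"
    using bimodule_pair.hom_zero[OF RA_pair h] by (simp add: G_out)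
qed

lemma CC_Y:
  assumes f: "f \<in> carrier (CC n)" and "b \<in> carrier L" "w \<in> carrier L"
  shows "f (Y n b i r w) = b \<otimes>\<^bsub>L\<^esub> (f (G n i r) \<otimes>\<^bsub>L\<^esub> w)"
  using assms(2,3) by (simp add: Y_def bimod_homD[OF f[unfolded CC_hom]])

lemma R_hom_eqI:
  assumes "bimodule L N" "f \<in> bimod_hom L (R n) N" "g \<in> bimod_hom L (R n) N"
    and eq: "\<And>i r. 0 \<le> r \<Longrightarrow> r \<le> int n \<Longrightarrow> f (G n i r) = g (G n i r)"
  shows "f = g"
proof (rule PS.hom_unique[OF _ _ assms(1)])
  fix p assume "p \<in> res_index m n"
  moreover obtain i r where "p = (i, r)" by (cases p)
  ultimately show "f (PS.gn n p) = g (PS.gn n p)"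
    using eq[of r i] G_gn[of r n i] by (auto simp: res_index_def)
qed (use assms(2,3) in \<open>simp_all add: R_eq\<close>)

lemma CC_eqI:
  assumes "f \<in> carrier (CC n)" "g \<in> carrier (CC n)"
    and "\<And>i r. 0 \<le> r \<Longrightarrow> r \<le> int n \<Longrightarrow> f (G n i r) = g (G n i r)"
  shows "f = g"
  using R_hom_eqI[OF L.bimodule_regular assms(1,2)[unfolded CC_hom] assms(3)] .

lemma CC_dd:
  assumes f: "f \<in> carrier (CC n)"
  shows "f (dd n (G (Suc n) i r)) =
    f (G n i r) \<otimes>\<^bsub>L\<^esub> aa (i + int n - 2 * r) \<oplus>\<^bsub>L\<^esub> f (G n i (r - 1)) \<otimes>\<^bsub>L\<^esub> ab (i + int n + 1 - 2 * r) \<oplus>\<^bsub>L\<^esub>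
    (aa i \<otimes>\<^bsub>L\<^esub> f (G n (i + 1) r) \<oplus>\<^bsub>L\<^esub> ab (i - 1) \<otimes>\<^bsub>L\<^esub> f (G n (i - 1) (r - 1)))"
proof -
  have add: "f (x \<oplus>\<^bsub>R n\<^esub> y) = f x \<oplus>\<^bsub>L\<^esub> f y" if "x \<in> carrier (R n)" "y \<in> carrier (R n)" for x y
    using bimod_homD(2)[OF f[unfolded CC_hom] that] by simp
  have e: "ee i \<otimes>\<^bsub>L\<^esub> (f (G n i r) \<otimes>\<^bsub>L\<^esub> w) = f (G n i r) \<otimes>\<^bsub>L\<^esub> w" if "w \<in> carrier L" for i r w
    using that CC_G(1,2)[OF f, of i r] by (simp flip: L.m_assoc)
  have e': "f (G n (i + 1) r) \<otimes>\<^bsub>L\<^esub> ee (i + int n + 1 - 2 * r) = f (G n (i + 1) r)"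
    "f (G n (i - 1) (r - 1)) \<otimes>\<^bsub>L\<^esub> ee (i + int n + 1 - 2 * r) = f (G n (i - 1) (r - 1))"
    using CC_G(3)[OF f, of "i + 1" r] CC_G(3)[OF f, of "i - 1" "r - 1"] by (simp_all add: algebra_simps)
  show ?thesis
    unfolding res_diff_G by (simp add: add CC_Y[OF f] e e')
qed

text \<open>The composite with the differential is a homomorphism and can be tested on generators.
  Letting \<open>i\<close> and \<open>r\<close> be arbitrary avoids range conditions later.\<close>

lemma ZZ_iff: "f \<in> ZZ n \<longleftrightarrow> f \<in> carrier (CC n) \<and> (\<forall>i r. f (dd n (G (Suc n) i r)) = \<zero>\<^bsub>L\<^esub>)"
proof -
  have "f (dd n x) = \<zero>\<^bsub>L\<^esub>" if f: "f \<in> carrier (CC n)" "\<forall>i r. f (dd n (G (Suc n) i r)) = \<zero>\<^bsub>L\<^esub>"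
    and x: "x \<in> carrier (R (Suc n))" for x
  proof -
    have "(\<lambda>x\<in>carrier (R (Suc n)). f (dd n x)) x = \<zero>\<^bsub>regular_bimod L\<^esub>"
      by (rule hom_zero_gens[OF L.bimodule_regular L.comp_hom[OF R_bimodule res_diff_hom f(1)[unfolded CC_hom]] _ x])
        (simp add: f(2))
    then show ?thesis using x by simp
  qed
  then show ?thesis by (auto simp: LC.Z_iff resolution_simps)
qed

text \<open>The elements of \<open>ee i\<close> Lambda1 \<open>ee (i + k)\<close> are the possible
  images of a generator from i to i + k; periodicity makes the family a function on the
  vertices.\<close>

definition adm :: "int \<Rightarrow> (int \<Rightarrow> 'k lam) \<Rightarrow> bool" where
  "adm k h \<longleftrightarrow> (\<forall>i. h i \<in> carrier L \<and> ee i \<otimes>\<^bsub>L\<^esub> h i = h i \<and> h i \<otimes>\<^bsub>L\<^esub> ee (i + k) = h i \<and> h (i mod M) = h i)"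

text \<open>Addressing the slice by \<open>\<rho>\<close> instead of
  \<open>k = n - 2 * \<rho>\<close> turns the range into \<open>0 \<le> \<rho> \<le> n\<close> and
  avoids halving.\<close>

definition ccs :: "nat \<Rightarrow> int \<Rightarrow> (int \<Rightarrow> 'k lam) \<Rightarrow> 'k res \<Rightarrow> 'k lam" where
  "ccs n \<rho> h = hom_of_gens m n (regular_bimod L) (\<lambda>i r. if r = \<rho> then h i else \<zero>\<^bsub>L\<^esub>)"

lemma HH_elem_ccs: "k = int n - 2 * \<rho> \<Longrightarrow> HH_elem m n k h = hg n (ccs n \<rho> h)"
  by (simp add: HH_elem_def ccs_def eq_commute[of \<rho>])

lemma ccs:
  assumes h: "adm (int n - 2 * \<rho>) h" and \<rho>: "0 \<le> \<rho>" "\<rho> \<le> int n"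
  shows ccs_in: "ccs n \<rho> h \<in> carrier (CC n)"
    and ccs_G: "ccs n \<rho> h (G n i r) = (if r = \<rho> then h i else \<zero>\<^bsub>L\<^esub>)"
proof -
  let ?h = "\<lambda>i r. if r = \<rho> then h i else \<zero>\<^bsub>L\<^esub>"
  have *: "?h i r \<in> carrier (regular_bimod L) \<and> lact (regular_bimod L) (ee i) (?h i r) = ?h i r \<and>
      ract (regular_bimod L) (?h i r) (ee (i + int n - 2 * r)) = ?h i r" for i r
    using h by (auto simp: adm_def add_diff_eq)
  note hom = hom_of_gens[OF L.bimodule_regular, of n ?h, OF *]
  show in': "ccs n \<rho> h \<in> carrier (CC n)" unfolding CC_hom ccs_def by (rule hom(1))
  have h_mod: "h (i mod M) = h i" using h by (simp add: adm_def)
  show "ccs n \<rho> h (G n i r) = (if r = \<rho> then h i else \<zero>\<^bsub>L\<^esub>)"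
  proof (cases "0 \<le> r \<and> r \<le> int n")
    case True
    then have "ccs n \<rho> h (G n (i mod M) r) = (if r = \<rho> then h (i mod M) else \<zero>\<^bsub>L\<^esub>)"
      unfolding ccs_def using m3 by (intro hom(2)) simp_all
    then show ?thesis by (simp add: G_mod h_mod)
  next
    case False
    then show ?thesis using \<rho> CC_G(4)[OF in'] by auto
  qed
qed

lemma e_cong: "i mod M = j mod M \<Longrightarrow> ee i = ee j" "i mod M = j mod M \<Longrightarrow> aa i = aa j"
  "i mod M = j mod M \<Longrightarrow> ab i = ab j"
  by (metis elem_mod(1)) (metis elem_mod(2), metis elem_mod(3))

lemma mod_shift: "k mod M = l mod M \<Longrightarrow> (i + k) mod M = (i + l) mod M"
  by (metis mod_add_right_eq)

lemma adm_basis: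
  shows adm_ee: "k mod M = 0 \<Longrightarrow> adm k ee"
    and adm_aa: "k mod M = 1 mod M \<Longrightarrow> adm k aa"
    and adm_ab: "k mod M = (- 1) mod M \<Longrightarrow> adm k (\<lambda>i. ab (i - 1))"
proof -
  assume k: "k mod M = 0"
  have "ee (i + k) = ee i" for i using e_cong(1)[OF mod_shift[of k 0 i]] k by simp
  then show "adm k ee" by (simp add: adm_def)
next
  assume k: "k mod M = 1 mod M"
  have "ee (i + k) = ee (i + 1)" for i using e_cong(1)[OF mod_shift[OF k, of i]] .
  then show "adm k aa" by (simp add: adm_def)
next
  assume k: "k mod M = (- 1) mod M"
  have "ee (i + k) = ee (i - 1)" for i using e_cong(1)[OF mod_shift[OF k, of i]] by simp
  then show "adm k (\<lambda>i. ab (i - 1))" by (simp add: adm_def)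
qed

section \<open>Shifts of the resolution and the classes chi\<close>

definition chi_lift :: "nat \<Rightarrow> int \<Rightarrow> nat \<Rightarrow> 'k res \<Rightarrow> 'k res" where
  "chi_lift n \<sigma> j = hom_of_gens m (j + n) (R j) (\<lambda>i r. G j i (r - \<sigma>))"

context
  fixes n :: nat and \<sigma> :: int
  assumes \<sigma>: "0 \<le> \<sigma>" "\<sigma> \<le> int n" and k0: "(int n - 2 * \<sigma>) mod M = 0"
begin

lemma k_shift: "(i + (int (j + n) - 2 * r)) mod M = (i + (int j - 2 * (r - \<sigma>))) mod M"
proof -
  have "(i + (int j - 2 * (r - \<sigma>)) + (int n - 2 * \<sigma>)) mod M = (i + (int j - 2 * (r - \<sigma>))) mod M"
    using mod_shift[of "int n - 2 * \<sigma>" 0 "i + (int j - 2 * (r - \<sigma>))"] k0 by simp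
  then show ?thesis by (simp add: algebra_simps)
qed

lemma chi_lift_hom: "chi_lift n \<sigma> j \<in> bimod_hom L (R (j + n)) (R j)"
  and chi_lift_G: "chi_lift n \<sigma> j (G (j + n) i r) = G j i (r - \<sigma>)"
proof -
  have *: "G j i (r - \<sigma>) \<in> carrier (R j) \<and> lact (R j) (ee i) (G j i (r - \<sigma>)) = G j i (r - \<sigma>) \<and>
      ract (R j) (G j i (r - \<sigma>)) (ee (i + int (j + n) - 2 * r)) = G j i (r - \<sigma>)" for i r
    using G_right[of j i "r - \<sigma>"] e_cong(1)[OF k_shift[of i j r]] by (simp add: G_left add_diff_eq)
  note hom = hom_of_gens[OF R_bimodule, of "j + n" "\<lambda>i r. G j i (r - \<sigma>)" j, OF *]
  show hom1: "chi_lift n \<sigma> j \<in> bimod_hom L (R (j + n)) (R j)"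
    unfolding chi_lift_def by (rule hom(1))
  show "chi_lift n \<sigma> j (G (j + n) i r) = G j i (r - \<sigma>)"
  proof (cases "0 \<le> r \<and> r \<le> int (j + n)")
    case True
    then have "chi_lift n \<sigma> j (G (j + n) (i mod M) r) = G j (i mod M) (r - \<sigma>)"
      unfolding chi_lift_def using m3 by (intro hom(2)) simp_all
    then show ?thesis by (simp add: G_mod)
  next
    case False
    then show ?thesis
      using \<sigma> bimodule_pair.hom_zero[OF RR_pair hom1] by (auto simp: G_out)
  qed
qed

lemma chi_lift_Y: "b \<in> carrier L \<Longrightarrow> w \<in> carrier L \<Longrightarrow> chi_lift n \<sigma> j (Y (j + n) b i r w) = Y j b i (r - \<sigma>) w"
  by (simp add: Y_def bimod_homD[OF chi_lift_hom] chi_lift_G)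

lemma chi_lift_dd:
  assumes x: "x \<in> carrier (R (Suc (j + n)))"
  shows "dd j (chi_lift n \<sigma> (Suc j) x) = chi_lift n \<sigma> j (dd (j + n) x)"
proof -
  let ?f = "\<lambda>x\<in>carrier (R (Suc (j + n))). dd j (chi_lift n \<sigma> (Suc j) x)"
  let ?g = "\<lambda>x\<in>carrier (R (Suc (j + n))). chi_lift n \<sigma> j (dd (j + n) x)"
  have hom: "chi_lift n \<sigma> (Suc j) \<in> bimod_hom L (R (Suc (j + n))) (R (Suc j))"
    using chi_lift_hom[of "Suc j"] by simp
  have f: "?f \<in> bimod_hom L (R (Suc (j + n))) (R j)"
    by (rule L.comp_hom[OF R_bimodule hom res_diff_hom])
  have g: "?g \<in> bimod_hom L (R (Suc (j + n))) (R j)"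
    by (rule L.comp_hom[OF R_bimodule res_diff_hom chi_lift_hom])
  have eq: "?f = ?g"
  proof (rule R_hom_eqI[OF R_bimodule f g])
    fix i r
    \<comment> \<open>Sources are untouched by the shift. The right-hand indices agree modulo
      \<open>m\<close> because \<open>n - 2 * \<sigma>\<close> is divisible by
      \<open>m\<close>.\<close>
    have sh: "aa (i + int (j + n) - 2 * r) = aa (i + int j - 2 * (r - \<sigma>))"
      "ab (i + int (j + n) + 1 - 2 * r) = ab (i + int j + 1 - 2 * (r - \<sigma>))"
      "ee (i + int (j + n) + 1 - 2 * r) = ee (i + int j + 1 - 2 * (r - \<sigma>))"
      using e_cong[OF k_shift[of i j r]] e_cong[OF k_shift[of "i + 1" j r]] by (simp_all add: algebra_simps)
    have "?f (G (Suc (j + n)) i r) = dd j (G (Suc j) i (r - \<sigma>))"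
      using chi_lift_G[of "Suc j" i r] by simp
    also have "\<dots> = chi_lift n \<sigma> j (dd (j + n) (G (Suc (j + n)) i r))"
      unfolding res_diff_G sh
      by (simp add: bimod_homD(2)[OF chi_lift_hom] chi_lift_Y) (simp add: algebra_simps)
    finally show "?f (G (Suc (j + n)) i r) = ?g (G (Suc (j + n)) i r)" by simp
  qed
  from fun_cong[OF eq, of x] show ?thesis using x by simp
qed

lemma chi_adm: "adm (int n - 2 * \<sigma>) ee"
  by (rule adm_ee[OF k0])

lemma chi_lift_aug:
  assumes x: "x \<in> carrier (R n)"
  shows "aug (chi_lift n \<sigma> 0 x) = ccs n \<sigma> ee x"
proof -
  let ?f = "\<lambda>x\<in>carrier (R n). aug (chi_lift n \<sigma> 0 x)"
  have hom: "chi_lift n \<sigma> 0 \<in> bimod_hom L (R n) (R 0)" using chi_lift_hom[of 0] by simp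
  have eq: "?f = ccs n \<sigma> ee"
  proof (rule CC_eqI[OF _ ccs_in[OF chi_adm \<sigma>]])
    show "?f \<in> carrier (CC n)"
      unfolding CC_hom by (rule L.comp_hom[OF R_bimodule hom aug_hom])
    show "?f (G n i r) = ccs n \<sigma> ee (G n i r)" for i r
      using chi_lift_G[of 0 i r] by (simp add: ccs_G[OF chi_adm \<sigma>] aug_G G_out)
  qed
  from fun_cong[OF eq, of x] show ?thesis using x by simp
qed

lemma chi_lifts: "lifts L (resolution m) n (ccs n \<sigma> ee) (chi_lift n \<sigma>)"
  by (rule LC.liftsI) (simp_all add: resolution_simps chi_lift_hom chi_lift_aug chi_lift_dd)

text \<open>The cochain is the augmentation of the degree 0 shift, so composing it with the
  differential gives \<open>aug\<close> after \<open>dd 0\<close> applied to the next shift, which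
  is zero.\<close>

lemma chi_Z: "ccs n \<sigma> ee \<in> ZZ n"
proof -
  have "ccs n \<sigma> ee (dd n x) = \<zero>\<^bsub>L\<^esub>" if x: "x \<in> carrier (R (Suc n))" for x
  proof -
    have "ccs n \<sigma> ee (dd n x) = aug (dd 0 (chi_lift n \<sigma> (Suc 0) x))"
      using chi_lift_dd[of x 0] chi_lift_aug[OF dd_in[OF x]] x by simp
    also have "\<dots> = \<zero>\<^bsub>L\<^esub>"
      using bimod_homD(1)[OF chi_lift_hom, of x "Suc 0"] x by (intro aug_dd) simp
    finally show ?thesis .
  qed
  then show ?thesis using ccs_in[OF chi_adm \<sigma>] by (simp add: ZZ_iff)
qed

lemma pull_chi:
  assumes h: "adm (int p - 2 * \<rho>) h" and \<rho>: "0 \<le> \<rho>" "\<rho> \<le> int p"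
  shows "LC.pull p n (ccs p \<rho> h) (chi_lift n \<sigma>) = ccs (p + n) (\<rho> + \<sigma>) h"
    and "adm (int (p + n) - 2 * (\<rho> + \<sigma>)) h"
proof -
  have "ee (i + (int (p + n) - 2 * (\<rho> + \<sigma>))) = ee (i + (int p - 2 * \<rho>))" for i
    using e_cong(1)[OF k_shift[of i p "\<rho> + \<sigma>"]] by simp
  then show adm: "adm (int (p + n) - 2 * (\<rho> + \<sigma>)) h"
    using h by (simp add: adm_def)
  have in': "ccs (p + n) (\<rho> + \<sigma>) h \<in> carrier (CC (p + n))"
    using \<rho> \<sigma> by (intro ccs_in[OF adm]) simp_all
  show "LC.pull p n (ccs p \<rho> h) (chi_lift n \<sigma>) = ccs (p + n) (\<rho> + \<sigma>) h"
  proof (rule CC_eqI[OF LC.pull_in[OF ccs_in[OF h \<rho>] chi_lifts] in'])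
    fix i r
    show "LC.pull p n (ccs p \<rho> h) (chi_lift n \<sigma>) (G (p + n) i r) = ccs (p + n) (\<rho> + \<sigma>) h (G (p + n) i r)"
      using \<rho> \<sigma> by (auto simp: LC.pull_def resolution_simps chi_lift_G ccs_G[OF h \<rho>] ccs_G[OF adm])
  qed
qed

end

end

locale lambda1_odd = lambda1_char2 m K for m and K :: "'k::field itself" +
  assumes odd_m: "odd m"
begin

lemma HHR_eq: "HH_Lambda1 m = LC.HHR"
  by (simp add: HH_Lambda1_def)

abbreviation GA where "GA \<equiv> generated_algebra LC.HHR (HH_generators m)"

lemma hg_in: "f \<in> ZZ n \<Longrightarrow> hg n f \<in> carrier LC.HHR"
  by (auto simp: LC.HH_carrier homogeneous_def LC.cls_H intro!: exI[of _ n])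

lemma hg_add: "f \<in> ZZ n \<Longrightarrow> g \<in> ZZ n \<Longrightarrow> hg n (f \<oplus>\<^bsub>CC n\<^esub> g) = hg n f \<oplus>\<^bsub>LC.HHR\<^esub> hg n g"
  by (rule ext) (simp add: LC.HH_simps homogeneous_def LC.H_add)

lemma hg_smult: "f \<in> ZZ n \<Longrightarrow> hg n (c \<odot>\<^bsub>CC n\<^esub> f) = c \<odot>\<^bsub>LC.HHR\<^esub> hg n f"
  by (rule ext) (simp add: LC.HH_simps homogeneous_def LC.H_smult LC.H_smult_zero)

lemma hg_B: "b \<in> coboundaries L (resolution m) n \<Longrightarrow> hg n b = \<zero>\<^bsub>LC.HHR\<^esub>"
  by (rule ext) (simp add: LC.HH_simps homogeneous_def LC.cls_B LC.H_simps)

text \<open>Homogeneous elements have at most one non-zero component, so the convolution reduces to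
  the summand \<open>j = p\<close> in degree \<open>p + q\<close>.\<close>

lemma hg_mult:
  assumes f: "f \<in> ZZ p" and g: "g \<in> ZZ q" and G: "lifts L (resolution m) q g F"
  shows "hg p f \<otimes>\<^bsub>LC.HHR\<^esub> hg q g = hg (p + q) (LC.pull p q f F)"
proof
  fix n
  let ?t = "\<lambda>j. yoneda L (resolution m) j (n - j) (hg p f j) (hg q g (n - j))"
  have zero: "?t j = \<zero>\<^bsub>LC.H n\<^esub>" if j: "j \<le> n" "\<not> (j = p \<and> n = p + q)" for j
  proof -
    have "hg p f j \<in> carrier (LC.H j)" "hg q g (n - j) \<in> carrier (LC.H (n - j))"
      using LC.HH_in[OF hg_in] f g by auto
    note z = LC.yoneda_zero[OF this]
    show ?thesis
    proof (cases "j = p")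
      case True
      then have "hg q g (n - j) = \<zero>\<^bsub>LC.H (n - j)\<^esub>" using j by (auto simp: homogeneous_def)
      then show ?thesis using z(2) j(1) by simp
    next
      case False
      then have "hg p f j = \<zero>\<^bsub>LC.H j\<^esub>" by (simp add: homogeneous_def)
      then show ?thesis using z(1) j(1) by simp
    qed
  qed
  have "(\<Oplus>\<^bsub>LC.H n\<^esub>j\<in>{..n}. ?t j) = hg (p + q) (LC.pull p q f F) n"
  proof (cases "n = p + q")
    case True
    let ?c = "coh_class L (resolution m) (p + q) (LC.pull p q f F)"
    have c: "?c \<in> carrier (LC.H n)" unfolding True by (rule LC.cls_H[OF LC.pull_Z[OF f G]])
    have p: "?t p = ?c" using LC.yoneda_cls[OF f g G] by (simp add: True homogeneous_def)
    have "(\<Oplus>\<^bsub>LC.H n\<^esub>j\<in>{..n}. ?t j) = (\<Oplus>\<^bsub>LC.H n\<^esub>j\<in>{..n}. if p = j then ?c else \<zero>\<^bsub>LC.H n\<^esub>)"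
    proof (rule LC.H.finsum_cong')
      show "?t j = (if p = j then ?c else \<zero>\<^bsub>LC.H n\<^esub>)" if "j \<in> {..n}" for j
        using that p zero[of j] by auto
    qed (use c in auto)
    also have "\<dots> = ?c"
      using LC.H.finsum_singleton[of p "{..n}" "\<lambda>_. ?c" n] True c by simp
    finally show ?thesis by (simp add: True homogeneous_def)
  next
    case False
    then have "(\<Oplus>\<^bsub>LC.H n\<^esub>j\<in>{..n}. ?t j) = \<zero>\<^bsub>LC.H n\<^esub>"
      using zero by (intro LC.H.add.finprod_one_eqI) auto
    then show ?thesis using False by (simp add: homogeneous_def)
  qed
  then show "(hg p f \<otimes>\<^bsub>LC.HHR\<^esub> hg q g) n = hg (p + q) (LC.pull p q f F) n"
    by (simp add: LC.HH_simps)
qed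

sublocale HHR: k_algebra LC.HHR
  by (rule LC.HH_k_algebra)

text \<open>Zero is not among the closure rules of \<open>generated_algebra\<close>; as a scalar
  multiple of the unit it still lies in every generated subalgebra.\<close>

lemma HHR_zero: "\<zero>\<^bsub>LC.HHR\<^esub> = 0 \<odot>\<^bsub>LC.HHR\<^esub> \<one>\<^bsub>LC.HHR\<^esub>"
proof -
  have "0 \<odot>\<^bsub>LC.HHR\<^esub> \<one>\<^bsub>LC.HHR\<^esub> = 0 \<odot>\<^bsub>LC.HHR\<^esub> \<one>\<^bsub>LC.HHR\<^esub> \<oplus>\<^bsub>LC.HHR\<^esub> 0 \<odot>\<^bsub>LC.HHR\<^esub> \<one>\<^bsub>LC.HHR\<^esub>"
    using HHR.smult_add_left[of "\<one>\<^bsub>LC.HHR\<^esub>" 0 0] by simp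
  then show ?thesis
    using HHR.smult_in[of "\<one>\<^bsub>LC.HHR\<^esub>" 0] by simp
qed

text \<open>The cocycles whose classes lie in the generated subalgebra. The set is closed under sums
  and scalars and contains the coboundaries, so a cocycle can be normalised before it is compared
  with the generators.\<close>

definition SS :: "nat \<Rightarrow> ('k res \<Rightarrow> 'k lam) set" where
  "SS n = {f \<in> ZZ n. hg n f \<in> GA}"

lemma SS_add: "f \<in> SS n \<Longrightarrow> g \<in> SS n \<Longrightarrow> f \<oplus>\<^bsub>CC n\<^esub> g \<in> SS n"
  by (auto simp: SS_def hg_add LC.Z_add intro: generated_algebra.add)

lemma SS_smult: "f \<in> SS n \<Longrightarrow> c \<odot>\<^bsub>CC n\<^esub> f \<in> SS n"
  by (auto simp: SS_def hg_smult LC.Z_smult intro: generated_algebra.smult)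

lemma SS_B: "b \<in> coboundaries L (resolution m) n \<Longrightarrow> b \<in> SS n"
  by (auto simp: SS_def LC.B_Z hg_B HHR_zero intro: generated_algebra.smult generated_algebra.one)

lemma SS_zero: "\<zero>\<^bsub>CC n\<^esub> \<in> SS n"
  by (rule SS_B[OF LC.B_zero])

lemma SS_carrier: "f \<in> SS n \<Longrightarrow> f \<in> carrier (CC n)"
  by (simp add: SS_def LC.Z_carrier)

lemma SS_chi_mult:
  assumes f: "ccs p \<rho> h \<in> SS p" and h: "adm (int p - 2 * \<rho>) h" and \<rho>: "0 \<le> \<rho>" "\<rho> \<le> int p"
    and g: "ccs q \<sigma> ee \<in> SS q" and \<sigma>: "0 \<le> \<sigma>" "\<sigma> \<le> int q" "(int q - 2 * \<sigma>) mod M = 0"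
  shows "ccs (p + q) (\<rho> + \<sigma>) h \<in> SS (p + q)"
proof -
  note l = chi_lifts[OF \<sigma>] and pull = pull_chi(1)[OF \<sigma> h \<rho>]
  have z: "ccs p \<rho> h \<in> ZZ p" "ccs q \<sigma> ee \<in> ZZ q" and ga: "hg p (ccs p \<rho> h) \<in> GA" "hg q (ccs q \<sigma> ee) \<in> GA"
    using f g by (simp_all add: SS_def)
  from hg_mult[OF z l] generated_algebra.mult[OF ga] LC.pull_Z[OF z(1) l] show ?thesis
    unfolding pull by (simp add: SS_def)
qed

text \<open>Only two slices of the coboundary need attention. At \<open>r = \<rho>\<close> the
  products of two arrows a vanish; at \<open>r = \<rho> + 1\<close> the two terms are the same socle
  element and cancel in characteristic 2.\<close>

lemma phi_Z:
  assumes k: "(int n - 2 * \<rho>) mod M = 1 mod M" and \<rho>: "0 \<le> \<rho>" "\<rho> \<le> int n"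
  shows "ccs n \<rho> aa \<in> ZZ n"
proof -
  note adm = adm_aa[OF k]
  have "aa (i + int n - 2 * \<rho>) = aa (i + 1)" "ab (i + int n + 1 - 2 * (\<rho> + 1)) = ab i" for i
    using e_cong(2)[OF mod_shift[OF k, of i]] e_cong(3)[OF mod_shift[OF k, of "i - 1"]]
    by (simp_all add: algebra_simps)
  moreover have "aa i \<otimes>\<^bsub>L\<^esub> aa (i + 1) = \<zero>\<^bsub>L\<^esub>" for i
    by (rule elem_eqI) (simp_all add: co_mult)
  moreover have "ab (i - 1) \<otimes>\<^bsub>L\<^esub> aa (i - 1) = ss i" for i using elem_table(9)[of "i - 1"] by simp
  ultimately have "ccs n \<rho> aa (dd n (G (Suc n) i r)) = \<zero>\<^bsub>L\<^esub>" for i r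
    using m3 by (cases "r = \<rho>"; cases "r = \<rho> + 1") (simp_all add: CC_dd[OF ccs_in[OF adm \<rho>]] ccs_G[OF adm \<rho>] L_double)
  then show ?thesis using ccs_in[OF adm \<rho>] by (simp add: ZZ_iff)
qed

lemma psi_Z:
  assumes k: "(int n - 2 * \<rho>) mod M = (- 1) mod M" and \<rho>: "0 \<le> \<rho>" "\<rho> \<le> int n"
  shows "ccs n \<rho> (\<lambda>i. ab (i - 1)) \<in> ZZ n"
proof -
  note adm = adm_ab[OF k]
  have "aa (i + int n - 2 * \<rho>) = aa (i - 1)" "ab (i + int n + 1 - 2 * (\<rho> + 1)) = ab (i - 2)" for i
    using e_cong(2)[OF mod_shift[OF k, of i]] e_cong(3)[OF mod_shift[OF k, of "i - 1"]]
    by (simp_all add: algebra_simps)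
  moreover have "ab (i - 1) \<otimes>\<^bsub>L\<^esub> ab (i - 2) = \<zero>\<^bsub>L\<^esub>" for i
    by (rule elem_eqI) (simp_all add: co_mult)
  moreover have "ab (i - 1) \<otimes>\<^bsub>L\<^esub> aa (i - 1) = ss i" for i using elem_table(9)[of "i - 1"] by simp
  ultimately have "ccs n \<rho> (\<lambda>i. ab (i - 1)) (dd n (G (Suc n) i r)) = \<zero>\<^bsub>L\<^esub>" for i r
    using m3 by (cases "r = \<rho>"; cases "r = \<rho> + 1") (simp_all add: CC_dd[OF ccs_in[OF adm \<rho>]] ccs_G[OF adm \<rho>] L_double)
  then show ?thesis using ccs_in[OF adm \<rho>] by (simp add: ZZ_iff)
qed

lemma adm_ss:
  assumes w: "\<And>i. w (i mod M) = w i" and k: "k mod M = 0"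
  shows "adm k (\<lambda>i. w i \<odot>\<^bsub>L\<^esub> ss i)"
proof -
  have "ee (i + k) = ee i" for i using e_cong(1)[OF mod_shift[of k 0 i]] k by simp
  note e = this
  have s: "ss (i mod M) = ss i" for i unfolding ss_def elem_mod ..
  have "ss i \<otimes>\<^bsub>L\<^esub> ee (i + k) = ss i" for i unfolding e by simp
  then show ?thesis unfolding adm_def w s by (intro allI) (simp add: L.smult_in L.smult_mult_left L.smult_mult_right)
qed

text \<open>Arrows annihilate the socle from both sides, so the coefficients may be prescribed
  independently at each vertex.\<close>

lemma sig_Z:
  assumes w: "\<And>i. w (i mod M) = w i" and k: "(int n - 2 * \<rho>) mod M = 0" and \<rho>: "0 \<le> \<rho>" "\<rho> \<le> int n"
  shows "ccs n \<rho> (\<lambda>i. w i \<odot>\<^bsub>L\<^esub> ss i) \<in> ZZ n"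
proof -
  note adm = adm_ss[of w, OF w k]
  have "(w i \<odot>\<^bsub>L\<^esub> ss i) \<otimes>\<^bsub>L\<^esub> aa j = \<zero>\<^bsub>L\<^esub>" "(w i \<odot>\<^bsub>L\<^esub> ss i) \<otimes>\<^bsub>L\<^esub> ab j = \<zero>\<^bsub>L\<^esub>"
    "aa j \<otimes>\<^bsub>L\<^esub> (w i \<odot>\<^bsub>L\<^esub> ss i) = \<zero>\<^bsub>L\<^esub>" "ab j \<otimes>\<^bsub>L\<^esub> (w i \<odot>\<^bsub>L\<^esub> ss i) = \<zero>\<^bsub>L\<^esub>" for i j
    by (rule elem_eqI; simp add: co_mult co_smult L.smult_in)+
  then have "ccs n \<rho> (\<lambda>i. w i \<odot>\<^bsub>L\<^esub> ss i) (dd n (G (Suc n) i r)) = \<zero>\<^bsub>L\<^esub>" for i r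
    by (simp add: CC_dd[OF ccs_in[OF adm \<rho>]] ccs_G[OF adm \<rho>])
  then show ?thesis using ccs_in[OF adm \<rho>] by (simp add: ZZ_iff)
qed

lemma adm_add: "adm k h \<Longrightarrow> adm k h' \<Longrightarrow> adm k (\<lambda>i. h i \<oplus>\<^bsub>L\<^esub> h' i)"
  by (simp add: adm_def L.r_distr L.l_distr)

lemma adm_smult: "adm k h \<Longrightarrow> adm k (\<lambda>i. c \<odot>\<^bsub>L\<^esub> h i)"
  by (simp add: adm_def L.smult_in L.smult_mult_left L.smult_mult_right)

lemma adm_zero: "adm k (\<lambda>i. \<zero>\<^bsub>L\<^esub>)"
  by (simp add: adm_def)

lemma C_apply_G:
  "(f \<oplus>\<^bsub>CC n\<^esub> g) (G n i r) = f (G n i r) \<oplus>\<^bsub>L\<^esub> g (G n i r)"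
  "f \<in> carrier (CC n) \<Longrightarrow> (c \<odot>\<^bsub>CC n\<^esub> f) (G n i r) = c \<odot>\<^bsub>L\<^esub> f (G n i r)"
  by (simp_all add: LC.C_apply resolution_simps)

context
  fixes n :: nat and \<rho> :: int
  assumes \<rho>: "0 \<le> \<rho>" "\<rho> \<le> int n"
begin

lemma ccs_SS_add:
  assumes h: "adm (int n - 2 * \<rho>) h" "adm (int n - 2 * \<rho>) h'" and S: "ccs n \<rho> h \<in> SS n" "ccs n \<rho> h' \<in> SS n"
  shows "ccs n \<rho> (\<lambda>i. h i \<oplus>\<^bsub>L\<^esub> h' i) \<in> SS n"
proof -
  note c = ccs_in[OF h(1) \<rho>] ccs_in[OF h(2) \<rho>] ccs_in[OF adm_add[OF h] \<rho>]
  have "ccs n \<rho> (\<lambda>i. h i \<oplus>\<^bsub>L\<^esub> h' i) = ccs n \<rho> h \<oplus>\<^bsub>CC n\<^esub> ccs n \<rho> h'"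
    by (rule CC_eqI[OF c(3) LC.C.a_closed[OF c(1,2)]])
      (simp add: C_apply_G ccs_G[OF h(1) \<rho>] ccs_G[OF h(2) \<rho>] ccs_G[OF adm_add[OF h] \<rho>])
  then show ?thesis using SS_add[OF S] by simp
qed

lemma ccs_SS_smult:
  assumes h: "adm (int n - 2 * \<rho>) h" and S: "ccs n \<rho> h \<in> SS n"
  shows "ccs n \<rho> (\<lambda>i. c \<odot>\<^bsub>L\<^esub> h i) \<in> SS n"
proof -
  note i = ccs_in[OF h \<rho>] ccs_in[OF adm_smult[OF h] \<rho>, of c]
  have "ccs n \<rho> (\<lambda>i. c \<odot>\<^bsub>L\<^esub> h i) = c \<odot>\<^bsub>CC n\<^esub> ccs n \<rho> h"
    by (rule CC_eqI[OF i(2) LC.C_smult_in[OF i(1)]])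
      (simp add: C_apply_G i ccs_G[OF h \<rho>] ccs_G[OF adm_smult[OF h] \<rho>] L.smult_zero)
  then show ?thesis using SS_smult[OF S] by simp
qed

lemma ccs_SS_zero: "ccs n \<rho> (\<lambda>i. \<zero>\<^bsub>L\<^esub>) \<in> SS n"
proof -
  have "ccs n \<rho> (\<lambda>i. \<zero>\<^bsub>L\<^esub>) = \<zero>\<^bsub>CC n\<^esub>"
    by (rule CC_eqI[OF ccs_in[OF adm_zero \<rho>]])
      (simp_all add: LC.C_apply ccs_G[OF adm_zero \<rho>] resolution_simps)
  then show ?thesis using SS_zero by simp
qed

end

lemma SS_genI: "HH_elem m n (int n - 2 * \<rho>) h \<in> HH_generators m \<Longrightarrow> ccs n \<rho> h \<in> ZZ n \<Longrightarrow> ccs n \<rho> h \<in> SS n"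
  by (simp add: SS_def HH_elem_ccs[OF refl] generated_algebra.incl)

lemma mod_dvd:
  "k mod M = 0 \<longleftrightarrow> M dvd k" "k mod M = 1 mod M \<longleftrightarrow> M dvd k - 1" "k mod M = (- 1) mod M \<longleftrightarrow> M dvd k + 1"
  using mod_eq_dvd_iff[of k M 1] mod_eq_dvd_iff[of k M "- 1"] by auto

lemma central_one: "central_elem m \<one>\<^bsub>L\<^esub> = HH_elem m 0 0 ee"
  by (simp add: central_elem_def)

text \<open>In the interior \<open>0 < \<rho> < n\<close> the pair (2, 1) of \<open>chi_2_0\<close>
  can be subtracted from (n, rho). On the edges \<open>\<rho> = 0\<close> and
  \<open>\<rho> = n\<close> the congruence says that \<open>m\<close> divides \<open>n\<close>;
  there (m, 0) or (m, m) is subtracted, the pairs of \<open>chi_m_1\<close> and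
  \<open>chi_m_neg1\<close>.\<close>

lemma chi_SS:
  "0 \<le> \<rho> \<Longrightarrow> \<rho> \<le> int n \<Longrightarrow> (int n - 2 * \<rho>) mod M = 0 \<Longrightarrow> ccs n \<rho> ee \<in> SS n"
proof (induction n arbitrary: \<rho> rule: less_induct)
  case (less n)
  note \<rho> = less.prems
  note k = \<rho>(3)[unfolded mod_dvd]
  have ee: "adm l ee" if "M dvd l" for l using that by (simp add: adm_ee mod_dvd)
  consider "n = 0" | "0 < \<rho>" "\<rho> < int n" | "\<rho> = 0" "n > 0" | "\<rho> = int n" "n > 0"
    using \<rho>(1,2) by linarith
  then show ?case
  proof cases
    case 1
    then show ?thesis
      using \<rho> chi_Z[OF \<rho>] by (intro SS_genI) (simp_all add: HH_generators_def central_one)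
  next
    case 2
    have c: "ccs 2 1 ee \<in> SS 2"
      by (rule SS_genI) (simp_all add: HH_generators_def chi_2_0_def chi_Z)
    have d: "M dvd int (n - 2) - 2 * (\<rho> - 1)" using k 2 by (simp add: of_nat_diff algebra_simps)
    have "ccs (n - 2 + 2) (\<rho> - 1 + 1) ee \<in> SS (n - 2 + 2)"
      by (rule SS_chi_mult[OF less.IH _ _ _ c]) (use 2 d in \<open>simp_all add: ee mod_dvd of_nat_diff\<close>)
    moreover have "n - 2 + 2 = n" using 2 by simp
    ultimately show ?thesis by (simp only: diff_add_cancel)
  next
    case 3
    then have dvd: "m dvd n" using k by simp
    then have m: "m \<le> n" using 3 by (simp add: dvd_imp_le)
    have c: "ccs m 0 ee \<in> SS m"
      by (rule SS_genI) (simp_all add: HH_generators_def chi_m_1_def chi_Z)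
    have "ccs (n - m + m) (0 + 0) ee \<in> SS (n - m + m)"
      by (rule SS_chi_mult[OF less.IH _ _ _ c]) (use m m3 dvd in \<open>simp_all add: ee mod_dvd\<close>)
    then show ?thesis using 3 m by simp
  next
    case 4
    then have dvd: "m dvd n" using k by simp
    then have m: "m \<le> n" using 4 by (simp add: dvd_imp_le)
    have c: "ccs m M ee \<in> SS m"
      by (rule SS_genI) (simp_all add: HH_generators_def chi_m_neg1_def chi_Z)
    have "ccs (n - m + m) (int (n - m) + M) ee \<in> SS (n - m + m)"
      by (rule SS_chi_mult[OF less.IH _ _ _ c]) (use m m3 dvd in \<open>simp_all add: ee mod_dvd\<close>)
    then show ?thesis using 4 m by simp
  qed
qed

text \<open>For \<open>\<rho> < n\<close> the factor \<open>phi_1_0\<close>, with pair (1, 0),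
  splits off and leaves a class chi. On the edge \<open>\<rho> = n\<close> the congruence makes
  \<open>m\<close> divide \<open>n + 1\<close>, and \<open>phi_pred_m_neg1\<close>, with pair (m -
  1, m - 1), splits off instead.\<close>

lemma phi_SS:
  assumes \<rho>: "0 \<le> \<rho>" "\<rho> \<le> int n" and k: "(int n - 2 * \<rho>) mod M = 1 mod M"
  shows "ccs n \<rho> aa \<in> SS n"
proof -
  note d = k[unfolded mod_dvd]
  have aa: "adm l aa" if "M dvd l - 1" for l using that by (simp add: adm_aa mod_dvd)
  have n: "n > 0"
  proof (rule ccontr)
    assume "\<not> n > 0"
    then have "M dvd 1" using d \<rho> by simp
    then show False using m3 by simp
  qed
  show ?thesis
  proof (cases "\<rho> = int n")
    case False
    then have r: "\<rho> \<le> int (n - 1)" using \<rho> n by linarith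
    have e: "(int (n - 1) - 2 * \<rho>) mod M = 0" using d n by (simp add: mod_dvd of_nat_diff algebra_simps)
    have c: "ccs 1 0 aa \<in> SS 1"
      by (rule SS_genI) (simp_all add: HH_generators_def phi_1_0_def phi_Z)
    have "ccs (1 + (n - 1)) (0 + \<rho>) aa \<in> SS (1 + (n - 1))"
      by (rule SS_chi_mult[OF c _ _ _ chi_SS[OF \<rho>(1) r e] \<rho>(1) r e]) (simp_all add: aa)
    then show ?thesis using n by simp
  next
    case True
    then have "M dvd - (int n + 1)" using d by simp
    then have *: "M dvd int n + 1" by (simp only: dvd_minus_iff)
    then have m: "m - 1 \<le> n" using zdvd_imp_le[OF *] by linarith
    \<comment> \<open>The complementary degree \<open>n + 1 - m\<close> is a multiple of
      \<open>m\<close>, so a class chi exists on the edge in this degree.\<close>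
    let ?q = "n - (m - 1)"
    have q: "int ?q = int n + 1 - M" using m m3 by linarith
    have "int ?q - 2 * int ?q = M - (int n + 1)" using q by simp
    then have e: "(int ?q - 2 * int ?q) mod M = 0" using dvd_diff[OF dvd_refl *] by (simp only: mod_dvd)
    have p: "M dvd int (m - 1) - 2 * int (m - 1) - 1" using m3 by (simp add: of_nat_diff)
    have c: "ccs (m - 1) (int (m - 1)) aa \<in> SS (m - 1)"
      by (rule SS_genI) (use p m3 in \<open>simp_all add: HH_generators_def phi_pred_m_neg1_def phi_Z mod_dvd of_nat_diff\<close>)
    have "ccs (m - 1 + ?q) (int (m - 1) + int ?q) aa \<in> SS (m - 1 + ?q)"
      by (rule SS_chi_mult[OF c _ _ _ chi_SS[OF _ _ e] _ _ e]) (use p in \<open>simp_all add: aa\<close>)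
    then show ?thesis using m True by (simp flip: of_nat_add)
  qed
qed

text \<open>The mirror image of \<open>phi_SS\<close>: since \<open>psi_1_0\<close> has the pair (1,
  1) and \<open>psi_pred_m_1\<close> the pair (m - 1, 0), the exceptional edge is
  \<open>\<rho> = 0\<close>.\<close>

lemma psi_SS:
  assumes \<rho>: "0 \<le> \<rho>" "\<rho> \<le> int n" and k: "(int n - 2 * \<rho>) mod M = (- 1) mod M"
  shows "ccs n \<rho> (\<lambda>i. ab (i - 1)) \<in> SS n"
proof -
  note d = k[unfolded mod_dvd]
  have ab: "adm l (\<lambda>i. ab (i - 1))" if "M dvd l + 1" for l using that by (simp add: adm_ab mod_dvd)
  show ?thesis
  proof (cases "\<rho> = 0")
    case False
    then have r: "0 \<le> \<rho> - 1" "\<rho> - 1 \<le> int (n - 1)" and n: "n > 0" using \<rho> by linarith+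
    have e: "(int (n - 1) - 2 * (\<rho> - 1)) mod M = 0" using d n by (simp add: mod_dvd of_nat_diff algebra_simps)
    have c: "ccs 1 1 (\<lambda>i. ab (i - 1)) \<in> SS 1"
      by (rule SS_genI) (simp_all add: HH_generators_def psi_1_0_def psi_Z)
    have "ccs (1 + (n - 1)) (1 + (\<rho> - 1)) (\<lambda>i. ab (i - 1)) \<in> SS (1 + (n - 1))"
      by (rule SS_chi_mult[OF c _ _ _ chi_SS[OF r e] r e]) (simp_all add: ab)
    then show ?thesis using n by simp
  next
    case True
    then have *: "M dvd int n + 1" using d by simp
    then have m: "m - 1 \<le> n" using zdvd_imp_le[OF *] by linarith
    let ?q = "n - (m - 1)"
    have q: "int ?q = int n + 1 - M" using m m3 by linarith
    have e: "(int ?q - 2 * 0) mod M = 0" unfolding mod_dvd q using * by simp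
    have p: "M dvd int (m - 1) - 2 * 0 + 1" using m3 by (simp add: of_nat_diff)
    have c: "ccs (m - 1) 0 (\<lambda>i. ab (i - 1)) \<in> SS (m - 1)"
      by (rule SS_genI) (use p m3 in \<open>simp_all add: HH_generators_def psi_pred_m_1_def psi_Z mod_dvd of_nat_diff\<close>)
    have "ccs (m - 1 + ?q) (0 + 0) (\<lambda>i. ab (i - 1)) \<in> SS (m - 1 + ?q)"
      by (rule SS_chi_mult[OF c _ _ _ chi_SS[OF _ _ e] _ _ e]) (use p in \<open>simp_all add: ab\<close>)
    then show ?thesis using m True by simp
  qed
qed

lemma central_ss_fun: "(\<lambda>i. ee i \<otimes>\<^bsub>L\<^esub> (aa j \<otimes>\<^bsub>L\<^esub> ab j)) = (\<lambda>i. (if i mod M = j mod M then 1 else 0) \<odot>\<^bsub>L\<^esub> ss i)"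
proof
  fix i
  show "ee i \<otimes>\<^bsub>L\<^esub> (aa j \<otimes>\<^bsub>L\<^esub> ab j) = (if i mod M = j mod M then 1 else 0) \<odot>\<^bsub>L\<^esub> ss i"
    by (intro elem_eqI) (simp_all add: co_mult co_smult L.smult_in)
qed

text \<open>The central generator for \<open>j\<close> is the socle cochain supported at the vertex
  \<open>j\<close>; the family \<open>w\<close> is assembled one vertex at a time.\<close>

lemma sig_SS_0:
  assumes w: "\<And>i. w (i mod M) = w i"
  shows "ccs 0 0 (\<lambda>i. w i \<odot>\<^bsub>L\<^esub> ss i) \<in> SS 0"
proof -
  let ?h = "\<lambda>N i. (if i mod M < int N then w i else 0) \<odot>\<^bsub>L\<^esub> ss i"
  have "N \<le> m \<Longrightarrow> ccs 0 0 (?h N) \<in> SS 0" for N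
  proof (induction N)
    case 0
    have "\<not> i mod M < 0" for i using m3 pos_mod_sign[of M i] by linarith
    then have "?h 0 = (\<lambda>i. \<zero>\<^bsub>L\<^esub>)" by (simp add: L.smult_zero_scalar)
    then show ?case using ccs_SS_zero[of 0 0] by simp
  next
    case (Suc N)
    let ?z = "\<lambda>i. ee i \<otimes>\<^bsub>L\<^esub> (aa (int N) \<otimes>\<^bsub>L\<^esub> ab (int N))"
    have N: "int N mod M = int N" using Suc.prems by simp
    note z = central_ss_fun[of "int N", unfolded N]
    have adm1: "adm (int 0 - 2 * 0) ?z" unfolding z by (rule adm_ss) simp_all
    have adm2: "adm (int 0 - 2 * 0) (?h N)" by (rule adm_ss) (simp_all add: w)
    have zS: "ccs 0 0 ?z \<in> SS 0"
    proof (rule SS_genI)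
      show "HH_elem m 0 (int 0 - 2 * 0) ?z \<in> HH_generators m"
        using Suc.prems unfolding HH_generators_def central_elem_def by auto
      show "ccs 0 0 ?z \<in> ZZ 0" unfolding z by (rule sig_Z) simp_all
    qed
    have "?h (Suc N) = (\<lambda>i. ?h N i \<oplus>\<^bsub>L\<^esub> w (int N) \<odot>\<^bsub>L\<^esub> ?z i)"
    proof
      fix i
      have "w i = w (int N)" if "i mod M = int N" using w[of i] that by simp
      then show "?h (Suc N) i = ?h N i \<oplus>\<^bsub>L\<^esub> w (int N) \<odot>\<^bsub>L\<^esub> ?z i"
        unfolding fun_cong[OF z] by (auto simp: L.smult_zero_scalar L.smult_zero L.smult_1 L.smult_in)
    qed
    then show ?case
      using ccs_SS_add[of 0 0 "?h N", OF _ _ adm2 adm_smult[OF adm1] _ ccs_SS_smult[OF _ _ adm1 zS]] Suc by simp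
  qed
  from this[of m] show ?thesis using m3 by simp
qed

text \<open>Arbitrary coefficients are realised in degree 0 and carried to degree \<open>n\<close>
  by a class chi.\<close>

lemma sig_SS:
  assumes w: "\<And>i. w (i mod M) = w i" and \<rho>: "0 \<le> \<rho>" "\<rho> \<le> int n" and k: "(int n - 2 * \<rho>) mod M = 0"
  shows "ccs n \<rho> (\<lambda>i. w i \<odot>\<^bsub>L\<^esub> ss i) \<in> SS n"
  using SS_chi_mult[OF sig_SS_0[of w, OF w] adm_ss[of w] _ _ chi_SS[OF \<rho> k] \<rho> k] w by simp

end

section \<open>Normal forms of cocycles\<close>

context lambda1_odd
begin

lemma double: "a + a = (0 :: 'k)"
proof -
  have "a + a = a * (1 + 1)" by (simp only: distrib_left mult_1_right)
  then show ?thesis by (simp only: two_zero mult_zero_right)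
qed

lemma add_eq_zero: "a + b = 0 \<longleftrightarrow> a = (b :: 'k)"
  using double[of a] double[of b] by (metis add_left_cancel)

text \<open>For \<open>c = 0\<close> the sum of \<open>u\<close> over a period is an obstruction; since \<open>m\<close> is odd, it can be
  absorbed into \<open>c\<close>.\<close>

lemma periodic_primitive:
  fixes u :: "int \<Rightarrow> 'k"
  assumes u: "\<And>i. u (i mod M) = u i"
  shows "\<exists>x c. (\<forall>i. x (i mod M) = x i) \<and> (\<forall>i. x i + x (i + 1) = u i + c) \<and> ((\<forall>i. u i = 0) \<longrightarrow> (\<forall>i. x i = 0))"
proof -
  \<comment> \<open>Going once around the cycle, the values \<open>u i + c\<close> must sum to zero.
    With \<open>c\<close> the sum of \<open>u\<close> over a period the total is
    \<open>c + m c\<close>, which vanishes because \<open>m\<close> is odd and the characteristic is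
    2.\<close>
  define c where "c = (\<Sum>j<m. u (int j))"
  define s where "s k = (\<Sum>j<k. u (int j) + c)" for k :: nat
  define x where "x i = s (nat (i mod M))" for i
  obtain k where k: "m = 2 * k + 1" using odd_m by (rule oddE)
  have "s m = c + of_nat m * c" by (simp add: s_def sum.distrib c_def)
  also have "\<dots> = (c + c) + (of_nat k * c + of_nat k * c)" by (simp add: k algebra_simps)
  finally have sm: "s m = 0" by (simp only: double add_0)
  have "x i + x (i + 1) = u i + c" for i
  proof -
    let ?k = "nat (i mod M)"
    have i: "0 \<le> i mod M" "i mod M < M" using m3 by simp_all
    have s: "s (Suc ?k) = s ?k + (u i + c)" using i u[of i] by (simp add: s_def)
    have mod: "(i + 1) mod M = (i mod M + 1) mod M" by simp
    show ?thesis
    proof (cases "i mod M + 1 < M")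
      case True
      then have "(i + 1) mod M = i mod M + 1" unfolding mod using i by (intro mod_pos_pos_trivial) simp_all
      then have "x (i + 1) = s (Suc ?k)" using i by (simp add: x_def nat_add_distrib)
      then have "x i + x (i + 1) = (s ?k + s ?k) + (u i + c)" by (simp only: x_def s add.assoc)
      then show ?thesis by (simp only: double add_0)
    next
      case False
      then have M: "i mod M + 1 = M" using i by simp
      have "x (i + 1) = 0" unfolding x_def mod M by (simp add: s_def)
      moreover have "Suc ?k = m" using M i by linarith
      then have "s ?k + (u i + c) = 0" using s sm by simp
      ultimately show ?thesis by (simp only: add_eq_zero x_def add_0_right)
    qed
  qed
  moreover have "x i = 0" if "\<forall>i. u i = 0" for i using that by (simp add: x_def s_def c_def)
  moreover have "x (i mod M) = x i" for i by (simp add: x_def)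
  ultimately show ?thesis by (intro exI[of _ x] exI[of _ c] conjI allI impI)
qed

lemma const_int:
  fixes h :: "int \<Rightarrow> 'k"
  assumes "\<And>i. h i = h (i + 1)" shows "h i = h 0"
proof (induction i rule: int_induct[of _ 0])
  case (step2 i)
  then show ?case using assms[of "i - 1"] by simp
qed (use assms in auto)

text \<open>A value on a generator with source \<open>i\<close> has no coordinates at other sources,
  so the separate source index is dropped.\<close>

definition ct :: "nat \<Rightarrow> ('k res \<Rightarrow> 'k lam) \<Rightarrow> basis_kind \<Rightarrow> int \<Rightarrow> int \<Rightarrow> 'k" where
  "ct n f t r i = co (f (G n i r)) i t"

lemma ct_mod: "ct n f t r (i mod M) = ct n f t r i"
  by (simp add: ct_def G_mod co_periodic)

lemma ct_co:
  assumes f: "f \<in> carrier (CC n)"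
  shows "co (f (G n i r)) j t = (if j mod M = i mod M then ct n f t r i else 0)"
proof -
  have "co (f (G n i r)) j t = co (ee i \<otimes>\<^bsub>L\<^esub> f (G n i r)) j t" by (simp add: CC_G[OF f])
  also have "\<dots> = (if j mod M = i mod M then co (f (G n i r)) j t else 0)"
    using CC_G(1)[OF f, of i r] by (cases t) (simp_all add: co_mult)
  finally have "co (f (G n i r)) j t = (if j mod M = i mod M then co (f (G n i r)) j t else 0)" .
  moreover have "co (f (G n i r)) j t = co (f (G n i r)) i t" if "j mod M = i mod M"
    using co_periodic[of "f (G n i r)" i t] co_periodic[of "f (G n i r)" j t] that by simp
  ultimately show ?thesis by (simp add: ct_def split: if_splits)
qed

text \<open>The value ends at the target of the generator, and a basis element can occur in it only
  if it has the same target.\<close>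

lemma ct_vanish:
  assumes f: "f \<in> carrier (CC n)"
  shows "ct n f BE r i \<noteq> 0 \<Longrightarrow> i mod M = (i + int n - 2 * r) mod M"
    and "ct n f BA r i \<noteq> 0 \<Longrightarrow> (i + 1) mod M = (i + int n - 2 * r) mod M"
    and "ct n f BB r i \<noteq> 0 \<Longrightarrow> (i - 1) mod M = (i + int n - 2 * r) mod M"
    and "ct n f BS r i \<noteq> 0 \<Longrightarrow> i mod M = (i + int n - 2 * r) mod M"
proof -
  have *: "ct n f t r i = co (f (G n i r) \<otimes>\<^bsub>L\<^esub> ee (i + int n - 2 * r)) i t" for t
    by (simp add: ct_def CC_G[OF f])
  show "ct n f BE r i \<noteq> 0 \<Longrightarrow> i mod M = (i + int n - 2 * r) mod M"
    "ct n f BA r i \<noteq> 0 \<Longrightarrow> (i + 1) mod M = (i + int n - 2 * r) mod M"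
    "ct n f BB r i \<noteq> 0 \<Longrightarrow> (i - 1) mod M = (i + int n - 2 * r) mod M"
    "ct n f BS r i \<noteq> 0 \<Longrightarrow> i mod M = (i + int n - 2 * r) mod M"
    using *[of BE] *[of BA] *[of BB] *[of BS] CC_G(1)[OF f, of i r]
    by (auto simp: co_mult split: if_splits)
qed

lemma ct_out: "f \<in> carrier (CC n) \<Longrightarrow> \<not> (0 \<le> r \<and> r \<le> int n) \<Longrightarrow> ct n f t r i = 0"
  by (simp add: ct_def CC_G(4))

text \<open>Multiplying a vertex by an arrow a on either side contributes to \<open>BA\<close>.
  Socle terms arise from products of abar with a in slice \<open>r\<close> and of a with abar in
  slice \<open>r - 1\<close>, in both orders.\<close>

lemma ct_dd:
  assumes f: "f \<in> carrier (CC n)"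
  shows "co (f (dd n (G (Suc n) i r))) i BA = ct n f BE r i + ct n f BE r (i + 1)"
    and "co (f (dd n (G (Suc n) i r))) i BS =
      ct n f BB r i + ct n f BB r (i + 1) + (ct n f BA (r - 1) i + ct n f BA (r - 1) (i - 1))"
proof -
  have sh: "i + int n + 1 - 2 * r + 1 = i + int n - 2 * (r - 1)" by simp
  note simps = CC_dd[OF f] co_add co_mult CC_G(1)[OF f] ct_co[OF f]
  show "co (f (dd n (G (Suc n) i r))) i BA = ct n f BE r i + ct n f BE r (i + 1)"
    \<comment> \<open>Either the coefficient is zero and its term disappears, or its target is known
      and the following arrow is composable with it.\<close>
    using ct_vanish(1)[OF f, of r i] by (cases "ct n f BE r i = 0") (auto simp: simps)
  show "co (f (dd n (G (Suc n) i r))) i BS =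
      ct n f BB r i + ct n f BB r (i + 1) + (ct n f BA (r - 1) i + ct n f BA (r - 1) (i - 1))"
    using ct_vanish(3)[OF f, of r i] ct_vanish(2)[OF f, of "r - 1" i]
    by (cases "ct n f BB r i = 0"; cases "ct n f BA (r - 1) i = 0") (auto simp: simps sh)
qed

lemma ct_cocycle:
  assumes f: "f \<in> ZZ n"
  shows "ct n f BE r i = ct n f BE r (i + 1)"
    and "ct n f BB r i + ct n f BB r (i + 1) = ct n f BA (r - 1) i + ct n f BA (r - 1) (i - 1)"
proof -
  note c = LC.Z_carrier[OF f]
  have "f (dd n (G (Suc n) i r)) = \<zero>\<^bsub>L\<^esub>" using f by (simp add: ZZ_iff)
  then show "ct n f BE r i = ct n f BE r (i + 1)"
    "ct n f BB r i + ct n f BB r (i + 1) = ct n f BA (r - 1) i + ct n f BA (r - 1) (i - 1)"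
    using ct_dd[OF c, of i r] by (simp_all add: add_eq_zero)
qed

text \<open>A cochain is the sum of its slices, and these are added up one value of \<open>r\<close>
  at a time.\<close>

lemma SS_slices:
  assumes f: "f \<in> carrier (CC n)"
    and S: "\<And>r. 0 \<le> r \<Longrightarrow> r \<le> int n \<Longrightarrow> ccs n r (\<lambda>i. f (G n i r)) \<in> SS n"
  shows "f \<in> SS n"
proof -
  have adm: "adm (int n - 2 * r) (\<lambda>i. f (G n i r))" for r
    using CC_G[OF f] by (simp add: adm_def G_mod add_diff_eq)
  have "\<exists>g\<in>SS n. \<forall>i r. g (G n i r) = (if r < int N then f (G n i r) else \<zero>\<^bsub>L\<^esub>)" for N
  proof (induction N)
    case 0
    have "\<zero>\<^bsub>CC n\<^esub> (G n i r) = (if r < int 0 then f (G n i r) else \<zero>\<^bsub>L\<^esub>)" for i r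
      using CC_G(4)[OF f, of r i] by (simp add: LC.C_apply resolution_simps)
    then show ?case using SS_zero by blast
  next
    case (Suc N)
    then obtain g where g: "g \<in> SS n" "\<And>i r. g (G n i r) = (if r < int N then f (G n i r) else \<zero>\<^bsub>L\<^esub>)"
      by blast
    show ?case
    proof (cases "N \<le> n")
      case True
      let ?c = "ccs n (int N) (\<lambda>i. f (G n i (int N)))"
      have c: "?c (G n i r) = (if r = int N then f (G n i (int N)) else \<zero>\<^bsub>L\<^esub>)" for i r
        using True by (intro ccs_G[OF adm]) simp_all
      have "(g \<oplus>\<^bsub>CC n\<^esub> ?c) (G n i r) = (if r < int (Suc N) then f (G n i r) else \<zero>\<^bsub>L\<^esub>)" for i r
        using CC_G(1)[OF f] by (auto simp: C_apply_G g(2) c)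
      moreover have "g \<oplus>\<^bsub>CC n\<^esub> ?c \<in> SS n" using True by (intro SS_add g S) simp_all
      ultimately show ?thesis by blast
    next
      case False
      then have "g (G n i r) = (if r < int (Suc N) then f (G n i r) else \<zero>\<^bsub>L\<^esub>)" for i r
        using CC_G(4)[OF f, of r i] by (auto simp: g(2))
      then show ?thesis using g(1) by blast
    qed
  qed
  from this[of "Suc n"] obtain g where
    g: "g \<in> SS n" "\<And>i r. g (G n i r) = (if r < int (Suc n) then f (G n i r) else \<zero>\<^bsub>L\<^esub>)"
    by blast
  have "g = f" by (rule CC_eqI[OF SS_carrier[OF g(1)] f]) (simp add: g(2))
  then show ?thesis using g(1) by simp
qed

text \<open>For constant \<open>BA\<close> coefficients the right side of the second cocycle
  equation is a doubled term, so the \<open>BB\<close> coefficients are constant as well. Every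
  slice is then a combination of cochains already known to lie in \<open>SS n\<close>.\<close>

lemma SS_const:
  assumes f: "f \<in> ZZ n" and BA: "\<And>r i. ct n f BA r i = ct n f BA r (i + 1)"
  shows "f \<in> SS n"
proof (rule SS_slices)
  show c: "f \<in> carrier (CC n)" by (rule LC.Z_carrier[OF f])
  fix r assume r: "0 \<le> r" "r \<le> int n"
  let ?k = "int n - 2 * r"
  have "ct n f BB r i = ct n f BB r (i + 1)" for i r
    using ct_cocycle(2)[OF f, of r i] BA[of "r - 1" "i - 1"] by (simp add: double add_eq_zero)
  then have BB: "ct n f BB r i = ct n f BB r 0" for i by (intro const_int) simp
  have BE: "ct n f BE r i = ct n f BE r 0" for i by (intro const_int ct_cocycle(1)[OF f])
  have BA: "ct n f BA r i = ct n f BA r 0" for i by (intro const_int BA)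
  \<comment> \<open>Each kind fits a slice only for one residue of \<open>n - 2 * r\<close> modulo
    \<open>m\<close>. A non-zero coefficient enforces this residue; a zero coefficient makes the
    whole family zero, which is admissible in every slice.\<close>
  have nz: "adm ?k (\<lambda>i. c \<odot>\<^bsub>L\<^esub> h i) \<and> ccs n r (\<lambda>i. c \<odot>\<^bsub>L\<^esub> h i) \<in> SS n"
    if "c \<noteq> 0 \<Longrightarrow> adm ?k h \<and> ccs n r h \<in> SS n" "\<And>i. h i \<in> carrier L" for c h
  proof (cases "c = 0")
    case True
    then show ?thesis using that(2) ccs_SS_zero[OF r] adm_zero by (simp add: L.smult_zero_scalar)
  next
    case False
    then show ?thesis using that(1) adm_smult[of ?k h] ccs_SS_smult[OF r, of h] by blast
  qed
  note v = ct_vanish[OF c, of r 0, simplified]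
  have 1: "adm ?k (\<lambda>i. ct n f BE r 0 \<odot>\<^bsub>L\<^esub> ee i) \<and> ccs n r (\<lambda>i. ct n f BE r 0 \<odot>\<^bsub>L\<^esub> ee i) \<in> SS n"
    using v(1) by (intro nz) (simp_all add: chi_SS[OF r] adm_ee)
  have 2: "adm ?k (\<lambda>i. ct n f BA r 0 \<odot>\<^bsub>L\<^esub> aa i) \<and> ccs n r (\<lambda>i. ct n f BA r 0 \<odot>\<^bsub>L\<^esub> aa i) \<in> SS n"
    using v(2) by (intro nz) (simp_all add: phi_SS[OF r] adm_aa)
  have 3: "adm ?k (\<lambda>i. ct n f BB r 0 \<odot>\<^bsub>L\<^esub> ab (i - 1)) \<and> ccs n r (\<lambda>i. ct n f BB r 0 \<odot>\<^bsub>L\<^esub> ab (i - 1)) \<in> SS n"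
    using v(3) by (intro nz) (simp_all add: psi_SS[OF r] adm_ab)
  have 4: "adm ?k (\<lambda>i. ct n f BS r i \<odot>\<^bsub>L\<^esub> ss i) \<and> ccs n r (\<lambda>i. ct n f BS r i \<odot>\<^bsub>L\<^esub> ss i) \<in> SS n"
  proof (cases "?k mod M = 0")
    case True
    then show ?thesis using sig_SS[of "ct n f BS r", OF ct_mod r] adm_ss[of "ct n f BS r", OF ct_mod] by simp
  next
    case False
    have "ct n f BS r i = 0" for i
    proof (rule ccontr)
      assume "ct n f BS r i \<noteq> 0"
      then have "(i + ?k) mod M = (i + 0) mod M" using ct_vanish(4)[OF c, of r i] by (simp add: add_diff_eq)
      then show False using False by (simp add: mod_eq_dvd_iff mod_dvd)
    qed
    then show ?thesis using ccs_SS_zero[OF r] adm_zero by (simp add: L.smult_zero_scalar)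
  qed
  have "(\<lambda>i. f (G n i r)) = (\<lambda>i. (ct n f BE r 0 \<odot>\<^bsub>L\<^esub> ee i \<oplus>\<^bsub>L\<^esub> ct n f BA r 0 \<odot>\<^bsub>L\<^esub> aa i) \<oplus>\<^bsub>L\<^esub>
      (ct n f BB r 0 \<odot>\<^bsub>L\<^esub> ab (i - 1) \<oplus>\<^bsub>L\<^esub> ct n f BS r i \<odot>\<^bsub>L\<^esub> ss i))"
    (is "_ = ?h")
  proof
    fix i
    show "f (G n i r) = ?h i"
      by (rule elem_eqI)
        (simp_all add: CC_G[OF c] L.smult_in co_add co_smult ct_co[OF c] BE[of i] BA[of i] BB[of i])
  qed
  moreover have "ccs n r ?h \<in> SS n"
    using 1 2 3 4 by (intro ccs_SS_add[OF r] adm_add) blast+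
  ultimately show "ccs n r (\<lambda>i. f (G n i r)) \<in> SS n" by simp
qed

lemma ct_add:
  "f \<in> carrier (CC n) \<Longrightarrow> g \<in> carrier (CC n) \<Longrightarrow> ct n (f \<oplus>\<^bsub>CC n\<^esub> g) t r i = ct n f t r i + ct n g t r i"
  by (simp add: ct_def C_apply_G co_add CC_G)

lemma ZZ_SS: "f \<in> ZZ n \<Longrightarrow> f \<in> SS n"
proof -
  assume f: "f \<in> ZZ n"
  note c = LC.Z_carrier[OF f]
  \<comment> \<open>Coboundaries from degree \<open>n - 1\<close> can correct the \<open>BA\<close>
    coefficients only in slices up to \<open>n - 1\<close>. In the top slice these are already
    constant, since the cocycle equation at \<open>r = n + 1\<close> contains no \<open>BB\<close>
    terms.\<close>
  have last: "ct n f BA r i = ct n f BA r (i + 1)" if "r \<ge> int n" for r i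
    using ct_cocycle(2)[OF f, of "r + 1" "i + 1"] ct_out[OF c, of "r + 1"] that by (auto simp: add_eq_zero)
  show ?thesis
  proof (cases n)
    case 0
    have "ct n f BA r i = ct n f BA r (i + 1)" for r i
      using last[of r i] ct_out[OF c, of r] 0 by (cases "r \<ge> 0") simp_all
    then show ?thesis by (rule SS_const[OF f])
  next
    case (Suc n')
    have "\<forall>r. \<exists>x c. (\<forall>i. x (i mod M) = x i) \<and> (\<forall>i. x i + x (i + 1) = ct n f BA r i + c) \<and>
        ((\<forall>i. ct n f BA r i = 0) \<longrightarrow> (\<forall>i. x i = 0))"
      by (intro allI periodic_primitive) (rule ct_mod)
    from choice[OF this] obtain x where x: "\<forall>r. \<exists>c. (\<forall>i. x r (i mod M) = x r i) \<and>
        (\<forall>i. x r i + x r (i + 1) = ct n f BA r i + c) \<and> ((\<forall>i. ct n f BA r i = 0) \<longrightarrow> (\<forall>i. x r i = 0))"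
      by (rule exE)
    have x: "x r (i mod M) = x r i" "\<exists>c. \<forall>i. x r i + x r (i + 1) = ct n f BA r i + c"
      "\<forall>i. ct n f BA r i = 0 \<Longrightarrow> \<forall>i. x r i = 0" for r i
      using spec[OF x, of r] by auto
    \<comment> \<open>A cochain with vertices as values changes the \<open>BA\<close> coefficients
      by \<open>x r i + x r (i + 1)\<close>, and this sum was chosen to leave a constant.\<close>
    let ?h = "\<lambda>i r. x r i \<odot>\<^bsub>L\<^esub> ee i"
    \<comment> \<open>A vertex is a possible value in degree \<open>n - 1\<close> only if
      \<open>m\<close> divides \<open>n - 1 - 2 * r\<close>. A non-zero \<open>x r\<close> comes
      from a non-zero \<open>BA\<close> coefficient, whose target condition is this divisibility;
      the last clause of \<open>periodic_primitive\<close> serves this purpose.\<close>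
    have sh: "i mod M = (i + int n' - 2 * r) mod M" if nz: "x r j \<noteq> 0" for i j r
    proof -
      obtain l where "ct n f BA r l \<noteq> 0" using nz x(3)[of r] by blast
      then have "(l + 1) mod M = (l + int n - 2 * r) mod M" by (rule ct_vanish(2)[OF c])
      then show ?thesis by (simp add: Suc mod_eq_dvd_iff)
    qed
    have "?h i r \<otimes>\<^bsub>L\<^esub> ee (i + int n' - 2 * r) = ?h i r" for i r
      using e_cong(1)[OF sh[of r i i]] by (cases "x r i = 0") (simp_all add: L.smult_zero_scalar L.smult_mult_left)
    then have h: "?h i r \<in> carrier (regular_bimod L) \<and> lact (regular_bimod L) (ee i) (?h i r) = ?h i r \<and>
      ract (regular_bimod L) (?h i r) (ee (i + int n' - 2 * r)) = ?h i r" for i r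
      by (simp add: L.smult_in L.smult_mult_right)
    define g where "g = hom_of_gens m n' (regular_bimod L) ?h"
    have g: "g \<in> carrier (CC n')"
      unfolding CC_hom g_def by (rule hom_of_gens(1)[OF L.bimodule_regular h])
    have "g (G n' (i mod M) r) = ?h (i mod M) r" if "0 \<le> r" "r \<le> int n'" for i r
      unfolding g_def using that m3 by (intro hom_of_gens(2)[OF L.bimodule_regular h]) simp_all
    then have gG: "g (G n' i r) = x r i \<odot>\<^bsub>L\<^esub> ee i" if "0 \<le> r" "r \<le> int n'" for i r
      using that by (simp add: G_mod x(1))
    have ctg: "ct n' g BE r i = (if 0 \<le> r \<and> r \<le> int n' then x r i else 0)" for r i
      using ct_out[OF g, of r BE i] by (auto simp: ct_def gG co_smult)
    let ?d = "LC.cobd n' g"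
    have dB: "?d \<in> coboundaries L (resolution m) n" unfolding Suc by (rule LC.cobdI[OF g])
    note dZ = LC.B_Z[OF dB]
    have "ct n ?d BA r i = ct n' g BE r i + ct n' g BE r (i + 1)" for r i
      using ct_dd(1)[OF g, of i r] by (simp add: ct_def Suc LC.cobd_def resolution_simps)
    then have ctd: "ct n (f \<oplus>\<^bsub>CC n\<^esub> ?d) BA r i = ct n f BA r i + (ct n' g BE r i + ct n' g BE r (i + 1))" for r i
      by (simp add: ct_add[OF c LC.Z_carrier[OF dZ]])
    have "ct n (f \<oplus>\<^bsub>CC n\<^esub> ?d) BA r i = ct n (f \<oplus>\<^bsub>CC n\<^esub> ?d) BA r (i + 1)" for r i
    proof (cases "0 \<le> r \<and> r \<le> int n'")
      case True
      obtain c where c: "\<And>i. x r i + x r (i + 1) = ct n f BA r i + c" using x(2)[of r] by blast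
      have "ct n (f \<oplus>\<^bsub>CC n\<^esub> ?d) BA r i = c" for i
      proof -
        have "ct n (f \<oplus>\<^bsub>CC n\<^esub> ?d) BA r i = (ct n f BA r i + ct n f BA r i) + c"
          using True by (simp add: ctd ctg c add.assoc)
        then show ?thesis by (simp add: double)
      qed
      then show ?thesis by simp
    next
      case False
      then have "ct n' g BE r i = 0" for i unfolding ctg by (rule if_not_P)
      moreover have "ct n f BA r i = ct n f BA r (i + 1)"
        using last[of r i] ct_out[OF c, of r] False Suc by (cases "r < 0") auto
      ultimately show ?thesis unfolding ctd by simp
    qed
    then have S: "f \<oplus>\<^bsub>CC n\<^esub> ?d \<in> SS n"
      by (rule SS_const[OF LC.Z_add[OF f dZ]])
    \<comment> \<open>Adding the coboundary twice restores \<open>f\<close> in characteristic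
      2.\<close>
    have "f = (f \<oplus>\<^bsub>CC n\<^esub> ?d) \<oplus>\<^bsub>CC n\<^esub> ?d"
    proof (rule CC_eqI[OF c])
      note d = LC.Z_carrier[OF dZ]
      show "f \<oplus>\<^bsub>CC n\<^esub> ?d \<oplus>\<^bsub>CC n\<^esub> ?d \<in> carrier (CC n)" using c d by simp
      show "f (G n i r) = (f \<oplus>\<^bsub>CC n\<^esub> ?d \<oplus>\<^bsub>CC n\<^esub> ?d) (G n i r)" for i r
        using CC_G(1)[OF c] CC_G(1)[OF d] by (simp add: C_apply_G L.a_assoc L_double)
    qed
    then show ?thesis using SS_add[OF S SS_B[OF dB]] by simp
  qed
qed

section \<open>Generation of the total cohomology\<close>

lemma generators_in: "HH_generators m \<subseteq> carrier LC.HHR"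
proof -
  have "HH_elem m n (int n - 2 * \<rho>) h \<in> carrier LC.HHR" if "ccs n \<rho> h \<in> ZZ n" for n \<rho> h
    using hg_in[OF that] by (simp add: HH_elem_ccs[OF refl])
  note hom = this
  note in' = hom[of 0 0] hom[of 1 0] hom[of 1 1] hom[of 2 1] hom[of m 0] hom[of m M]
  have m1: "int (m - 1) = M - 1" using m3 by (simp add: of_nat_diff)
  have pred: "HH_elem m (m - 1) (1 - M) aa \<in> carrier LC.HHR"
    using hom[OF phi_Z, of "m - 1" "M - 1"] m3 unfolding m1 by (simp add: mod_dvd)
  have pred': "HH_elem m (m - 1) (M - 1) (\<lambda>i. ab (i - 1)) \<in> carrier LC.HHR"
    using hom[OF psi_Z, of "m - 1" 0] m3 unfolding m1 by (simp add: mod_dvd)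
  have central: "central_elem m (aa j \<otimes>\<^bsub>L\<^esub> ab j) =
      HH_elem m 0 0 (\<lambda>i. (if i mod M = j mod M then 1 else 0) \<odot>\<^bsub>L\<^esub> ss i)" for j
    unfolding central_elem_def central_ss_fun ..
  show ?thesis
    unfolding HH_generators_def central_one central phi_1_0_def psi_1_0_def chi_2_0_def
      phi_pred_m_neg1_def psi_pred_m_1_def chi_m_1_def chi_m_neg1_def
    by (intro Un_least insert_subsetI image_subsetI empty_subsetI)
      (use pred pred' in \<open>simp_all add: in'[simplified] chi_Z phi_Z psi_Z sig_Z\<close>)
qed

lemma generators_finite: "finite (HH_generators m)"
  by (simp add: HH_generators_def)

lemma generated: "GA = carrier LC.HHR"
proof
  show "GA \<subseteq> carrier LC.HHR"
  proof
    fix x assume "x \<in> GA"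
    then show "x \<in> carrier LC.HHR"
      by induction (use generators_in in \<open>auto intro: HHR.smult_in\<close>)
  qed
  show "carrier LC.HHR \<subseteq> GA"
  proof
    fix x assume x: "x \<in> carrier LC.HHR"
    \<comment> \<open>Almost all components vanish, so \<open>x\<close> equals one of its
      truncations, and these grow by one homogeneous component at a time.\<close>
    have tr: "(\<lambda>n. if n < N then x n else \<zero>\<^bsub>LC.H n\<^esub>) \<in> GA" for N
    proof (induction N)
      case 0
      have "\<zero>\<^bsub>LC.HHR\<^esub> \<in> GA"
        unfolding HHR_zero by (intro generated_algebra.smult generated_algebra.one)
      then show ?case by (simp add: LC.HH_simps)
    next
      case (Suc N)
      obtain f where f: "f \<in> ZZ N" "x N = coh_class L (resolution m) N f"
        using LC.H_cases[OF LC.HH_in[OF x]] by blast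
      have "hg N f \<in> GA" using ZZ_SS[OF f(1)] by (simp add: SS_def)
      with Suc have "(\<lambda>n. if n < N then x n else \<zero>\<^bsub>LC.H n\<^esub>) \<oplus>\<^bsub>LC.HHR\<^esub> hg N f \<in> GA"
        by (rule generated_algebra.add)
      moreover have "(\<lambda>n. if n < N then x n else \<zero>\<^bsub>LC.H n\<^esub>) \<oplus>\<^bsub>LC.HHR\<^esub> hg N f =
          (\<lambda>n. if n < Suc N then x n else \<zero>\<^bsub>LC.H n\<^esub>)"
      proof
        fix n
        have "x n \<in> carrier (LC.H n)" by (rule LC.HH_in[OF x])
        then show "((\<lambda>n. if n < N then x n else \<zero>\<^bsub>LC.H n\<^esub>) \<oplus>\<^bsub>LC.HHR\<^esub> hg N f) n =
          (if n < Suc N then x n else \<zero>\<^bsub>LC.H n\<^esub>)"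
          using f(2) by (cases n N rule: linorder_cases) (simp_all add: LC.HH_simps homogeneous_def)
      qed
      ultimately show ?case by simp
    qed
    obtain N where N: "\<forall>n>N. x n = \<zero>\<^bsub>LC.H n\<^esub>" using x by (auto simp: LC.HH_carrier)
    have "(\<lambda>n. if n < Suc N then x n else \<zero>\<^bsub>LC.H n\<^esub>) = x"
      using N by (intro ext) auto
    then show "x \<in> GA" using tr[of "Suc N"] by simp
  qed
qed

end

theorem theorem5p7:
  fixes m :: nat
  assumes "m \<ge> 3" and "odd m" and "CHAR('k::field) = 2"
  shows "projective_bimodule_resolution (Lambda1 m :: ('k, 'k lam) module) (resolution m) \<and>
    k_algebra (HH_Lambda1 m :: ('k, nat \<Rightarrow> ('k res \<Rightarrow> 'k lam) set) module) \<and>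
    finite (HH_generators m :: (nat \<Rightarrow> ('k res \<Rightarrow> 'k lam) set) set) \<and>
    HH_generators m \<subseteq> carrier (HH_Lambda1 m :: ('k, nat \<Rightarrow> ('k res \<Rightarrow> 'k lam) set) module) \<and>
    generated_algebra (HH_Lambda1 m :: ('k, nat \<Rightarrow> ('k res \<Rightarrow> 'k lam) set) module) (HH_generators m)
      = carrier (HH_Lambda1 m)"
proof -
  interpret lambda1_odd m "TYPE('k)"
    by unfold_locales (use assms in auto)
  show ?thesis
    unfolding HHR_eq
    using resolution_projective LC.HH_k_algebra generators_finite generators_in generated by blast
qed

end
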